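(* Let $w^0=(y^0,u^0)$ be an admissible process of Problem C for which there are $0<t_1^0<t_2^0<T$ such that, with $\Delta_1=[0,t_1^0]$, $\Delta_2=[t_1^0,t_2^0]$, $\Delta_3=[t_2^0,T]$: (i) $\Phi(y^0(t))=0$ on $\Delta_2$ and $\Phi(y^0(t))>0$ on $[0,T]\setminus\Delta_2$; (ii) $u^0$ is continuous on $\Delta_1$ and on $\Delta_3$ and Lipschitz continuous on $\Delta_2$ (at $t_1^0,t_2^0$ the function $u^0$ has left and right values, and continuity on each closed interval is understood with the corresponding one-sided values); (iii) $\varphi_s(u^0(t))<0$ on $\Delta_2$ for all $s$; (iv) $\Phi'(y^0(t_1^0))f(y^0(t_1^0),u^0(t_1^0-0))<0$ and $\Phi'(y^0(t_2^0))f(y^0(t_2^0),u^0(t_2^0+0))>0$; (v) $\Phi'(y^0(t))f'_u(y^0(t),u^0(t))\ne 0$ on $\Delta_2$; (vi) for all $t\in\Delta_1\cup\Delta_3$ the gradients $\varphi_s'(u^0(t))$, $s\in I(u^0(t))=\{s:\varphi_s(u^0(t))=0\}$, are positively independent; (vii) there exist an open set $\Omega\subset\mathbb{R}^{n+1}$ containing the curve $y^0(t)$, $t\in[0,T]$, and twice continuously differentiable functions $P_i:\Omega\to\mathbb{R}$, $i=1,\dots,n$, such that the gradients $P_1'(y),\dots,P_n'(y),\Phi'(y)$ are linearly independent at every $y\in\Omega$ and the map $F=(P_1,\dots,P_n,\Phi):\Omega\to\mathbb{R}^{n+1}$ is injective. Suppose that $w^0$ provides the extended weak minimality in Problem C.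 Then there exist a constant $c$, functions $\psi_y(t)$ (an $(n+1)$-dimensional row vector) and $\mu(t)$ (scalar) that are Lipschitz continuous on each interval $\Delta_i$, $i=1,2,3$ (with possible jumps at $t_1^0,t_2^0$), and a measurable bounded function $h:[0,T]\to\mathbb{R}^d$ (row vector), which generate the Pontryagin function $H(\psi_y,y,u)=\psi_y f(y,u)$ and the extended Pontryagin function $$\overline H(\psi_y,y,u)=\psi_y f(y,u)+\dot\mu\,\Phi(y)-h\,\varphi(u),$$ such that the following conditions hold: (a) non-negativity: $\dot\mu(t)\ge0$ a.e. on $\Delta_2$, $\Delta\mu(t_1^0)\ge0$, $\Delta\mu(t_2^0)\ge 0$, and $h(t)\ge0$ a.e. on $[0,T]$; (b) complementary slackness: $\dot\mu(t)\,\Phi(y^0(t))=0$ on $[0,T]$ (i.e. the measure $\Phi(y^0(t))\,d\mu(t)$ is zero) and $h(t)\,\varphi(u^0(t))=0$ a.e. on $[0,T]$; (c) adjoint equation: $-\dot\psi_y=\overline H'_y=\psi_y f'_y(y^0,u^0)+\dot\mu\,\Phi'(y^0)$ on $[0,T]$, understood as an equality of measures; (d) transversality: $\psi_y(0)=J'_{y(0)}$, $\psi_y(T)=-J'_{y(T)}$; (e) jump conditions: $\Delta\psi_y(t_1^0)=-\Delta\mu(t_1^0)\,\Phi'(y^0(t_1^0))$ and $\Delta\psi_y(t_2^0)=-\Delta\mu(t_2^0)\,\Phi'(y^0(t_2^0))$; (f) energy conservation law: $H(\psi_y(t),y^0(t),u^0(t))=c$ on $[0,T]$; (g) stationarity with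 respect to the control: $\overline H'_u(\psi_y(t),y^0(t),u^0(t))=0$ a.e. on $[0,T]$.
   Context: Problem C. Fix $T>0$ and integers $n,k,d\ge1$. On the fixed interval $[0,T]$ minimize $J_C=J(y(0),y(T))$ subject to $$\dot y=f(y,u),\qquad \varphi_s(u(t))\le 0,\ s=1,\dots,d,\qquad \Phi(y(t))\ge 0,$$ where $y\in\mathbb{R}^{n+1}$ is the state (absolutely continuous in $t$) and $u\in\mathbb{R}^k$ is the control (measurable and bounded). The functions $f$ (with values in $\mathbb{R}^{n+1}$), $\varphi=(\varphi_1,\dots,\varphi_d)$ (depending only on $u$) and $\Phi$ (scalar, depending only on $y$), formally regarded as functions of $(y,u)$, are defined and twice continuously differentiable on an open set $\mathcal Q\subset\mathbb{R}^{n+1+k}$; $J$ is continuously differentiable. Processes take values in $\mathcal Q$, and the reference process (including one-sided values of the control) lies in $\mathcal Q$. A process is a pair $w=(y,u)$ of functions of these classes on $[0,T]$ satisfying $\dot y=f(y,u)$; it is admissible if it satisfies all constraints. Extended weak minimality: an admissible process $w^0=(y^0,u^0)$ provides the extended weak minimality in Problem C if there exists $\varepsilon>0$ such that for every Lipschitz continuous surjective map $\sigma:[0,T]\to[0,T]$ with $|\sigma(t)-t|<\varepsilon$ and $|\dot\sigma(t)-1|<\varepsilon$, and every admissible process $w=(y,u)$ with $|y(t)-y^0(\sigma(t))|<\varepsilon$ for all $t$ and $|u(t)-u^0(\sigma(t))|<\varepsilon$ for almost all $t$, one has $J_C(w)\ge J_C(w^0)$. Vectors are positively independent if no nontrivial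 linear combination of them with non-negative coefficients vanishes (the empty family is positively independent). Notation: $J'_{y(0)},J'_{y(T)}$ are the partial derivatives of $J$ at $(y^0(0),y^0(T))$. For a piecewise continuous function $p$, $\Delta p(t)=p(t+0)-p(t-0)$. $\dot\mu$ denotes the generalized derivative of the function $\mu$ of bounded variation, i.e. $\dot\mu(t)\,dt=d\mu(t)$ is the Riemann–Stieltjes measure generated by $\mu$ (on the interior of each $\Delta_i$ it is the usual a.e. derivative). $h\varphi=\sum_s h_s\varphi_s$. *)

theory Defs
  imports "HOL-Analysis.Analysis"
begin

definition C1_on :: "'a::real_normed_vector set \<Rightarrow> ('a \<Rightarrow> 'b::real_normed_vector) \<Rightarrow> bool" where
  "C1_on S g \<longleftrightarrow> (\<exists>g' :: 'a \<Rightarrow> 'a \<Rightarrow>\<^sub>L 'b.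
     (\<forall>x\<in>S. (g has_derivative blinfun_apply (g' x)) (at x)) \<and> continuous_on S g')"

definition C2_on :: "'a::real_normed_vector set \<Rightarrow> ('a \<Rightarrow> 'b::real_normed_vector) \<Rightarrow> bool" where
  "C2_on S g \<longleftrightarrow> (\<exists>g' :: 'a \<Rightarrow> 'a \<Rightarrow>\<^sub>L 'b.
     (\<forall>x\<in>S. (g has_derivative blinfun_apply (g' x)) (at x)) \<and> C1_on S g')"

text \<open>Row vectors are elements of \<open>real ^ 'm\<close>; a row vector acts on column vectors by the inner
  product and on matrices by \<open>v*\<close>.\<close>

definition grad :: "(real ^ 'm \<Rightarrow> real) \<Rightarrow> real ^ 'm \<Rightarrow> real ^ 'm::finite" where
  "grad g x = (\<chi> i. frechet_derivative g (at x) (axis i 1))"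

text \<open>Independence is that of a family, not of its set of values: a vector occurring for two
  indices makes the family linearly dependent.\<close>

definition linearly_independent :: "'i set \<Rightarrow> ('i \<Rightarrow> 'a::real_vector) \<Rightarrow> bool" where
  "linearly_independent I v \<longleftrightarrow>
     (\<forall>a. (\<Sum>i\<in>I. a i *\<^sub>R v i) = 0 \<longrightarrow> (\<forall>i\<in>I. a i = 0))"

definition positively_independent :: "'i set \<Rightarrow> ('i \<Rightarrow> 'a::real_vector) \<Rightarrow> bool" where
  "positively_independent I v \<longleftrightarrow>
     (\<forall>a. (\<forall>i\<in>I. 0 \<le> a i) \<and> (\<Sum>i\<in>I. a i *\<^sub>R v i) = 0 \<longrightarrow> (\<forall>i\<in>I. a i = 0))"

definition absolutely_continuous_fun :: "real \<Rightarrow> real \<Rightarrow> (real \<Rightarrow> 'a::real_normed_vector) \<Rightarrow> bool" where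
  "absolutely_continuous_fun a b y \<longleftrightarrow>
     (\<forall>\<epsilon>>0. \<exists>\<delta>>0. \<forall>D :: (real \<times> real) set.
        finite D \<and> (\<forall>(s, t)\<in>D. a \<le> s \<and> s \<le> t \<and> t \<le> b) \<and>
        pairwise (\<lambda>(s, t) (s', t'). {s<..<t} \<inter> {s'<..<t'} = {}) D \<and>
        (\<Sum>(s, t)\<in>D. t - s) < \<delta>
        \<longrightarrow> (\<Sum>(s, t)\<in>D. norm (y t - y s)) < \<epsilon>)"

subsection \<open>Piecewise continuous functions\<close>

definition left_value :: "(real \<Rightarrow> 'a::t2_space) \<Rightarrow> real \<Rightarrow> 'a" where
  "left_value p t = Lim (at_left t) p"

definition right_value :: "(real \<Rightarrow> 'a::t2_space) \<Rightarrow> real \<Rightarrow> 'a" where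
  "right_value p t = Lim (at_right t) p"

definition jump :: "(real \<Rightarrow> 'a::real_normed_vector) \<Rightarrow> real \<Rightarrow> 'a" where
  "jump p t = right_value p t - left_value p t"

text \<open>The function \<open>p\<close> read on \<open>[0,t1]\<close>, \<open>[t1,t2]\<close> and \<open>[t2,T]\<close>: at \<open>t1\<close> and \<open>t2\<close> its own value is
  replaced by the one-sided value from within the interval. Continuity of \<open>piece1 t1 p\<close> on
  \<open>[0,t1]\<close> (etc.) forces that one-sided limit to exist, so no default value of \<open>Lim\<close> enters.\<close>

definition piece1 :: "real \<Rightarrow> (real \<Rightarrow> 'a::t2_space) \<Rightarrow> real \<Rightarrow> 'a" where
  "piece1 t1 p = p(t1 := left_value p t1)"

definition piece2 :: "real \<Rightarrow> real \<Rightarrow> (real \<Rightarrow> 'a::t2_space) \<Rightarrow> real \<Rightarrow> 'a" where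
  "piece2 t1 t2 p = p(t1 := right_value p t1, t2 := left_value p t2)"

definition piece3 :: "real \<Rightarrow> (real \<Rightarrow> 'a::t2_space) \<Rightarrow> real \<Rightarrow> 'a" where
  "piece3 t2 p = p(t2 := right_value p t2)"

definition piecewise_Lipschitz ::
  "real \<Rightarrow> real \<Rightarrow> real \<Rightarrow> (real \<Rightarrow> 'a::metric_space) \<Rightarrow> bool" where
  "piecewise_Lipschitz T t1 t2 p \<longleftrightarrow>
     (\<exists>L. L-lipschitz_on {0..t1} (piece1 t1 p)) \<and>
     (\<exists>L. L-lipschitz_on {t1..t2} (piece2 t1 t2 p)) \<and>
     (\<exists>L. L-lipschitz_on {t2..T} (piece3 t2 p))"

subsection \<open>Riemann--Stieltjes measures\<close>

definition has_RS_integral ::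
  "(real \<Rightarrow> real) \<Rightarrow> (real \<Rightarrow> real) \<Rightarrow> real \<Rightarrow> real \<Rightarrow> real \<Rightarrow> bool" where
  "has_RS_integral g \<mu> a b I \<longleftrightarrow>
     (\<forall>\<epsilon>>0. \<exists>\<delta>>0. \<forall>p. p tagged_division_of {a..b} \<and> (\<lambda>x. ball x \<delta>) fine p
        \<longrightarrow> \<bar>(\<Sum>(x, K)\<in>p. g x * (\<mu> (Sup K) - \<mu> (Inf K))) - I\<bar> < \<epsilon>)"

text \<open>A signed measure on \<open>[0,T]\<close> is identified with the functional it induces on continuous
  functions \<open>g\<close>: \<open>d\<mu>\<close> is the functional sending \<open>g\<close> to the Riemann--Stieltjes integral of
  \<open>g d\<mu>\<close>, and two measures are equal when these functionals agree. The values of \<open>\<mu>\<close> at its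
  interior jump points do not affect \<open>d\<mu>\<close>.\<close>

text \<open>The measure \<open>\<beta>(t) d\<mu>(t)\<close> is zero.\<close>

definition RS_measure_zero :: "real \<Rightarrow> (real \<Rightarrow> real) \<Rightarrow> (real \<Rightarrow> real) \<Rightarrow> bool" where
  "RS_measure_zero T \<beta> \<mu> \<longleftrightarrow>
     (\<forall>g. continuous_on {0..T} g \<longrightarrow> has_RS_integral (\<lambda>t. g t * \<beta> t) \<mu> 0 T 0)"

text \<open>The equality of vector measures \<open>- d\<psi> = \<alpha>(t) dt + \<beta>(t) d\<mu>(t)\<close>.\<close>

definition adjoint_measure_eq ::
  "real \<Rightarrow> (real \<Rightarrow> real ^ 'm::finite) \<Rightarrow> (real \<Rightarrow> real ^ 'm) \<Rightarrow> (real \<Rightarrow> real ^ 'm) \<Rightarrow> (real \<Rightarrow> real) \<Rightarrow> bool"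
  where
  "adjoint_measure_eq T \<psi> \<alpha> \<beta> \<mu> \<longleftrightarrow>
     (\<forall>i. integrable (lebesgue_on {0..T}) (\<lambda>t. \<alpha> t $ i)) \<and>
     (\<forall>g i. continuous_on {0..T} g \<longrightarrow>
        (\<exists>A B. has_RS_integral g (\<lambda>t. \<psi> t $ i) 0 T A \<and>
               has_RS_integral (\<lambda>t. g t * \<beta> t $ i) \<mu> 0 T B \<and>
               - A = (LINT t|lebesgue_on {0..T}. g t * \<alpha> t $ i) + B))"

subsection \<open>Problem C\<close>

text \<open>The control is a measurable, essentially bounded function, so every pointwise condition
  involving it is imposed for almost all \<open>t\<close>; conditions on the state alone are imposed for
  all \<open>t\<close>. The condition \<open>y t \<in> fst ` Q\<close> says that \<open>\<Phi> (y t)\<close> is defined.\<close>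

definition is_process ::
  "real \<Rightarrow> ((real ^ 'm) \<times> (real ^ 'k)) set \<Rightarrow> (real ^ 'm \<Rightarrow> real ^ 'k \<Rightarrow> real ^ 'm::finite) \<Rightarrow>
   (real \<Rightarrow> real ^ 'm) \<Rightarrow> (real \<Rightarrow> real ^ 'k::finite) \<Rightarrow> bool" where
  "is_process T Q f y u \<longleftrightarrow>
     absolutely_continuous_fun 0 T y \<and>
     u \<in> borel_measurable (lebesgue_on {0..T}) \<and>
     (\<exists>M. AE t in lebesgue_on {0..T}. norm (u t) \<le> M) \<and>
     (\<forall>t\<in>{0..T}. y t \<in> fst ` Q) \<and>
     (AE t in lebesgue_on {0..T}. (y t, u t) \<in> Q) \<and>
     (AE t in lebesgue_on {0..T}. (y has_vector_derivative f (y t) (u t)) (at t))"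

definition admissible ::
  "real \<Rightarrow> ((real ^ 'm) \<times> (real ^ 'k)) set \<Rightarrow> (real ^ 'm \<Rightarrow> real ^ 'k \<Rightarrow> real ^ 'm::finite) \<Rightarrow>
   (real ^ 'k \<Rightarrow> real ^ 'd::finite) \<Rightarrow> (real ^ 'm \<Rightarrow> real) \<Rightarrow>
   (real \<Rightarrow> real ^ 'm) \<Rightarrow> (real \<Rightarrow> real ^ 'k::finite) \<Rightarrow> bool" where
  "admissible T Q f \<phi> \<Phi> y u \<longleftrightarrow>
     is_process T Q f y u \<and>
     (AE t in lebesgue_on {0..T}. \<forall>s. \<phi> (u t) $ s \<le> 0) \<and>
     (\<forall>t\<in>{0..T}. 0 \<le> \<Phi> (y t))"

definition extended_weak_minimum ::
  "real \<Rightarrow> ((real ^ 'm) \<times> (real ^ 'k)) set \<Rightarrow> (real ^ 'm \<Rightarrow> real ^ 'k \<Rightarrow> real ^ 'm::finite) \<Rightarrow>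
   (real ^ 'k \<Rightarrow> real ^ 'd::finite) \<Rightarrow> (real ^ 'm \<Rightarrow> real) \<Rightarrow> (real ^ 'm \<Rightarrow> real ^ 'm \<Rightarrow> real) \<Rightarrow>
   (real \<Rightarrow> real ^ 'm) \<Rightarrow> (real \<Rightarrow> real ^ 'k::finite) \<Rightarrow> bool" where
  "extended_weak_minimum T Q f \<phi> \<Phi> J y0 u0 \<longleftrightarrow>
     admissible T Q f \<phi> \<Phi> y0 u0 \<and>
     (\<exists>\<epsilon>>0. \<forall>\<sigma> y u.
        (\<exists>L. L-lipschitz_on {0..T} \<sigma>) \<and> \<sigma> ` {0..T} = {0..T} \<and>
        (\<forall>t\<in>{0..T}. \<bar>\<sigma> t - t\<bar> < \<epsilon>) \<and>
        (AE t in lebesgue_on {0..T}. \<exists>D. (\<sigma> has_real_derivative D) (at t) \<and> \<bar>D - 1\<bar> < \<epsilon>) \<and>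
        admissible T Q f \<phi> \<Phi> y u \<and>
        (\<forall>t\<in>{0..T}. norm (y t - y0 (\<sigma> t)) < \<epsilon>) \<and>
        (AE t in lebesgue_on {0..T}. norm (u t - u0 (\<sigma> t)) < \<epsilon>)
        \<longrightarrow> J (y0 0) (y0 T) \<le> J (y 0) (y T))"

definition active :: "(real ^ 'k \<Rightarrow> real ^ 'd) \<Rightarrow> real ^ 'k \<Rightarrow> 'd set" where
  "active \<phi> v = {s. \<phi> v $ s = 0}"

definition active_gradients_positively_independent ::
  "(real ^ 'k::finite \<Rightarrow> real ^ 'd::finite) \<Rightarrow> real ^ 'k \<Rightarrow> bool" where
  "active_gradients_positively_independent \<phi> v \<longleftrightarrow>
     positively_independent (active \<phi> v) (\<lambda>s. grad (\<lambda>w. \<phi> w $ s) v)"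

definition pontryagin ::
  "(real ^ 'm \<Rightarrow> real ^ 'k \<Rightarrow> real ^ 'm::finite) \<Rightarrow> real ^ 'm \<Rightarrow> real ^ 'm \<Rightarrow> real ^ 'k \<Rightarrow> real" where
  "pontryagin f p y v = p \<bullet> f y v"

text \<open>Here \<open>m\<close> is the value of the derivative of \<open>\<mu>\<close> and \<open>h\<close> that of the control multiplier.\<close>

definition extended_pontryagin ::
  "(real ^ 'm \<Rightarrow> real ^ 'k \<Rightarrow> real ^ 'm::finite) \<Rightarrow> (real ^ 'k \<Rightarrow> real ^ 'd::finite) \<Rightarrow>
   (real ^ 'm \<Rightarrow> real) \<Rightarrow> real \<Rightarrow> real ^ 'd \<Rightarrow> real ^ 'm \<Rightarrow> real ^ 'm \<Rightarrow> real ^ 'k \<Rightarrow> real" where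
  "extended_pontryagin f \<phi> \<Phi> m h p y v = p \<bullet> f y v + m * \<Phi> y - h \<bullet> \<phi> v"

end

(* Variations of the reference process combine a small variation of the control with a time change
   sigma; the perturbed trajectory is obtained by shadowing the linearised one, so minimality gives a
   linear inequality for the variations that strictly increase Phi to first order on the boundary arc.
   The multipliers are then explicit. On the boundary arc the density of mu is chosen so that psi f'_u
   vanishes along the direction Phi' f'_u, which turns the adjoint equation into a linear equation
   without measure, integrated backwards from T. Integration by parts against its solutions decouples
   the linear inequality: the time dilations give the energy law, the tangential control variations
   give stationarity, the variations of Phi(y) give the monotonicity of mu, and the initial value
   gives the jump at t1. On the free arcs Farkas' lemma yields h pointwise; a measurable choice
   exists because the admissible values form a compact convex-valued graph. *)
theory Submission
  imports Defs
begin

section \<open>Bounded, piecewise continuous data and linear differential equations\<close>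

text \<open>An abstract multiplier theorem would yield the multiplier of the state constraint only
  as a functional, without regularity, and a cost coefficient that might vanish. Since \<Phi>' f'_u
  is nonzero on the boundary arc, the values of \<Phi>' along a linearised trajectory can be
  prescribed there by feedback; the multipliers become formulas with cost coefficient 1, and their
  Lipschitz continuity is read off from the formulas. Three points shape the construction. The
  costate \<open>\<psi>\<close> jumps, so the work is done with \<open>\<psi> + \<mu> p\<close>,
  where p = \<Phi>'(y0): it is continuous, because the jumps of the two terms cancel. Fixed at
  \<open>T\<close> by transversality, it may miss the condition at 0; the mismatch is carried
  forward to \<open>t1\<close> by a second adjoint solution, and optimality forces it to be parallel
  to \<open>p t1\<close> there, which makes it a jump of \<mu>. Finally \<mu> is normalised to
  vanish from \<open>t2\<close> on, so that on the arc \<mu> itself, not only its derivative, is an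
  algebraic expression in the adjoint solution, and its sign and monotonicity can be tested
  pointwise.\<close>

definition bcont_off :: "real set \<Rightarrow> real \<Rightarrow> real \<Rightarrow> (real \<Rightarrow> 'a::real_normed_vector) \<Rightarrow> bool" where
  "bcont_off S a b g \<longleftrightarrow> bounded (g ` {a..b}) \<and> continuous_on ({a..b} - S) g"

text \<open>No derivative is asked at the end points or on \<open>S\<close>, but continuity is; so
  the fundamental theorem of calculus holds across the points of \<open>S\<close>, where a control
  may jump.\<close>

definition solves :: "real set \<Rightarrow> real \<Rightarrow> real \<Rightarrow> (real \<Rightarrow> 'a::real_normed_vector) \<Rightarrow> (real \<Rightarrow> 'a) \<Rightarrow> bool" where
  "solves S a b x g \<longleftrightarrow> continuous_on {a..b} x \<and>
     (\<forall>t\<in>{a<..<b} - S. (x has_vector_derivative g t) (at t))"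

lemma bcont_off_measurable:
  fixes g :: "real \<Rightarrow> 'a::euclidean_space"
  assumes "finite S" "bcont_off S a b g"
  shows "g \<in> borel_measurable (lebesgue_on {a..b})"
proof -
  have m: "{a..b} - S \<in> sets lebesgue"
    using negligible_imp_sets[OF negligible_finite[OF assms(1)]] by (intro sets.Diff) auto
  have "g \<in> borel_measurable (lebesgue_on ({a..b} - S))"
    using assms m by (intro continuous_imp_measurable_on_sets_lebesgue) (auto simp: bcont_off_def)
  then have "(\<lambda>x. if x \<in> {a..b} - S then g x else 0) \<in> borel_measurable lebesgue"
    using m by (simp only: borel_measurable_if)
  then have "(\<lambda>x. if x \<in> {a..b} then g x else 0) \<in> borel_measurable lebesgue"
    by (rule measurable_discrete_difference[where X=S]) (use assms(1) in \<open>auto intro: countable_finite\<close>)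
  then show ?thesis by (rule borel_measurable_if_D)
qed

lemma bcont_off_integrable:
  fixes g :: "real \<Rightarrow> 'a::euclidean_space"
  assumes "finite S" "bcont_off S a b g"
  shows "g integrable_on {a..b}"
proof -
  obtain B where B: "\<forall>x\<in>{a..b}. norm (g x) \<le> B"
    using assms(2) unfolding bcont_off_def bounded_iff by auto
  show ?thesis
    by (rule measurable_bounded_by_integrable_imp_integrable[of _ _ "\<lambda>_. B"])
      (use bcont_off_measurable[OF assms] B in auto)
qed

lemma bcont_off_subinterval:
  "bcont_off S a b g \<Longrightarrow> a \<le> c \<Longrightarrow> d \<le> b \<Longrightarrow> bcont_off S c d g"
  unfolding bcont_off_def
  by (auto elim!: bounded_subset continuous_on_subset)

lemma solves_has_integral:
  fixes x :: "real \<Rightarrow> 'a::banach"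
  assumes "finite S" "solves S a b x g" "a \<le> s" "s \<le> t" "t \<le> b"
  shows "(g has_integral (x t - x s)) {s..t}"
proof (rule fundamental_theorem_of_calculus_interior_strong[OF \<open>finite S\<close> \<open>s \<le> t\<close>])
  show "continuous_on {s..t} x"
    using assms unfolding solves_def by (auto elim!: continuous_on_subset)
qed (use assms in \<open>auto simp: solves_def\<close>)

lemma solves_of_integral:
  fixes x :: "real \<Rightarrow> 'a::euclidean_space"
  assumes S: "finite S" and g: "bcont_off S a b g"
    and x: "\<And>t. t \<in> {a..b} \<Longrightarrow> x t = \<xi> + integral {a..t} g"
  shows "solves S a b x g"
proof -
  have int: "g integrable_on {a..b}" using bcont_off_integrable[OF S g] .
  have "continuous_on {a..b} (\<lambda>t. \<xi> + integral {a..t} g)"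
    by (intro continuous_intros indefinite_integral_continuous_1 int)
  then have "continuous_on {a..b} x" using x by (metis (no_types, lifting) continuous_on_cong)
  moreover have "(x has_vector_derivative g t) (at t)" if t: "t \<in> {a<..<b} - S" for t
  proof -
    have op: "open ({a<..<b} - S)" using S by (auto intro: finite_imp_closed)
    have c: "continuous (at t within ({a..b} - S)) g"
      using g t unfolding bcont_off_def by (auto simp: continuous_on_eq_continuous_within)
    have "((\<lambda>u. integral {a..u} g) has_vector_derivative g t) (at t within ({a..b} - S))"
      by (rule integral_has_vector_derivative_continuous_at[OF int _ S c]) (use t in auto)
    then have "((\<lambda>u. integral {a..u} g) has_vector_derivative g t) (at t within ({a<..<b} - S))"
      by (rule has_vector_derivative_within_subset) auto
    then have "((\<lambda>u. integral {a..u} g) has_vector_derivative g t) (at t)"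
      using at_within_open[OF t op] by simp
    then have "((\<lambda>u. \<xi> + integral {a..u} g) has_vector_derivative g t) (at t)"
      by (auto intro!: derivative_eq_intros)
    then show ?thesis
      by (rule has_vector_derivative_transform_within_open[of _ _ _ "{a<..<b}"])
        (use t x in auto)
  qed
  ultimately show ?thesis unfolding solves_def by blast
qed

lemma solves_lipschitz:
  fixes x :: "real \<Rightarrow> 'a::banach"
  assumes S: "finite S" and x: "solves S a b x g" and B: "\<And>t. t \<in> {a..b} \<Longrightarrow> norm (g t) \<le> B" and "0 \<le> B"
  shows "B-lipschitz_on {a..b} x"
proof -
  have *: "norm (x t - x s) \<le> B * (t - s)" if "a \<le> s" "s \<le> t" "t \<le> b" for s t
    using has_integral_bound[OF \<open>0 \<le> B\<close>, of g _ s t] solves_has_integral[OF S x that] B that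
    by (auto simp: content_real)
  show ?thesis
  proof (rule lipschitz_onI)
    fix s t assume "s \<in> {a..b}" "t \<in> {a..b}"
    then show "dist (x s) (x t) \<le> B * dist s t"
      using *[of s t] *[of t s] by (cases "s \<le> t") (auto simp: dist_norm norm_minus_commute)
  qed (rule \<open>0 \<le> B\<close>)
qed

text \<open>Picard iteration started at the approximate solution \<open>z\<close>. \<open>F\<close>
  is Lipschitz only in the tube of radius \<open>r\<close> about \<open>z\<close>, so the induction
  must also keep the iterates in the tube; the smallness hypothesis is exactly what this
  takes.\<close>

lemma shadowing:
  fixes F :: "real \<Rightarrow> 'a::euclidean_space \<Rightarrow> 'a"
  assumes "a \<le> b" and z: "continuous_on {a..b} z" and "0 \<le> L" "0 \<le> \<eta>"
    and int: "\<And>y. continuous_on {a..b} y \<Longrightarrow> (\<forall>t\<in>{a..b}. norm (y t - z t) \<le> r) \<Longrightarrow>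
       (\<lambda>s. F s (y s)) integrable_on {a..b}"
    and lip: "\<And>s x y. s \<in> {a..b} \<Longrightarrow> norm (x - z s) \<le> r \<Longrightarrow> norm (y - z s) \<le> r \<Longrightarrow>
       norm (F s x - F s y) \<le> L * norm (x - y)"
    and defect: "\<And>t. t \<in> {a..b} \<Longrightarrow> norm (z t - (\<xi> + integral {a..t} (\<lambda>s. F s (z s)))) \<le> \<eta>"
    and small: "2 * \<eta> * exp (2 * L * (b - a)) \<le> r"
  obtains y where "continuous_on {a..b} y"
    "\<And>t. t \<in> {a..b} \<Longrightarrow> y t = \<xi> + integral {a..t} (\<lambda>s. F s (y s))"
    "\<And>t. t \<in> {a..b} \<Longrightarrow> norm (y t - z t) \<le> 2 * \<eta> * exp (2 * L * (b - a))"
proof -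
  \<comment> \<open>Exponential weight: the integral of \<open>L * E\<close> is at most
    \<open>E / 2\<close>, so in the norm weighted by \<open>E\<close> the Picard map contracts by
    1/2, however long the interval.\<close>
  define E where "E t = exp (2 * L * (t - a))" for t
  have E1: "0 < E t" for t by (simp add: E_def)
  have Emono: "E t \<le> E b" if "t \<le> b" for t
    using that \<open>0 \<le> L\<close> by (simp add: E_def mult_left_mono)
  define Y where "Y = rec_nat z (\<lambda>k y t. \<xi> + integral {a..t} (\<lambda>s. F s (y s)))"
  have Y0: "Y 0 = z" and YS: "Y (Suc k) = (\<lambda>t. \<xi> + integral {a..t} (\<lambda>s. F s (Y k s)))" for k
    by (simp_all add: Y_def)
  have Eint: "((\<lambda>s. L * (c * E s)) has_integral (c/2 * E t - c/2 * E a)) {a..t}" if "a \<le> t" for t c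
  proof (rule fundamental_theorem_of_calculus[OF that])
    fix s
    show "((\<lambda>s. c/2 * E s) has_vector_derivative L * (c * E s)) (at s within {a..t})"
      unfolding E_def has_real_derivative_iff_has_vector_derivative[symmetric]
      by (auto intro!: derivative_eq_intros simp: field_simps)
  qed
  \<comment> \<open>The factor \<open>2 * \<eta> * (1 - (1/2)^k)\<close> is the sum of the first
    \<open>k\<close> increments \<open>\<eta> * (1/2)^j\<close>.\<close>
  have tube: "norm (y - z t) \<le> r" if "norm (y - z t) \<le> 2 * \<eta> * (1 - (1/2)^k) * E t" "t \<in> {a..b}" for y t k
  proof -
    have "2 * \<eta> * (1 - (1/2)^k) \<le> 2 * \<eta> * 1"
      using \<open>0 \<le> \<eta>\<close> by (intro mult_left_mono) auto
    then have "2 * \<eta> * (1 - (1/2)^k) * E t \<le> 2 * \<eta> * E b"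
      using that Emono[of t] E1[of t] \<open>0 \<le> \<eta>\<close> by (intro mult_mono[of _ "2 * \<eta>"]) auto
    then show ?thesis using that small by (simp add: E_def)
  qed
  have inv: "continuous_on {a..b} (Y k) \<and>
     (\<forall>t\<in>{a..b}. norm (Y k t - z t) \<le> 2 * \<eta> * (1 - (1/2)^k) * E t) \<and>
     (\<forall>t\<in>{a..b}. norm (Y (Suc k) t - Y k t) \<le> \<eta> * (1/2)^k * E t)" for k
  proof (induction k)
    case 0
    have "norm (Y (Suc 0) t - z t) \<le> \<eta> * E t" if "t \<in> {a..b}" for t
    proof -
      have "1 \<le> E t" using that \<open>0 \<le> L\<close> by (simp add: E_def)
      then have "\<eta> \<le> \<eta> * E t" using \<open>0 \<le> \<eta>\<close> by (simp add: mult_le_cancel_left1)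
      then show ?thesis using defect[OF that] by (simp add: YS Y0 norm_minus_commute)
    qed
    then show ?case using z by (simp add: Y0)
  next
    case (Suc k)
    then have ck: "continuous_on {a..b} (Y k)"
      and dk: "\<And>t. t\<in>{a..b} \<Longrightarrow> norm (Y k t - z t) \<le> 2 * \<eta> * (1 - (1/2)^k) * E t"
      and sk: "\<And>t. t\<in>{a..b} \<Longrightarrow> norm (Y (Suc k) t - Y k t) \<le> \<eta> * (1/2)^k * E t" by auto
    have ik: "(\<lambda>s. F s (Y k s)) integrable_on {a..b}"
      using int[OF ck] tube[OF dk] by blast
    have c1: "continuous_on {a..b} (Y (Suc k))"
      unfolding YS by (intro continuous_intros indefinite_integral_continuous_1 ik)
    have d1: "norm (Y (Suc k) t - z t) \<le> 2 * \<eta> * (1 - (1/2)^Suc k) * E t" if "t \<in> {a..b}" for t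
    proof -
      have "norm (Y (Suc k) t - z t) \<le> norm (Y (Suc k) t - Y k t) + norm (Y k t - z t)"
        using norm_triangle_ineq[of "Y (Suc k) t - Y k t" "Y k t - z t"] by simp
      also have "\<dots> \<le> \<eta> * (1/2)^k * E t + 2 * \<eta> * (1 - (1/2)^k) * E t"
        using sk[OF that] dk[OF that] by linarith
      also have "\<dots> = 2 * \<eta> * (1 - (1/2)^Suc k) * E t" by (simp add: algebra_simps)
      finally show ?thesis .
    qed
    have ik1: "(\<lambda>s. F s (Y (Suc k) s)) integrable_on {a..b}"
      using int[OF c1] tube[OF d1] by blast
    have s1: "norm (Y (Suc (Suc k)) t - Y (Suc k) t) \<le> \<eta> * (1/2)^Suc k * E t" if t: "t \<in> {a..b}" for t
    proof -
      have it: "(\<lambda>s. F s (Y (Suc k) s)) integrable_on {a..t}" "(\<lambda>s. F s (Y k s)) integrable_on {a..t}"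
        using ik ik1 t by (auto elim!: integrable_on_subinterval)
      have E: "((\<lambda>s. L * (\<eta> * (1/2)^k * E s)) has_integral (\<eta> * (1/2)^k/2 * E t - \<eta> * (1/2)^k/2 * E a)) {a..t}"
        using Eint[of t "\<eta> * (1/2)^k"] t by simp
      have "norm (integral {a..t} (\<lambda>s. F s (Y (Suc k) s) - F s (Y k s))) \<le>
          integral {a..t} (\<lambda>s. L * (\<eta> * (1/2)^k * E s))"
      proof (rule integral_norm_bound_integral)
        fix s assume s: "s \<in> {a..t}"
        then have s': "s \<in> {a..b}" using t by auto
        have "norm (F s (Y (Suc k) s) - F s (Y k s)) \<le> L * norm (Y (Suc k) s - Y k s)"
          by (rule lip[OF s' tube[OF d1[OF s'] s'] tube[OF dk[OF s'] s']])
        also have "\<dots> \<le> L * (\<eta> * (1/2)^k * E s)" using sk[OF s'] \<open>0 \<le> L\<close> by (rule mult_left_mono)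
        finally show "norm (F s (Y (Suc k) s) - F s (Y k s)) \<le> L * (\<eta> * (1/2)^k * E s)" .
      qed (use it E in \<open>auto intro: integrable_diff\<close>)
      also have "\<dots> = \<eta> * (1/2)^k/2 * E t - \<eta> * (1/2)^k/2 * E a" using E by (rule integral_unique)
      also have "\<dots> \<le> \<eta> * (1/2)^Suc k * E t" using E1[of a] \<open>0 \<le> \<eta>\<close> by simp
      finally show ?thesis unfolding YS[of "Suc k"] YS[of k]
        using it by (simp add: integral_diff YS)
    qed
    from c1 d1 s1 show ?case by blast
  qed
  \<comment> \<open>The limit is written as a telescoping series, so that uniform convergence
    follows from a geometric majorant.\<close>
  define y where "y t = z t + (\<Sum>k. Y (Suc k) t - Y k t)" for t
  have ul: "uniform_limit {a..b} (\<lambda>n t. \<Sum>k<n. Y (Suc k) t - Y k t) (\<lambda>t. \<Sum>k. Y (Suc k) t - Y k t) sequentially"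
  proof (rule Weierstrass_m_test)
    fix k t assume t: "t \<in> {a..b}"
    have "\<eta> * (1/2)^k * E t \<le> \<eta> * (1/2)^k * E b"
      using t Emono[of t] \<open>0 \<le> \<eta>\<close> by (intro mult_left_mono) auto
    with inv[of k] t show "norm (Y (Suc k) t - Y k t) \<le> \<eta> * E b * (1/2)^k"
      by (force simp: algebra_simps)
  qed (intro summable_mult summable_geometric, simp)
  have ulY: "uniform_limit {a..b} Y y sequentially"
  proof -
    have "uniform_limit {a..b} (\<lambda>n t. z t + (\<Sum>k<n. Y (Suc k) t - Y k t)) y sequentially"
      unfolding y_def by (intro uniform_limit_intros ul)
    moreover have "z t + (\<Sum>k<n. Y (Suc k) t - Y k t) = Y n t" for n t
      by (subst sum_lessThan_telescope) (simp add: Y0)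
    ultimately show ?thesis by simp
  qed
  have yc: "continuous_on {a..b} y"
    by (rule uniform_limit_theorem[OF _ ulY]) (use inv in \<open>auto intro: always_eventually\<close>)
  have lim: "(\<lambda>n. Y n t) \<longlonglongrightarrow> y t" if "t \<in> {a..b}" for t
    using tendsto_uniform_limitI[OF ulY that] .
  have dist: "norm (y t - z t) \<le> 2 * \<eta> * E b" if t: "t \<in> {a..b}" for t
  proof (rule tendsto_upperbound)
    show "(\<lambda>n. norm (Y n t - z t)) \<longlonglongrightarrow> norm (y t - z t)"
      by (intro tendsto_intros lim t)
    have "norm (Y n t - z t) \<le> 2 * \<eta> * E b" for n
    proof -
      have "2 * \<eta> * (1 - (1/2)^n) \<le> 2 * \<eta> * 1"
        using \<open>0 \<le> \<eta>\<close> by (intro mult_left_mono) auto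
      then have "2 * \<eta> * (1 - (1/2)^n) * E t \<le> 2 * \<eta> * E b"
        using t Emono[of t] E1[of t] \<open>0 \<le> \<eta>\<close> by (intro mult_mono[of _ "2 * \<eta>"]) auto
      with inv[of n] t show ?thesis by force
    qed
    then show "\<forall>\<^sub>F n in sequentially. norm (Y n t - z t) \<le> 2 * \<eta> * E b" by simp
  qed simp
  have yr: "norm (y t - z t) \<le> r" if "t \<in> {a..b}" for t
    using dist[OF that] small by (simp add: E_def)
  have iy: "(\<lambda>s. F s (y s)) integrable_on {a..b}" using int[OF yc] yr by blast
  have eq: "y t = \<xi> + integral {a..t} (\<lambda>s. F s (y s))" if t: "t \<in> {a..b}" for t
  proof (rule LIMSEQ_unique)
    show "(\<lambda>n. Y (Suc n) t) \<longlonglongrightarrow> y t" using lim[OF t] by (rule LIMSEQ_Suc)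
    have "(\<lambda>n. integral {a..t} (\<lambda>s. F s (Y n s))) \<longlonglongrightarrow> integral {a..t} (\<lambda>s. F s (y s))"
    proof (rule LIMSEQ_I)
      fix e :: real assume "0 < e"
      define d where "d = e / (L * (b - a) + 1)"
      have den: "0 < L * (b - a) + 1" using \<open>0 \<le> L\<close> \<open>a \<le> b\<close> by (simp add: add_nonneg_pos)
      then have "0 < d" using \<open>0 < e\<close> by (simp add: d_def)
      then have "\<forall>\<^sub>F n in sequentially. \<forall>s\<in>{a..b}. dist (Y n s) (y s) < d"
        using ulY by (simp add: uniform_limit_iff)
      then obtain N where N: "\<And>n s. n \<ge> N \<Longrightarrow> s \<in> {a..b} \<Longrightarrow> dist (Y n s) (y s) < d"
        unfolding eventually_sequentially by blast
      have "norm (integral {a..t} (\<lambda>s. F s (Y n s)) - integral {a..t} (\<lambda>s. F s (y s))) < e" if n: "n \<ge> N" for n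
      proof -
        have nt: "norm (Y n s - z s) \<le> r" if "s \<in> {a..b}" for s
          using inv[of n] tube[OF _ that] that by blast
        have "(\<lambda>s. F s (Y n s)) integrable_on {a..b}" using int inv[of n] nt by blast
        then have it: "(\<lambda>s. F s (Y n s)) integrable_on {a..t}" "(\<lambda>s. F s (y s)) integrable_on {a..t}"
          using iy t by (auto elim!: integrable_on_subinterval)
        have "norm (integral {a..t} (\<lambda>s. F s (Y n s) - F s (y s))) \<le> integral {a..t} (\<lambda>s. L * d)"
        proof (rule integral_norm_bound_integral)
          fix s assume s: "s \<in> {a..t}"
          then have s': "s \<in> {a..b}" using t by auto
          have "norm (F s (Y n s) - F s (y s)) \<le> L * norm (Y n s - y s)"
            by (rule lip[OF s' nt[OF s'] yr[OF s']])
          also have "\<dots> \<le> L * d" using N[OF n s'] \<open>0 \<le> L\<close> by (intro mult_left_mono) (auto simp: dist_norm)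
          finally show "norm (F s (Y n s) - F s (y s)) \<le> L * d" .
        qed (use it in \<open>auto intro: integrable_diff\<close>)
        also have "\<dots> = L * (t - a) * d" using t by simp
        also have "\<dots> \<le> L * (b - a) * d" using t \<open>0 \<le> L\<close> \<open>0 < d\<close> by (intro mult_right_mono mult_left_mono) auto
        also have "\<dots> < (L * (b - a) + 1) * d" using \<open>0 < d\<close> by simp
        also have "\<dots> = e" using den by (simp add: d_def)
        finally show ?thesis using it by (simp add: integral_diff)
      qed
      then show "\<exists>N. \<forall>n\<ge>N. norm (integral {a..t} (\<lambda>s. F s (Y n s)) - integral {a..t} (\<lambda>s. F s (y s))) < e" by blast
    qed
    then show "(\<lambda>n. Y (Suc n) t) \<longlonglongrightarrow> \<xi> + integral {a..t} (\<lambda>s. F s (y s))"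
      unfolding YS by (intro tendsto_intros)
  qed
  show thesis by (rule that[OF yc eq]) (use dist in \<open>auto simp: E_def\<close>)
qed

section \<open>Closure properties of bounded, piecewise continuous functions\<close>

lemma bcont_off_bound:
  assumes "bcont_off S a b g"
  shows "\<exists>B\<ge>0. \<forall>t\<in>{a..b}. norm (g t) \<le> B"
  using assms unfolding bcont_off_def bounded_pos by (auto dest: less_imp_le)

lemma bcont_off_continuous: "continuous_on {a..b} g \<Longrightarrow> bcont_off S a b g"
  unfolding bcont_off_def
  by (auto intro: compact_imp_bounded compact_continuous_image elim: continuous_on_subset)

lemma bcont_off_cong:
  assumes "bcont_off S a b g" "finite S" "\<And>t. t \<in> {a..b} - S \<Longrightarrow> h t = g t"
  shows "bcont_off S a b h"
proof -
  have "h ` {a..b} \<subseteq> g ` {a..b} \<union> h ` S" using assms(3) by force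
  moreover have "bounded (g ` {a..b} \<union> h ` S)"
    using assms(1,2) by (simp add: bcont_off_def finite_imp_bounded)
  ultimately show ?thesis
    using assms(1,3) unfolding bcont_off_def by (metis bounded_subset continuous_on_cong)
qed

lemma bcont_off_compose:
  assumes "bcont_off S a b g" "continuous_on K h" "compact K" "\<And>t. t \<in> {a..b} \<Longrightarrow> g t \<in> K"
  shows "bcont_off S a b (\<lambda>t. h (g t))"
proof -
  have "bounded (h ` K)" using assms(2,3) by (simp add: compact_continuous_image compact_imp_bounded)
  then have "bounded ((\<lambda>t. h (g t)) ` {a..b})"
    by (rule bounded_subset) (use assms(4) in auto)
  then show ?thesis
    using assms unfolding bcont_off_def by (auto intro!: continuous_on_compose2[OF assms(2)])
qed

lemma bcont_off_Pair:
  assumes "bcont_off S a b g" "bcont_off S a b h"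
  shows "bcont_off S a b (\<lambda>t. (g t, h t))"
proof -
  have "bounded (g ` {a..b} \<times> h ` {a..b})" using assms by (simp add: bcont_off_def bounded_Times)
  then have "bounded ((\<lambda>t. (g t, h t)) ` {a..b})" by (rule bounded_subset) auto
  then show ?thesis using assms unfolding bcont_off_def by (auto intro!: continuous_intros)
qed

lemma bcont_off_add:
  assumes "bcont_off S a b g" "bcont_off S a b h"
  shows "bcont_off S a b (\<lambda>t. g t + h t)"
  using assms unfolding bcont_off_def
  by (auto intro!: continuous_intros bounded_plus_comp)

lemma bcont_off_diff:
  assumes "bcont_off S a b g" "bcont_off S a b h"
  shows "bcont_off S a b (\<lambda>t. g t - h t)"
  using assms unfolding bcont_off_def
  by (auto intro!: continuous_intros bounded_minus_comp)

lemma bcont_off_bilinear: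
  assumes "bounded_bilinear B" "bcont_off S a b g" "bcont_off S a b h"
  shows "bcont_off S a b (\<lambda>t. B (g t) (h t))"
proof -
  interpret bounded_bilinear B by fact
  obtain G where "0 \<le> G" and G: "\<And>t. t \<in> {a..b} \<Longrightarrow> norm (g t) \<le> G"
    using bcont_off_bound[OF assms(2)] by blast
  obtain H where "0 \<le> H" and H: "\<And>t. t \<in> {a..b} \<Longrightarrow> norm (h t) \<le> H"
    using bcont_off_bound[OF assms(3)] by blast
  obtain K where K: "0 \<le> K" "\<And>a b. norm (B a b) \<le> norm a * norm b * K"
    using nonneg_bounded by blast
  have "norm (B (g t) (h t)) \<le> G * H * K" if "t \<in> {a..b}" for t
  proof -
    have "norm (g t) * norm (h t) * K \<le> G * H * K"
      using G[OF that] H[OF that] K(1) \<open>0 \<le> G\<close>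
      by (intro mult_right_mono mult_mono) auto
    then show ?thesis using K(2)[of "g t" "h t"] by linarith
  qed
  then have "bounded ((\<lambda>t. B (g t) (h t)) ` {a..b})" unfolding bounded_iff by blast
  moreover have "continuous_on ({a..b} - S) (\<lambda>t. B (g t) (h t))"
    by (rule continuous_on) (use assms(2,3) in \<open>simp_all add: bcont_off_def\<close>)
  ultimately show ?thesis unfolding bcont_off_def by blast
qed

lemma bounded_bilinear_matrix_vector_mult: "bounded_bilinear ((*v) :: real^'n^'m \<Rightarrow> real^'n \<Rightarrow> real^'m)"
  unfolding bilinear_conv_bounded_bilinear[symmetric] bilinear_def
  by (auto intro!: linearI simp: matrix_vector_right_distrib matrix_vector_mult_add_rdistrib
      scaleR_matrix_vector_assoc[symmetric] matrix_vector_mult_scaleR)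

lemma bounded_bilinear_vector_matrix_mult: "bounded_bilinear ((v*) :: real^'m \<Rightarrow> real^'n^'m \<Rightarrow> real^'n)"
  unfolding bilinear_conv_bounded_bilinear[symmetric] bilinear_def
  by (auto intro!: linearI simp: vec_eq_iff vector_matrix_mult_def sum.distrib algebra_simps sum_distrib_left)

lemmas bcont_off_intros =
  bcont_off_add bcont_off_diff bcont_off_Pair
  bcont_off_bilinear[OF bounded_bilinear_scaleR] bcont_off_bilinear[OF bounded_bilinear_inner]
  bcont_off_bilinear[OF bounded_bilinear_mult]
  bcont_off_bilinear[OF bounded_bilinear_matrix_vector_mult]
  bcont_off_bilinear[OF bounded_bilinear_vector_matrix_mult]
  bcont_off_continuous[OF continuous_on_const]

text \<open>Both end points of the inner interval are exceptional, so the breaks made by the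
  extension by zero do no harm.\<close>

lemma bcont_off_if:
  assumes "bcont_off S c d g" "a \<le> c" "d \<le> b" "c \<in> S" "d \<in> S"
  shows "bcont_off S a b (\<lambda>t. if c \<le> t \<and> t \<le> d then g t else 0)"
proof -
  let ?h = "\<lambda>t. if c \<le> t \<and> t \<le> d then g t else 0"
  have "?h ` {a..b} \<subseteq> insert 0 (g ` {c..d})" by auto
  moreover have "bounded (insert 0 (g ` {c..d}))" using assms(1) by (simp add: bcont_off_def)
  ultimately have "bounded (?h ` {a..b})" by (rule bounded_subset[rotated])
  moreover have "continuous_on ({a..b} - S) ?h"
  proof -
    have 1: "continuous_on ({c..d} - S) ?h"
    proof (rule continuous_on_eq)
      show "continuous_on ({c..d} - S) g" using assms(1) by (simp add: bcont_off_def)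
    qed auto
    have "continuous (at t within ({a..b} - S)) ?h" if t: "t \<in> {a..b} - S" for t
    proof (cases "c \<le> t \<and> t \<le> d")
      case True
      have "t \<noteq> c" "t \<noteq> d" using t assms(4,5) by auto
      then have t': "t \<in> {c<..<d}" using True by auto
      have "continuous (at t within ({c..d} - S)) ?h"
        using 1 t' t by (auto simp: continuous_on_eq_continuous_within)
      moreover have "at t within ({c..d} - S) = at t within ({a..b} - S)"
        by (rule at_within_nhd[of _ "{c<..<d}"]) (use t' assms(2,3) in auto)
      ultimately show ?thesis by simp
    next
      case False
      have "continuous (at t within ({a..b} - S)) (\<lambda>_. 0 :: 'a)" by simp
      then show ?thesis
      proof (rule continuous_transform_within_openin[of _ _ _ "({a..b} - S) \<inter> (- {c..d})"])
        show "openin (top_of_set ({a..b} - S)) (({a..b} - S) \<inter> - {c..d})"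
          by (rule openin_open_Int) (simp add: open_Compl)
      qed (use False t in auto)
    qed
    then show ?thesis by (simp add: continuous_on_eq_continuous_within)
  qed
  ultimately show ?thesis unfolding bcont_off_def by blast
qed

text \<open>A linear right-hand side is Lipschitz on the whole space, so the zero function can be
  shadowed in a tube whose radius is taken equal to the error bound itself; no smallness is
  involved. The constant \<eta> bounds the defect of the zero function.\<close>

lemma linear_ode_forward:
  fixes M :: "real \<Rightarrow> real^'m^'m::finite"
  assumes S: "finite S" and "a \<le> b" and M: "bcont_off S a b M" and c: "bcont_off S a b c"
  shows "\<exists>x. x a = \<xi> \<and> solves S a b x (\<lambda>t. M t *v x t + c t)"
proof -
  interpret mv: bounded_bilinear "(*v) :: real^'m^'m \<Rightarrow> real^'m \<Rightarrow> real^'m"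
    by (rule bounded_bilinear_matrix_vector_mult)
  obtain K where K: "0 \<le> K" "\<And>(a::real^'m^'m) b. norm (a *v b) \<le> norm a * norm b * K"
    using mv.nonneg_bounded by blast
  obtain G where "0 \<le> G" and G: "\<And>t. t \<in> {a..b} \<Longrightarrow> norm (M t) \<le> G"
    using bcont_off_bound[OF M] by blast
  obtain H where "0 \<le> H" and H: "\<And>t. t \<in> {a..b} \<Longrightarrow> norm (c t) \<le> H"
    using bcont_off_bound[OF c] by blast
  define \<eta> where "\<eta> = norm \<xi> + H * (b - a)"
  define L where "L = G * K"
  have "0 \<le> L" "0 \<le> \<eta>" using \<open>0 \<le> G\<close> \<open>0 \<le> H\<close> K \<open>a \<le> b\<close> by (auto simp: L_def \<eta>_def)
  have int: "bcont_off S a b (\<lambda>s. M s *v y s + c s)" if "continuous_on {a..b} y" for y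
    by (intro bcont_off_intros M c bcont_off_continuous that)
  obtain y where y: "continuous_on {a..b} y" "\<And>t. t \<in> {a..b} \<Longrightarrow> y t = \<xi> + integral {a..t} (\<lambda>s. M s *v y s + c s)"
  proof (rule shadowing[of a b "\<lambda>_. 0" L \<eta> "2 * \<eta> * exp (2 * L * (b - a))" "\<lambda>s x. M s *v x + c s" \<xi>])
    fix y :: "real \<Rightarrow> real^'m" assume "continuous_on {a..b} y"
    then show "(\<lambda>s. M s *v y s + c s) integrable_on {a..b}"
      using bcont_off_integrable[OF S int] by blast
  next
    fix s and x y :: "real^'m" assume s: "s \<in> {a..b}"
    have "norm (M s *v (x - y)) \<le> norm (M s) * norm (x - y) * K" by (rule K)
    also have "\<dots> \<le> G * norm (x - y) * K" using G[OF s] K by (intro mult_right_mono) auto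
    finally show "norm (M s *v x + c s - (M s *v y + c s)) \<le> L * norm (x - y)"
      by (simp add: L_def mv.diff_right algebra_simps)
  next
    fix t assume t: "t \<in> {a..b}"
    have "c integrable_on {a..t}"
      using bcont_off_integrable[OF S bcont_off_subinterval[OF c, of a t]] t by auto
    then have "norm (integral {a..t} c) \<le> H * (t - a)"
      using integral_bound[of a t c H] H t has_integral_bound[OF \<open>0 \<le> H\<close>, of c "integral {a..t} c" a t]
      by (auto simp: integrable_integral)
    also have "\<dots> \<le> H * (b - a)" using t \<open>0 \<le> H\<close> by (intro mult_left_mono) auto
    finally have "norm (integral {a..t} c) \<le> H * (b - a)" .
    then show "norm (0 - (\<xi> + integral {a..t} (\<lambda>s. M s *v 0 + c s))) \<le> \<eta>"
      unfolding \<eta>_def using norm_triangle_ineq[of \<xi> "integral {a..t} c"]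
      by (simp only: diff_0 norm_minus_cancel matrix_vector_mult_0_right add_0)
  qed (use \<open>a \<le> b\<close> \<open>0 \<le> L\<close> \<open>0 \<le> \<eta>\<close> in auto)
  have "solves S a b y (\<lambda>t. M t *v y t + c t)"
    using solves_of_integral[OF S int[OF y(1)] y(2)] .
  moreover have "y a = \<xi>" using y(2)[of a] \<open>a \<le> b\<close> by simp
  ultimately show ?thesis by blast
qed

text \<open>Reflection of time reduces the terminal value problem to the initial value problem; the
  exceptional set is reflected as well.\<close>

lemma linear_ode_backward:
  fixes M :: "real \<Rightarrow> real^'m^'m::finite"
  assumes S: "finite S" and ab: "a \<le> b" and M: "bcont_off S a b M" and c: "bcont_off S a b c"
  shows "\<exists>x. x b = \<xi> \<and> solves S a b x (\<lambda>t. M t *v x t + c t)"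
proof -
  have rev: "bcont_off (uminus ` S) (-b) (-a) (\<lambda>t. - g (- t))" if "bcont_off S a b g" for g :: "real \<Rightarrow> 'x::real_normed_vector"
  proof -
    have "(\<lambda>t. - g (- t)) ` {-b..-a} = uminus ` g ` {a..b}"
      by (simp only: image_image image_uminus_atLeastAtMost[symmetric] minus_minus)
    moreover have "continuous_on ({-b..-a} - uminus ` S) (\<lambda>t. - g (- t))"
    proof (rule continuous_on_minus, rule continuous_on_compose2[of "{a..b} - S" g])
      show "continuous_on ({a..b} - S) g" using that by (simp add: bcont_off_def)
      show "uminus ` ({-b..-a} - uminus ` S) \<subseteq> {a..b} - S"
      proof clarify
        fix x assume "x \<in> {-b..-a}" "x \<notin> uminus ` S"
        then show "- x \<in> {a..b} - S" by (auto intro: rev_image_eqI)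
      qed
    qed (rule continuous_on_minus[OF continuous_on_id])
    moreover have "bounded (uminus ` g ` {a..b})" using that by (simp add: bcont_off_def)
    ultimately show ?thesis unfolding bcont_off_def by (simp only: simp_thms)
  qed
  obtain x where x: "x (-b) = \<xi>" "solves (uminus ` S) (-b) (-a) x (\<lambda>t. (- M (- t)) *v x t + - c (- t))"
    using linear_ode_forward[OF finite_imageI[OF S] _ rev[OF M] rev[OF c], of \<xi>] ab by auto
  have "solves S a b (\<lambda>t. x (- t)) (\<lambda>t. M t *v x (- t) + c t)"
    unfolding solves_def
  proof (intro conjI ballI)
    show "continuous_on {a..b} (\<lambda>t. x (- t))"
      by (rule continuous_on_compose2[of "{-b..-a}" x])
        (use x(2) in \<open>auto simp: solves_def intro!: continuous_on_minus\<close>)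
    fix t assume t: "t \<in> {a<..<b} - S"
    then have "(x has_vector_derivative ((- M (- (- t))) *v x (- t) + - c (- (- t)))) (at (- t))"
    proof -
      have "- t \<in> {- b<..<- a} - uminus ` S" using t by (auto simp: image_iff)
      then show ?thesis using x(2) unfolding solves_def by blast
    qed
    then have "((x \<circ> uminus) has_vector_derivative (-1) *\<^sub>R ((- M t) *v x (- t) + - c t)) (at t)"
    proof (intro vector_diff_chain_at)
      show "(uminus has_vector_derivative - 1) (at t)"
        using has_vector_derivative_minus[OF has_vector_derivative_id] by simp
    qed simp
    then show "((\<lambda>t. x (- t)) has_vector_derivative M t *v x (- t) + c t) (at t)"
      by (simp add: o_def bounded_bilinear.minus_left[OF bounded_bilinear_matrix_vector_mult] add.commute)
  qed
  then show ?thesis using x(1) by (intro exI[of _ "\<lambda>t. x (- t)"]) auto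
qed

text \<open>The junction \<open>c\<close> is exceptional, so only the values have to match there and
  the two right-hand sides may differ.\<close>

lemma solves_combine:
  assumes x: "solves S a c x g" and y: "solves S c b y h" and "x c = y c" "a \<le> c" "c \<le> b" "c \<in> S"
    and "\<And>t. t \<in> {a..c} - S \<Longrightarrow> k t = g t" "\<And>t. t \<in> {c..b} - S \<Longrightarrow> k t = h t"
  shows "solves S a b (\<lambda>t. if t \<le> c then x t else y t) k"
  unfolding solves_def
proof (intro conjI ballI)
  have "continuous_on ({a..c} \<union> {c..b}) (\<lambda>t. if t \<le> c then x t else y t)"
    using x y \<open>x c = y c\<close> unfolding solves_def
    by (intro continuous_on_If) auto
  then show "continuous_on {a..b} (\<lambda>t. if t \<le> c then x t else y t)"
    using assms by (simp add: ivl_disj_un_two_touch)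
  fix t assume t: "t \<in> {a<..<b} - S"
  show "((\<lambda>t. if t \<le> c then x t else y t) has_vector_derivative k t) (at t)"
  proof (cases "t < c")
    case True
    then have "(x has_vector_derivative k t) (at t)" using x t assms unfolding solves_def by auto
    then show ?thesis
      by (rule has_vector_derivative_transform_within_open[of _ _ _ "{..<c}"]) (use True in auto)
  next
    case False
    then have c: "c < t" using t \<open>c \<in> S\<close> by (metis Diff_iff linorder_neqE_linordered_idom)
    then have "(y has_vector_derivative k t) (at t)" using y t assms unfolding solves_def by auto
    then show ?thesis
      by (rule has_vector_derivative_transform_within_open[of _ _ _ "{c<..}"]) (use c in auto)
  qed
qed

lemma linear_ode:
  fixes M :: "real \<Rightarrow> real^'m^'m::finite"
  assumes S: "finite S" and t0: "a \<le> t0" "t0 \<le> b" "t0 \<in> S"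
    and M: "bcont_off S a b M" and c: "bcont_off S a b c"
  shows "\<exists>x. x t0 = \<xi> \<and> solves S a b x (\<lambda>t. M t *v x t + c t)"
proof -
  obtain x where x: "x t0 = \<xi>" "solves S a t0 x (\<lambda>t. M t *v x t + c t)"
    using linear_ode_backward[OF S t0(1) bcont_off_subinterval[OF M] bcont_off_subinterval[OF c]] t0 by blast
  obtain y where y: "y t0 = \<xi>" "solves S t0 b y (\<lambda>t. M t *v y t + c t)"
    using linear_ode_forward[OF S t0(2) bcont_off_subinterval[OF M] bcont_off_subinterval[OF c]] t0 by blast
  let ?z = "\<lambda>t. if t \<le> t0 then x t else y t"
  have "solves S a b ?z (\<lambda>t. M t *v ?z t + c t)"
    by (rule solves_combine[OF x(2) y(2)]) (use x y t0 in auto)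
  then show ?thesis using x(1) by (intro exI[of _ ?z]) auto
qed

section \<open>Absolutely continuous functions\<close>

lemma absolutely_continuous_fun_diff:
  assumes "absolutely_continuous_fun a b x" "absolutely_continuous_fun a b y"
  shows "absolutely_continuous_fun a b (\<lambda>t. x t - y t)"
  unfolding absolutely_continuous_fun_def
proof (intro allI impI)
  fix e :: real assume "0 < e"
  then have "0 < e/2" by simp
  obtain d1 where d1: "0 < d1" "\<And>D :: (real \<times> real) set.
        finite D \<and> (\<forall>(s, t)\<in>D. a \<le> s \<and> s \<le> t \<and> t \<le> b) \<and>
        pairwise (\<lambda>(s, t) (s', t'). {s<..<t} \<inter> {s'<..<t'} = {}) D \<and>
        (\<Sum>(s, t)\<in>D. t - s) < d1 \<Longrightarrow> (\<Sum>(s, t)\<in>D. norm (x t - x s)) < e/2"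
    using assms(1)[unfolded absolutely_continuous_fun_def, rule_format, OF \<open>0 < e/2\<close>] by blast
  obtain d2 where d2: "0 < d2" "\<And>D :: (real \<times> real) set.
        finite D \<and> (\<forall>(s, t)\<in>D. a \<le> s \<and> s \<le> t \<and> t \<le> b) \<and>
        pairwise (\<lambda>(s, t) (s', t'). {s<..<t} \<inter> {s'<..<t'} = {}) D \<and>
        (\<Sum>(s, t)\<in>D. t - s) < d2 \<Longrightarrow> (\<Sum>(s, t)\<in>D. norm (y t - y s)) < e/2"
    using assms(2)[unfolded absolutely_continuous_fun_def, rule_format, OF \<open>0 < e/2\<close>] by blast
  show "\<exists>\<delta>>0. \<forall>D. finite D \<and> (\<forall>(s, t)\<in>D. a \<le> s \<and> s \<le> t \<and> t \<le> b) \<and>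
        pairwise (\<lambda>(s, t) (s', t'). {s<..<t} \<inter> {s'<..<t'} = {}) D \<and>
        (\<Sum>(s, t)\<in>D. t - s) < \<delta> \<longrightarrow>
        (\<Sum>(s, t)\<in>D. norm (x t - y t - (x s - y s))) < e"
  proof (intro exI[of _ "min d1 d2"] conjI allI impI)
    fix D :: "(real \<times> real) set"
    assume D: "finite D \<and> (\<forall>(s, t)\<in>D. a \<le> s \<and> s \<le> t \<and> t \<le> b) \<and>
        pairwise (\<lambda>(s, t) (s', t'). {s<..<t} \<inter> {s'<..<t'} = {}) D \<and>
        (\<Sum>(s, t)\<in>D. t - s) < min d1 d2"
    have "(\<Sum>(s, t)\<in>D. norm (x t - y t - (x s - y s))) \<le>
       (\<Sum>(s, t)\<in>D. norm (x t - x s) + norm (y t - y s))"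
    proof (rule sum_mono, clarify)
      fix s t
      show "norm (x t - y t - (x s - y s)) \<le> norm (x t - x s) + norm (y t - y s)"
        using norm_triangle_ineq4[of "x t - x s" "y t - y s"] by (simp add: algebra_simps)
    qed
    also have "\<dots> = (\<Sum>(s, t)\<in>D. norm (x t - x s)) + (\<Sum>(s, t)\<in>D. norm (y t - y s))"
      by (simp add: sum.distrib case_prod_unfold)
    also have "\<dots> < e" using d1(2)[of D] d2(2)[of D] D by auto
    finally show "(\<Sum>(s, t)\<in>D. norm (x t - y t - (x s - y s))) < e" .
  qed (use d1(1) d2(1) in auto)
qed

lemma lipschitz_imp_absolutely_continuous_fun:
  assumes "L-lipschitz_on {a..b} y"
  shows "absolutely_continuous_fun a b y"
  unfolding absolutely_continuous_fun_def
proof (intro allI impI)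
  fix e :: real assume "0 < e"
  have L: "0 \<le> L" using assms by (rule lipschitz_on_nonneg)
  show "\<exists>\<delta>>0. \<forall>D. finite D \<and> (\<forall>(s, t)\<in>D. a \<le> s \<and> s \<le> t \<and> t \<le> b) \<and>
        pairwise (\<lambda>(s, t) (s', t'). {s<..<t} \<inter> {s'<..<t'} = {}) D \<and>
        (\<Sum>(s, t)\<in>D. t - s) < \<delta> \<longrightarrow> (\<Sum>(s, t)\<in>D. norm (y t - y s)) < e"
  proof (intro exI[of _ "e / (L + 1)"] conjI allI impI)
    show "0 < e / (L + 1)" using \<open>0 < e\<close> L by simp
    fix D :: "(real \<times> real) set"
    assume D: "finite D \<and> (\<forall>(s, t)\<in>D. a \<le> s \<and> s \<le> t \<and> t \<le> b) \<and>
        pairwise (\<lambda>(s, t) (s', t'). {s<..<t} \<inter> {s'<..<t'} = {}) D \<and>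
        (\<Sum>(s, t)\<in>D. t - s) < e / (L + 1)"
    have "(\<Sum>(s, t)\<in>D. norm (y t - y s)) \<le> (\<Sum>(s, t)\<in>D. L * (t - s))"
    proof (rule sum_mono, clarify)
      fix s t assume "(s, t) \<in> D"
      then have "a \<le> s" "s \<le> t" "t \<le> b" using D by auto
      then show "norm (y t - y s) \<le> L * (t - s)"
        using lipschitz_on_normD[OF assms, of t s] by auto
    qed
    also have "\<dots> = L * (\<Sum>(s, t)\<in>D. t - s)" by (simp add: sum_distrib_left case_prod_unfold)
    also have "\<dots> \<le> L * (e / (L + 1))" using D L by (intro mult_left_mono) auto
    also have "\<dots> < e" using \<open>0 < e\<close> L by (simp add: field_simps)
    finally show "(\<Sum>(s, t)\<in>D. norm (y t - y s)) < e" .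
  qed
qed

text \<open>A gauge proof: points of zero derivative contribute little by the choice of the gauge, the
  exceptional null set contributes little by absolute continuity.\<close>

lemma absolutely_continuous_fun_zero_derivative:
  fixes d :: "real \<Rightarrow> 'a::real_normed_vector"
  assumes ac: "absolutely_continuous_fun a b d" and "a \<le> b"
    and deriv: "AE t in lebesgue_on {a..b}. (d has_vector_derivative 0) (at t)"
  shows "d b = d a"
proof -
  have "norm (d b - d a) \<le> e * (b - a) + e" if "0 < e" for e :: real
  proof -
    obtain \<delta> where \<delta>: "0 < \<delta>" and ac': "\<And>D :: (real \<times> real) set. finite D \<Longrightarrow> (\<forall>(s, t)\<in>D. a \<le> s \<and> s \<le> t \<and> t \<le> b) \<Longrightarrow>
        pairwise (\<lambda>(s, t) (s', t'). {s<..<t} \<inter> {s'<..<t'} = {}) D \<Longrightarrow>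
        (\<Sum>(s, t)\<in>D. t - s) < \<delta> \<Longrightarrow> (\<Sum>(s, t)\<in>D. norm (d t - d s)) < e"
      using ac[unfolded absolutely_continuous_fun_def, rule_format, OF \<open>0 < e\<close>] by blast
    define N where "N = {t \<in> {a..b}. \<not> (d has_vector_derivative 0) (at t)}"
    have "negligible N"
    proof -
      have "AE t in lebesgue. t \<in> {a..b} \<longrightarrow> (d has_vector_derivative 0) (at t)"
        using deriv by (simp add: AE_restrict_space_iff)
      then obtain N' where N': "\<And>t. t \<in> space lebesgue - N' \<Longrightarrow> t \<in> {a..b} \<longrightarrow> (d has_vector_derivative 0) (at t)"
          "N' \<in> null_sets lebesgue"
        by (rule AE_E3) blast
      have "negligible N'" "N \<subseteq> N'" using N' by (auto simp: negligible_iff_null_sets N_def)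
      then show ?thesis by (rule negligible_subset)
    qed
    then obtain G where G: "open G" "N \<subseteq> G" "G \<in> lmeasurable" "measure lebesgue G < \<delta>"
    proof -
      have "\<exists>G. N \<subseteq> G \<and> open G \<and> G \<in> lmeasurable \<and> measure lebesgue G < \<delta>"
      proof -
        obtain G where G: "open G" "N \<subseteq> G" "G - N \<in> lmeasurable" "emeasure lebesgue (G - N) < ennreal \<delta>"
          using sets_lebesgue_outer_open[OF negligible_imp_sets[OF \<open>negligible N\<close>] \<delta>] by blast
        have N: "N \<in> null_sets lebesgue" using \<open>negligible N\<close> by (simp add: negligible_iff_null_sets)
        have "G \<in> sets lebesgue" using \<open>open G\<close> by auto
        have "emeasure lebesgue G = emeasure lebesgue (G - N)"
          by (rule emeasure_Diff_null_set[OF N \<open>G \<in> sets lebesgue\<close>, symmetric])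
        then have "emeasure lebesgue G < ennreal \<delta>" using G(4) by simp
        have Gm: "G \<in> lmeasurable"
          using less_trans[OF \<open>emeasure lebesgue G < ennreal \<delta>\<close> ennreal_less_top] \<open>G \<in> sets lebesgue\<close>
          by (simp add: fmeasurableI)
        then have "measure lebesgue G < \<delta>"
          using \<open>emeasure lebesgue G < ennreal \<delta>\<close>
          by (simp add: emeasure_eq_measure2 ennreal_less_iff)
        then show ?thesis using G Gm by blast
      qed
      then show ?thesis using that by blast
    qed
    \<comment> \<open>\<open>Q t r\<close> says that the radius \<open>r\<close> suits the tag
      \<open>t\<close>; it is named so that one application of choice produces the gauge.\<close>
    define Q where "Q t r \<longleftrightarrow> (\<forall>u v. t \<in> {a..b} \<longrightarrow> u \<le> t \<and> t \<le> v \<and> {u..v} \<subseteq> ball t r \<longrightarrow>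
        (if t \<in> N then {u..v} \<subseteq> G else norm (d v - d u) \<le> e * (v - u)))" for t r
    have "\<exists>r>0. Q t r" for t
    proof (cases "t \<in> N")
      case True
      then obtain r where "0 < r" "ball t r \<subseteq> G" using G open_contains_ball by blast
      then show ?thesis unfolding Q_def using True by auto
    next
      case False
      show ?thesis
      proof (cases "t \<in> {a..b}")
        case True
        then have "(d has_vector_derivative 0) (at t)" using False by (auto simp: N_def)
        then obtain r where r: "0 < r" "\<And>s. norm (s - t) < r \<Longrightarrow> norm (d s - d t) \<le> e * norm (s - t)"
          using \<open>0 < e\<close> unfolding has_vector_derivative_def has_derivative_at_alt by auto
        have "norm (d v - d u) \<le> e * (v - u)" if "u \<le> t" "t \<le> v" "{u..v} \<subseteq> ball t r" for u v
        proof -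
          have "u \<in> {u..v}" "v \<in> {u..v}" using that by auto
          then have "u \<in> ball t r" "v \<in> ball t r" using that(3) by blast+
          then have "norm (d u - d t) \<le> e * (t - u)" "norm (d v - d t) \<le> e * (v - t)"
            using r(2)[of u] r(2)[of v] that by (auto simp: dist_real_def abs_minus_commute)
          then show ?thesis
            using norm_triangle_ineq4[of "d v - d t" "d u - d t"] by (simp add: algebra_simps)
        qed
        then show ?thesis unfolding Q_def using False \<open>0 < r\<close> by auto
      qed (auto simp: Q_def intro: exI[of _ 1])
    qed
    then have "\<forall>t. \<exists>r. 0 < r \<and> Q t r" by blast
    from choice[OF this] obtain r where r0: "\<And>t. 0 < r t" "\<And>t. Q t (r t)" by blast
    have r: "if t \<in> N then {u..v} \<subseteq> G else norm (d v - d u) \<le> e * (v - u)"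
      if "t \<in> {a..b}" "u \<le> t" "t \<le> v" "{u..v} \<subseteq> ball t (r t)" for t u v
      by (rule r0(2)[of t, unfolded Q_def, THEN spec, THEN spec, THEN mp, THEN mp])
        (use that in blast)+
    have "gauge (\<lambda>t. ball t (r t))" using r0(1) by (auto simp: gauge_def)
    then obtain p where p: "p tagged_division_of {a..b}" "(\<lambda>t. ball t (r t)) fine p"
      using fine_division_exists_real by blast
    have fin: "finite p" using p(1) by blast
    have K: "\<exists>u v. K = {u..v} \<and> u \<le> x \<and> x \<le> v \<and> a \<le> u \<and> v \<le> b \<and> Sup K = v \<and> Inf K = u"
      if xK: "(x, K) \<in> p" for x K
    proof -
      obtain u v where "K = cbox u v" using tagged_division_ofD(4)[OF p(1) xK] by blast
      moreover have "x \<in> K" "K \<subseteq> {a..b}" using tagged_division_ofD(2,3)[OF p(1) xK] by simp_all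
      ultimately show ?thesis by (intro exI[of _ u] exI[of _ v]) auto
    qed
    define pN where "pN = {(x, K) \<in> p. x \<in> N}"
    define pG where "pG = {(x, K) \<in> p. x \<notin> N}"
    have p_eq: "p = pN \<union> pG" "pN \<inter> pG = {}" "pN \<subseteq> p" "pG \<subseteq> p" by (auto simp: pN_def pG_def)
    have tel: "(\<Sum>(x, K)\<in>p. d (Sup K) - d (Inf K)) = d b - d a"
      using additive_tagged_division_1[OF \<open>a \<le> b\<close> p(1), of d] by simp
    have A: "(\<Sum>(x, K)\<in>pG. norm (d (Sup K) - d (Inf K))) \<le> e * (b - a)"
    proof -
      have "(\<Sum>(x, K)\<in>pG. norm (d (Sup K) - d (Inf K))) \<le> (\<Sum>(x, K)\<in>pG. e * (Sup K - Inf K))"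
      proof (rule sum_mono, clarify)
        fix x K assume xK: "(x, K) \<in> pG"
        then have "(x, K) \<in> p" "x \<notin> N" by (auto simp: pG_def)
        moreover have "K \<subseteq> ball x (r x)" using p(2) \<open>(x, K) \<in> p\<close> by (auto dest: fineD)
        moreover obtain u v where uv: "K = {u..v}" "u \<le> x" "x \<le> v" "a \<le> u" "v \<le> b" "Sup K = v" "Inf K = u"
          using K[OF \<open>(x, K) \<in> p\<close>] by blast
        have xab: "x \<in> {a..b}" using uv by auto
        ultimately show "norm (d (Sup K) - d (Inf K)) \<le> e * (Sup K - Inf K)"
          using r[OF xab, of u v] uv by simp
      qed
      also have "\<dots> \<le> (\<Sum>(x, K)\<in>p. e * (Sup K - Inf K))"
      proof (rule sum_mono2[OF fin p_eq(4)])
        fix i assume "i \<in> p - pG"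
        then obtain x K1 where i: "i = (x, K1)" "(x, K1) \<in> p" by (cases i) auto
        then have "Inf K1 \<le> Sup K1" using K[of x K1] by auto
        then show "0 \<le> (case i of (x, K) \<Rightarrow> e * (Sup K - Inf K))" using i \<open>0 < e\<close> by simp
      qed
      also have "\<dots> = e * (\<Sum>(x, K)\<in>p. Sup K - Inf K)" by (simp add: sum_distrib_left case_prod_unfold)
      also have "(\<Sum>(x, K)\<in>p. Sup K - Inf K) = b - a"
        using additive_tagged_division_1[OF \<open>a \<le> b\<close> p(1), of "\<lambda>x. x"] by simp
      finally show ?thesis .
    qed
    have B: "(\<Sum>(x, K)\<in>pN. norm (d (Sup K) - d (Inf K))) \<le> e"
    proof -
      \<comment> \<open>Degenerate intervals contribute nothing and are dropped. Among the others,
        distinct tagged intervals have disjoint nonempty interiors, so passing to pairs of end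
        points is injective.\<close>
      define nz where "nz = {(x, K) \<in> pN. Inf K < Sup K}"
      define D where "D = (\<lambda>(x, K). (Inf K, Sup K)) ` nz"
      have nzp: "nz \<subseteq> p" "finite nz" using fin p_eq(3) by (auto simp: nz_def intro: finite_subset)
      have disj: "{Inf K<..<Sup K} \<inter> {Inf K'<..<Sup K'} = {}" if xK: "(x, K) \<in> p" "(x', K') \<in> p" "(x, K) \<noteq> (x', K')" for x K x' K'
      proof -
        obtain u v where uv: "K = {u..v}" "Sup K = v" "Inf K = u" using K[OF xK(1)] by blast
        obtain u' v' where uv': "K' = {u'..v'}" "Sup K' = v'" "Inf K' = u'" using K[OF xK(2)] by blast
        show ?thesis using tagged_division_ofD(5)[OF p(1) xK]
          unfolding uv(2,3) uv'(2,3) by (simp add: uv(1) uv'(1))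
      qed
      have inj: "inj_on (\<lambda>(x, K). (Inf K, Sup K)) nz"
      proof (rule inj_onI, clarify)
        fix x K x' K' assume *: "(x, K) \<in> nz" "(x', K') \<in> nz" "Inf K = Inf K'" "Sup K = Sup K'"
        show "x = x' \<and> K = K'"
        proof (rule ccontr)
          assume "\<not> (x = x' \<and> K = K')"
          then have "{Inf K<..<Sup K} \<inter> {Inf K<..<Sup K} = {}"
            using disj[of x K x' K'] * nzp by auto
          then show False using *(1) by (auto simp: nz_def)
        qed
      qed
      have pw: "pairwise (\<lambda>(s, t) (s', t'). {s<..<t} \<inter> {s'<..<t'} = {}) D"
        unfolding pairwise_def
      proof (intro ballI impI)
        fix i j assume "i \<in> D" "j \<in> D" "i \<noteq> j"
        then obtain x K x' K' where *: "(x, K) \<in> nz" "(x', K') \<in> nz" "i = (Inf K, Sup K)" "j = (Inf K', Sup K')"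
          unfolding D_def by auto
        then have "(x, K) \<noteq> (x', K')" using \<open>i \<noteq> j\<close> by auto
        then show "(case i of (s, t) \<Rightarrow> (\<lambda>(s', t'). {s<..<t} \<inter> {s'<..<t'} = {})) j"
          using disj[of x K x' K'] * nzp by auto
      qed
      have KG: "K \<subseteq> G" if "(x, K) \<in> nz" for x K
      proof -
        have "(x, K) \<in> p" "x \<in> N" using that by (auto simp: nz_def pN_def)
        moreover have "K \<subseteq> ball x (r x)" using p(2) \<open>(x, K) \<in> p\<close> by (auto dest: fineD)
        moreover obtain u v where uv: "K = {u..v}" "u \<le> x" "x \<le> v" "a \<le> u" "v \<le> b" "Sup K = v" "Inf K = u"
          using K[OF \<open>(x, K) \<in> p\<close>] by blast
        have xab: "x \<in> {a..b}" using uv by auto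
        ultimately show ?thesis using r[OF xab, of u v] uv by simp
      qed
      have "(\<Sum>(s, t)\<in>D. t - s) = (\<Sum>(x, K)\<in>nz. Sup K - Inf K)"
        unfolding D_def by (subst sum.reindex[OF inj]) (simp add: case_prod_unfold)
      also have "\<dots> = (\<Sum>(x, K)\<in>nz. measure lebesgue {Inf K<..<Sup K})"
        by (rule sum.cong) (auto simp: nz_def)
      also have "\<dots> = measure lebesgue (\<Union>(x, K)\<in>nz. {Inf K<..<Sup K})"
      proof -
        have "measure lebesgue (\<Union>i\<in>nz. case i of (x, K) \<Rightarrow> {Inf K<..<Sup K}) =
          (\<Sum>i\<in>nz. measure lebesgue (case i of (x, K) \<Rightarrow> {Inf K<..<Sup K}))"
        proof (rule measure_finite_Union[OF nzp(2)])
          show "disjoint_family_on (\<lambda>i. case i of (x, K) \<Rightarrow> {Inf K<..<Sup K}) nz"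
            unfolding disjoint_family_on_def
          proof (intro ballI impI)
            fix i j assume *: "i \<in> nz" "j \<in> nz" "i \<noteq> j"
            obtain x K x' K' where ij: "i = (x, K)" "j = (x', K')" by (cases i, cases j)
            show "(case i of (x, K) \<Rightarrow> {Inf K<..<Sup K}) \<inter> (case j of (x, K) \<Rightarrow> {Inf K<..<Sup K}) = {}"
              using disj[of x K x' K'] * nzp ij by auto
          qed
        qed (auto simp: nz_def)
        then show ?thesis by (simp add: case_prod_unfold)
      qed
      also have "\<dots> \<le> measure lebesgue G"
      proof (rule measure_mono_fmeasurable)
        show "(\<Union>(x, K)\<in>nz. {Inf K<..<Sup K}) \<subseteq> G"
        proof clarify
          fix x K s assume xK: "(x, K) \<in> nz" and s: "s \<in> {Inf K<..<Sup K}"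
          have "(x, K) \<in> p" using xK nzp by blast
          from K[OF this] obtain u v where "K = {u..v}" "Sup K = v" "Inf K = u" by blast
          then have "s \<in> K" using s by auto
          then show "s \<in> G" using KG[OF xK] by blast
        qed
      qed (use nzp G in auto)
      also have "\<dots> < \<delta>" by fact
      finally have sm: "(\<Sum>(s, t)\<in>D. t - s) < \<delta>" .
      have "(\<Sum>(x, K)\<in>pN. norm (d (Sup K) - d (Inf K))) = (\<Sum>(x, K)\<in>nz. norm (d (Sup K) - d (Inf K)))"
      proof (rule sum.mono_neutral_right)
        show "finite pN" using fin p_eq(3) by (rule finite_subset[rotated])
        show "\<forall>i\<in>pN - nz. (case i of (x, K) \<Rightarrow> norm (d (Sup K) - d (Inf K))) = 0"
        proof clarify
          fix x K assume "(x, K) \<in> pN" "(x, K) \<notin> nz"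
          then have "\<not> Inf K < Sup K" "(x, K) \<in> p" by (auto simp: nz_def pN_def)
          then have "Inf K = Sup K" using K[of x K] by auto
          then show "norm (d (Sup K) - d (Inf K)) = 0" by simp
        qed
      qed (auto simp: nz_def)
      also have "\<dots> = (\<Sum>(s, t)\<in>D. norm (d t - d s))"
        unfolding D_def by (subst sum.reindex[OF inj]) (simp add: case_prod_unfold)
      also have "\<dots> < e"
      proof (rule ac'[OF _ _ pw sm])
        show "finite D" using nzp by (simp add: D_def)
        show "\<forall>(s, t)\<in>D. a \<le> s \<and> s \<le> t \<and> t \<le> b" 
        proof clarify
          fix s t assume "(s, t) \<in> D"
          then obtain x K where "(x, K) \<in> nz" "s = Inf K" "t = Sup K" unfolding D_def by auto
          then show "a \<le> s \<and> s \<le> t \<and> t \<le> b" using K[of x K] nzp by auto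
        qed
      qed
      finally show ?thesis by simp
    qed
    have "norm (d b - d a) \<le> (\<Sum>(x, K)\<in>p. norm (d (Sup K) - d (Inf K)))"
      unfolding tel[symmetric] by (rule order_trans[OF norm_sum]) (simp add: case_prod_unfold)
    also have "\<dots> = (\<Sum>(x, K)\<in>pN. norm (d (Sup K) - d (Inf K))) + (\<Sum>(x, K)\<in>pG. norm (d (Sup K) - d (Inf K)))"
      using fin p_eq by (subst p_eq(1), intro sum.union_disjoint) (auto intro: finite_subset)
    finally show ?thesis using A B by linarith
  qed
  then have "norm (d b - d a) \<le> 0 + e" if "0 < e" for e :: real
  proof -
    have den: "0 < b - a + 1" using \<open>a \<le> b\<close> by simp
    have "norm (d b - d a) \<le> e / (b - a + 1) * (b - a) + e / (b - a + 1)"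
      by (rule \<open>\<And>e. 0 < e \<Longrightarrow> norm (d b - d a) \<le> e * (b - a) + e\<close>) (use that den in simp)
    also have "\<dots> = e / (b - a + 1) * (b - a + 1)" by (simp only: distrib_left mult_1_right)
    also have "\<dots> = e" using den by simp
    finally show ?thesis by simp
  qed
  then have "norm (d b - d a) \<le> 0" by (rule field_le_epsilon)
  then show ?thesis by simp
qed

section \<open>Differentiability of monotone Lipschitz functions\<close>

text \<open>By the Henstock lemma, the intervals on which the mean of \<open>f\<close> differs much from the value at
  a tag have small total length; a Vitali cover by such intervals then bounds the set of bad points.\<close>

lemma integral_has_real_derivative_ae:
  fixes f :: "real \<Rightarrow> real"
  assumes f: "f integrable_on {a..b}"
  shows "negligible {x \<in> {a<..<b}. \<not> ((\<lambda>u. integral {a..u} f) has_real_derivative f x) (at x)}"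
proof -
  define F where "F u = integral {a..u} f" for u
  define bad where "bad n x u v \<longleftrightarrow> x \<in> {u..v} \<and> u < v \<and> {u..v} \<subseteq> {a<..<b} \<and>
     \<bar>F v - F u - f x * (v - u)\<bar> > (v - u) / real (Suc n)" for n x u v
  \<comment> \<open>Points with arbitrarily short bad intervals around them: precisely what makes
    the bad intervals a Vitali cover.\<close>
  define E where "E n = {x \<in> {a<..<b}. \<forall>\<delta>>0. \<exists>u v. bad n x u v \<and> {u..v} \<subseteq> ball x \<delta>}" for n
  have Fdiff: "F v - F u = integral {u..v} f" if "a \<le> u" "u \<le> v" "v \<le> b" for u v
  proof -
    have "f integrable_on {a..v}" by (rule integrable_on_subinterval[OF f]) (use that in auto)
    then show ?thesis
      using Henstock_Kurzweil_Integration.integral_combine[of a u v f] that by (simp add: F_def)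
  qed
  have negE: "negligible (E n)" for n
    unfolding negligible_outer_le
  proof (intro allI impI)
    fix e :: real assume "0 < e"
    define e' where "e' = e / real (Suc n)"
    have "0 < e'" using \<open>0 < e\<close> by (simp add: e'_def)
    obtain \<gamma> where \<gamma>: "gauge \<gamma>" "\<And>p. p tagged_partial_division_of (cbox a b) \<Longrightarrow> \<gamma> fine p \<Longrightarrow>
        (\<Sum>(x, K)\<in>p. norm (measure lborel K *\<^sub>R f x - integral K f)) < e'"
      using Henstock_lemma[of f a b e'] f \<open>0 < e'\<close> by auto
    \<comment> \<open>An index keeps the tag together with its interval, because the Henstock lemma
      compares the integral with the value at the tag.\<close>
    define K where "K = {(x, u, v). x \<in> E n \<and> bad n x u v \<and> {u..v} \<subseteq> \<gamma> x}"
    define ivl where "ivl = (\<lambda>(x::real, u::real, v::real). {u..v})"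
    have cb: "cball ((u + v) / 2) ((v - u) / 2) = {u..v}" for u v :: real
      by (simp add: cball_eq_atLeastAtMost field_simps)
    obtain C where C: "countable C" "C \<subseteq> K"
      "pairwise (\<lambda>i j. disjnt (ivl i) (ivl j)) C" "negligible (E n - (\<Union>i\<in>C. ivl i))"
    proof (rule Vitali_covering_theorem_cballs[of K "\<lambda>(x, u, v). (v - u) / 2" "E n" "\<lambda>(x, u, v). (u + v) / 2"])
      fix x d :: real assume x: "x \<in> E n" and "0 < d"
      obtain r where r: "0 < r" "ball x r \<subseteq> \<gamma> x"
        using \<gamma>(1) unfolding gauge_def open_contains_ball by blast
      obtain u v where uv: "bad n x u v" "{u..v} \<subseteq> ball x (min r d)"
      proof -
        have "0 < min r d" using r(1) \<open>0 < d\<close> by simp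
        then show ?thesis using x that unfolding E_def by blast
      qed
      have "u \<in> {u..v}" "v \<in> {u..v}" using uv(1) by (auto simp: bad_def)
      then have "u \<in> ball x (min r d)" "v \<in> ball x (min r d)" using uv(2) by blast+
      then have "(v - u) / 2 < d" by (auto simp: dist_real_def)
      moreover have "(x, u, v) \<in> K"
      proof -
        have "ball x (min r d) \<subseteq> ball x r" by auto
        then have "{u..v} \<subseteq> \<gamma> x" using uv(2) r(2) by blast
        then show ?thesis using uv(1) x by (simp add: K_def)
      qed
      moreover have "x \<in> {u..v}" using uv by (simp add: bad_def)
      ultimately show "\<exists>i. i \<in> K \<and> x \<in> cball (case i of (x, u, v) \<Rightarrow> (u + v) / 2) (case i of (x, u, v) \<Rightarrow> (v - u) / 2) \<and>
         (case i of (x, u, v) \<Rightarrow> (v - u) / 2) < d"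
        by (intro exI[of _ "(x, u, v)"]) (simp add: cb)
    next
      fix C assume *: "countable C" "C \<subseteq> K"
        "pairwise (\<lambda>i j. disjnt (cball (case i of (x, u, v) \<Rightarrow> (u + v) / 2) (case i of (x, u, v) \<Rightarrow> (v - u) / 2))
            (cball (case j of (x, u, v) \<Rightarrow> (u + v) / 2) (case j of (x, u, v) \<Rightarrow> (v - u) / 2))) C"
        "negligible (E n - (\<Union>i\<in>C. cball (case i of (x, u, v) \<Rightarrow> (u + v) / 2) (case i of (x, u, v) \<Rightarrow> (v - u) / 2)))"
      have "cball (case i of (x, u, v) \<Rightarrow> (u + v) / 2) (case i of (x, u, v) \<Rightarrow> (v - u) / 2) = ivl i"
        for i :: "real \<times> real \<times> real"
        by (cases i) (simp add: cb ivl_def)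
      then show thesis using that[OF *(1,2)] *(3,4) by simp
    next
      fix i assume "i \<in> K"
      then show "0 < (case i of (x, u, v) \<Rightarrow> (v - u) / 2)" by (cases i) (simp add: K_def bad_def)
    qed
    \<comment> \<open>A bad interval is no longer than \<open>Suc n\<close> times its Henstock
      error, so a finite disjoint family has total length at most \<open>Suc n * e'\<close>, which
      is \<open>e\<close>.\<close>
    have fin: "measure lebesgue (\<Union>i\<in>D. ivl i) \<le> e" if D: "D \<subseteq> C" "finite D" for D
    proof -
      define p where "p = (\<lambda>(x::real, u::real, v::real). (x, {u..v})) ` D"
      have DK: "D \<subseteq> K" using D C by blast
      have bad: "bad n x u v" if "(x, u, v) \<in> D" for x u v using that DK by (auto simp: K_def)
      have inj: "inj_on (\<lambda>(x::real, u::real, v::real). (x, {u..v})) D"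
      proof (rule inj_onI)
        fix i j assume *: "i \<in> D" "j \<in> D"
          "(\<lambda>(x::real, u::real, v::real). (x, {u..v})) i = (\<lambda>(x::real, u::real, v::real). (x, {u..v})) j"
        obtain x u v where i: "i = (x, u, v)" by (cases i)
        then have "u < v" using bad * by (simp add: bad_def)
        then show "i = j" using * i by (cases j) (simp add: Icc_eq_Icc)
      qed
      have disj: "ivl i \<inter> ivl j = {}" if "i \<in> D" "j \<in> D" "i \<noteq> j" for i j
        using C(3) D(1) that unfolding pairwise_def disjnt_def by blast
      have "p tagged_partial_division_of (cbox a b)"
        unfolding tagged_partial_division_of_def
      proof (intro conjI allI impI)
        show "finite p" using D by (simp add: p_def)
        fix x K1 assume "(x, K1) \<in> p"
        then obtain u v where "(x, u, v) \<in> D" "K1 = {u..v}" by (auto simp: p_def)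
        then show "x \<in> K1" "K1 \<subseteq> cbox a b" "\<exists>a b. K1 = cbox a b"
          using bad[of x u v] unfolding bad_def by (auto simp: subset_iff)
      next
        fix x1 K1 x2 K2 assume *: "(x1, K1) \<in> p \<and> (x2, K2) \<in> p \<and> (x1, K1) \<noteq> (x2, K2)"
        then obtain u1 v1 u2 v2 where **: "(x1, u1, v1) \<in> D" "K1 = {u1..v1}" "(x2, u2, v2) \<in> D" "K2 = {u2..v2}"
          by (auto simp: p_def)
        then have "(x1, u1, v1) \<noteq> (x2, u2, v2)" using * by auto
        then have "K1 \<inter> K2 = {}" using disj[OF **(1,3)] ** by (simp add: ivl_def)
        then show "interior K1 \<inter> interior K2 = {}" using interior_subset by blast
      qed
      moreover have "\<gamma> fine p"
        using DK unfolding fine_def p_def K_def by auto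
      ultimately have less: "(\<Sum>(x, K)\<in>p. norm (measure lborel K *\<^sub>R f x - integral K f)) < e'" by (rule \<gamma>(2))
      have "measure lebesgue (\<Union>i\<in>D. ivl i) = (\<Sum>i\<in>D. measure lebesgue (ivl i))"
      proof (rule measure_finite_Union[OF D(2)])
        show "disjoint_family_on ivl D" unfolding disjoint_family_on_def using disj by blast
      qed (auto simp: ivl_def case_prod_unfold emeasure_lborel_Icc_eq)
      also have "\<dots> \<le> (\<Sum>(x, u, v)\<in>D. real (Suc n) * norm (measure lborel {u..v} *\<^sub>R f x - integral {u..v} f))"
      proof (rule sum_mono, clarify)
        fix x u v assume xuv: "(x, u, v) \<in> D"
        then have b: "u < v" "{u..v} \<subseteq> {a<..<b}" "\<bar>F v - F u - f x * (v - u)\<bar> > (v - u) / real (Suc n)"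
          using bad[OF xuv] by (auto simp: bad_def)
        have "u \<in> {u..v}" "v \<in> {u..v}" using b(1) by auto
        then have "u \<in> {a<..<b}" "v \<in> {a<..<b}" using b(2) by blast+
        then have "a \<le> u" "v \<le> b" by auto
        then have "F v - F u = integral {u..v} f" using Fdiff b(1) by auto
        then have "norm (measure lborel {u..v} *\<^sub>R f x - integral {u..v} f) = \<bar>F v - F u - f x * (v - u)\<bar>"
          using b(1) by (simp add: abs_minus_commute mult.commute)
        then have "(v - u) / real (Suc n) \<le> norm (measure lborel {u..v} *\<^sub>R f x - integral {u..v} f)"
          using b(3) by linarith
        then have "v - u \<le> real (Suc n) * norm (measure lborel {u..v} *\<^sub>R f x - integral {u..v} f)"
          by (simp add: field_simps)
        then show "measure lebesgue (ivl (x, u, v)) \<le> real (Suc n) * norm (measure lborel {u..v} *\<^sub>R f x - integral {u..v} f)"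
          using b(1) by (simp add: ivl_def)
      qed
      also have "\<dots> = real (Suc n) * (\<Sum>(x, K)\<in>p. norm (measure lborel K *\<^sub>R f x - integral K f))"
        unfolding p_def by (subst sum.reindex[OF inj]) (simp add: sum_distrib_left case_prod_unfold)
      also have "\<dots> \<le> real (Suc n) * e'" using less by (intro mult_left_mono) auto
      also have "\<dots> = e" by (simp add: e'_def)
      finally show ?thesis .
    qed
    have ivlm: "ivl i \<in> lmeasurable" for i by (cases i) (simp add: ivl_def)
    let ?U = "\<Union>i\<in>C. ivl i"
    have U: "?U \<in> lmeasurable" "measure lebesgue ?U \<le> e"
      by (rule fmeasurable_UN_bound[OF C(1) ivlm fin] measure_UN_bound[OF C(1) ivlm fin]; simp)+
    let ?T = "?U \<union> (E n - ?U)"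
    have neg: "E n - ?U \<in> lmeasurable" "measure lebesgue (E n - ?U) = 0"
      using C(4) by (rule negligible_imp_measurable, rule negligible_imp_measure0)
    have "?T \<in> lmeasurable" using U(1) neg(1) by (rule fmeasurable.Un)
    moreover have "measure lebesgue ?T \<le> e"
      using measure_Un_le[OF fmeasurableD[OF U(1)] fmeasurableD[OF neg(1)]] U(2) neg(2) by linarith
    moreover have "E n \<subseteq> ?T" by blast
    ultimately show "\<exists>T. E n \<subseteq> T \<and> T \<in> lmeasurable \<and> measure lebesgue T \<le> e"
      by (intro exI[of _ ?T] conjI)
  qed
  have "{x \<in> {a<..<b}. \<not> (F has_real_derivative f x) (at x)} \<subseteq> (\<Union>n. E n)"
  proof clarify
    fix x assume x: "x \<in> {a<..<b}" and nd: "\<not> (F has_real_derivative f x) (at x)"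
    show "x \<in> (\<Union>n. E n)"
    proof (rule ccontr)
      assume "x \<notin> (\<Union>n. E n)"
      then have "\<And>n. x \<notin> E n" by simp
      then have nE: "\<exists>\<delta>>0. \<forall>u v. {u..v} \<subseteq> ball x \<delta> \<longrightarrow> \<not> bad n x u v" for n
        using x unfolding E_def mem_Collect_eq by meson
      have "(F has_derivative (\<lambda>h. h * f x)) (at x)"
        unfolding has_derivative_at_alt
      proof (intro conjI allI impI)
        show "bounded_linear (\<lambda>h. h * f x)" by (rule bounded_linear_mult_left)
        fix e :: real assume "0 < e"
        then obtain n where n: "1 / real (Suc n) < e" using nat_approx_posE by blast
        obtain \<delta> where \<delta>: "0 < \<delta>" "\<And>u v. {u..v} \<subseteq> ball x \<delta> \<Longrightarrow> \<not> bad n x u v" using nE by blast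
        obtain \<delta>' where \<delta>': "0 < \<delta>'" "ball x \<delta>' \<subseteq> {a<..<b}"
          using x open_contains_ball[of "{a<..<b}"] open_greaterThanLessThan by blast
        have *: "\<bar>F v - F u - f x * (v - u)\<bar> \<le> e * (v - u)"
          if "u \<le> x" "x \<le> v" "u < v" "u \<in> ball x (min \<delta> \<delta>')" "v \<in> ball x (min \<delta> \<delta>')" for u v
        proof -
          have "{u..v} \<subseteq> ball x (min \<delta> \<delta>')" using that by (auto simp: dist_real_def)
          then have "{u..v} \<subseteq> ball x \<delta>" "{u..v} \<subseteq> {a<..<b}" using \<delta>' by (auto simp: subset_iff)
          then have "\<bar>F v - F u - f x * (v - u)\<bar> \<le> (v - u) / real (Suc n)"
            using \<delta>(2)[of u v] that by (auto simp: bad_def not_less)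
          also have "\<dots> \<le> e * (v - u)" using n that by (simp add: divide_inverse mult.commute mult_left_mono)
          finally show ?thesis .
        qed
        show "\<exists>d>0. \<forall>y. norm (y - x) < d \<longrightarrow> norm (F y - F x - (y - x) * f x) \<le> e * norm (y - x)"
        proof (intro exI[of _ "min \<delta> \<delta>'"] conjI allI impI)
          fix y assume y: "norm (y - x) < min \<delta> \<delta>'"
          consider "x < y" | "y < x" | "x = y" by linarith
          then show "norm (F y - F x - (y - x) * f x) \<le> e * norm (y - x)"
          proof cases
            case 1 then show ?thesis using *[of x y] y \<delta> \<delta>' by (simp add: dist_real_def abs_minus_commute mult.commute)
          next
            case 2
            have "F y - F x - (y - x) * f x = - (F x - F y - f x * (x - y))" by (simp add: algebra_simps)
            then show ?thesis using *[of y x] y \<delta> \<delta>' 2 by (simp only: norm_minus_cancel real_norm_def) (simp add: dist_real_def abs_minus_commute)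
          qed simp
        qed (use \<delta> \<delta>' in auto)
      qed
      then show False using nd by (simp add: has_field_derivative_def mult.commute[of _ "f x"] cong: if_cong)
    qed
  qed
  moreover have "negligible (\<Union>n. E n)" by (rule negligible_countable_Union) (use negE in auto)
  ultimately show ?thesis using negligible_subset unfolding F_def by blast
qed

text \<open>The density is the Radon--Nikodym derivative of the image of Lebesgue measure under the
  quantile function of \<open>F\<close>; a Lipschitz \<open>F\<close> maps null sets to null sets.\<close>

lemma lipschitz_mono_density:
  fixes f :: "real \<Rightarrow> real"
  assumes lip: "L-lipschitz_on {a..b} f" and mono: "mono_on {a..b} f" and "a < b"
  shows "\<exists>k. k integrable_on {a..b} \<and> (\<forall>u\<in>{a..b}. f u = f a + integral {a..u} k)"
proof -
  have cont: "continuous_on {a..b} f" using lip by (rule lipschitz_on_continuous_on)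
  define G where "G y = Inf {x \<in> {a..b}. y \<le> f x}" for y
  have ne: "b \<in> {x \<in> {a..b}. y \<le> f x}" if "y \<le> f b" for y using that \<open>a < b\<close> by auto
  have bdd: "bdd_below {x \<in> {a..b}. y \<le> f x}" for y by (rule bdd_belowI[of _ a]) auto
  have cl: "closed {x \<in> {a..b}. y \<le> f x}" for y
  proof -
    have "{x \<in> {a..b}. y \<le> f x} = {x \<in> {a..b}. f x \<in> {y..}}" by auto
    then show ?thesis using continuous_closed_preimage[OF cont, of "{y..}"] by (simp add: vimage_def Int_def)
  qed
  have Gin: "G y \<in> {a..b} \<and> y \<le> f (G y)" if "y \<le> f b" for y
    using closed_contains_Inf[OF _ bdd cl, of y] ne[OF that] unfolding G_def by blast
  have G_le: "G y \<le> x \<longleftrightarrow> y \<le> f x" if "y \<le> f b" "x \<in> {a..b}" for x y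
  proof
    assume "G y \<le> x"
    then have "f (G y) \<le> f x" using Gin[OF that(1)] that mono by (auto simp: mono_on_def)
    then show "y \<le> f x" using Gin[OF that(1)] by linarith
  next
    assume "y \<le> f x"
    then show "G y \<le> x" unfolding G_def by (intro cInf_lower bdd) (use that in auto)
  qed
  have fG: "f (G y) = y" if "f a < y" "y \<le> f b" for y
  proof (rule antisym)
    have "\<exists>x\<ge>a. x \<le> b \<and> f x = y"
      by (rule IVT') (use that cont \<open>a < b\<close> in auto)
    then obtain x where x: "a \<le> x" "x \<le> b" "f x = y" by blast
    then have "G y \<le> x" using G_le[OF that(2), of x] by auto
    then show "f (G y) \<le> y" using Gin[OF that(2)] x mono by (auto simp: mono_on_def)
  qed (use Gin[OF that(2)] in auto)
  let ?R = "restrict_space lborel {f a<..f b}"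
  have Gm: "G \<in> borel_measurable ?R"
  proof -
    have "mono_on {f a<..f b} G"
      unfolding mono_on_def
    proof (intro allI impI)
      fix r s assume *: "r \<in> {f a<..f b} \<and> s \<in> {f a<..f b} \<and> r \<le> s"
      then show "G r \<le> G s" using G_le[of r "G s"] Gin[of s] fG[of s] by auto
    qed
    then have "G \<in> borel_measurable (restrict_space borel {f a<..f b})"
      by (rule borel_measurable_mono_on_fnc)
    then show ?thesis by (simp cong: measurable_cong_sets sets_restrict_space_cong)
  qed
  define N where "N = distr ?R borel G"
  have N_em: "emeasure N A = emeasure lborel {y \<in> {f a<..f b}. G y \<in> A}" if "A \<in> sets borel" for A :: "real set"
  proof -
    have "emeasure N A = emeasure ?R (G -` A \<inter> space ?R)"
      unfolding N_def by (rule emeasure_distr[OF Gm that])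
    also have "\<dots> = emeasure lborel (G -` A \<inter> space ?R)"
      by (rule emeasure_restrict_space) (auto simp: space_restrict_space)
    also have "G -` A \<inter> space ?R = {y \<in> {f a<..f b}. G y \<in> A}" by (auto simp: space_restrict_space)
    finally show ?thesis .
  qed
  \<comment> \<open>If \<open>G y\<close> lies in a null set \<open>A\<close>, then
    \<open>y = f (G y)\<close> lies in the image of \<open>A\<close> under the Lipschitz function
    \<open>f\<close>, which is null.\<close>
  have ac: "absolutely_continuous lborel N"
    unfolding absolutely_continuous_def
  proof
    fix A :: "real set" assume A: "A \<in> null_sets lborel"
    then have Ab: "A \<in> sets borel" by auto
    let ?Y = "{y \<in> {f a<..f b}. G y \<in> A}"
    have "negligible A" using A by (simp add: negligible_iff_null_sets null_sets_completionI)
    then have "negligible (A \<inter> {a..b})" by (rule negligible_subset) auto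
    then have "negligible (f ` (A \<inter> {a..b}))"
    proof (rule negligible_locally_Lipschitz_image[OF order_refl])
      fix x assume "x \<in> A \<inter> {a..b}"
      then show "\<exists>T B. open T \<and> x \<in> T \<and> (\<forall>y \<in> A \<inter> {a..b} \<inter> T. norm (f y - f x) \<le> B * norm (y - x))"
        using lipschitz_on_normD[OF lip] by (intro exI[of _ UNIV] exI[of _ L]) auto
    qed
    moreover have "?Y \<subseteq> f ` (A \<inter> {a..b})" using fG Gin by (auto simp: image_iff) (metis IntI atLeastAtMost_iff)
    ultimately have "negligible ?Y" by (rule negligible_subset)
    moreover have "?Y \<in> sets lborel"
    proof -
      have "G -` A \<inter> space ?R \<in> sets ?R" using Gm Ab by (rule measurable_sets)
      moreover have "G -` A \<inter> space ?R = ?Y" by (auto simp: space_restrict_space)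
      ultimately show ?thesis by (simp add: sets_restrict_space_iff)
    qed
    ultimately have "emeasure lborel ?Y = 0"
      by (simp add: negligible_iff_null_sets null_sets_completion_iff null_setsD1)
    then show "A \<in> null_sets N"
      using N_em[OF Ab] Ab by (auto simp: null_sets_def N_def)
  qed
  obtain k where k: "k \<in> borel_measurable lborel" "density lborel k = N"
    using sigma_finite_measure.Radon_Nikodym[OF sigma_finite_lborel ac] by (auto simp: N_def)
  have ioc: "(\<integral>\<^sup>+x. k x * indicator {a<..u} x \<partial>lborel) = ennreal (f u - f a)" if u: "u \<in> {a..b}" for u
  proof -
    have "f a \<le> f u" "f u \<le> f b" using mono u \<open>a < b\<close> by (auto simp: mono_on_def)
    have "{y \<in> {f a<..f b}. G y \<in> {a<..u}} = {f a<..f u}"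
    proof (intro set_eqI iffI)
      fix y assume "y \<in> {y \<in> {f a<..f b}. G y \<in> {a<..u}}"
      then show "y \<in> {f a<..f u}" using G_le[of y u] u by auto
    next
      fix y assume y: "y \<in> {f a<..f u}"
      then have "y \<le> f b" using \<open>f u \<le> f b\<close> by auto
      moreover have "\<not> G y \<le> a" using G_le[of y a] \<open>a < b\<close> y \<open>y \<le> f b\<close> by auto
      ultimately show "y \<in> {y \<in> {f a<..f b}. G y \<in> {a<..u}}" using G_le[of y u] u y by auto
    qed
    then have "emeasure N {a<..u} = ennreal (f u - f a)"
      using N_em[of "{a<..u}"] \<open>f a \<le> f u\<close> by simp
    moreover have "emeasure N {a<..u} = (\<integral>\<^sup>+x. k x * indicator {a<..u} x \<partial>lborel)"
      unfolding k(2)[symmetric] by (rule emeasure_density[OF k(1)]) simp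
    ultimately show ?thesis by simp
  qed
  \<comment> \<open>The density has finite integral over \<open>{a<..b}\<close>, hence is finite
    almost everywhere; \<open>enn2real\<close> sends its infinite values to 0.\<close>
  define k' where "k' x = enn2real (k x * indicator {a<..b} x)" for x
  have k'm: "k' \<in> borel_measurable borel" using k(1) unfolding k'_def by measurable
  have fin: "AE x in lborel. k x * indicator {a<..b} x \<noteq> \<infinity>"
    by (rule nn_integral_PInf_AE) (use k(1) ioc[of b] \<open>a < b\<close> in auto)
  have int: "(k' has_integral (f u - f a)) {a..u}" if u: "u \<in> {a..b}" for u
  proof -
    have fau: "0 \<le> f u - f a" using mono u by (auto simp: mono_on_def)
    have "(\<integral>\<^sup>+x. ennreal (indicator {a<..u} x * k' x) \<partial>lborel) = (\<integral>\<^sup>+x. k x * indicator {a<..u} x \<partial>lborel)"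
    proof (rule nn_integral_cong_AE)
      show "AE x in lborel. ennreal (indicator {a<..u} x * k' x) = k x * indicator {a<..u} x"
        using fin
      proof eventually_elim
        case (elim x)
        show ?case
        proof (cases "x \<in> {a<..u}")
          case True
          then have "x \<in> {a<..b}" using u by auto
          then show ?thesis using elim True by (simp add: k'_def less_top)
        qed simp
      qed
    qed
    also have "\<dots> = ennreal (f u - f a)" by (rule ioc[OF u])
    finally have "((\<lambda>x. indicator {a<..u} x * k' x) has_integral (f u - f a)) UNIV"
    proof (intro nn_integral_has_integral)
      show "(\<lambda>x. indicator {a<..u} x * k' x) \<in> borel_measurable borel" using k'm by measurable
      show "0 \<le> indicator {a<..u} x * k' x" for x by (simp add: k'_def)
    qed (use fau in auto)
    then have "((\<lambda>x. if x \<in> {a<..u} then k' x else 0) has_integral (f u - f a)) UNIV"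
      by (rule has_integral_eq[rotated]) auto
    then have "(k' has_integral (f u - f a)) {a<..u}" by (simp only: has_integral_restrict_UNIV)
    then show ?thesis
      by (rule has_integral_spike_set_eq[THEN iffD1, rotated -1])
        (rule negligible_subset[of "{a}"], simp, force)+
  qed
  show ?thesis
  proof (intro exI conjI ballI)
    show "k' integrable_on {a..b}" using int[of b] \<open>a < b\<close> by auto
    fix u assume "u \<in> {a..b}"
    then show "f u = f a + integral {a..u} k'" using integral_unique[OF int] by auto
  qed
qed

text \<open>The density supplies the derivative and monotonicity its sign. The end points join the
  exceptional set because the derivative is two-sided.\<close>

lemma lipschitz_mono_differentiable_ae:
  fixes f :: "real \<Rightarrow> real"
  assumes lip: "L-lipschitz_on {a..b} f" and mono: "mono_on {a..b} f" and "a < b"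
  shows "negligible {x \<in> {a..b}. \<not> (\<exists>m\<ge>0. (f has_real_derivative m) (at x))}"
proof -
  obtain k where k: "k integrable_on {a..b}" "\<And>u. u \<in> {a..b} \<Longrightarrow> f u = f a + integral {a..u} k"
    using lipschitz_mono_density[OF assms] by blast
  let ?N = "{x \<in> {a<..<b}. \<not> ((\<lambda>u. integral {a..u} k) has_real_derivative k x) (at x)}"
  have main: "x \<in> ?N" if x: "x \<in> {a<..<b}" "\<not> (\<exists>m\<ge>0. (f has_real_derivative m) (at x))" for x
  proof (rule ccontr)
    assume "x \<notin> ?N"
    then have "((\<lambda>u. integral {a..u} k) has_real_derivative k x) (at x)" using x(1) by simp
    from DERIV_add[OF DERIV_const[of "f a"] this]
    have "((\<lambda>u. f a + integral {a..u} k) has_real_derivative k x) (at x)" by simp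
    then have d: "(f has_real_derivative k x) (at x)"
      by (rule has_field_derivative_transform_within_open[of _ _ _ "{a<..<b}"]) (use x(1) k(2)[symmetric] in simp_all)
    moreover have "0 \<le> k x" by (rule mono_on_imp_deriv_nonneg[OF mono d]) (use x(1) in simp)
    ultimately show False using x(2) by blast
  qed
  have "{x \<in> {a..b}. \<not> (\<exists>m\<ge>0. (f has_real_derivative m) (at x))} \<subseteq> ?N \<union> {a, b}"
  proof
    fix x assume x: "x \<in> {x \<in> {a..b}. \<not> (\<exists>m\<ge>0. (f has_real_derivative m) (at x))}"
    then consider "x = a" | "x = b" | "x \<in> {a<..<b}" by force
    then show "x \<in> ?N \<union> {a, b}"
    proof cases
      case 3
      then have "x \<in> ?N" using main[of x] x by blast
      then show ?thesis by blast
    qed auto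
  qed
  moreover have "negligible (?N \<union> {a, b})"
    by (intro negligible_Un integral_has_real_derivative_ae[OF k(1)] negligible_finite) simp
  ultimately show ?thesis by (rule negligible_subset[rotated])
qed

section \<open>Riemann--Stieltjes integrals against monotone functions\<close>

lemma tagged_division_interval:
  assumes "p tagged_division_of {a..b::real}" "(x, K) \<in> p"
  shows "\<exists>u v. K = {u..v} \<and> a \<le> u \<and> u \<le> x \<and> x \<le> v \<and> v \<le> b \<and> Inf K = u \<and> Sup K = v"
proof -
  obtain u v where "K = cbox u v" using tagged_division_ofD(4)[OF assms] by blast
  moreover have "x \<in> K" "K \<subseteq> {a..b}" using tagged_division_ofD(2,3)[OF assms] by simp_all
  ultimately show ?thesis by (intro exI[of _ u] exI[of _ v]) auto
qed

lemma fine_ball_interval: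
  assumes "p tagged_division_of {a..b::real}" "(x, K) \<in> p" "(\<lambda>x. ball x \<delta>) fine p"
  shows "\<bar>Sup K - x\<bar> < \<delta>" "\<bar>Inf K - x\<bar> < \<delta>" "0 < \<delta>"
proof -
  obtain u v where uv: "K = {u..v}" "u \<le> x" "x \<le> v" "Inf K = u" "Sup K = v"
    using tagged_division_interval[OF assms(1,2)] by blast
  have "K \<subseteq> ball x \<delta>" using assms by (auto dest: fineD)
  moreover have "u \<in> K" "v \<in> K" using uv by auto
  ultimately have "u \<in> ball x \<delta>" "v \<in> ball x \<delta>" by blast+
  then show "\<bar>Sup K - x\<bar> < \<delta>" "\<bar>Inf K - x\<bar> < \<delta>" "0 < \<delta>" using uv by (auto simp: dist_real_def)
qed

lemma RS_sum_telescope: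
  fixes \<mu> :: "real \<Rightarrow> real"
  assumes "a \<le> b" "p tagged_division_of {a..b}"
  shows "(\<Sum>(x, K)\<in>p. \<mu> (Sup K) - \<mu> (Inf K)) = \<mu> b - \<mu> a"
  using additive_tagged_division_1[OF assms, of \<mu>] by simp

text \<open>The integral is obtained from the Stieltjes measure of \<mu>. By right continuity a cell
  with end points \<open>u\<close> and \<open>v\<close> corresponds to \<open>{u<..v}\<close>, of
  mass \<open>\<mu> v - \<mu> u\<close>, so each term of a Riemann sum differs from the integral
  over its cell by at most the oscillation of \<open>g\<close> times that mass.\<close>

lemma RS_integral_mono_exists:
  assumes "a \<le> b" and mono: "mono_on {a..b} \<mu>"
    and rc: "\<And>t. a \<le> t \<Longrightarrow> t < b \<Longrightarrow> continuous (at_right t) \<mu>"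
    and g: "continuous_on {a..b} g"
  shows "\<exists>I. has_RS_integral g \<mu> a b I"
proof -
  \<comment> \<open>Constant continuation beyond \<open>a\<close> and \<open>b\<close>: a Stieltjes
    measure is made from a monotone, right continuous function on the whole line.\<close>
  define F where "F t = \<mu> (max a (min b t))" for t
  have Fmono: "F s \<le> F t" if "s \<le> t" for s t
    using mono that \<open>a \<le> b\<close> by (auto simp: F_def mono_on_def)
  have Frc: "continuous (at_right t) F" for t
  proof -
    consider "t < a" | "a \<le> t" "t < b" | "b \<le> t" by linarith
    then show ?thesis
    proof cases
      case 1
      have "\<forall>\<^sub>F s in at_right t. F s = F t"
        using eventually_at_right_less[of t] eventually_at_right[of t a] 1 \<open>a \<le> b\<close>
        by (auto simp: F_def eventually_at_right intro!: exI[of _ a])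
      then show ?thesis unfolding continuous_within by (simp add: tendsto_eventually)
    next
      case 2
      have "\<forall>\<^sub>F s in at_right t. F s = \<mu> s"
        using 2 by (auto simp: F_def eventually_at_right intro!: exI[of _ b])
      moreover have "(\<mu> \<longlongrightarrow> F t) (at_right t)"
        using rc[OF 2] 2 by (simp add: continuous_within F_def)
      ultimately show ?thesis unfolding continuous_within
        by (simp add: tendsto_cong)
    next
      case 3
      have "\<forall>\<^sub>F s in at_right t. F s = F t"
        using eventually_at_right_less[of t] by eventually_elim (use 3 \<open>a \<le> b\<close> in \<open>auto simp: F_def\<close>)
      then show ?thesis unfolding continuous_within by (simp add: tendsto_eventually)
    qed
  qed
  define N where "N = interval_measure F"
  have N: "emeasure N {u<..v} = ennreal (F v - F u)" if "u \<le> v" for u v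
    unfolding N_def by (rule emeasure_interval_measure_Ioc[OF that Fmono Frc])
  have setsN: "sets N = sets borel" "space N = UNIV" by (auto simp: N_def)
  have mN: "measure N {u<..v} = F v - F u" if "u \<le> v" for u v
    using N[OF that] Fmono[OF that] by (simp add: measure_def)
  define g' where "g' t = g (max a (min b t))" for t
  have g'c: "continuous_on UNIV g'"
    unfolding g'_def using \<open>a \<le> b\<close>
    by (intro continuous_on_compose2[OF g]) (auto intro!: continuous_intros)
  then have g'm: "g' \<in> borel_measurable N"
    using borel_measurable_continuous_onI setsN by (metis measurable_cong_sets)
  obtain B where B: "\<And>t. \<bar>g' t\<bar> \<le> B"
  proof -
    have "bounded (g ` {a..b})" using g by (intro compact_imp_bounded compact_continuous_image) auto
    then obtain B where "\<forall>t\<in>{a..b}. \<bar>g t\<bar> \<le> B" by (auto simp: bounded_iff)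
    then have "\<bar>g' t\<bar> \<le> B" for t using \<open>a \<le> b\<close> by (auto simp: g'_def)
    then show thesis by (rule that)
  qed
  have intI: "integrable N (\<lambda>t. indicator {u<..v} t * h t)"
    if "u \<le> v" "h \<in> borel_measurable N" "\<And>t. t \<in> {u<..v} \<Longrightarrow> \<bar>h t\<bar> \<le> C" for u v C and h :: "real \<Rightarrow> real"
  proof (rule Bochner_Integration.integrable_bound)
    show "integrable N (\<lambda>t. indicator {u<..v} t * C)"
      using N[OF that(1)] setsN by (intro integrable_mult_left integrable_real_indicator) auto
    show "(\<lambda>t. indicator {u<..v} t * h t) \<in> borel_measurable N"
      using that(2) setsN by (intro borel_measurable_times borel_measurable_indicator) auto
    show "AE t in N. norm (indicator {u<..v} t * h t) \<le> norm (indicator {u<..v} t * C)"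
    proof (rule AE_I2)
      fix t
      show "norm (indicator {u<..v} t * h t) \<le> norm (indicator {u<..v} t * C)"
        using that(3)[of t] by (auto simp: indicator_def)
    qed
  qed
  define II where "II u v = (LINT t|N. indicator {u<..v} t * g' t)" for u v
  have addI: "II u w = II u v + II v w" if "u \<le> v" "v \<le> w" for u v w
  proof -
    have "II u v + II v w = (LINT t|N. indicator {u<..v} t * g' t + indicator {v<..w} t * g' t)"
      unfolding II_def using intI[OF that(1) g'm B] intI[OF that(2) g'm B]
      by (rule Bochner_Integration.integral_add[symmetric])
    also have "\<dots> = II u w"
      unfolding II_def by (rule Bochner_Integration.integral_cong) (use that in \<open>auto simp: indicator_def\<close>)
    finally show ?thesis by simp
  qed
  define G where "G t = II a t" for t
  have Gd: "G v - G u = II u v" if "a \<le> u" "u \<le> v" for u v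
    using addI[OF that] by (simp add: G_def)
  have est: "\<bar>c * (F v - F u) - II u v\<bar> \<le> e * (F v - F u)"
    if uv: "u \<le> v" and c: "\<And>t. t \<in> {u<..v} \<Longrightarrow> \<bar>c - g' t\<bar> \<le> e" for u v c e
  proof -
    have "c * (F v - F u) = (LINT t|N. indicator {u<..v} t * c)"
      using mN[OF uv] setsN by simp
    moreover have i1: "integrable N (\<lambda>t. indicator {u<..v} t * c)"
      by (rule intI[OF uv, of _ "\<bar>c\<bar>"]) auto
    ultimately have "c * (F v - F u) - II u v = (LINT t|N. indicator {u<..v} t * c - indicator {u<..v} t * g' t)"
      unfolding II_def using intI[OF uv g'm B] by (simp add: Bochner_Integration.integral_diff)
    also have "\<bar>\<dots>\<bar> \<le> (LINT t|N. indicator {u<..v} t * e)"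
    proof (rule integral_abs_bound_integral)
      show "integrable N (\<lambda>t. indicator {u<..v} t * c - indicator {u<..v} t * g' t)"
        using i1 intI[OF uv g'm B] by (rule Bochner_Integration.integrable_diff)
      show "integrable N (\<lambda>t. indicator {u<..v} t * e)" by (rule intI[OF uv, of _ "\<bar>e\<bar>"]) auto
      show "\<bar>indicator {u<..v} t * c - indicator {u<..v} t * g' t\<bar> \<le> indicator {u<..v} t * e" for t
        using c[of t] by (auto simp: indicator_def)
    qed
    also have "\<dots> = e * (F v - F u)" using mN[OF uv] setsN by simp
    finally show ?thesis .
  qed
  have "has_RS_integral g \<mu> a b (G b)"
    unfolding has_RS_integral_def
  proof (intro allI impI)
    fix e :: real assume "0 < e"
    define V where "V = \<mu> b - \<mu> a"
    have V: "0 \<le> V" using mono \<open>a \<le> b\<close> by (auto simp: V_def mono_on_def)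
    define e' where "e' = e / (V + 1)"
    have "0 < e'" using \<open>0 < e\<close> V by (simp add: e'_def)
    have "uniformly_continuous_on {a..b} g" using g by (rule compact_uniformly_continuous) simp
    then obtain \<delta> where \<delta>: "0 < \<delta>" "\<And>s t. s \<in> {a..b} \<Longrightarrow> t \<in> {a..b} \<Longrightarrow> \<bar>s - t\<bar> < \<delta> \<Longrightarrow> \<bar>g s - g t\<bar> < e'"
      using \<open>0 < e'\<close> unfolding uniformly_continuous_on_def dist_real_def by metis
    show "\<exists>\<delta>>0. \<forall>p. p tagged_division_of {a..b} \<and> (\<lambda>x. ball x \<delta>) fine p \<longrightarrow>
        \<bar>(\<Sum>(x, K)\<in>p. g x * (\<mu> (Sup K) - \<mu> (Inf K))) - G b\<bar> < e"
    proof (intro exI[of _ \<delta>] conjI allI impI \<delta>(1))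
      fix p assume p: "p tagged_division_of {a..b} \<and> (\<lambda>x. ball x \<delta>) fine p"
      have "G b = (\<Sum>(x, K)\<in>p. G (Sup K) - G (Inf K))"
        using RS_sum_telescope[OF \<open>a \<le> b\<close> conjunct1[OF p], of G] by (simp add: G_def II_def)
      then have "(\<Sum>(x, K)\<in>p. g x * (\<mu> (Sup K) - \<mu> (Inf K))) - G b =
          (\<Sum>(x, K)\<in>p. g x * (\<mu> (Sup K) - \<mu> (Inf K)) - (G (Sup K) - G (Inf K)))"
        by (simp add: sum_subtractf case_prod_unfold)
      also have "\<bar>\<dots>\<bar> \<le> (\<Sum>(x, K)\<in>p. e' * (\<mu> (Sup K) - \<mu> (Inf K)))"
      proof (rule order_trans[OF sum_abs sum_mono], clarify)
        fix x K assume xK: "(x, K) \<in> p"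
        obtain u v where uv: "K = {u..v}" "a \<le> u" "u \<le> x" "x \<le> v" "v \<le> b" "Inf K = u" "Sup K = v"
          using tagged_division_interval[OF conjunct1[OF p] xK] by blast
        have d: "\<bar>v - x\<bar> < \<delta>" "\<bar>u - x\<bar> < \<delta>" using fine_ball_interval[OF conjunct1[OF p] xK conjunct2[OF p]] uv by auto
        have F: "F v = \<mu> v" "F u = \<mu> u" using uv by (auto simp: F_def)
        have "\<bar>g x * (F v - F u) - II u v\<bar> \<le> e' * (F v - F u)"
        proof (rule est)
          fix t assume "t \<in> {u<..v}"
          then have t: "t \<in> {a..b}" "\<bar>x - t\<bar> < \<delta>" "g' t = g t" using uv d by (auto simp: g'_def)
          then show "\<bar>g x - g' t\<bar> \<le> e'" using \<delta>(2)[of x t] uv by auto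
        qed (use uv in auto)
        then show "\<bar>g x * (\<mu> (Sup K) - \<mu> (Inf K)) - (G (Sup K) - G (Inf K))\<bar> \<le> e' * (\<mu> (Sup K) - \<mu> (Inf K))"
          using F Gd[of u v] uv by simp
      qed
      also have "\<dots> = e' * V"
        unfolding V_def RS_sum_telescope[OF \<open>a \<le> b\<close> conjunct1[OF p], of \<mu>, symmetric]
        by (simp add: sum_distrib_left case_prod_unfold)
      also have "\<dots> < e" using V \<open>0 < e\<close> by (simp add: e'_def field_simps)
      finally show "\<bar>(\<Sum>(x, K)\<in>p. g x * (\<mu> (Sup K) - \<mu> (Inf K))) - G b\<bar> < e" .
    qed
  qed
  then show ?thesis by blast
qed

section \<open>Time changes and perturbed processes\<close>

lemma AE_lebesgue_on_negligible:
  assumes "negligible N" "\<And>t. t \<in> {a..b} - N \<Longrightarrow> P t"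
  shows "AE t in lebesgue_on {a..b::real}. P t"
proof -
  have "AE t in lebesgue. t \<notin> N"
    using assms(1) by (simp add: negligible_iff_null_sets AE_not_in)
  then have "AE t in lebesgue. t \<in> {a..b} \<longrightarrow> P t"
    by eventually_elim (use assms(2) in auto)
  then show ?thesis by (simp add: AE_restrict_space_iff)
qed

text \<open>\<open>\<sigma>\<close> inverts the primitive \<theta> of \<open>v\<close>; in the new
  time \<open>\<theta> \<tau>\<close> the dilating factor \<open>v\<close> cancels. The integral of
  \<open>v\<close> is \<open>T\<close>, so both end times are fixed, and speeds within
  \<open>a \<le> 1/2\<close> of 1 invert to speeds within \<open>2 * a\<close> of 1. The last
  conclusion holds because \<sigma> is injective and so meets a finite set at finitely many times
  only.\<close>

lemma time_change_process:
  fixes f :: "real^'m \<Rightarrow> real^'k \<Rightarrow> real^'m::finite" and U :: "real \<Rightarrow> real^'k::finite"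
  assumes "0 < T" and S: "finite S"
    and Y: "solves S 0 T Y (\<lambda>\<tau>. v \<tau> *\<^sub>R f (Y \<tau>) (U \<tau>))"
    and B: "\<And>\<tau>. \<tau> \<in> {0..T} \<Longrightarrow> norm (v \<tau> *\<^sub>R f (Y \<tau>) (U \<tau>)) \<le> B" "0 \<le> B"
    and v: "bcont_off S 0 T v" "\<And>\<tau>. \<tau> \<in> {0..T} \<Longrightarrow> \<bar>v \<tau> - 1\<bar> \<le> a" "a \<le> 1/2" "integral {0..T} v = T"
    and U: "bcont_off S 0 T U"
    and Q: "\<And>\<tau>. \<tau> \<in> {0..T} \<Longrightarrow> (Y \<tau>, U \<tau>) \<in> Q"
  obtains \<sigma> where "2-lipschitz_on {0..T} \<sigma>" "\<sigma> ` {0..T} = {0..T}" "\<sigma> 0 = 0" "\<sigma> T = T"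
    "\<And>t. t \<in> {0..T} \<Longrightarrow> \<bar>\<sigma> t - t\<bar> \<le> a * T"
    "AE t in lebesgue_on {0..T}. \<exists>D. (\<sigma> has_real_derivative D) (at t) \<and> \<bar>D - 1\<bar> \<le> 2 * a"
    "is_process T Q f (\<lambda>t. Y (\<sigma> t)) (\<lambda>t. U (\<sigma> t))"
    "\<And>N. finite N \<Longrightarrow> AE t in lebesgue_on {0..T}. \<sigma> t \<in> {0..T} - N"
proof -
  define \<theta> where "\<theta> \<tau> = integral {0..\<tau>} v" for \<tau>
  have \<theta>s: "solves S 0 T \<theta> v"
    by (rule solves_of_integral[OF S v(1), of _ 0]) (simp add: \<theta>_def)
  have \<theta>0: "\<theta> 0 = 0" "\<theta> T = T" using v(4) by (simp_all add: \<theta>_def)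
  have \<theta>c: "continuous_on {0..T} \<theta>" using \<theta>s by (simp add: solves_def)
  have \<theta>int: "\<bar>(\<theta> t - \<theta> s) - (t - s)\<bar> \<le> a * (t - s)" if "0 \<le> s" "s \<le> t" "t \<le> T" for s t
  proof -
    have "0 \<le> a" using v(2)[of 0] \<open>0 < T\<close> by auto
    have "((\<lambda>\<tau>. v \<tau> - 1) has_integral ((\<theta> t - \<theta> s) - (t - s))) {s..t}"
      using has_integral_diff[OF solves_has_integral[OF S \<theta>s that] has_integral_const_real[of 1 s t]] that by simp
    then have "norm ((\<theta> t - \<theta> s) - (t - s)) \<le> a * measure lborel (cbox s t)"
      by (intro has_integral_bound[OF \<open>0 \<le> a\<close>]) (use v(2) that in auto)
    then show ?thesis using that by simp
  qed
  \<comment> \<open>Slopes of at least 1/2 give injectivity of \<theta> and the Lipschitz constant 2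
    of its inverse.\<close>
  have \<theta>lower: "(t - s) / 2 \<le> \<theta> t - \<theta> s" if "0 \<le> s" "s \<le> t" "t \<le> T" for s t
  proof -
    have "a * (t - s) \<le> 1/2 * (t - s)" using v(3) that by (intro mult_right_mono) auto
    moreover have "- (a * (t - s)) \<le> (\<theta> t - \<theta> s) - (t - s)"
      using \<theta>int[OF that] by (simp only: abs_le_iff) linarith
    ultimately show ?thesis by simp
  qed
  have inj: "inj_on \<theta> {0..T}"
  proof (rule inj_onI)
    fix s t assume *: "s \<in> {0..T}" "t \<in> {0..T}" "\<theta> s = \<theta> t"
    show "s = t"
    proof (cases "s \<le> t")
      case True
      then have "(t - s) / 2 \<le> \<theta> t - \<theta> s" using * by (intro \<theta>lower) simp_all
      then show ?thesis using True * by simp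
    next
      case False
      then have "(s - t) / 2 \<le> \<theta> s - \<theta> t" using * by (intro \<theta>lower) simp_all
      then show ?thesis using False * by simp
    qed
  qed
  have img: "\<theta> ` {0..T} = {0..T}"
  proof
    show "\<theta> ` {0..T} \<subseteq> {0..T}"
    proof clarify
      fix t assume "t \<in> {0..T}"
      then show "\<theta> t \<in> {0..T}" using \<theta>lower[of 0 t] \<theta>lower[of t T] \<theta>0 by auto
    qed
    show "{0..T} \<subseteq> \<theta> ` {0..T}"
    proof
      fix y assume y: "y \<in> {0..T}"
      have "\<exists>x\<ge>0. x \<le> T \<and> \<theta> x = y"
        by (rule IVT') (use y \<theta>0 \<theta>c \<open>0 < T\<close> in auto)
      then show "y \<in> \<theta> ` {0..T}" by auto
    qed
  qed
  define \<sigma> where "\<sigma> = inv_into {0..T} \<theta>"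
  have \<theta>\<sigma>: "\<theta> (\<sigma> t) = t" "\<sigma> t \<in> {0..T}" if "t \<in> {0..T}" for t
  proof -
    have "t \<in> \<theta> ` {0..T}" using that img by simp
    then show "\<theta> (\<sigma> t) = t" "\<sigma> t \<in> {0..T}"
      unfolding \<sigma>_def by (rule f_inv_into_f, rule inv_into_into)
  qed
  have \<sigma>\<theta>: "\<sigma> (\<theta> t) = t" if "t \<in> {0..T}" for t
    unfolding \<sigma>_def by (rule inv_into_f_f[OF inj that])
  have \<sigma>img: "\<sigma> ` {0..T} = {0..T}"
    using img unfolding \<sigma>_def by (metis inv_into_image_cancel inj order_refl)
  have lip: "2-lipschitz_on {0..T} \<sigma>"
  proof (rule lipschitz_onI)
    fix s t assume *: "s \<in> {0..T}" "t \<in> {0..T}"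
    show "dist (\<sigma> s) (\<sigma> t) \<le> 2 * dist s t"
      using \<theta>lower[of "\<sigma> s" "\<sigma> t"] \<theta>lower[of "\<sigma> t" "\<sigma> s"] \<theta>\<sigma>[OF *(1)] \<theta>\<sigma>[OF *(2)]
      by (cases "\<sigma> s \<le> \<sigma> t") (auto simp: dist_real_def)
  qed simp
  have \<sigma>c: "continuous_on {0..T} \<sigma>" using lip by (rule lipschitz_on_continuous_on)
  have \<sigma>0: "\<sigma> 0 = 0" "\<sigma> T = T" using \<sigma>\<theta>[of 0] \<sigma>\<theta>[of T] \<theta>0 \<open>0 < T\<close> by auto
  have close: "\<bar>\<sigma> t - t\<bar> \<le> a * T" if "t \<in> {0..T}" for t
  proof -
    have "0 \<le> a" using v(2)[of 0] \<open>0 < T\<close> by auto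
    then have "a * \<sigma> t \<le> a * T" using \<theta>\<sigma>(2)[OF that] by (intro mult_left_mono) auto
    then show ?thesis using \<theta>int[of 0 "\<sigma> t"] \<theta>\<sigma>[OF that] \<theta>0 by auto
  qed
  have avoid: "AE t in lebesgue_on {0..T}. \<sigma> t \<in> {0..T} - N" if "finite N" for N
  proof (rule AE_lebesgue_on_negligible)
    show "negligible (\<theta> ` N)" using that by (intro negligible_finite) simp
    fix t assume t: "t \<in> {0..T} - \<theta> ` N"
    then show "\<sigma> t \<in> {0..T} - N" using \<theta>\<sigma>[of t] by (auto intro: rev_image_eqI)
  qed
  \<comment> \<open>The two-sided derivatives below are available at interior times only.\<close>
  let ?S = "S \<union> {0, T}"
  have der: "(\<sigma> has_real_derivative inverse (v (\<sigma> t))) (at t)" "t \<in> {0<..<T}" "v (\<sigma> t) \<noteq> 0" "\<sigma> t \<in> {0<..<T} - S"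
    if t: "t \<in> {0..T}" "\<sigma> t \<in> {0..T} - ?S" for t
  proof -
    have s: "\<sigma> t \<in> {0<..<T} - S" using t(2) by auto
    show "v (\<sigma> t) \<noteq> 0" using v(2)[of "\<sigma> t"] v(3) s by auto
    show t': "t \<in> {0<..<T}" using t \<sigma>0 by (cases "t = 0 \<or> t = T") auto
    have d: "(\<theta> has_real_derivative v (\<sigma> t)) (at (\<sigma> t))"
      using \<theta>s s by (simp add: solves_def has_real_derivative_iff_has_vector_derivative)
    have "isCont \<sigma> t"
      using \<sigma>c t' by (auto intro: continuous_on_interior)
    then show "(\<sigma> has_real_derivative inverse (v (\<sigma> t))) (at t)"
      using t' \<theta>\<sigma>(1) d \<open>v (\<sigma> t) \<noteq> 0\<close>
      by (intro DERIV_inverse_function[where f = \<theta> and a = 0 and b = T]) simp_all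
    show "\<sigma> t \<in> {0<..<T} - S" by (rule s)
  qed
  have finS: "finite ?S" using S by simp
  have AEt: "AE t in lebesgue_on {0..T}. t \<in> {0..T}"
    by (rule AE_lebesgue_on_negligible[of "{}"]) auto
  have AED: "AE t in lebesgue_on {0..T}. \<exists>D. (\<sigma> has_real_derivative D) (at t) \<and> \<bar>D - 1\<bar> \<le> 2 * a"
    using avoid[OF finS] AEt
  proof eventually_elim
    case (elim t)
    let ?v = "v (\<sigma> t)"
    have "\<bar>?v - 1\<bar> \<le> a" using v(2) elim by auto
    then have "1/2 \<le> ?v" using v(3) by auto
    have "\<bar>inverse ?v - 1\<bar> = \<bar>?v - 1\<bar> / ?v" using \<open>1/2 \<le> ?v\<close> by (simp add: field_simps abs_if)
    also have "\<dots> \<le> a / (1/2)" using \<open>\<bar>?v - 1\<bar> \<le> a\<close> \<open>1/2 \<le> ?v\<close> by (intro frac_le) auto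
    finally show ?case using der(1)[OF elim(2,1)] by (intro exI[of _ "inverse ?v"]) simp
  qed
  have Ylip: "B-lipschitz_on {0..T} Y" by (rule solves_lipschitz[OF S Y B])
  have proc: "is_process T Q f (\<lambda>t. Y (\<sigma> t)) (\<lambda>t. U (\<sigma> t))"
    unfolding is_process_def
  proof (intro conjI ballI)
    show "absolutely_continuous_fun 0 T (\<lambda>t. Y (\<sigma> t))"
      using lipschitz_imp_absolutely_continuous_fun[OF lipschitz_on_compose2[OF lip]] Ylip \<sigma>img by auto
    have Ub: "bcont_off (\<theta> ` S) 0 T (\<lambda>t. U (\<sigma> t))"
      unfolding bcont_off_def
    proof
      have "(\<lambda>t. U (\<sigma> t)) ` {0..T} = U ` {0..T}" using \<sigma>img by (metis image_image)
      then show "bounded ((\<lambda>t. U (\<sigma> t)) ` {0..T})" using U by (simp add: bcont_off_def)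
      show "continuous_on ({0..T} - \<theta> ` S) (\<lambda>t. U (\<sigma> t))"
      proof (rule continuous_on_compose2[of "{0..T} - S" U])
        show "continuous_on ({0..T} - S) U" using U by (simp add: bcont_off_def)
        show "continuous_on ({0..T} - \<theta> ` S) \<sigma>" using \<sigma>c by (rule continuous_on_subset) auto
        show "\<sigma> ` ({0..T} - \<theta> ` S) \<subseteq> {0..T} - S"
        proof clarify
          fix t assume "t \<in> {0..T}" "t \<notin> \<theta> ` S"
          then show "\<sigma> t \<in> {0..T} - S" using \<theta>\<sigma>[of t] by (auto intro: rev_image_eqI)
        qed
      qed
    qed
    show "(\<lambda>t. U (\<sigma> t)) \<in> borel_measurable (lebesgue_on {0..T})"
      by (rule bcont_off_measurable[OF _ Ub]) (use S in simp)
    obtain M where "\<forall>\<tau>\<in>{0..T}. norm (U \<tau>) \<le> M" using bcont_off_bound[OF U] by blast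
    then show "\<exists>M. AE t in lebesgue_on {0..T}. norm (U (\<sigma> t)) \<le> M"
      using \<theta>\<sigma>(2) by (intro exI[of _ M] AE_lebesgue_on_negligible[of "{}"]) auto
    show "Y (\<sigma> t) \<in> fst ` Q" if "t \<in> {0..T}" for t
      using Q[OF \<theta>\<sigma>(2)[OF that]] by force
    show "AE t in lebesgue_on {0..T}. (Y (\<sigma> t), U (\<sigma> t)) \<in> Q"
      by (rule AE_lebesgue_on_negligible[of "{}"]) (use Q \<theta>\<sigma>(2) in auto)
    show "AE t in lebesgue_on {0..T}. ((\<lambda>t. Y (\<sigma> t)) has_vector_derivative f (Y (\<sigma> t)) (U (\<sigma> t))) (at t)"
      using avoid[OF finS] AEt
    proof eventually_elim
      case (elim t)
      note d = der[OF elim(2,1)]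
      have "(Y has_vector_derivative v (\<sigma> t) *\<^sub>R f (Y (\<sigma> t)) (U (\<sigma> t))) (at (\<sigma> t))"
        using Y d(4) by (simp add: solves_def)
      then have "((Y \<circ> \<sigma>) has_vector_derivative inverse (v (\<sigma> t)) *\<^sub>R v (\<sigma> t) *\<^sub>R f (Y (\<sigma> t)) (U (\<sigma> t))) (at t)"
        using d(1) by (intro vector_diff_chain_at) (simp_all add: has_real_derivative_iff_has_vector_derivative)
      then show ?case using d(3) by (simp add: o_def)
    qed
  qed
  show thesis by (rule that[OF lip \<sigma>img \<sigma>0 close AED proc avoid])
qed

section \<open>Uniform first order estimates near a compact set\<close>

lemma compact_cball_neighbourhood:
  fixes K :: "'a::euclidean_space set"
  assumes "compact K" "open Q" "K \<subseteq> Q"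
  obtains r where "0 < r" "(\<Union>x\<in>K. cball x r) \<subseteq> Q" "compact (\<Union>x\<in>K. cball x r)"
proof -
  obtain r where r: "0 < r" "(\<Union>x\<in>K. cball x r) \<subseteq> Q"
    using compact_subset_open_imp_cball_epsilon_subset[OF assms] by blast
  \<comment> \<open>The neighbourhood is the Minkowski sum of \<open>K\<close> and a closed ball,
    hence compact.\<close>
  have "(\<Union>x\<in>K. \<Union>y\<in>cball 0 r. {x + y}) = (\<Union>x\<in>K. cball x r)"
  proof (intro set_eqI iffI)
    fix z assume "z \<in> (\<Union>x\<in>K. cball x r)"
    then obtain x where "x \<in> K" "dist x z \<le> r" by auto
    then show "z \<in> (\<Union>x\<in>K. \<Union>y\<in>cball 0 r. {x + y})"
      by (intro UN_I[of x] UN_I[of "z - x"]) (auto simp: dist_norm norm_minus_commute)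
  next
    fix z assume "z \<in> (\<Union>x\<in>K. \<Union>y\<in>cball 0 r. {x + y})"
    then obtain x y where "x \<in> K" "norm y \<le> r" "z = x + y" by auto
    then show "z \<in> (\<Union>x\<in>K. cball x r)" by (intro UN_I[of x]) (simp_all add: dist_norm)
  qed
  then have "compact (\<Union>x\<in>K. cball x r)"
    using compact_sums'[OF assms(1) compact_cball, of 0 r] by simp
  with r show thesis by (rule that)
qed

text \<open>The derivative is uniformly continuous on a compact neighbourhood, and the mean value
  inequality is applied on each ball about a point of \<open>K\<close>.\<close>

lemma C1_uniform_remainder:
  fixes g :: "'a::euclidean_space \<Rightarrow> 'b::euclidean_space" and g' :: "'a \<Rightarrow> 'a \<Rightarrow>\<^sub>L 'b"
  assumes K: "compact K" "open Q" "K \<subseteq> Q"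
    and g: "\<And>x. x \<in> Q \<Longrightarrow> (g has_derivative blinfun_apply (g' x)) (at x)" "continuous_on Q g'"
    and "0 < e"
  shows "\<exists>\<delta>>0. \<forall>x\<in>K. \<forall>h. norm h \<le> \<delta> \<longrightarrow> x + h \<in> Q \<and> norm (g (x + h) - g x - g' x h) \<le> e * norm h"
proof -
  obtain r where r: "0 < r" "(\<Union>x\<in>K. cball x r) \<subseteq> Q" "compact (\<Union>x\<in>K. cball x r)"
    using compact_cball_neighbourhood[OF K] by blast
  let ?C = "\<Union>x\<in>K. cball x r"
  have "uniformly_continuous_on ?C g'"
    using r(2,3) g(2) by (intro compact_uniformly_continuous) (auto elim: continuous_on_subset)
  then obtain d where d: "0 < d" "\<And>x y. x \<in> ?C \<Longrightarrow> y \<in> ?C \<Longrightarrow> dist y x < d \<Longrightarrow> dist (g' y) (g' x) < e"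
    using \<open>0 < e\<close> unfolding uniformly_continuous_on_def by metis
  define \<delta> where "\<delta> = min r (d/2)"
  have \<delta>: "0 < \<delta>" "\<delta> \<le> r" "\<delta> < d" using r(1) d(1) by (auto simp: \<delta>_def)
  show ?thesis
  proof (intro exI[of _ \<delta>] conjI ballI allI impI)
    fix x h :: 'a assume x: "x \<in> K" and h: "norm h \<le> \<delta>"
    have sub: "cball x \<delta> \<subseteq> ?C" using x \<delta> by auto
    have "x + h \<in> cball x \<delta>" using h by (simp add: dist_norm)
    then show "x + h \<in> Q" using sub r(2) by blast
    have "norm (g (x + h) - g x - g' x ((x + h) - x)) \<le> norm ((x + h) - x) * e"
    proof (rule differentiable_bound_linearization[where S = "cball x \<delta>"])
      fix t :: real assume "t \<in> {0..1}"
      then have "norm (t *\<^sub>R h) \<le> 1 * norm h" unfolding norm_scaleR by (intro mult_right_mono) auto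
      then show "x + t *\<^sub>R (x + h - x) \<in> cball x \<delta>" using h by (simp add: dist_norm)
    next
      fix y assume y: "y \<in> cball x \<delta>"
      then have yC: "y \<in> ?C" using sub by blast
      then show "(g has_derivative blinfun_apply (g' y)) (at y within cball x \<delta>)"
        using g(1) r(2) by (blast intro: has_derivative_at_withinI)
      have "dist (g' y) (g' x) < e"
      proof (rule d(2)[OF _ yC])
        show "x \<in> ?C" using x r(1) by (intro UN_I[of x]) simp_all
        show "dist y x < d" using y \<delta> by (simp add: dist_commute)
      qed
      then have "norm (g' y - g' x) \<le> e" by (simp add: dist_norm)
      then have "norm (blinfun_apply (g' y) k - blinfun_apply (g' x) k) \<le> e * norm k" for k
        using norm_blinfun[of "g' y - g' x" k] mult_right_mono[of "norm (g' y - g' x)" e "norm k"]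
        by (simp add: blinfun.diff_left)
      then show "onorm (blinfun_apply (g' y) - blinfun_apply (g' x)) \<le> e"
        by (intro onorm_le) simp
    qed (use \<delta> in auto)
    then show "norm (g (x + h) - g x - g' x h) \<le> e * norm h" by (simp add: mult.commute)
  qed (rule \<delta>)
qed

text \<open>The Lipschitz estimate is confined to single balls, because the mean value inequality
  wants a convex set and the neighbourhood need not be convex.\<close>

lemma C1_uniform_lipschitz:
  fixes g :: "'a::euclidean_space \<Rightarrow> 'b::euclidean_space" and g' :: "'a \<Rightarrow> 'a \<Rightarrow>\<^sub>L 'b"
  assumes K: "compact K" "open Q" "K \<subseteq> Q"
    and g: "\<And>x. x \<in> Q \<Longrightarrow> (g has_derivative blinfun_apply (g' x)) (at x)" "continuous_on Q g'"
  shows "\<exists>r>0. \<exists>L\<ge>0. compact (\<Union>x\<in>K. cball x r) \<and> (\<Union>x\<in>K. cball x r) \<subseteq> Q \<and>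
    (\<forall>x\<in>K. \<forall>y\<in>cball x r. norm (g' y) \<le> L) \<and>
    (\<forall>x\<in>K. \<forall>y\<in>cball x r. \<forall>z\<in>cball x r. norm (g y - g z) \<le> L * norm (y - z))"
proof -
  obtain r where r: "0 < r" "(\<Union>x\<in>K. cball x r) \<subseteq> Q" "compact (\<Union>x\<in>K. cball x r)"
    using compact_cball_neighbourhood[OF K] by blast
  let ?C = "\<Union>x\<in>K. cball x r"
  have "bounded (g' ` ?C)"
    using r(2,3) g(2) by (intro compact_imp_bounded compact_continuous_image) (auto elim: continuous_on_subset)
  then obtain L where L: "0 < L" "\<forall>y\<in>?C. norm (g' y) \<le> L" unfolding bounded_pos by auto
  have "norm (g y - g z) \<le> L * norm (y - z)" if xyz: "x \<in> K" "y \<in> cball x r" "z \<in> cball x r" for x y z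
  proof (rule differentiable_bound[OF convex_cball[of x r] _ _ xyz(2,3)])
    fix w assume "w \<in> cball x r"
    then have w: "w \<in> ?C" using xyz(1) by blast
    then show "(g has_derivative blinfun_apply (g' w)) (at w within cball x r)"
      using g(1) r(2) by (blast intro: has_derivative_at_withinI)
    have "norm (g' w) \<le> L" using L w by blast
    then show "onorm (blinfun_apply (g' w)) \<le> L" by (simp add: norm_blinfun.rep_eq)
  qed
  moreover have "norm (g' y) \<le> L" if "x \<in> K" "y \<in> cball x r" for x y using L that by blast
  ultimately have "compact ?C \<and> ?C \<subseteq> Q \<and> (\<forall>x\<in>K. \<forall>y\<in>cball x r. norm (g' y) \<le> L) \<and>
      (\<forall>x\<in>K. \<forall>y\<in>cball x r. \<forall>z\<in>cball x r. norm (g y - g z) \<le> L * norm (y - z))"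
    using r(2,3) by (intro conjI ballI)
  then show ?thesis
    by - (rule exI[of _ r], rule conjI[OF r(1)], rule exI[of _ L], rule conjI[OF less_imp_le[OF L(1)]])
qed

text \<open>\<open>u\<close> is \<open>u0\<close> redefined at \<open>t1\<close> and \<open>t2\<close>, \<open>G\<close> the gradient of \<open>\<Phi>\<close>; \<open>K\<close> is a compact set containing the
  reference process, including the one-sided values of the control.\<close>

locale reference_process =
  fixes T t1 t2 :: real
    and Q :: "((real ^ 'm::finite) \<times> (real ^ 'k::finite)) set"
    and f :: "real ^ 'm \<Rightarrow> real ^ 'k \<Rightarrow> real ^ 'm"
    and f' :: "(real ^ 'm) \<times> (real ^ 'k) \<Rightarrow> ((real ^ 'm) \<times> (real ^ 'k)) \<Rightarrow>\<^sub>L (real ^ 'm)"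
    and \<phi> :: "real ^ 'k \<Rightarrow> real ^ 'd::finite"
    and \<Phi> :: "real ^ 'm \<Rightarrow> real"
    and G :: "real ^ 'm \<Rightarrow> real ^ 'm"
    and J :: "real ^ 'm \<Rightarrow> real ^ 'm \<Rightarrow> real"
    and J0 JT :: "real ^ 'm"
    and y0 :: "real \<Rightarrow> real ^ 'm"
    and u0 u :: "real \<Rightarrow> real ^ 'k"
    and K :: "((real ^ 'm) \<times> (real ^ 'k)) set"
  assumes times: "0 < t1" "t1 < t2" "t2 < T"
    and openQ: "open Q"
    and df: "\<And>x. x \<in> Q \<Longrightarrow> ((\<lambda>(y, v). f y v) has_derivative blinfun_apply (f' x)) (at x)"
    and cf': "continuous_on Q f'"
    and dPhi: "\<And>y. y \<in> fst ` Q \<Longrightarrow> (\<Phi> has_derivative (\<lambda>h. G y \<bullet> h)) (at y)"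
    and cG: "continuous_on (fst ` Q) G"
    and dJ: "((\<lambda>(a, b). J a b) has_derivative (\<lambda>(a, b). J0 \<bullet> a + JT \<bullet> b)) (at (y0 0, y0 T))"
    and K: "compact K" "K \<subseteq> Q" "\<And>t. t \<in> {0..T} \<Longrightarrow> (y0 t, u t) \<in> K"
    and u: "bcont_off {t1, t2} 0 T u" "\<And>t. t \<in> {0..T} - {t1, t2} \<Longrightarrow> u t = u0 t"
    and y0: "solves {t1, t2} 0 T y0 (\<lambda>t. f (y0 t) (u t))"
    and Phi0: "\<And>t. t \<in> {t1..t2} \<Longrightarrow> \<Phi> (y0 t) = 0" "\<And>t. t \<in> {0..T} - {t1..t2} \<Longrightarrow> 0 < \<Phi> (y0 t)"
    and minimal: "extended_weak_minimum T Q f \<phi> \<Phi> J y0 u0"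
begin

section \<open>Realising linear variations by admissible processes\<close>

abbreviation "S \<equiv> {t1, t2}"

lemma T_pos: "0 < T" using times by simp

lemma y0_continuous: "continuous_on {0..T} y0"
  using y0 by (simp add: solves_def)

text \<open>Uniformity in \<open>t\<close> comes from the compact set \<open>K\<close>, although the
  control jumps: the remainder depends on \<open>t\<close> only through a point of \<open>K\<close>.
  The product of dilation and linear displacement is of second order.\<close>

lemma perturbed_rhs_expansion:
  assumes Yb: "continuous_on {0..T} Yb" and Ub: "bcont_off S 0 T Ub" and vb: "bcont_off S 0 T vb"
    and "0 < \<kappa>"
  shows "\<exists>\<epsilon>1>0. \<forall>\<epsilon>. 0 < \<epsilon> \<and> \<epsilon> < \<epsilon>1 \<longrightarrow> (\<forall>t\<in>{0..T}.
    norm ((1 + \<epsilon> * vb t) *\<^sub>R f (y0 t + \<epsilon> *\<^sub>R Yb t) (u t + \<epsilon> *\<^sub>R Ub t) - f (y0 t) (u t)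
      - \<epsilon> *\<^sub>R (f' (y0 t, u t) (Yb t, Ub t) + vb t *\<^sub>R f (y0 t) (u t))) \<le> \<kappa> * \<epsilon>)"
proof -
  obtain C where C: "0 \<le> C" "\<And>t. t \<in> {0..T} \<Longrightarrow> norm (Yb t, Ub t) \<le> C"
    using bcont_off_bound[OF bcont_off_Pair[OF bcont_off_continuous[OF Yb] Ub]] by blast
  obtain V where V: "0 \<le> V" "\<And>t. t \<in> {0..T} \<Longrightarrow> norm (vb t) \<le> V"
    using bcont_off_bound[OF vb] by blast
  obtain r L where rL: "0 < r" "0 \<le> L" "\<And>x y. x \<in> K \<Longrightarrow> y \<in> cball x r \<Longrightarrow> norm (f' y) \<le> L"
    using C1_uniform_lipschitz[OF K(1) openQ K(2) df cf'] by blast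
  have L: "norm (f' x) \<le> L" if "x \<in> K" for x using rL(3)[OF that, of x] rL(1) by simp
  \<comment> \<open>Half of \<kappa> is reserved for the Taylor remainder, which the dilation at
    most doubles; the other half is for the product term.\<close>
  define e where "e = \<kappa> / (4 * (C + 1))"
  have e: "0 < e" "2 * e * C \<le> \<kappa> / 2"
    using \<open>0 < \<kappa>\<close> C(1) by (auto simp: e_def field_simps)
  obtain \<delta> where \<delta>: "0 < \<delta>" "\<And>x h. x \<in> K \<Longrightarrow> norm h \<le> \<delta> \<Longrightarrow>
      norm ((\<lambda>(y, v). f y v) (x + h) - (\<lambda>(y, v). f y v) x - f' x h) \<le> e * norm h"
    using C1_uniform_remainder[OF K(1) openQ K(2) df cf' e(1)] by blast
  \<comment> \<open>In this order: the displacement stays where the remainder estimate holds, the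
    dilation changes by at most 1, and the product term is at most
    \<open>\<kappa> / 2 * \<epsilon>\<close>.\<close>
  define \<epsilon>1 where "\<epsilon>1 = min (\<delta> / (C + 1)) (min (1 / (V + 1)) (\<kappa> / (2 * (V * L * C + 1))))"
  have VLC: "0 \<le> V * L * C" using V C rL by simp
  have "0 < \<epsilon>1" using \<delta>(1) C(1) V(1) \<open>0 < \<kappa>\<close> VLC by (simp add: \<epsilon>1_def add_nonneg_pos)
  moreover have "norm ((1 + \<epsilon> * vb t) *\<^sub>R f (y0 t + \<epsilon> *\<^sub>R Yb t) (u t + \<epsilon> *\<^sub>R Ub t) - f (y0 t) (u t)
      - \<epsilon> *\<^sub>R (f' (y0 t, u t) (Yb t, Ub t) + vb t *\<^sub>R f (y0 t) (u t))) \<le> \<kappa> * \<epsilon>"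
    if \<epsilon>: "0 < \<epsilon>" "\<epsilon> < \<epsilon>1" and t: "t \<in> {0..T}" for \<epsilon> t
  proof -
    define h where "h = \<epsilon> *\<^sub>R (Yb t, Ub t)"
    have nh: "norm h \<le> \<epsilon> * C" using C(2)[OF t] \<epsilon>(1) unfolding h_def norm_scaleR by (simp add: mult_left_mono)
    have "\<epsilon> * C \<le> \<epsilon> * (C + 1)" using \<epsilon> by simp
    also have "\<dots> \<le> \<delta>" using \<epsilon> C(1) unfolding \<epsilon>1_def by (simp add: pos_less_divide_eq)
    finally have "norm h \<le> \<delta>" using nh by linarith
    define R where "R = f (y0 t + \<epsilon> *\<^sub>R Yb t) (u t + \<epsilon> *\<^sub>R Ub t) - f (y0 t) (u t) - f' (y0 t, u t) h"
    have "norm R \<le> e * norm h"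
      using \<delta>(2)[OF K(3)[OF t] \<open>norm h \<le> \<delta>\<close>] by (simp add: R_def h_def)
    also have "\<dots> \<le> e * (\<epsilon> * C)" using nh e(1) by (intro mult_left_mono) auto
    finally have nR: "norm R \<le> e * (\<epsilon> * C)" .
    have f'h: "f' (y0 t, u t) h = \<epsilon> *\<^sub>R f' (y0 t, u t) (Yb t, Ub t)"
      unfolding h_def by (rule blinfun.scaleR_right)
    have nf: "norm (f' (y0 t, u t) h) \<le> L * (\<epsilon> * C)"
    proof -
      have "norm (f' (y0 t, u t) h) \<le> norm (f' (y0 t, u t)) * norm h" by (rule norm_blinfun)
      also have "\<dots> \<le> L * (\<epsilon> * C)" using L[OF K(3)[OF t]] nh by (intro mult_mono) (auto simp: rL)
      finally show ?thesis .
    qed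
    have "\<bar>\<epsilon> * vb t\<bar> \<le> \<epsilon> * V" using V(2)[OF t] \<epsilon>(1) by (simp add: abs_mult mult_left_mono)
    moreover have "\<epsilon> * V \<le> 1"
    proof -
      have "\<epsilon> * (V + 1) \<le> 1" using \<epsilon> V(1) unfolding \<epsilon>1_def by (simp add: pos_less_divide_eq)
      then show ?thesis using \<epsilon> by (simp add: algebra_simps)
    qed
    ultimately have v1: "\<bar>1 + \<epsilon> * vb t\<bar> \<le> 2" and v2: "\<bar>\<epsilon> * vb t\<bar> \<le> \<epsilon> * V" by auto
    have "(1 + \<epsilon> * vb t) *\<^sub>R f (y0 t + \<epsilon> *\<^sub>R Yb t) (u t + \<epsilon> *\<^sub>R Ub t) - f (y0 t) (u t)
      - \<epsilon> *\<^sub>R (f' (y0 t, u t) (Yb t, Ub t) + vb t *\<^sub>R f (y0 t) (u t))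
      = (1 + \<epsilon> * vb t) *\<^sub>R R + (\<epsilon> * vb t) *\<^sub>R f' (y0 t, u t) h"
      unfolding f'h R_def by (simp add: algebra_simps)
    also have "norm \<dots> \<le> \<bar>1 + \<epsilon> * vb t\<bar> * norm R + \<bar>\<epsilon> * vb t\<bar> * norm (f' (y0 t, u t) h)"
      by (rule order_trans[OF norm_triangle_ineq]) simp
    also have "\<dots> \<le> 2 * (e * (\<epsilon> * C)) + (\<epsilon> * V) * (L * (\<epsilon> * C))"
      using v1 v2 nR nf \<epsilon> V(1) by (intro add_mono mult_mono) auto
    also have "\<dots> = \<epsilon> * (2 * e * C) + \<epsilon> * (\<epsilon> * (V * L * C))" by simp
    also have "\<dots> \<le> \<epsilon> * (\<kappa> / 2) + \<epsilon> * (\<kappa> / 2)"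
    proof (intro add_mono mult_left_mono)
      have "\<epsilon> * (V * L * C) \<le> \<epsilon> * (V * L * C + 1)" using \<epsilon> by simp
      also have "\<dots> \<le> \<kappa> / 2"
      proof -
        have "\<epsilon> < \<kappa> / (2 * (V * L * C + 1))" using \<epsilon> by (simp add: \<epsilon>1_def)
        then have "\<epsilon> * (2 * (V * L * C + 1)) < \<kappa>" using VLC by (simp add: pos_less_divide_eq add_nonneg_pos)
        then show ?thesis by (simp add: algebra_simps)
      qed
      finally show "\<epsilon> * (V * L * C) \<le> \<kappa> / 2" .
    qed (use \<epsilon> e in auto)
    also have "\<dots> = \<kappa> * \<epsilon>" by simp
    finally show ?thesis .
  qed
  ultimately show ?thesis by blast
qed

text \<open>The curve \<open>y0 + \<epsilon> Yb\<close> solves the dilated equation up to a defect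
  of order \<epsilon> with an arbitrarily small constant; shadowing replaces it by a true solution
  with the same initial value and an error of the same kind.\<close>

lemma perturbed_solution:
  assumes Yb: "solves S 0 T Yb (\<lambda>t. f' (y0 t, u t) (Yb t, Ub t) + vb t *\<^sub>R f (y0 t) (u t))"
    and Ub: "bcont_off S 0 T Ub" and vb: "bcont_off S 0 T vb" and "0 < \<kappa>"
  shows "\<exists>\<epsilon>2>0. \<forall>\<epsilon>. 0 < \<epsilon> \<and> \<epsilon> < \<epsilon>2 \<longrightarrow> (\<exists>Y B.
    solves S 0 T Y (\<lambda>t. (1 + \<epsilon> * vb t) *\<^sub>R f (Y t) (u t + \<epsilon> *\<^sub>R Ub t)) \<and> 0 \<le> B \<and>
    (\<forall>t\<in>{0..T}. norm (Y t - (y0 t + \<epsilon> *\<^sub>R Yb t)) \<le> \<kappa> * \<epsilon> \<and> (Y t, u t + \<epsilon> *\<^sub>R Ub t) \<in> Q \<and>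
      norm ((1 + \<epsilon> * vb t) *\<^sub>R f (Y t) (u t + \<epsilon> *\<^sub>R Ub t)) \<le> B) \<and> Y 0 = y0 0 + \<epsilon> *\<^sub>R Yb 0)"
proof -
  have finS: "finite S" by simp
  have Ybc: "continuous_on {0..T} Yb" using Yb by (simp add: solves_def)
  obtain C where C: "0 \<le> C" "\<And>t. t \<in> {0..T} \<Longrightarrow> norm (Yb t, Ub t) \<le> C"
    using bcont_off_bound[OF bcont_off_Pair[OF bcont_off_continuous[OF Ybc] Ub]] by blast
  obtain V where V: "0 \<le> V" "\<And>t. t \<in> {0..T} \<Longrightarrow> norm (vb t) \<le> V"
    using bcont_off_bound[OF vb] by blast
  have "\<exists>r>0. \<exists>L\<ge>0. compact (\<Union>x\<in>K. cball x r) \<and> (\<Union>x\<in>K. cball x r) \<subseteq> Q \<and>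
    (\<forall>x\<in>K. \<forall>y\<in>cball x r. norm (f' y) \<le> L) \<and>
    (\<forall>x\<in>K. \<forall>y\<in>cball x r. \<forall>z\<in>cball x r.
      norm ((\<lambda>(y, v). f y v) y - (\<lambda>(y, v). f y v) z) \<le> L * norm (y - z))"
    by (rule C1_uniform_lipschitz[OF K(1) openQ K(2) df cf'])
  then obtain r L where rL: "0 < r" "0 \<le> L" "compact (\<Union>x\<in>K. cball x r)" "(\<Union>x\<in>K. cball x r) \<subseteq> Q"
    and lip: "\<forall>x\<in>K. \<forall>y\<in>cball x r. \<forall>z\<in>cball x r.
        norm ((\<lambda>(y, v). f y v) y - (\<lambda>(y, v). f y v) z) \<le> L * norm (y - z)"
    by (elim exE conjE) (rule that)
  let ?N = "\<Union>x\<in>K. cball x r"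
  have cf: "continuous_on ?N (\<lambda>(y, v). f y v)"
  proof (rule has_derivative_continuous_on[where f' = "\<lambda>x. blinfun_apply (f' x)"])
    fix x assume "x \<in> ?N"
    then have "x \<in> Q" using rL(4) by blast
    then show "((\<lambda>(y, v). f y v) has_derivative blinfun_apply (f' x)) (at x within ?N)"
      by (rule has_derivative_at_withinI[OF df])
  qed
  \<comment> \<open>The factor by which shadowing magnifies a pointwise defect: \<open>T\<close>
    from integrating it, the exponential from the Lipschitz constant \<open>2 * L\<close>, where 2
    bounds the dilation.\<close>
  define M where "M = 2 * T * exp (2 * (2 * L) * (T - 0))"
  have M: "0 < M" using T_pos by (simp add: M_def)
  obtain \<epsilon>1 where \<epsilon>1: "0 < \<epsilon>1" "\<And>\<epsilon> t. 0 < \<epsilon> \<Longrightarrow> \<epsilon> < \<epsilon>1 \<Longrightarrow> t \<in> {0..T} \<Longrightarrow>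
    norm ((1 + \<epsilon> * vb t) *\<^sub>R f (y0 t + \<epsilon> *\<^sub>R Yb t) (u t + \<epsilon> *\<^sub>R Ub t) - f (y0 t) (u t)
      - \<epsilon> *\<^sub>R (f' (y0 t, u t) (Yb t, Ub t) + vb t *\<^sub>R f (y0 t) (u t))) \<le> \<kappa> / M * \<epsilon>"
    using perturbed_rhs_expansion[OF Ybc Ub vb divide_pos_pos[OF \<open>0 < \<kappa>\<close> M]] by blast
  \<comment> \<open>In this order: the expansion applies, the linear displacement and the shadowing
    error each use at most half of the radius \<open>r\<close>, and the dilation stays at most
    2.\<close>
  define \<epsilon>2 where "\<epsilon>2 = min \<epsilon>1 (min (r / (2 * (C + 1))) (min (r / (2 * \<kappa>)) (1 / (V + 1))))"
  have "0 < \<epsilon>2" using \<epsilon>1(1) rL(1) C(1) V(1) \<open>0 < \<kappa>\<close> by (simp add: \<epsilon>2_def)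
  moreover have "\<exists>Y B. solves S 0 T Y (\<lambda>t. (1 + \<epsilon> * vb t) *\<^sub>R f (Y t) (u t + \<epsilon> *\<^sub>R Ub t)) \<and> 0 \<le> B \<and>
    (\<forall>t\<in>{0..T}. norm (Y t - (y0 t + \<epsilon> *\<^sub>R Yb t)) \<le> \<kappa> * \<epsilon> \<and> (Y t, u t + \<epsilon> *\<^sub>R Ub t) \<in> Q \<and>
      norm ((1 + \<epsilon> * vb t) *\<^sub>R f (Y t) (u t + \<epsilon> *\<^sub>R Ub t)) \<le> B) \<and> Y 0 = y0 0 + \<epsilon> *\<^sub>R Yb 0"
    if \<epsilon>: "0 < \<epsilon>" "\<epsilon> < \<epsilon>2" for \<epsilon>
  proof -
    have "\<epsilon> < r / (2 * (C + 1))" using \<epsilon> by (simp add: \<epsilon>2_def)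
    then have "\<epsilon> * (2 * (C + 1)) < r" using C(1) by (simp add: pos_less_divide_eq)
    then have eC: "\<epsilon> * C \<le> r / 2" using \<epsilon>(1) by (simp add: algebra_simps)
    have "\<epsilon> < r / (2 * \<kappa>)" using \<epsilon> by (simp add: \<epsilon>2_def)
    then have ek: "\<kappa> * \<epsilon> \<le> r / 2" using \<open>0 < \<kappa>\<close> by (simp add: pos_less_divide_eq algebra_simps)
    have "\<epsilon> < 1 / (V + 1)" using \<epsilon> by (simp add: \<epsilon>2_def)
    then have "\<epsilon> * (V + 1) < 1" using V(1) by (simp add: pos_less_divide_eq)
    then have eV: "\<epsilon> * V \<le> 1" using \<epsilon>(1) by (simp add: algebra_simps)
    define z where "z t = y0 t + \<epsilon> *\<^sub>R Yb t" for t
    define F where "F t y = (1 + \<epsilon> * vb t) *\<^sub>R f y (u t + \<epsilon> *\<^sub>R Ub t)" for t y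
    have v2: "\<bar>1 + \<epsilon> * vb t\<bar> \<le> 2" if "t \<in> {0..T}" for t
    proof -
      have "\<bar>\<epsilon> * vb t\<bar> \<le> \<epsilon> * V" using V(2)[OF that] \<epsilon>(1) by (simp add: abs_mult mult_left_mono)
      then show ?thesis using eV by linarith
    qed
    have inN: "(y, u t + \<epsilon> *\<^sub>R Ub t) \<in> cball (y0 t, u t) r" if "norm (y - z t) \<le> r / 2" "t \<in> {0..T}" for t y
    proof -
      have "(y, u t + \<epsilon> *\<^sub>R Ub t) - (y0 t, u t) = (y - z t, 0) + \<epsilon> *\<^sub>R (Yb t, Ub t)"
        by (simp add: z_def)
      then have "norm ((y, u t + \<epsilon> *\<^sub>R Ub t) - (y0 t, u t)) \<le> norm (y - z t, 0 :: real^'k) + norm (\<epsilon> *\<^sub>R (Yb t, Ub t))"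
        by (metis norm_triangle_ineq)
      also have "\<dots> \<le> norm (y - z t) + \<epsilon> * C"
        using C(2)[OF that(2)] \<epsilon>(1) unfolding norm_scaleR by (simp add: norm_Pair mult_left_mono)
      also have "\<dots> \<le> r" using that(1) eC by linarith
      finally show ?thesis unfolding mem_cball by (subst dist_commute) (simp only: dist_norm)
    qed
    have zc: "continuous_on {0..T} z"
      unfolding z_def by (intro continuous_intros y0_continuous Ybc)
    have vbc: "bcont_off S 0 T (\<lambda>t. 1 + \<epsilon> * vb t)" by (intro bcont_off_intros vb)
    have Ubc: "bcont_off S 0 T (\<lambda>t. u t + \<epsilon> *\<^sub>R Ub t)" by (intro bcont_off_intros u(1) Ub)
    have Fb: "bcont_off S 0 T (\<lambda>s. F s (y s))"
      if yc: "continuous_on {0..T} y" and yr: "\<forall>t\<in>{0..T}. norm (y t - z t) \<le> r / 2" for y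
    proof -
      have "bcont_off S 0 T (\<lambda>s. (\<lambda>(y, v). f y v) (y s, u s + \<epsilon> *\<^sub>R Ub s))"
      proof (rule bcont_off_compose[OF _ cf rL(3)])
        show "bcont_off S 0 T (\<lambda>s. (y s, u s + \<epsilon> *\<^sub>R Ub s))"
          by (intro bcont_off_Pair bcont_off_continuous yc Ubc)
        show "(y t, u t + \<epsilon> *\<^sub>R Ub t) \<in> ?N" if "t \<in> {0..T}" for t
          using inN[OF _ that] K(3)[OF that] yr that by blast
      qed
      then show ?thesis unfolding F_def by (intro bcont_off_bilinear[OF bounded_bilinear_scaleR vbc]) simp
    qed
    have z0: "norm (z t - z t) \<le> r / 2" for t using rL(1) by simp
    define \<eta> where "\<eta> = T * (\<kappa> / M * \<epsilon>)"
    have \<eta>0: "0 \<le> \<eta>" using T_pos \<open>0 < \<kappa>\<close> M \<epsilon> by (simp add: \<eta>_def)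
    have "2 * \<eta> * exp (2 * (2 * L) * (T - 0)) = M * (\<kappa> / M * \<epsilon>)" by (simp add: \<eta>_def M_def)
    then have \<eta>: "2 * \<eta> * exp (2 * (2 * L) * (T - 0)) = \<kappa> * \<epsilon>" using M by simp
    obtain Y where Y: "continuous_on {0..T} Y" "\<And>t. t \<in> {0..T} \<Longrightarrow> Y t = z 0 + integral {0..t} (\<lambda>s. F s (Y s))"
      "\<And>t. t \<in> {0..T} \<Longrightarrow> norm (Y t - z t) \<le> 2 * \<eta> * exp (2 * (2 * L) * (T - 0))"
    proof (rule shadowing[of 0 T z "2 * L" \<eta> "r / 2" F "z 0"])
      show "(\<lambda>s. F s (y s)) integrable_on {0..T}"
        if "continuous_on {0..T} y" "\<forall>t\<in>{0..T}. norm (y t - z t) \<le> r / 2" for y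
        using bcont_off_integrable[OF finS Fb[OF that]] .
      show "norm (F s x - F s y) \<le> 2 * L * norm (x - y)"
        if s: "s \<in> {0..T}" and xy: "norm (x - z s) \<le> r / 2" "norm (y - z s) \<le> r / 2" for s x y
      proof -
        have *: "norm (f x (u s + \<epsilon> *\<^sub>R Ub s) - f y (u s + \<epsilon> *\<^sub>R Ub s)) \<le> L * norm (x - y)"
          using lip[rule_format, OF K(3)[OF s] inN[OF xy(1) s] inN[OF xy(2) s]] by (simp add: norm_Pair)
        have "F s x - F s y = (1 + \<epsilon> * vb s) *\<^sub>R (f x (u s + \<epsilon> *\<^sub>R Ub s) - f y (u s + \<epsilon> *\<^sub>R Ub s))"
          by (simp add: F_def scaleR_diff_right)
        also have "norm \<dots> \<le> 2 * (L * norm (x - y))"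
          unfolding norm_scaleR by (intro mult_mono v2[OF s] *) simp_all
        finally show ?thesis by simp
      qed
      show "norm (z t - (z 0 + integral {0..t} (\<lambda>s. F s (z s)))) \<le> \<eta>" if t: "t \<in> {0..T}" for t
      proof -
        define w where "w s = f (y0 s) (u s) + \<epsilon> *\<^sub>R (f' (y0 s, u s) (Yb s, Ub s) + vb s *\<^sub>R f (y0 s) (u s))" for s
        have t': "0 \<le> t" "t \<le> T" using t by auto
        have "((\<lambda>s. w s) has_integral ((y0 t - y0 0) + \<epsilon> *\<^sub>R (Yb t - Yb 0))) {0..t}"
          unfolding w_def
          by (intro has_integral_add has_integral_cmul solves_has_integral[OF finS y0 order_refl t']
              solves_has_integral[OF finS Yb order_refl t'])
        then have iw: "(w has_integral (z t - z 0)) {0..t}" by (simp add: z_def algebra_simps)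
        have "(\<lambda>s. F s (z s)) integrable_on {0..T}" using bcont_off_integrable[OF finS Fb[OF zc]] z0 by blast
        then have iF: "(\<lambda>s. F s (z s)) integrable_on {0..t}" by (rule integrable_on_subinterval) (use t in auto)
        have "((\<lambda>s. w s - F s (z s)) has_integral (z t - z 0 - integral {0..t} (\<lambda>s. F s (z s)))) {0..t}"
          by (rule has_integral_diff[OF iw integrable_integral[OF iF]])
        moreover have "norm (w s - F s (z s)) \<le> \<kappa> / M * \<epsilon>" if s: "s \<in> {0..t}" for s
        proof -
          have "s \<in> {0..T}" "\<epsilon> < \<epsilon>1" using s t \<epsilon> by (auto simp: \<epsilon>2_def)
          from \<epsilon>1(2)[OF \<epsilon>(1) this(2,1)] show ?thesis
            unfolding w_def F_def z_def by (subst norm_minus_commute) (simp add: algebra_simps)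
        qed
        ultimately have "norm (z t - z 0 - integral {0..t} (\<lambda>s. F s (z s))) \<le> \<kappa> / M * \<epsilon> * measure lborel (cbox 0 t)"
          using \<epsilon>(1) \<open>0 < \<kappa>\<close> M by (intro has_integral_bound) auto
        also have "\<dots> \<le> \<eta>" unfolding \<eta>_def using t \<epsilon>(1) \<open>0 < \<kappa>\<close> M by (simp add: mult.commute mult_left_mono divide_right_mono)
        finally show ?thesis by (simp add: algebra_simps)
      qed
      show "2 * \<eta> * exp (2 * (2 * L) * (T - 0)) \<le> r / 2" using \<eta> ek by simp
    qed (use T_pos zc rL(2) \<eta>0 in auto)
    have d: "norm (Y t - z t) \<le> \<kappa> * \<epsilon>" if "t \<in> {0..T}" for t using Y(3)[OF that] \<eta> by simp
    have dr: "\<forall>t\<in>{0..T}. norm (Y t - z t) \<le> r / 2" using d ek by force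
    have FY: "bcont_off S 0 T (\<lambda>s. F s (Y s))" by (rule Fb[OF Y(1) dr])
    have sol: "solves S 0 T Y (\<lambda>s. F s (Y s))" by (rule solves_of_integral[OF finS FY Y(2)])
    obtain B where B: "0 \<le> B" "\<forall>t\<in>{0..T}. norm (F t (Y t)) \<le> B" using bcont_off_bound[OF FY] by blast
    have "Y 0 = z 0" using Y(2)[of 0] T_pos by simp
    moreover have "(Y t, u t + \<epsilon> *\<^sub>R Ub t) \<in> Q" if "t \<in> {0..T}" for t
      using inN[OF _ that, of "Y t"] dr that K(3)[OF that] rL(4) by blast
    ultimately show ?thesis
      using sol B d unfolding F_def z_def by (intro exI[of _ Y] exI[of _ B]) simp
  qed
  ultimately show ?thesis by blast
qed

text \<open>On the boundary arc the first order increase of \<Phi> decides, elsewhere its positive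
  value. That value tends to 0 at \<open>t1\<close> and \<open>t2\<close>, so the two regimes have
  to overlap with a common margin.\<close>

lemma perturbed_state_constraint:
  assumes Yb: "continuous_on {0..T} Yb" and pos: "\<And>t. t \<in> {t1..t2} \<Longrightarrow> 0 < G (y0 t) \<bullet> Yb t"
  shows "\<exists>\<kappa>>0. \<exists>\<epsilon>3>0. \<forall>\<epsilon> Y. 0 < \<epsilon> \<and> \<epsilon> < \<epsilon>3 \<and>
    (\<forall>t\<in>{0..T}. norm (Y t - (y0 t + \<epsilon> *\<^sub>R Yb t)) \<le> \<kappa> * \<epsilon>) \<longrightarrow> (\<forall>t\<in>{0..T}. 0 \<le> \<Phi> (Y t))"
proof -
  let ?K = "y0 ` {0..T}"
  have KQ: "?K \<subseteq> fst ` Q" using K(2,3) by force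
  have cK: "compact ?K" using y0_continuous by (intro compact_continuous_image) auto
  have oQ: "open (fst ` Q)" by (rule open_image_fst[OF openQ])
  have cGy: "continuous_on {0..T} (\<lambda>t. G (y0 t))"
    by (rule continuous_on_compose2[OF cG y0_continuous KQ])
  have cP: "continuous_on {0..T} (\<lambda>t. \<Phi> (y0 t))"
  proof (rule continuous_on_compose2[OF _ y0_continuous KQ])
    show "continuous_on (fst ` Q) \<Phi>"
      by (rule has_derivative_continuous_on[where f' = "\<lambda>y h. G y \<bullet> h"])
        (rule has_derivative_at_withinI, rule dPhi)
  qed
  define m where "m t = G (y0 t) \<bullet> Yb t" for t
  \<comment> \<open>The pointwise maximum of the first order rate and of the value of \<Phi> is
    continuous and positive on the compact interval; its minimum \<open>c\<close> serves as margin
    for both regimes.\<close>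
  have "continuous_on {0..T} (\<lambda>t. max (m t) (\<Phi> (y0 t)))"
    unfolding m_def by (intro continuous_on_max continuous_on_inner cGy Yb cP)
  moreover have "{0..T} \<noteq> {}" using T_pos by auto
  ultimately have "\<exists>s\<in>{0..T}. \<forall>t\<in>{0..T}. max (m s) (\<Phi> (y0 s)) \<le> max (m t) (\<Phi> (y0 t))"
    by (intro continuous_attains_inf compact_Icc)
  then obtain s where s: "s \<in> {0..T}" "\<forall>t\<in>{0..T}. max (m s) (\<Phi> (y0 s)) \<le> max (m t) (\<Phi> (y0 t))"
    by (elim bexE) (rule that)
  define c where "c = max (m s) (\<Phi> (y0 s))"
  have "0 < c"
    using pos[of s] Phi0(2)[of s] s(1) by (cases "s \<in> {t1..t2}") (auto simp: c_def m_def less_max_iff_disj)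
  have c: "c \<le> m t \<or> c \<le> \<Phi> (y0 t)" if "t \<in> {0..T}" for t
    using bspec[OF s(2) that] by (auto simp: c_def le_max_iff_disj)
  obtain C where C: "0 \<le> C" "\<And>t. t \<in> {0..T} \<Longrightarrow> norm (Yb t) \<le> C"
    using bcont_off_bound[OF bcont_off_continuous[OF Yb]] by blast
  obtain P where P: "0 \<le> P" "\<And>t. t \<in> {0..T} \<Longrightarrow> norm (G (y0 t)) \<le> P"
    using bcont_off_bound[OF bcont_off_continuous[OF cGy]] by blast
  have cancel: "y * (x / y) = x" if "0 < y" for x y :: real using that by simp
  \<comment> \<open>The shadowing error may lower the first order term by
    \<open>\<epsilon> * (c / 4)\<close>, and \<open>e\<close> below allows the same loss for the
    Taylor remainder; half of the margin is left.\<close>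
  define \<kappa> where "\<kappa> = min 1 (c / 4 / (P + 1))"
  have k1: "0 < \<kappa>" "\<kappa> \<le> 1" using \<open>0 < c\<close> P(1) by (auto simp: \<kappa>_def)
  have k2: "P * \<kappa> \<le> c / 4"
  proof -
    have "P * \<kappa> \<le> (P + 1) * (c / 4 / (P + 1))"
      using P(1) k1 by (intro mult_mono) (auto simp: \<kappa>_def)
    also have "\<dots> = c / 4" using P(1) by (intro cancel) simp
    finally show ?thesis .
  qed
  define e where "e = c / 4 / (C + 1)"
  have e: "0 < e" "e * (C + 1) = c / 4" using \<open>0 < c\<close> C(1) cancel[of "C + 1" "c / 4"] by (simp_all only: e_def mult.commute[of _ "C + 1"]) simp_all
  have "\<exists>\<delta>>0. \<forall>x\<in>?K. \<forall>h. norm h \<le> \<delta> \<longrightarrow> x + h \<in> fst ` Q \<and>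
      norm (\<Phi> (x + h) - \<Phi> x - blinfun_inner_right (G x) h) \<le> e * norm h"
  proof (rule C1_uniform_remainder[OF cK oQ KQ])
    show "continuous_on (fst ` Q) (\<lambda>y. blinfun_inner_right (G y))"
      by (rule bounded_linear.continuous_on[OF bounded_linear_blinfun_inner_right cG])
  qed (use dPhi e in auto)
  then obtain \<delta> where \<delta>: "0 < \<delta>" "\<And>x h. x \<in> ?K \<Longrightarrow> norm h \<le> \<delta> \<Longrightarrow> \<bar>\<Phi> (x + h) - \<Phi> x - G x \<bullet> h\<bar> \<le> e * norm h"
    by auto
  \<comment> \<open>Where only the value of \<Phi> is at least \<open>c\<close>, the rate is at
    least \<open>- (P * C)\<close>, so the total loss stays below
    \<open>\<epsilon> * (P * C + c)\<close>, which the second bound keeps at most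
    \<open>c\<close>.\<close>
  define \<epsilon>3 where "\<epsilon>3 = min (\<delta> / (C + 1)) (c / (P * C + c))"
  have PC: "0 \<le> P * C" using P C by simp
  have "0 < \<epsilon>3" using \<delta>(1) C(1) \<open>0 < c\<close> PC by (simp add: \<epsilon>3_def add_nonneg_pos)
  have main: "0 \<le> \<Phi> (Y t)" if \<epsilon>: "0 < \<epsilon>" "\<epsilon> < \<epsilon>3" and Y: "\<forall>t\<in>{0..T}. norm (Y t - (y0 t + \<epsilon> *\<^sub>R Yb t)) \<le> \<kappa> * \<epsilon>"
    and t: "t \<in> {0..T}" for \<epsilon> Y t
  proof -
    define w where "w = Y t - (y0 t + \<epsilon> *\<^sub>R Yb t)"
    have nw: "norm w \<le> \<kappa> * \<epsilon>" using Y t by (simp add: w_def)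
    define h where "h = \<epsilon> *\<^sub>R Yb t + w"
    have Yt: "Y t = y0 t + h" by (simp add: h_def w_def)
    have "norm h \<le> \<epsilon> * C + \<kappa> * \<epsilon>"
    proof -
      have "norm h \<le> norm (\<epsilon> *\<^sub>R Yb t) + norm w" unfolding h_def by (rule norm_triangle_ineq)
      also have "\<dots> \<le> \<epsilon> * C + \<kappa> * \<epsilon>"
        using nw C(2)[OF t] \<epsilon>(1) unfolding norm_scaleR by (intro add_mono) (auto intro: mult_left_mono)
      finally show ?thesis .
    qed
    also have "\<dots> \<le> \<epsilon> * (C + 1)" using k1 \<epsilon>(1) by (simp add: algebra_simps)
    finally have nh: "norm h \<le> \<epsilon> * (C + 1)" .
    have "\<epsilon> < \<delta> / (C + 1)" using \<epsilon> by (simp add: \<epsilon>3_def)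
    then have "\<epsilon> * (C + 1) \<le> \<delta>" using C(1) by (simp add: pos_less_divide_eq)
    then have "norm h \<le> \<delta>" using nh by linarith
    then have "\<bar>\<Phi> (Y t) - \<Phi> (y0 t) - G (y0 t) \<bullet> h\<bar> \<le> e * norm h"
      unfolding Yt using t by (intro \<delta>(2)) auto
    also have "\<dots> \<le> e * (\<epsilon> * (C + 1))" using nh e(1) by (intro mult_left_mono) auto
    also have "\<dots> = \<epsilon> * (c / 4)" by (simp only: e(2)[symmetric] mult.left_commute)
    finally have 1: "\<Phi> (y0 t) + G (y0 t) \<bullet> h - \<epsilon> * (c / 4) \<le> \<Phi> (Y t)" by linarith
    have "\<bar>G (y0 t) \<bullet> w\<bar> \<le> P * (\<kappa> * \<epsilon>)"
      by (rule order_trans[OF Cauchy_Schwarz_ineq2 mult_mono[OF P(2)[OF t] nw]]) (use P in auto)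
    also have "\<dots> = \<epsilon> * (P * \<kappa>)" by simp
    also have "\<dots> \<le> \<epsilon> * (c / 4)" using k2 \<epsilon>(1) by (intro mult_left_mono) auto
    finally have "- (\<epsilon> * (c / 4)) \<le> G (y0 t) \<bullet> w" by linarith
    moreover have "G (y0 t) \<bullet> h = \<epsilon> * m t + G (y0 t) \<bullet> w" by (simp add: h_def m_def inner_add_right)
    ultimately have 2: "\<Phi> (y0 t) + \<epsilon> * m t - \<epsilon> * (c / 2) \<le> \<Phi> (Y t)" using 1 by simp
    have \<Phi>0: "0 \<le> \<Phi> (y0 t)" using Phi0[of t] t by (cases "t \<in> {t1..t2}") auto
    from c[OF t] show ?thesis
    proof
      assume "c \<le> m t"
      then have "\<epsilon> * c \<le> \<epsilon> * m t" using \<epsilon>(1) by simp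
      moreover have "0 < \<epsilon> * c" using \<epsilon>(1) \<open>0 < c\<close> by simp
      ultimately show ?thesis using 2 \<Phi>0 by simp
    next
      assume c0: "c \<le> \<Phi> (y0 t)"
      have "\<bar>m t\<bar> \<le> P * C" unfolding m_def
        by (rule order_trans[OF Cauchy_Schwarz_ineq2 mult_mono[OF P(2)[OF t] C(2)[OF t]]]) (use P in auto)
      then have "\<epsilon> * - (P * C) \<le> \<epsilon> * m t" using \<epsilon>(1) by (intro mult_left_mono) auto
      moreover have "\<epsilon> * (P * C + c) \<le> c"
      proof -
        have "\<epsilon> < c / (P * C + c)" using \<epsilon> by (simp add: \<epsilon>3_def)
        then show ?thesis using PC \<open>0 < c\<close> by (simp add: pos_less_divide_eq add_nonneg_pos)
      qed
      moreover have "0 < \<epsilon> * c" using \<epsilon>(1) \<open>0 < c\<close> by simp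
      ultimately show ?thesis using 2 c0 by (simp add: algebra_simps)
    qed
  qed
  show ?thesis using k1(1) \<open>0 < \<epsilon>3\<close> main by blast
qed

text \<open>The shadowing solution, read in the changed time, is compared with the reference at
  \<open>\<sigma> t\<close>: the jumps of the control move along with \<sigma>, so the controls stay
  uniformly close. Minimality then bounds the first variation from below by an arbitrarily small
  error.\<close>

lemma variation_inequality:
  assumes Yb: "solves S 0 T Yb (\<lambda>t. f' (y0 t, u t) (Yb t, Ub t) + vb t *\<^sub>R f (y0 t) (u t))"
    and Ub: "bcont_off S 0 T Ub" and vb: "bcont_off S 0 T vb" and iv: "integral {0..T} vb = 0"
    and pos: "\<And>t. t \<in> {t1..t2} \<Longrightarrow> 0 < G (y0 t) \<bullet> Yb t"
    and feas: "\<exists>\<epsilon>0>0. \<forall>\<epsilon>. 0 < \<epsilon> \<and> \<epsilon> < \<epsilon>0 \<longrightarrow> (\<forall>t\<in>{0..T} - S. \<forall>s. \<phi> (u t + \<epsilon> *\<^sub>R Ub t) $ s \<le> 0)"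
  shows "0 \<le> J0 \<bullet> Yb 0 + JT \<bullet> Yb T"
proof -
  define D where "D = J0 \<bullet> Yb 0 + JT \<bullet> Yb T"
  have finS: "finite S" by simp
  have Ybc: "continuous_on {0..T} Yb" using Yb by (simp add: solves_def)
  have T0: "0 \<in> {0..T}" "T \<in> {0..T}" using T_pos by auto
  obtain C where C: "0 \<le> C" "\<And>t. t \<in> {0..T} \<Longrightarrow> norm (Yb t) \<le> C"
    using bcont_off_bound[OF bcont_off_continuous[OF Ybc]] by blast
  obtain C' where C': "0 \<le> C'" "\<And>t. t \<in> {0..T} \<Longrightarrow> norm (Ub t) \<le> C'"
    using bcont_off_bound[OF Ub] by blast
  obtain V where V: "0 \<le> V" "\<And>t. t \<in> {0..T} \<Longrightarrow> norm (vb t) \<le> V"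
    using bcont_off_bound[OF vb] by blast
  obtain \<kappa>3 \<epsilon>3 where c3: "0 < \<kappa>3" "0 < \<epsilon>3" "\<forall>\<epsilon> Y. 0 < \<epsilon> \<and> \<epsilon> < \<epsilon>3 \<and>
    (\<forall>t\<in>{0..T}. norm (Y t - (y0 t + \<epsilon> *\<^sub>R Yb t)) \<le> \<kappa>3 * \<epsilon>) \<longrightarrow> (\<forall>t\<in>{0..T}. 0 \<le> \<Phi> (Y t))"
    using perturbed_state_constraint[OF Ybc pos] by blast
  obtain \<epsilon>0 where c0: "0 < \<epsilon>0" "\<And>\<epsilon> t s. 0 < \<epsilon> \<Longrightarrow> \<epsilon> < \<epsilon>0 \<Longrightarrow> t \<in> {0..T} - S \<Longrightarrow> \<phi> (u t + \<epsilon> *\<^sub>R Ub t) $ s \<le> 0"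
    using feas by blast
  obtain \<epsilon>m where cm: "0 < \<epsilon>m" "\<And>\<sigma> y w. (\<exists>L. L-lipschitz_on {0..T} \<sigma>) \<and> \<sigma> ` {0..T} = {0..T} \<and>
        (\<forall>t\<in>{0..T}. \<bar>\<sigma> t - t\<bar> < \<epsilon>m) \<and>
        (AE t in lebesgue_on {0..T}. \<exists>D. (\<sigma> has_real_derivative D) (at t) \<and> \<bar>D - 1\<bar> < \<epsilon>m) \<and>
        admissible T Q f \<phi> \<Phi> y w \<and>
        (\<forall>t\<in>{0..T}. norm (y t - y0 (\<sigma> t)) < \<epsilon>m) \<and>
        (AE t in lebesgue_on {0..T}. norm (w t - u0 (\<sigma> t)) < \<epsilon>m)
        \<Longrightarrow> J (y0 0) (y0 T) \<le> J (y 0) (y T)"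
    using minimal unfolding extended_weak_minimum_def by blast
  have cancel: "y * (x / y) = x" if "y \<noteq> 0" for x y :: real using that by simp
  have "0 \<le> D + \<kappa>0" if "0 < \<kappa>0" for \<kappa>0
  proof -
    \<comment> \<open>The bound \<open>\<kappa>3\<close> serves the state constraint. The last bound
      makes the shadowing error at \<open>T\<close> cost at most
      \<open>\<epsilon> * (\<kappa>0 / 2)\<close>; the initial value is exact. The other half of
      \<open>\<kappa>0\<close> goes to the remainder of \<open>J\<close>, through
      \<open>e\<close>.\<close>
    define \<kappa> where "\<kappa> = min (min \<kappa>3 1) (\<kappa>0 / 2 / (norm JT + 1))"
    have \<kappa>: "0 < \<kappa>" "\<kappa> \<le> \<kappa>3" "\<kappa> \<le> 1"
      using c3(1) \<open>0 < \<kappa>0\<close> by (simp_all add: \<kappa>_def add_nonneg_pos)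
    have "norm JT * \<kappa> \<le> (norm JT + 1) * (\<kappa>0 / 2 / (norm JT + 1))"
      using \<kappa> by (intro mult_mono) (simp_all add: \<kappa>_def)
    also have "\<dots> = \<kappa>0 / 2"
    proof -
      have "norm JT + 1 \<noteq> 0" using norm_ge_zero[of JT] by linarith
      then show ?thesis by (rule cancel)
    qed
    finally have \<kappa>J: "norm JT * \<kappa> \<le> \<kappa>0 / 2" .
    define e where "e = \<kappa>0 / 2 / (2 * C + 1)"
    have e: "0 < e" using \<open>0 < \<kappa>0\<close> C(1) by (simp add: e_def)
    have "(2 * C + 1) \<noteq> 0" using C(1) by simp
    then have eC: "e * (2 * C + 1) = \<kappa>0 / 2" unfolding e_def by (subst mult.commute) (rule cancel)
    obtain d where d: "0 < d" "\<And>z. norm (z - (y0 0, y0 T)) < d \<Longrightarrow>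
       norm ((case z of (a, b) \<Rightarrow> J a b) - J (y0 0) (y0 T) - (case z - (y0 0, y0 T) of (a, b) \<Rightarrow> J0 \<bullet> a + JT \<bullet> b))
        \<le> e * norm (z - (y0 0, y0 T))"
      using dJ e unfolding has_derivative_at_alt by auto
    obtain \<epsilon>2 where c2: "0 < \<epsilon>2" "\<And>\<epsilon>. 0 < \<epsilon> \<Longrightarrow> \<epsilon> < \<epsilon>2 \<Longrightarrow> \<exists>Y B.
        solves S 0 T Y (\<lambda>t. (1 + \<epsilon> * vb t) *\<^sub>R f (Y t) (u t + \<epsilon> *\<^sub>R Ub t)) \<and> 0 \<le> B \<and>
        (\<forall>t\<in>{0..T}. norm (Y t - (y0 t + \<epsilon> *\<^sub>R Yb t)) \<le> \<kappa> * \<epsilon> \<and> (Y t, u t + \<epsilon> *\<^sub>R Ub t) \<in> Q \<and>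
          norm ((1 + \<epsilon> * vb t) *\<^sub>R f (Y t) (u t + \<epsilon> *\<^sub>R Ub t)) \<le> B) \<and> Y 0 = y0 0 + \<epsilon> *\<^sub>R Yb 0"
      using perturbed_solution[OF Yb Ub vb \<kappa>(1)] by blast
    \<comment> \<open>Besides the earlier thresholds: the speed stays within 1/2 of 1; \<sigma>, its
      derivative, the state and the control stay within \<open>\<epsilon>m\<close>; the end points
      stay within the radius \<open>d\<close> for \<open>J\<close>.\<close>
    define bnd where "bnd = min (min (min \<epsilon>0 \<epsilon>2) (min \<epsilon>3 (1 / (2 * V + 1))))
       (min (min (\<epsilon>m / (V * T + 1)) (\<epsilon>m / (2 * V + 1))) (min (min (\<epsilon>m / (C + 1)) (\<epsilon>m / (C' + 1))) (d / (2 * C + 1))))"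
    have VT: "0 \<le> V * T" using V(1) T_pos by simp
    have "0 < bnd" using c0(1) c2(1) c3(2) cm(1) d(1) V(1) C(1) C'(1) VT by (simp add: bnd_def)
    then obtain \<epsilon> where \<epsilon>: "0 < \<epsilon>" "\<epsilon> < bnd" using dense by blast
    have "\<epsilon> < \<epsilon>0" "\<epsilon> < \<epsilon>2" "\<epsilon> < \<epsilon>3" using \<epsilon>(2) by (simp_all add: bnd_def)
    have q: "\<epsilon> < 1 / (2 * V + 1)" "\<epsilon> < \<epsilon>m / (V * T + 1)" "\<epsilon> < \<epsilon>m / (2 * V + 1)"
      "\<epsilon> < \<epsilon>m / (C + 1)" "\<epsilon> < \<epsilon>m / (C' + 1)" "\<epsilon> < d / (2 * C + 1)" using \<epsilon>(2) by (simp_all add: bnd_def)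
    have b1: "\<epsilon> * (2 * V + 1) < 1" using q(1) V(1) by (simp add: pos_less_divide_eq)
    have b2: "\<epsilon> * (V * T + 1) < \<epsilon>m" using q(2) VT by (simp add: pos_less_divide_eq)
    have b3: "\<epsilon> * (2 * V + 1) < \<epsilon>m" using q(3) V(1) by (simp add: pos_less_divide_eq)
    have b4: "\<epsilon> * (C + 1) < \<epsilon>m" using q(4) C(1) by (simp add: pos_less_divide_eq)
    have b5: "\<epsilon> * (C' + 1) < \<epsilon>m" using q(5) C'(1) by (simp add: pos_less_divide_eq)
    have b6: "\<epsilon> * (2 * C + 1) < d" using q(6) C(1) by (simp add: pos_less_divide_eq)
    obtain Y B where Y: "solves S 0 T Y (\<lambda>t. (1 + \<epsilon> * vb t) *\<^sub>R f (Y t) (u t + \<epsilon> *\<^sub>R Ub t))" and B: "0 \<le> B"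
      and YB: "\<And>t. t \<in> {0..T} \<Longrightarrow> norm (Y t - (y0 t + \<epsilon> *\<^sub>R Yb t)) \<le> \<kappa> * \<epsilon>"
        "\<And>t. t \<in> {0..T} \<Longrightarrow> (Y t, u t + \<epsilon> *\<^sub>R Ub t) \<in> Q"
        "\<And>t. t \<in> {0..T} \<Longrightarrow> norm ((1 + \<epsilon> * vb t) *\<^sub>R f (Y t) (u t + \<epsilon> *\<^sub>R Ub t)) \<le> B"
      and Y0: "Y 0 = y0 0 + \<epsilon> *\<^sub>R Yb 0"
      using c2(2)[OF \<epsilon>(1) \<open>\<epsilon> < \<epsilon>2\<close>] by blast
    have vc: "bcont_off S 0 T (\<lambda>t. 1 + \<epsilon> * vb t)" by (intro bcont_off_intros vb)
    have Uc: "bcont_off S 0 T (\<lambda>t. u t + \<epsilon> *\<^sub>R Ub t)" by (intro bcont_off_intros u(1) Ub)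
    have v1: "\<bar>1 + \<epsilon> * vb t - 1\<bar> \<le> \<epsilon> * V" if "t \<in> {0..T}" for t
      using V(2)[OF that] \<epsilon>(1) by (simp add: abs_mult mult_left_mono)
    have vint: "integral {0..T} (\<lambda>t. 1 + \<epsilon> * vb t) = T"
    proof -
      have "vb integrable_on {0..T}" by (rule bcont_off_integrable[OF finS vb])
      then have "((\<lambda>t. 1 + \<epsilon> * vb t) has_integral (T + \<epsilon> * 0)) {0..T}"
        using has_integral_const_real[of "1::real" 0 T] T_pos iv
        by (intro has_integral_add has_integral_mult_right) (auto simp: integrable_integral has_integral_iff)
      then show ?thesis by (simp add: integral_unique)
    qed
    have aV: "\<epsilon> * V \<le> 1 / 2" using b1 \<epsilon>(1) by (simp add: algebra_simps)
    obtain \<sigma> where \<sigma>: "2-lipschitz_on {0..T} \<sigma>" "\<sigma> ` {0..T} = {0..T}" "\<sigma> 0 = 0" "\<sigma> T = T"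
      "\<And>t. t \<in> {0..T} \<Longrightarrow> \<bar>\<sigma> t - t\<bar> \<le> \<epsilon> * V * T"
      "AE t in lebesgue_on {0..T}. \<exists>D. (\<sigma> has_real_derivative D) (at t) \<and> \<bar>D - 1\<bar> \<le> 2 * (\<epsilon> * V)"
      "is_process T Q f (\<lambda>t. Y (\<sigma> t)) (\<lambda>t. u (\<sigma> t) + \<epsilon> *\<^sub>R Ub (\<sigma> t))"
      "\<And>N. finite N \<Longrightarrow> AE t in lebesgue_on {0..T}. \<sigma> t \<in> {0..T} - N"
      using time_change_process[OF T_pos finS Y YB(3) B vc v1 aV vint Uc YB(2)] by blast
    have \<sigma>in: "\<sigma> t \<in> {0..T}" if "t \<in> {0..T}" for t using \<sigma>(2) that by blast
    have YQ: "0 \<le> \<Phi> (Y t)" if "t \<in> {0..T}" for t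
    proof -
      have "\<forall>t\<in>{0..T}. norm (Y t - (y0 t + \<epsilon> *\<^sub>R Yb t)) \<le> \<kappa>3 * \<epsilon>"
        using YB(1) \<kappa>(2) \<epsilon>(1) by (meson mult_right_mono order_trans less_imp_le)
      then show ?thesis using c3(3) \<epsilon>(1) \<open>\<epsilon> < \<epsilon>3\<close> that by blast
    qed
    have close: "norm (Y t - y0 t) < \<epsilon>m" if t: "t \<in> {0..T}" for t
    proof -
      have "Y t - y0 t = (Y t - (y0 t + \<epsilon> *\<^sub>R Yb t)) + \<epsilon> *\<^sub>R Yb t" by simp
      then have "norm (Y t - y0 t) \<le> norm (Y t - (y0 t + \<epsilon> *\<^sub>R Yb t)) + norm (\<epsilon> *\<^sub>R Yb t)"
        by (metis norm_triangle_ineq)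
      also have "\<dots> \<le> \<kappa> * \<epsilon> + \<epsilon> * C"
        using YB(1)[OF t] C(2)[OF t] \<epsilon>(1) by (intro add_mono) (simp_all add: mult_left_mono)
      also have "\<dots> \<le> \<epsilon> * (C + 1)" using \<kappa>(3) \<epsilon>(1) by (simp add: algebra_simps)
      finally show ?thesis using b4 by linarith
    qed
    have adm: "admissible T Q f \<phi> \<Phi> (\<lambda>t. Y (\<sigma> t)) (\<lambda>t. u (\<sigma> t) + \<epsilon> *\<^sub>R Ub (\<sigma> t))"
      unfolding admissible_def
    proof (intro conjI ballI)
      show "AE t in lebesgue_on {0..T}. \<forall>s. \<phi> (u (\<sigma> t) + \<epsilon> *\<^sub>R Ub (\<sigma> t)) $ s \<le> 0"
        using \<sigma>(8)[OF finS] by eventually_elim (use c0(2)[OF \<epsilon>(1) \<open>\<epsilon> < \<epsilon>0\<close>] in blast)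
    qed (use \<sigma>(7) YQ \<sigma>in in auto)
    have "J (y0 0) (y0 T) \<le> J (Y (\<sigma> 0)) (Y (\<sigma> T))"
    proof (rule cm(2), intro conjI)
      show "\<forall>t\<in>{0..T}. \<bar>\<sigma> t - t\<bar> < \<epsilon>m"
      proof
        fix t assume "t \<in> {0..T}"
        then have "\<bar>\<sigma> t - t\<bar> \<le> \<epsilon> * (V * T)" using \<sigma>(5) by (simp add: mult.assoc)
        also have "\<dots> < \<epsilon>m" using b2 \<epsilon>(1) by (simp add: algebra_simps)
        finally show "\<bar>\<sigma> t - t\<bar> < \<epsilon>m" .
      qed
      have "2 * (\<epsilon> * V) < \<epsilon>m" using b3 \<epsilon>(1) by (simp add: algebra_simps)
      then show "AE t in lebesgue_on {0..T}. \<exists>D. (\<sigma> has_real_derivative D) (at t) \<and> \<bar>D - 1\<bar> < \<epsilon>m"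
        using \<sigma>(6) by (auto elim!: eventually_mono intro: le_less_trans)
      show "\<forall>t\<in>{0..T}. norm (Y (\<sigma> t) - y0 (\<sigma> t)) < \<epsilon>m" using close \<sigma>in by blast
      show "AE t in lebesgue_on {0..T}. norm (u (\<sigma> t) + \<epsilon> *\<^sub>R Ub (\<sigma> t) - u0 (\<sigma> t)) < \<epsilon>m"
        using \<sigma>(8)[OF finS]
      proof eventually_elim
        case (elim t)
        have "norm (u (\<sigma> t) + \<epsilon> *\<^sub>R Ub (\<sigma> t) - u0 (\<sigma> t)) = \<epsilon> * norm (Ub (\<sigma> t))"
          using u(2)[OF elim] \<epsilon>(1) by simp
        also have "\<dots> \<le> \<epsilon> * C'" using C'(2)[of "\<sigma> t"] elim \<epsilon>(1) by (intro mult_left_mono) auto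
        also have "\<dots> < \<epsilon>m" using b5 \<epsilon>(1) by (simp add: algebra_simps)
        finally show ?case .
      qed
    qed (use \<sigma>(1,2) adm in auto)
    then have Jle: "J (y0 0) (y0 T) \<le> J (Y 0) (Y T)" using \<sigma>(3,4) by simp
    define w where "w = Y T - (y0 T + \<epsilon> *\<^sub>R Yb T)"
    have nw: "norm w \<le> \<kappa> * \<epsilon>" using YB(1)[OF T0(2)] by (simp add: w_def)
    have YT: "Y T = y0 T + (\<epsilon> *\<^sub>R Yb T + w)" by (simp add: w_def)
    let ?h = "(\<epsilon> *\<^sub>R Yb 0, \<epsilon> *\<^sub>R Yb T + w)"
    have hz: "(Y 0, Y T) - (y0 0, y0 T) = ?h" using Y0 YT by simp
    have nh: "norm ?h \<le> \<epsilon> * (2 * C + 1)"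
    proof -
      have "norm ?h \<le> norm (\<epsilon> *\<^sub>R Yb 0) + norm (\<epsilon> *\<^sub>R Yb T + w)" by (rule norm_Pair_le)
      also have "\<dots> \<le> norm (\<epsilon> *\<^sub>R Yb 0) + (norm (\<epsilon> *\<^sub>R Yb T) + norm w)"
        by (intro add_left_mono norm_triangle_ineq)
      also have "\<dots> \<le> \<epsilon> * C + (\<epsilon> * C + \<kappa> * \<epsilon>)"
        using C(2)[OF T0(1)] C(2)[OF T0(2)] nw \<epsilon>(1) by (intro add_mono) (simp_all add: mult_left_mono)
      also have "\<dots> \<le> \<epsilon> * (2 * C + 1)" using \<kappa>(3) \<epsilon>(1) by (simp add: algebra_simps)
      finally show ?thesis .
    qed
    then have "norm ((Y 0, Y T) - (y0 0, y0 T)) < d" unfolding hz using b6 by linarith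
    from d(2)[OF this]
    have "\<bar>J (Y 0) (Y T) - J (y0 0) (y0 T) - (J0 \<bullet> \<epsilon> *\<^sub>R Yb 0 + JT \<bullet> (\<epsilon> *\<^sub>R Yb T + w))\<bar> \<le> e * norm ?h"
      unfolding hz by simp
    also have "\<dots> \<le> e * (\<epsilon> * (2 * C + 1))" using nh e by (intro mult_left_mono) auto
    also have "\<dots> = \<epsilon> * (\<kappa>0 / 2)" by (simp only: eC[symmetric] mult.left_commute)
    finally have "0 \<le> J0 \<bullet> \<epsilon> *\<^sub>R Yb 0 + JT \<bullet> (\<epsilon> *\<^sub>R Yb T + w) + \<epsilon> * (\<kappa>0 / 2)" using Jle by linarith
    also have "J0 \<bullet> \<epsilon> *\<^sub>R Yb 0 + JT \<bullet> (\<epsilon> *\<^sub>R Yb T + w) = \<epsilon> * D + JT \<bullet> w"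
      by (simp add: D_def inner_add_right algebra_simps)
    finally have "0 \<le> \<epsilon> * D + JT \<bullet> w + \<epsilon> * (\<kappa>0 / 2)" .
    moreover have "JT \<bullet> w \<le> \<epsilon> * (\<kappa>0 / 2)"
    proof -
      have "JT \<bullet> w \<le> norm JT * norm w" by (rule norm_cauchy_schwarz)
      also have "\<dots> \<le> norm JT * (\<kappa> * \<epsilon>)" using nw by (intro mult_left_mono) auto
      also have "\<dots> = \<epsilon> * (norm JT * \<kappa>)" by simp
      also have "\<dots> \<le> \<epsilon> * (\<kappa>0 / 2)" using \<kappa>J \<epsilon>(1) by (intro mult_left_mono) auto
      finally show ?thesis .
    qed
    ultimately have "0 \<le> \<epsilon> * (D + \<kappa>0)" by (simp add: algebra_simps)
    then show ?thesis using \<epsilon>(1) by (simp add: zero_le_mult_iff)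
  qed
  then have "0 \<le> D" by (rule field_le_epsilon)
  then show ?thesis by (simp add: D_def)
qed

end

section \<open>The linear variational inequality and its multipliers\<close>

lemma bcont_off_linear:
  assumes "bounded_linear h" "bcont_off S a b g"
  shows "bcont_off S a b (\<lambda>t. h (g t))"
proof -
  have "bounded (h ` g ` {a..b})"
    by (rule bounded_linear_image[OF _ assms(1)]) (use assms(2) in \<open>simp add: bcont_off_def\<close>)
  then show ?thesis
    using assms unfolding bcont_off_def
    by (auto simp: image_image intro: bounded_linear.continuous_on)
qed

text \<open>Around a point off the finite set \<open>S\<close> the function is continuous on a small
  interval, over which its integral must vanish too.\<close>

lemma bcont_off_nonneg_integral_zero:
  fixes g :: "real \<Rightarrow> real"
  assumes S: "finite S" and g: "bcont_off S a b g" and "a < b"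
    and nonneg: "\<And>t. t \<in> {a..b} \<Longrightarrow> 0 \<le> g t" and le: "integral {a..b} g \<le> 0" and t: "t \<in> {a..b} - S"
  shows "g t = 0"
proof -
  have "open (- S)" using S by (simp add: finite_imp_closed open_Compl)
  then obtain \<rho> where \<rho>: "0 < \<rho>" "ball t \<rho> \<subseteq> - S" using t unfolding open_contains_ball by blast
  define c where "c = max a (t - \<rho> / 2)"
  define d where "d = min b (t + \<rho> / 2)"
  have cd: "c < d" "t \<in> {c..d}" "{c..d} \<subseteq> {a..b}" using t \<rho>(1) \<open>a < b\<close> by (auto simp: c_def d_def)
  have "{c..d} \<subseteq> ball t \<rho>" using \<rho>(1) by (auto simp: c_def d_def dist_real_def)
  then have sub: "{c..d} \<subseteq> {a..b} - S" using cd(3) \<rho>(2) by blast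
  have cont: "continuous_on {c..d} g" using g sub by (auto simp: bcont_off_def elim: continuous_on_subset)
  have "integral {c..d} g \<le> integral {a..b} g"
    by (rule integral_subset_le[OF cd(3) integrable_continuous_real[OF cont] bcont_off_integrable[OF S g]])
      (use nonneg in auto)
  moreover have "0 \<le> integral {c..d} g"
    by (rule integral_nonneg[OF integrable_continuous_real[OF cont]]) (use nonneg cd in auto)
  ultimately have "integral {c..d} g = 0" using le by linarith
  moreover have "0 \<le> g x" if "x \<in> {c..d}" for x using nonneg cd(3) that by blast
  ultimately have "\<forall>x\<in>{c..d}. g x = 0" using integral_eq_0_iff[OF cont cd(1)] by simp
  then show ?thesis using cd(2) by blast
qed

lemma bump_exists:
  fixes s \<rho> :: real
  assumes "0 < \<rho>" "a \<le> s - \<rho>" "s + \<rho> \<le> b"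
  shows "\<exists>\<beta> :: real \<Rightarrow> real. continuous_on UNIV \<beta> \<and> (\<forall>t. 0 \<le> \<beta> t) \<and> (\<forall>t. \<rho> \<le> \<bar>t - s\<bar> \<longrightarrow> \<beta> t = 0) \<and>
    integral {a..b} \<beta> = 1"
proof -
  define \<gamma> where "\<gamma> t = max 0 (\<rho> - \<bar>t - s\<bar>)" for t
  have c: "continuous_on A \<gamma>" for A unfolding \<gamma>_def by (intro continuous_intros)
  have nn: "0 \<le> \<gamma> t" for t by (simp add: \<gamma>_def)
  have "a < b" using assms by linarith
  have "integral {a..b} \<gamma> \<noteq> 0"
  proof
    assume "integral {a..b} \<gamma> = 0"
    then have "\<forall>t\<in>{a..b}. \<gamma> t = 0" using integral_eq_0_iff[OF c \<open>a < b\<close>] nn by simp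
    then have "\<gamma> s = 0" using assms by simp
    then show False using \<open>0 < \<rho>\<close> by (simp add: \<gamma>_def)
  qed
  moreover have "0 \<le> integral {a..b} \<gamma>" by (intro integral_nonneg integrable_continuous_real c nn)
  ultimately have pos: "0 < integral {a..b} \<gamma>" by linarith
  show ?thesis
  proof (intro exI[of _ "\<lambda>t. inverse (integral {a..b} \<gamma>) * \<gamma> t"] conjI)
    show "continuous_on UNIV (\<lambda>t. inverse (integral {a..b} \<gamma>) * \<gamma> t)" by (intro continuous_on_mult continuous_on_const c)
    show "integral {a..b} (\<lambda>t. inverse (integral {a..b} \<gamma>) * \<gamma> t) = 1" using pos by simp
  qed (use nn pos in \<open>auto simp: \<gamma>_def\<close>)
qed

text \<open>An approximate identity: it recovers the value of a function at a continuity point,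
  turning integral inequalities for test variations into pointwise ones.\<close>

lemma bump_average:
  fixes g :: "real \<Rightarrow> real"
  assumes S: "finite S" and g: "bcont_off S a b g" and s: "s \<in> {a<..<b} - S" and "0 < e" "0 < r"
  shows "\<exists>\<beta> :: real \<Rightarrow> real. continuous_on UNIV \<beta> \<and> (\<forall>t. 0 \<le> \<beta> t) \<and> (\<forall>t. r \<le> \<bar>t - s\<bar> \<longrightarrow> \<beta> t = 0) \<and>
    integral {a..b} \<beta> = 1 \<and> \<bar>integral {a..b} (\<lambda>t. g t * \<beta> t) - g s\<bar> \<le> e"
proof -
  have op: "open ({a<..<b} - S)" using S by (auto intro: finite_imp_closed)
  have "continuous (at s) g"
    using continuous_on_subset[of "{a..b} - S" g "{a<..<b} - S"] g s op
    by (auto simp: bcont_off_def continuous_on_eq_continuous_at subset_iff)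
  then obtain d where d: "0 < d" "\<And>t. dist t s < d \<Longrightarrow> dist (g t) (g s) < e"
    using \<open>0 < e\<close> unfolding continuous_at_eps_delta by blast
  define \<rho> where "\<rho> = min (min (s - a) (b - s)) (min r d)"
  have \<rho>: "0 < \<rho>" "a \<le> s - \<rho>" "s + \<rho> \<le> b" "\<rho> \<le> r" "\<rho> \<le> d" using s d \<open>0 < r\<close> by (auto simp: \<rho>_def)
  obtain \<beta> :: "real \<Rightarrow> real" where \<beta>: "continuous_on UNIV \<beta>" "\<And>t. 0 \<le> \<beta> t" "\<And>t. \<rho> \<le> \<bar>t - s\<bar> \<Longrightarrow> \<beta> t = 0" "integral {a..b} \<beta> = 1"
    using bump_exists[OF \<rho>(1-3)] by blast
  have cb: "continuous_on {a..b} \<beta>" using \<beta>(1) by (rule continuous_on_subset) simp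
  have i1: "(\<lambda>t. g t * \<beta> t) integrable_on {a..b}"
    by (intro bcont_off_integrable[OF S] bcont_off_intros g bcont_off_continuous cb)
  have i2: "\<beta> integrable_on {a..b}" by (rule integrable_continuous_real[OF cb])
  have i3: "(\<lambda>t. c * \<beta> t) integrable_on {a..b}" for c using integrable_cmul[OF i2, of c] by simp
  have "norm (integral {a..b} (\<lambda>t. g t * \<beta> t - g s * \<beta> t)) \<le> integral {a..b} (\<lambda>t. e * \<beta> t)"
  proof (rule integral_norm_bound_integral)
    fix t
    show "norm (g t * \<beta> t - g s * \<beta> t) \<le> e * \<beta> t"
    proof (cases "\<rho> \<le> \<bar>t - s\<bar>")
      case False
      then have "\<bar>g t - g s\<bar> \<le> e" using d(2)[of t] \<rho>(5) by (auto simp: dist_real_def)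
      then have "\<bar>g t - g s\<bar> * \<beta> t \<le> e * \<beta> t" using \<beta>(2) by (rule mult_right_mono)
      then show ?thesis using \<beta>(2)[of t] by (simp add: left_diff_distrib[symmetric] abs_mult)
    qed (use \<beta>(3) in simp)
  qed (use i1 i3 in \<open>auto intro!: integrable_diff\<close>)
  moreover have "integral {a..b} (\<lambda>t. g t * \<beta> t - g s * \<beta> t) = integral {a..b} (\<lambda>t. g t * \<beta> t) - g s"
    using \<beta>(4) by (simp add: Henstock_Kurzweil_Integration.integral_diff[OF i1 i3])
  ultimately have "\<bar>integral {a..b} (\<lambda>t. g t * \<beta> t) - g s\<bar> \<le> e" using \<beta>(4) by simp
  with \<beta> \<rho>(4) show ?thesis by (intro exI[of _ \<beta>] conjI) auto
qed

section \<open>Rank one matrices and the calculus of solutions\<close>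

definition outer_product :: "real^'m \<Rightarrow> real^'n \<Rightarrow> real^'n^'m" where
  "outer_product a b = (\<chi> i j. a $ i * b $ j)"

lemma outer_product_mult_vector: "outer_product a b *v x = (b \<bullet> x) *\<^sub>R a"
  by (simp add: vec_eq_iff outer_product_def matrix_vector_mult_def inner_vec_def sum_distrib_left algebra_simps)

lemma vector_mult_outer_product: "x v* outer_product a b = (x \<bullet> a) *\<^sub>R b"
  by (simp add: vec_eq_iff outer_product_def vector_matrix_mult_def inner_vec_def sum_distrib_left sum_distrib_right algebra_simps)

lemma bounded_bilinear_outer_product: "bounded_bilinear (outer_product :: real^'m \<Rightarrow> real^'n \<Rightarrow> real^'n^'m)"
  unfolding bilinear_conv_bounded_bilinear[symmetric] bilinear_def
  by (auto intro!: linearI simp: vec_eq_iff outer_product_def algebra_simps)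

lemma solves_inner:
  fixes x y :: "real \<Rightarrow> 'a::real_inner"
  assumes "solves S a b x g" "solves S a b y h"
  shows "solves S a b (\<lambda>t. x t \<bullet> y t) (\<lambda>t. x t \<bullet> h t + g t \<bullet> y t)"
  using assms unfolding solves_def
  by (auto intro!: continuous_on_inner bounded_bilinear.has_vector_derivative[OF bounded_bilinear_inner])

lemma solves_cong:
  "solves S a b x g \<Longrightarrow> (\<And>t. t \<in> {a<..<b} - S \<Longrightarrow> g t = h t) \<Longrightarrow> solves S a b x h"
  unfolding solves_def by simp

lemma solves_subinterval:
  "solves S a b x g \<Longrightarrow> a \<le> c \<Longrightarrow> d \<le> b \<Longrightarrow> solves S c d x g"
  unfolding solves_def by (auto elim: continuous_on_subset)

lemma solves_const: "solves S a b (\<lambda>_. c) (\<lambda>_. 0)"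
  unfolding solves_def by (auto intro: has_vector_derivative_const)

lemma solves_add:
  "solves S a b x g \<Longrightarrow> solves S a b y h \<Longrightarrow> solves S a b (\<lambda>t. x t + y t) (\<lambda>t. g t + h t)"
  unfolding solves_def by (auto intro!: continuous_on_add has_vector_derivative_add)

lemma solves_diff:
  "solves S a b x g \<Longrightarrow> solves S a b y h \<Longrightarrow> solves S a b (\<lambda>t. x t - y t) (\<lambda>t. g t - h t)"
  unfolding solves_def by (auto intro!: continuous_on_diff has_vector_derivative_diff)

lemma solves_scaleR:
  "solves S a b x g \<Longrightarrow> solves S a b (\<lambda>t. (k::real) *\<^sub>R x t) (\<lambda>t. k *\<^sub>R g t)"
  unfolding solves_def
  by (auto intro!: continuous_intros bounded_linear.has_vector_derivative[OF bounded_linear_scaleR_right])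

lemma solves_zero_derivative:
  fixes x :: "real \<Rightarrow> 'a::banach"
  assumes "finite S" "solves S a b x (\<lambda>_. 0)" "s \<in> {a..b}" "t \<in> {a..b}"
  shows "x t = x s"
proof -
  have *: "x v = x w" if "a \<le> w" "w \<le> v" "v \<le> b" for v w
    using has_integral_unique[OF solves_has_integral[OF assms(1,2) that] has_integral_0] by simp
  show ?thesis using *[of s t] *[of t s] assms by (cases "s \<le> t") auto
qed

lemma adjoint_ode:
  fixes M :: "real \<Rightarrow> real^'m^'m::finite"
  assumes S: "finite S" and "a \<le> b" and M: "bcont_off S a b M"
  shows "\<exists>x. x b = \<xi> \<and> solves S a b x (\<lambda>t. - (x t v* M t))"
    and "\<exists>x. x a = \<xi> \<and> solves S a b x (\<lambda>t. - (x t v* M t))"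
proof -
  have lin: "bounded_linear (\<lambda>X::real^'m^'m. - transpose X)"
    unfolding linear_conv_bounded_linear[symmetric]
    by (auto intro!: linearI simp: vec_eq_iff transpose_def)
  have M': "bcont_off S a b (\<lambda>t. - transpose (M t))" by (rule bcont_off_linear[OF lin M])
  have eq: "(- transpose X) *v x + 0 = - (x v* X)" for X :: "real^'m^'m" and x
    by (simp add: bounded_bilinear.minus_left[OF bounded_bilinear_matrix_vector_mult])
  show "\<exists>x. x b = \<xi> \<and> solves S a b x (\<lambda>t. - (x t v* M t))"
    using linear_ode_backward[OF S \<open>a \<le> b\<close> M' bcont_off_continuous[OF continuous_on_const], of \<xi> 0]
    unfolding eq .
  show "\<exists>x. x a = \<xi> \<and> solves S a b x (\<lambda>t. - (x t v* M t))"
    using linear_ode_forward[OF S \<open>a \<le> b\<close> M' bcont_off_continuous[OF continuous_on_const], of \<xi> 0]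
    unfolding eq .
qed

text \<open>Here \<open>p\<close> stands for \<open>\<Phi>'(y0)\<close> and \<open>e\<close> for the velocity \<open>f(y0, u0)\<close>; \<open>ok\<close> holds for the control
  variations feasible for small positive multiples, and \<open>strict \<tau>\<close> for the directions along which all
  constraints active at \<open>\<tau>\<close> decrease to first order.\<close>

locale linear_variation =
  fixes T t1 t2 :: real
    and A :: "real \<Rightarrow> real^'m^'m::finite" and B :: "real \<Rightarrow> real^'k::finite^'m"
    and e p q :: "real \<Rightarrow> real^'m" and J0 JT :: "real^'m" and c0 :: real
    and ok :: "(real \<Rightarrow> real^'k) \<Rightarrow> bool" and strict :: "real \<Rightarrow> real^'k \<Rightarrow> bool"
  assumes times: "0 < t1" "t1 < t2" "t2 < T"
    and A: "bcont_off {t1, t2} 0 T A" and B: "bcont_off {t1, t2} 0 T B"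
    and e: "bcont_off {t1, t2} 0 T e" and q: "bcont_off {t1, t2} 0 T q"
    and p: "solves {t1, t2} 0 T p q"
    and pe: "\<And>t. t \<in> {t1<..<t2} \<Longrightarrow> p t \<bullet> e t = 0"
    and p1: "p t1 \<noteq> 0"
    and c0: "0 < c0" "\<And>t. t \<in> {t1..<t2} \<Longrightarrow> c0 \<le> norm (p t v* B t)"
    and Blip: "\<exists>L. L-lipschitz_on {t1..<t2} B"
    and variation: "\<And>Yb Ub vb.
      solves {t1, t2} 0 T Yb (\<lambda>t. A t *v Yb t + B t *v Ub t + vb t *\<^sub>R e t) \<Longrightarrow>
      bcont_off {t1, t2} 0 T Ub \<Longrightarrow> bcont_off {t1, t2} 0 T vb \<Longrightarrow> integral {0..T} vb = 0 \<Longrightarrow>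
      (\<And>t. t \<in> {t1..t2} \<Longrightarrow> 0 < p t \<bullet> Yb t) \<Longrightarrow> ok Ub \<Longrightarrow> 0 \<le> J0 \<bullet> Yb 0 + JT \<bullet> Yb T"
    and ok_zero: "ok (\<lambda>_. 0)"
    and ok_modify: "\<And>W W'. ok W \<Longrightarrow> bcont_off {t1, t2} 0 T W' \<Longrightarrow>
      (\<And>t. t \<in> {0..T} - {t1..t2} \<Longrightarrow> W' t = W t) \<Longrightarrow> ok W'"
    and ok_bump: "\<And>\<tau> w. \<tau> \<in> {0<..<t1} \<union> {t2<..<T} \<Longrightarrow> strict \<tau> w \<Longrightarrow>
      \<exists>\<rho>>0. \<forall>\<beta>. continuous_on UNIV \<beta> \<and> (\<forall>t. 0 \<le> \<beta> t) \<and> (\<forall>t. \<rho> \<le> \<bar>t - \<tau>\<bar> \<longrightarrow> \<beta> t = 0) \<longrightarrow>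
        ok (\<lambda>t. \<beta> t *\<^sub>R w)"
begin

abbreviation "S \<equiv> {t1, t2}"

lemma finS: "finite S" by simp

lemma T_pos: "0 < T" using times by simp

text \<open>On the boundary arc \<open>gi\<close> is a right inverse of \<open>g\<close>; the maximum is \<open>g \<bullet> g\<close> there and only guards the
  value at \<open>t2\<close>.\<close>

definition "g t = p t v* B t"
definition "gi t = (if t1 \<le> t \<and> t \<le> t2 then inverse (max (c0\<^sup>2) (g t \<bullet> g t)) *\<^sub>R g t else 0)"
text \<open>Along the linearised system the derivative of \<open>p \<bullet> Yb\<close> is
  \<open>r \<bullet> Yb + g \<bullet> Ub + vb * (p \<bullet> e)\<close>, so \<open>r\<close> is its
  rate without control or dilation.\<close>

definition "r t = q t + p t v* A t"
text \<open>The closed loop matrix: the feedback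
  \<open>- (r t \<bullet> Yb t) *\<^sub>R gi t\<close> cancels the rate \<open>r\<close> on the arc.
  Outside the arc \<open>gi\<close> is 0 and \<open>M\<close> is \<open>A\<close>.\<close>

definition "M t = A t - outer_product (B t *v gi t) (r t)"

lemma p_continuous: "continuous_on {0..T} p" using p by (simp add: solves_def)

lemma g_bcont: "bcont_off S 0 T g"
  unfolding g_def by (intro bcont_off_intros B bcont_off_continuous p_continuous)

lemma r_bcont: "bcont_off S 0 T r"
  unfolding r_def by (intro bcont_off_intros A q bcont_off_continuous p_continuous)

lemma g_pos: "t \<in> {t1..<t2} \<Longrightarrow> 0 < g t \<bullet> g t \<and> max (c0\<^sup>2) (g t \<bullet> g t) = g t \<bullet> g t"
proof -
  assume "t \<in> {t1..<t2}"
  then have "c0 \<le> norm (g t)" using c0 by (simp add: g_def)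
  then have "c0\<^sup>2 \<le> (norm (g t))\<^sup>2" using c0(1) by (intro power_mono) auto
  then have "c0\<^sup>2 \<le> g t \<bullet> g t" by (simp add: power2_norm_eq_inner)
  moreover have "0 < c0\<^sup>2" using c0(1) by simp
  ultimately show ?thesis by auto
qed

lemma gi_bcont: "bcont_off S 0 T gi"
  unfolding gi_def
proof (rule bcont_off_if)
  have gb: "bcont_off S t1 t2 g" by (rule bcont_off_subinterval[OF g_bcont]) (use times in auto)
  obtain C where C: "\<And>t. t \<in> {t1..t2} \<Longrightarrow> norm (g t) \<le> C" using bcont_off_bound[OF gb] by blast
  show "bcont_off S t1 t2 (\<lambda>t. inverse (max (c0\<^sup>2) (g t \<bullet> g t)) *\<^sub>R g t)"
  proof (rule bcont_off_compose[OF gb, of "cball 0 C" "\<lambda>x. inverse (max (c0\<^sup>2) (x \<bullet> x)) *\<^sub>R x"])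
    have "0 < max (c0\<^sup>2) (x \<bullet> x)" for x :: "real^'k" using c0(1) by (simp add: less_max_iff_disj)
    then have "max (c0\<^sup>2) (x \<bullet> x) \<noteq> 0" for x :: "real^'k" by (metis less_irrefl)
    then show "continuous_on (cball 0 C) (\<lambda>x::real^'k. inverse (max (c0\<^sup>2) (x \<bullet> x)) *\<^sub>R x)"
      by (intro continuous_intros continuous_on_max) auto
  qed (use C in auto)
qed (use times in auto)

lemma M_bcont: "bcont_off S 0 T M"
  unfolding M_def
  by (intro bcont_off_diff bcont_off_bilinear[OF bounded_bilinear_outer_product] bcont_off_intros A B gi_bcont r_bcont)

lemma gi_outside: "t \<notin> {t1..t2} \<Longrightarrow> gi t = 0" by (auto simp: gi_def)

lemma g_gi: "t \<in> {t1<..<t2} \<Longrightarrow> g t \<bullet> gi t = 1" "t \<in> {t1<..<t2} \<Longrightarrow> gi t = inverse (g t \<bullet> g t) *\<^sub>R g t"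
  using g_pos[of t] by (auto simp: gi_def)

text \<open>Adjoint solution of the closed loop system with the terminal transversality condition.
  On the arc it will turn out to be \<open>\<psi> + \<mu> p\<close> rather than the costate.\<close>

definition "\<psi>h = (SOME x. x T = - JT \<and> solves S 0 T x (\<lambda>t. - (x t v* M t)))"
text \<open>Repairs the initial condition, since \<open>\<psi>h + \<xi>\<close> equals
  \<open>J0\<close> at 0. It enters only up to \<open>t1\<close>, and before \<open>t1\<close> both
  functions obey the same equation because there \<open>M\<close> is \<open>A\<close>.\<close>

definition "\<xi> = (SOME x. x 0 = J0 - \<psi>h 0 \<and> solves S 0 T x (\<lambda>t. - (x t v* A t)))"

lemma \<psi>h: "\<psi>h T = - JT" "solves S 0 T \<psi>h (\<lambda>t. - (\<psi>h t v* M t))"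
proof -
  have "\<exists>x. x T = - JT \<and> solves S 0 T x (\<lambda>t. - (x t v* M t))"
    by (rule adjoint_ode(1)[OF finS less_imp_le[OF T_pos] M_bcont])
  then have "\<psi>h T = - JT \<and> solves S 0 T \<psi>h (\<lambda>t. - (\<psi>h t v* M t))"
    unfolding \<psi>h_def by (rule someI_ex)
  then show "\<psi>h T = - JT" "solves S 0 T \<psi>h (\<lambda>t. - (\<psi>h t v* M t))" by auto
qed

lemma \<xi>: "\<xi> 0 = J0 - \<psi>h 0" "solves S 0 T \<xi> (\<lambda>t. - (\<xi> t v* A t))"
proof -
  have "\<exists>x. x 0 = J0 - \<psi>h 0 \<and> solves S 0 T x (\<lambda>t. - (x t v* A t))"
    by (rule adjoint_ode(2)[OF finS less_imp_le[OF T_pos] A])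
  then have "\<xi> 0 = J0 - \<psi>h 0 \<and> solves S 0 T \<xi> (\<lambda>t. - (\<xi> t v* A t))"
    unfolding \<xi>_def by (rule someI_ex)
  then show "\<xi> 0 = J0 - \<psi>h 0" "solves S 0 T \<xi> (\<lambda>t. - (\<xi> t v* A t))" by auto
qed

text \<open>Off the boundary arc and the switching times this is the costate, on the arc
  \<open>\<psi> + \<mu> p\<close>.\<close>

definition "\<psi>1 t = \<psi>h t + (if 0 \<le> t \<and> t \<le> t1 then \<xi> t else 0)"
text \<open>On the arc \<open>g \<bullet> gi = 1\<close>, so this is the number for which
  \<open>(\<psi>h t - m t *\<^sub>R p t) v* B t\<close> annihilates \<open>gi t\<close>. There it is
  \<mu> itself, not its derivative.\<close>

definition "m t = \<psi>h t \<bullet> (B t *v gi t)"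

lemma \<psi>h_continuous: "continuous_on {0..T} \<psi>h" using \<psi>h by (simp add: solves_def)
lemma \<xi>_continuous: "continuous_on {0..T} \<xi>" using \<xi> by (simp add: solves_def)

lemma \<xi>if_bcont: "bcont_off S 0 T (\<lambda>t. if 0 \<le> t \<and> t \<le> t1 then \<xi> t else 0)"
proof -
  \<comment> \<open>\<open>bcont_off_if\<close> wants the left end point to be exceptional, and 0 is
    not in \<open>S\<close>; so only boundedness is taken from it and continuity is proved
    separately.\<close>
  have "bcont_off (insert 0 S) 0 T (\<lambda>t. if 0 \<le> t \<and> t \<le> t1 then \<xi> t else 0)"
    by (rule bcont_off_if[OF bcont_off_subinterval[OF bcont_off_continuous[OF \<xi>_continuous]]]) (use times in auto)
  then have b: "bounded ((\<lambda>t. if 0 \<le> t \<and> t \<le> t1 then \<xi> t else 0) ` {0..T})" by (simp add: bcont_off_def)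
  have "continuous_on ({0..T} - S) (\<lambda>t. if t \<in> {..t1} then \<xi> t else 0)"
  proof -
    have "continuous_on (({0..T} - S) \<inter> {..<t1} \<union> ({0..T} - S) \<inter> {t1<..}) (\<lambda>t. if t \<in> {..t1} then \<xi> t else 0)"
    proof (rule continuous_on_Un_local_open)
      let ?U = "({0..T} - S) \<inter> {..<t1} \<union> ({0..T} - S) \<inter> {t1<..}"
      have "?U \<inter> {..<t1} = ({0..T} - S) \<inter> {..<t1}" "?U \<inter> {t1<..} = ({0..T} - S) \<inter> {t1<..}" by auto
      then show "openin (top_of_set ?U) (({0..T} - S) \<inter> {..<t1})" "openin (top_of_set ?U) (({0..T} - S) \<inter> {t1<..})"
        using openin_open_Int[of "{..<t1}" ?U] openin_open_Int[of "{t1<..}" ?U] by simp_all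
      have "continuous_on (({0..T} - S) \<inter> {..<t1}) \<xi>" by (rule continuous_on_subset[OF \<xi>_continuous]) auto
      then show "continuous_on (({0..T} - S) \<inter> {..<t1}) (\<lambda>t. if t \<in> {..t1} then \<xi> t else 0)"
        by (rule continuous_on_eq) auto
      have "continuous_on (({0..T} - S) \<inter> {t1<..}) (\<lambda>_. 0 :: real^'m)" by simp
      then show "continuous_on (({0..T} - S) \<inter> {t1<..}) (\<lambda>t. if t \<in> {..t1} then \<xi> t else 0)"
        by (rule continuous_on_eq) auto
    qed
    moreover have "({0..T} - S) \<inter> {..<t1} \<union> ({0..T} - S) \<inter> {t1<..} = {0..T} - S" by auto
    ultimately show ?thesis by (simp only:)
  qed
  then have "continuous_on ({0..T} - S) (\<lambda>t. if 0 \<le> t \<and> t \<le> t1 then \<xi> t else 0)"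
    by (rule continuous_on_eq) auto
  with b show ?thesis by (simp add: bcont_off_def)
qed

lemma \<psi>1_bcont: "bcont_off S 0 T \<psi>1"
  unfolding \<psi>1_def by (intro bcont_off_add bcont_off_continuous \<psi>h_continuous \<xi>if_bcont)

lemma m_bcont: "bcont_off S 0 T m"
  unfolding m_def by (intro bcont_off_intros bcont_off_continuous \<psi>h_continuous B gi_bcont)

lemma m_outside: "t \<notin> {t1..t2} \<Longrightarrow> m t = 0" by (simp add: m_def gi_outside)

text \<open>Integration by parts against the adjoint solutions turns the first variation of the cost into an
  expression in which the values \<open>\<eta>\<close> at \<open>t1\<close>, the constraint increment \<open>\<zeta>\<close>, the tangential part \<open>W\<close>
  of the control variation and the time dilation \<open>vb\<close> are decoupled.\<close>

lemma decoupled_inequality_strict: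
  assumes \<zeta>: "solves S 0 T \<zeta> \<zeta>'" "bcont_off S 0 T \<zeta>'" "\<And>t. t \<in> {t1..t2} \<Longrightarrow> 0 < \<zeta> t"
    and \<eta>: "p t1 \<bullet> \<eta> = \<zeta> t1"
    and W: "bcont_off S 0 T W" "ok W" "\<And>t. t \<in> {t1<..<t2} \<Longrightarrow> g t \<bullet> W t = 0"
    and vb: "bcont_off S 0 T vb" "integral {0..T} vb = 0"
  shows "0 \<le> \<xi> t1 \<bullet> \<eta> - integral {0..T} (\<lambda>t. m t * \<zeta>' t + (\<psi>1 t v* B t) \<bullet> W t + vb t * (\<psi>1 t \<bullet> e t))"
proof -
  let ?b = "\<lambda>t. \<zeta>' t *\<^sub>R (B t *v gi t) + B t *v W t + vb t *\<^sub>R e t"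
  have bb: "bcont_off S 0 T ?b"
    by (intro bcont_off_intros \<zeta>(2) B gi_bcont W(1) vb(1) e)
  \<comment> \<open>The value is imposed at the interior time \<open>t1\<close>, where
    \<open>p \<bullet> Yb\<close> has to start following \<zeta>; the values at 0 and
    \<open>T\<close> come out of the equation.\<close>
  obtain Yb where Yb: "Yb t1 = \<eta>" "solves S 0 T Yb (\<lambda>t. M t *v Yb t + ?b t)"
    using linear_ode[OF finS _ _ _ M_bcont bb, of t1 \<eta>] times by auto
  \<comment> \<open>As \<open>g \<bullet> gi = 1\<close> on the arc, the first term makes the
    derivative of \<open>p \<bullet> Yb\<close> equal to \<open>\<zeta>'\<close> there, while
    \<open>W\<close> does not affect it. Inserting this control is what turns \<open>A\<close> into
    \<open>M\<close>.\<close>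
  define Ub where "Ub t = (\<zeta>' t - r t \<bullet> Yb t) *\<^sub>R gi t + W t" for t
  have Ybc: "continuous_on {0..T} Yb" using Yb by (simp add: solves_def)
  have Ub_bcont: "bcont_off S 0 T Ub"
    unfolding Ub_def by (intro bcont_off_intros \<zeta>(2) r_bcont bcont_off_continuous[OF Ybc] gi_bcont W(1))
  have rhs: "M t *v Yb t + ?b t = A t *v Yb t + B t *v Ub t + vb t *\<^sub>R e t" for t
    by (simp add: M_def Ub_def matrix_vector_mult_diff_rdistrib outer_product_mult_vector
        matrix_vector_right_distrib matrix_vector_mult_scaleR scaleR_diff_left algebra_simps)
  have Yb': "solves S 0 T Yb (\<lambda>t. A t *v Yb t + B t *v Ub t + vb t *\<^sub>R e t)"
    using Yb(2) unfolding rhs .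
  have okU: "ok Ub"
    by (rule ok_modify[OF W(2) Ub_bcont]) (simp add: Ub_def gi_outside)
  have gU: "g t \<bullet> Ub t = \<zeta>' t - r t \<bullet> Yb t" if "t \<in> {t1<..<t2}" for t
    using g_gi(1)[OF that] W(3)[OF that] by (simp add: Ub_def inner_add_right)
  have pY: "p t \<bullet> Yb t = \<zeta> t" if t: "t \<in> {t1..t2}" for t
  proof -
    have "solves S t1 t2 (\<lambda>t. p t \<bullet> Yb t - \<zeta> t)
        (\<lambda>t. (p t \<bullet> (A t *v Yb t + B t *v Ub t + vb t *\<^sub>R e t) + q t \<bullet> Yb t) - \<zeta>' t)"
      by (rule solves_subinterval[OF solves_diff[OF solves_inner[OF p Yb'] \<zeta>(1)]]) (use times in auto)
    then have "solves S t1 t2 (\<lambda>t. p t \<bullet> Yb t - \<zeta> t) (\<lambda>_. 0)"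
    proof (rule solves_cong)
      fix t assume "t \<in> {t1<..<t2} - S"
      then have t: "t \<in> {t1<..<t2}" by simp
      have "p t \<bullet> (A t *v Yb t + B t *v Ub t + vb t *\<^sub>R e t) + q t \<bullet> Yb t - \<zeta>' t
          = r t \<bullet> Yb t + g t \<bullet> Ub t + vb t * (p t \<bullet> e t) - \<zeta>' t"
        by (simp add: r_def g_def inner_add_right inner_add_left dot_lmul_matrix)
      then show "p t \<bullet> (A t *v Yb t + B t *v Ub t + vb t *\<^sub>R e t) + q t \<bullet> Yb t - \<zeta>' t = 0"
        using gU[OF t] pe[OF t] by simp
    qed
    from solves_zero_derivative[OF finS this, of t1 t] show ?thesis
      using t times Yb(1) \<eta> by simp
  qed
  have main: "0 \<le> J0 \<bullet> Yb 0 + JT \<bullet> Yb T"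
    by (rule variation[OF Yb' Ub_bcont vb _ okU]) (simp add: pY \<zeta>(3))
  have "solves S 0 T (\<lambda>t. \<psi>h t \<bullet> Yb t) (\<lambda>t. \<psi>h t \<bullet> (M t *v Yb t + ?b t) + - (\<psi>h t v* M t) \<bullet> Yb t)"
    by (rule solves_inner[OF \<psi>h(2) Yb(2)])
  then have s1: "solves S 0 T (\<lambda>t. \<psi>h t \<bullet> Yb t) (\<lambda>t. \<psi>h t \<bullet> ?b t)"
    by (rule solves_cong) (simp add: inner_add_right dot_lmul_matrix)
  \<comment> \<open>Before \<open>t1\<close> the feedback is switched off and \<open>Ub\<close> is
    \<open>W\<close>, so pairing with the open loop adjoint \<xi> leaves no term in
    \<open>Yb\<close>.\<close>
  have "solves S 0 t1 (\<lambda>t. \<xi> t \<bullet> Yb t) (\<lambda>t. \<xi> t \<bullet> (A t *v Yb t + B t *v Ub t + vb t *\<^sub>R e t) + - (\<xi> t v* A t) \<bullet> Yb t)"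
    by (rule solves_subinterval[OF solves_inner[OF \<xi>(2) Yb']]) (use times in auto)
  then have s2: "solves S 0 t1 (\<lambda>t. \<xi> t \<bullet> Yb t) (\<lambda>t. \<xi> t \<bullet> (B t *v W t + vb t *\<^sub>R e t))"
    by (rule solves_cong) (simp add: inner_add_right dot_lmul_matrix Ub_def gi_outside)
  \<comment> \<open>Continued by its constant value at \<open>t1\<close>, so that both products are
    integrated over the same interval.\<close>
  have s3: "solves S 0 T (\<lambda>t. if t \<le> t1 then \<xi> t \<bullet> Yb t else \<xi> t1 \<bullet> Yb t1)
      (\<lambda>t. (if 0 \<le> t \<and> t \<le> t1 then \<xi> t else 0) \<bullet> (B t *v W t + vb t *\<^sub>R e t))"
    by (rule solves_combine[OF s2 solves_const]) (use times in auto)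
  have "solves S 0 T (\<lambda>t. \<psi>h t \<bullet> Yb t + (if t \<le> t1 then \<xi> t \<bullet> Yb t else \<xi> t1 \<bullet> Yb t1))
      (\<lambda>t. \<psi>h t \<bullet> ?b t + (if 0 \<le> t \<and> t \<le> t1 then \<xi> t else 0) \<bullet> (B t *v W t + vb t *\<^sub>R e t))"
    by (rule solves_add[OF s1 s3])
  then have s4: "solves S 0 T (\<lambda>t. \<psi>h t \<bullet> Yb t + (if t \<le> t1 then \<xi> t \<bullet> Yb t else \<xi> t1 \<bullet> Yb t1))
      (\<lambda>t. m t * \<zeta>' t + (\<psi>1 t v* B t) \<bullet> W t + vb t * (\<psi>1 t \<bullet> e t))"
    by (rule solves_cong)
      (simp add: m_def \<psi>1_def inner_add_right inner_add_left dot_lmul_matrix algebra_simps)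
  have "((\<lambda>t. m t * \<zeta>' t + (\<psi>1 t v* B t) \<bullet> W t + vb t * (\<psi>1 t \<bullet> e t)) has_integral
      (\<psi>h T \<bullet> Yb T + \<xi> t1 \<bullet> Yb t1 - (\<psi>h 0 \<bullet> Yb 0 + \<xi> 0 \<bullet> Yb 0))) {0..T}"
    using solves_has_integral[OF finS s4, of 0 T] times by simp
  then have "integral {0..T} (\<lambda>t. m t * \<zeta>' t + (\<psi>1 t v* B t) \<bullet> W t + vb t * (\<psi>1 t \<bullet> e t))
      = \<psi>h T \<bullet> Yb T + \<xi> t1 \<bullet> Yb t1 - (\<psi>h 0 \<bullet> Yb 0 + \<xi> 0 \<bullet> Yb 0)" by (rule integral_unique)
  then have "\<xi> t1 \<bullet> \<eta> - integral {0..T} (\<lambda>t. m t * \<zeta>' t + (\<psi>1 t v* B t) \<bullet> W t + vb t * (\<psi>1 t \<bullet> e t))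
      = J0 \<bullet> Yb 0 + JT \<bullet> Yb T"
    using \<psi>h(1) \<xi>(1) Yb(1) by (simp add: inner_diff_left)
  then show ?thesis using main by simp
qed

text \<open>Raising \<zeta> by a constant \<delta> and \<eta> by \<delta> times a vector
  \<open>\<eta>1\<close> with \<open>p t1 \<bullet> \<eta>1 = 1\<close> gives a strict variation;
  then \<delta> tends to 0. Equality is thereby allowed, so variations with \<zeta> = 0 can be used
  with both signs.\<close>

lemma decoupled_inequality:
  assumes \<zeta>: "solves S 0 T \<zeta> \<zeta>'" "bcont_off S 0 T \<zeta>'" "\<And>t. t \<in> {t1..t2} \<Longrightarrow> 0 \<le> \<zeta> t"
    and \<eta>: "p t1 \<bullet> \<eta> = \<zeta> t1"
    and W: "bcont_off S 0 T W" "ok W" "\<And>t. t \<in> {t1<..<t2} \<Longrightarrow> g t \<bullet> W t = 0"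
    and vb: "bcont_off S 0 T vb" "integral {0..T} vb = 0"
  shows "0 \<le> \<xi> t1 \<bullet> \<eta> - integral {0..T} (\<lambda>t. m t * \<zeta>' t + (\<psi>1 t v* B t) \<bullet> W t + vb t * (\<psi>1 t \<bullet> e t))"
    (is "0 \<le> ?I \<eta>")
proof (rule field_le_epsilon)
  fix \<epsilon> :: real assume "0 < \<epsilon>"
  define \<eta>1 where "\<eta>1 = inverse (p t1 \<bullet> p t1) *\<^sub>R p t1"
  have \<eta>1: "p t1 \<bullet> \<eta>1 = 1" using p1 by (simp add: \<eta>1_def)
  define \<delta> where "\<delta> = \<epsilon> / (\<bar>\<xi> t1 \<bullet> \<eta>1\<bar> + 1)"
  have \<delta>: "0 < \<delta>" using \<open>0 < \<epsilon>\<close> by (simp add: \<delta>_def add_nonneg_pos)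
  have "0 \<le> ?I (\<eta> + \<delta> *\<^sub>R \<eta>1)"
  proof (rule decoupled_inequality_strict[of "\<lambda>t. \<zeta> t + \<delta>" \<zeta>'])
    show "solves S 0 T (\<lambda>t. \<zeta> t + \<delta>) \<zeta>'"
      using solves_add[OF \<zeta>(1) solves_const, of \<delta>] by simp
    show "0 < \<zeta> t + \<delta>" if "t \<in> {t1..t2}" for t using \<zeta>(3)[OF that] \<delta> by linarith
    show "p t1 \<bullet> (\<eta> + \<delta> *\<^sub>R \<eta>1) = \<zeta> t1 + \<delta>" using \<eta> \<eta>1 by (simp add: inner_add_right)
  qed (use \<zeta> W vb in auto)
  then have "0 \<le> ?I \<eta> + \<delta> * (\<xi> t1 \<bullet> \<eta>1)" by (simp add: inner_add_right algebra_simps)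
  moreover have "\<delta> * (\<xi> t1 \<bullet> \<eta>1) \<le> \<epsilon>"
  proof -
    have "\<delta> * (\<xi> t1 \<bullet> \<eta>1) \<le> \<delta> * (\<bar>\<xi> t1 \<bullet> \<eta>1\<bar> + 1)" using \<delta> by (intro mult_left_mono) auto
    also have "\<dots> = \<epsilon>" by (simp add: \<delta>_def add_nonneg_pos)
    finally show ?thesis .
  qed
  ultimately show "0 \<le> ?I \<eta> + \<epsilon>" by linarith
qed

text \<open>The coefficient in the projection of \<open>\<xi> t1\<close> on \<open>p t1\<close>,
  with the sign changed; it becomes the constant value of \<mu> on the first arc.\<close>

definition "\<mu>1 = - (\<xi> t1 \<bullet> p t1) / (p t1 \<bullet> p t1)"

text \<open>With \<zeta> = 0 every \<eta> orthogonal to \<open>p t1\<close> is allowed, in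
  particular minus the orthogonal part \<open>d\<close> of \<open>\<xi> t1\<close>, so this part
  vanishes. Hence the costate can jump only along \<Phi>'.\<close>

lemma \<xi>_t1: "\<xi> t1 = - (\<mu>1 *\<^sub>R p t1)"
proof -
  define d where "d = \<xi> t1 + \<mu>1 *\<^sub>R p t1"
  have pd: "p t1 \<bullet> d = 0" using p1 by (simp add: d_def \<mu>1_def inner_add_right inner_diff_right inner_commute)
  have "0 \<le> \<xi> t1 \<bullet> (- d) - integral {0..T} (\<lambda>t. m t * 0 + (\<psi>1 t v* B t) \<bullet> 0 + 0 * (\<psi>1 t \<bullet> e t))"
    by (rule decoupled_inequality[of "\<lambda>_. 0"])
      (use pd ok_zero in \<open>auto intro: solves_const bcont_off_continuous\<close>)
  then have "\<xi> t1 \<bullet> d \<le> 0" by simp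
  moreover have "d \<bullet> d = (\<xi> t1 + \<mu>1 *\<^sub>R p t1) \<bullet> d" by (simp only: d_def)
  then have "\<xi> t1 \<bullet> d = d \<bullet> d" using pd by (simp add: inner_add_left)
  ultimately have "d = 0" by (metis inner_ge_zero inner_eq_zero_iff order_antisym)
  then show ?thesis by (simp add: d_def eq_neg_iff_add_eq_0)
qed

section \<open>Test variations: energy, stationarity, monotonicity\<close>

lemma pe_bcont: "bcont_off S 0 T (\<lambda>t. \<psi>1 t \<bullet> e t)" and k_bcont: "bcont_off S 0 T (\<lambda>t. \<psi>1 t v* B t)"
  by (intro bcont_off_intros \<psi>1_bcont e B)+

text \<open>The du Bois-Reymond argument: the dilation is taken to be the energy minus its mean, and
  the inequality says that the integral of its square is at most 0.\<close>

lemma hamiltonian_constant: "\<exists>c. \<forall>t\<in>{0..T} - S. \<psi>1 t \<bullet> e t = c"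
proof -
  let ?H = "\<lambda>t. \<psi>1 t \<bullet> e t"
  define c where "c = integral {0..T} ?H / T"
  have iH: "?H integrable_on {0..T}" by (rule bcont_off_integrable[OF finS pe_bcont])
  have vb: "bcont_off S 0 T (\<lambda>t. ?H t - c)" by (intro bcont_off_intros pe_bcont)
  have ic: "((\<lambda>_. c) has_integral c * T) {0..T}"
    using has_integral_const_real[of c 0 T] T_pos by (simp add: mult.commute)
  have "((\<lambda>t. ?H t - c) has_integral (integral {0..T} ?H - c * T)) {0..T}"
    by (rule has_integral_diff[OF integrable_integral[OF iH] ic])
  moreover have "integral {0..T} ?H - c * T = 0" using T_pos by (simp add: c_def)
  ultimately have iv: "((\<lambda>t. ?H t - c) has_integral 0) {0..T}" by simp
  have "0 \<le> \<xi> t1 \<bullet> 0 - integral {0..T} (\<lambda>t. m t * 0 + (\<psi>1 t v* B t) \<bullet> 0 + (?H t - c) * ?H t)"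
    by (rule decoupled_inequality[of "\<lambda>_. 0"])
      (use ok_zero vb integral_unique[OF iv] in \<open>auto intro: solves_const bcont_off_continuous\<close>)
  then have le: "integral {0..T} (\<lambda>t. (?H t - c) * ?H t) \<le> 0" by simp
  have sq: "bcont_off S 0 T (\<lambda>t. (?H t - c) * (?H t - c))" by (intro bcont_off_intros pe_bcont)
  have i1: "(\<lambda>t. (?H t - c) * ?H t) integrable_on {0..T}"
    by (rule bcont_off_integrable[OF finS]) (intro bcont_off_intros pe_bcont)
  have "((\<lambda>t. (?H t - c) * ?H t - c * (?H t - c)) has_integral (integral {0..T} (\<lambda>t. (?H t - c) * ?H t) - c * 0)) {0..T}"
    by (rule has_integral_diff[OF integrable_integral[OF i1] has_integral_mult_right[OF iv]])
  then have "((\<lambda>t. (?H t - c) * (?H t - c)) has_integral (integral {0..T} (\<lambda>t. (?H t - c) * ?H t))) {0..T}"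
    by (simp add: algebra_simps)
  then have "integral {0..T} (\<lambda>t. (?H t - c) * (?H t - c)) \<le> 0" using le by (simp add: integral_unique)
  then have "(?H t - c) * (?H t - c) = 0" if "t \<in> {0..T} - S" for t
    using bcont_off_nonneg_integral_zero[OF finS sq T_pos _ _ that] by simp
  then show ?thesis by (intro exI[of _ c]) simp
qed

lemma m_eq: "t \<in> {t1<..<t2} \<Longrightarrow> m t = (\<psi>1 t v* B t) \<bullet> gi t"
  by (simp add: m_def \<psi>1_def dot_lmul_matrix)

text \<open>The tested control is the part of \<open>\<psi>1 t v* B t\<close> orthogonal to
  \<open>g\<close>, which leaves \<open>p \<bullet> Yb\<close> unchanged; the integral of its square
  is at most 0. What remains is a multiple of \<open>g\<close>, and the factor is \<open>m\<close>
  by its choice.\<close>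

lemma stationarity_boundary:
  assumes t: "t \<in> {t1<..<t2}"
  shows "\<psi>1 t v* B t = m t *\<^sub>R g t"
proof -
  let ?k = "\<lambda>t. \<psi>1 t v* B t"
  define W where "W t = (if t1 \<le> t \<and> t \<le> t2 then ?k t - (?k t \<bullet> g t) *\<^sub>R gi t else 0)" for t
  have W: "bcont_off S 0 T W"
    unfolding W_def
    by (rule bcont_off_if[OF bcont_off_subinterval[of S 0 T]])
      (use times in \<open>auto intro!: bcont_off_intros k_bcont g_bcont gi_bcont\<close>)
  have gW: "g t \<bullet> W t = 0" if "t \<in> {t1<..<t2}" for t
    using that g_gi(1)[OF that] by (simp add: W_def inner_diff_right inner_commute)
  have okW: "ok W" by (rule ok_modify[OF ok_zero W]) (auto simp: W_def)
  have kW: "?k t \<bullet> W t = W t \<bullet> W t" if "t \<notin> S" for t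
  proof (cases "t \<in> {t1<..<t2}")
    case True
    have "?k t = W t + (?k t \<bullet> g t) *\<^sub>R gi t" using True by (simp add: W_def)
    moreover have "gi t \<bullet> W t = 0" using gW[OF True] g_gi(2)[OF True] by simp
    ultimately show ?thesis by (metis add.right_neutral inner_add_left inner_scaleR_left mult_zero_right)
  next
    case False
    then have "W t = 0" using that by (auto simp: W_def)
    then show ?thesis by simp
  qed
  have "0 \<le> \<xi> t1 \<bullet> 0 - integral {0..T} (\<lambda>t. m t * 0 + ?k t \<bullet> W t + 0 * (\<psi>1 t \<bullet> e t))"
    by (rule decoupled_inequality[of "\<lambda>_. 0"])
      (use okW W gW in \<open>auto intro: solves_const bcont_off_continuous\<close>)
  then have "integral {0..T} (\<lambda>t. ?k t \<bullet> W t) \<le> 0" by simp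
  moreover have "integral {0..T} (\<lambda>t. ?k t \<bullet> W t) = integral {0..T} (\<lambda>t. W t \<bullet> W t)"
    by (rule integral_spike[of S]) (auto simp: kW)
  ultimately have "integral {0..T} (\<lambda>t. W t \<bullet> W t) \<le> 0" by simp
  then have "W t \<bullet> W t = 0"
    by (intro bcont_off_nonneg_integral_zero[OF finS bcont_off_bilinear[OF bounded_bilinear_inner W W] T_pos])
      (use t times in auto)
  then have "?k t = (?k t \<bullet> g t) *\<^sub>R gi t" using t by (simp add: W_def)
  also have "\<dots> = m t *\<^sub>R g t" using g_gi(2)[OF t] by (simp add: m_eq[OF t] inner_scaleR_right mult.commute)
  finally show ?thesis .
qed

text \<open>A bump at \<tau> in the direction \<open>w\<close> is feasible, and as it concentrates,
  its contribution tends to the value of the integrand at \<tau>.\<close>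

lemma stationarity_free:
  assumes \<tau>: "\<tau> \<in> {0<..<t1} \<union> {t2<..<T}" and w: "strict \<tau> w"
  shows "(\<psi>1 \<tau> v* B \<tau>) \<bullet> w \<le> 0"
proof (rule field_le_epsilon)
  fix \<epsilon> :: real assume "0 < \<epsilon>"
  let ?k = "\<lambda>t. (\<psi>1 t v* B t) \<bullet> w"
  have kb: "bcont_off S 0 T ?k" by (intro bcont_off_intros \<psi>1_bcont B)
  obtain \<rho> where \<rho>: "0 < \<rho>" "\<And>\<beta>. continuous_on UNIV \<beta> \<Longrightarrow> (\<forall>t. 0 \<le> \<beta> t) \<Longrightarrow>
      (\<forall>t. \<rho> \<le> \<bar>t - \<tau>\<bar> \<longrightarrow> \<beta> t = 0) \<Longrightarrow> ok (\<lambda>t. \<beta> t *\<^sub>R w)"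
    using ok_bump[OF assms] by blast
  \<comment> \<open>The support must also miss the boundary arc, so that the tangency condition
    there holds trivially.\<close>
  define \<rho>' where "\<rho>' = (if \<tau> < t1 then min \<rho> (t1 - \<tau>) else min \<rho> (\<tau> - t2))"
  have \<rho>': "0 < \<rho>'" "\<rho>' \<le> \<rho>" using \<rho>(1) \<tau> times by (auto simp: \<rho>'_def)
  have far: "\<rho>' \<le> \<bar>t - \<tau>\<bar>" if "t \<in> {t1..t2}" for t using that \<tau> times by (auto simp: \<rho>'_def)
  have \<tau>': "\<tau> \<in> {0<..<T} - S" using \<tau> times by auto
  obtain \<beta> where \<beta>: "continuous_on UNIV \<beta>" "\<forall>t. 0 \<le> \<beta> t" "\<forall>t. \<rho>' \<le> \<bar>t - \<tau>\<bar> \<longrightarrow> \<beta> t = 0"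
    "integral {0..T} \<beta> = 1" "\<bar>integral {0..T} (\<lambda>t. ?k t * \<beta> t) - ?k \<tau>\<bar> \<le> \<epsilon>"
    using bump_average[OF finS kb \<tau>' \<open>0 < \<epsilon>\<close> \<rho>'(1)] by blast
  have okW: "ok (\<lambda>t. \<beta> t *\<^sub>R w)"
    by (rule \<rho>(2)[OF \<beta>(1,2)]) (use \<beta>(3) \<rho>'(2) in auto)
  have W: "bcont_off S 0 T (\<lambda>t. \<beta> t *\<^sub>R w)"
    by (intro bcont_off_intros bcont_off_continuous continuous_on_subset[OF \<beta>(1)]) simp
  have "0 \<le> \<xi> t1 \<bullet> 0 - integral {0..T} (\<lambda>t. m t * 0 + (\<psi>1 t v* B t) \<bullet> (\<beta> t *\<^sub>R w) + 0 * (\<psi>1 t \<bullet> e t))"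
  proof (rule decoupled_inequality[of "\<lambda>_. 0"])
    show "g t \<bullet> (\<beta> t *\<^sub>R w) = 0" if "t \<in> {t1<..<t2}" for t
      using \<beta>(3) far[of t] that by simp
  qed (use okW W in \<open>auto intro: solves_const bcont_off_continuous\<close>)
  then have "integral {0..T} (\<lambda>t. ?k t * \<beta> t) \<le> 0" by (simp add: mult.commute)
  then show "?k \<tau> \<le> 0 + \<epsilon>" using \<beta>(5) by linarith
qed

text \<open>Formally, integration by parts turns this into \<integral> \<zeta> d\<mu> \<ge> 0 for
  the function that is \<open>\<mu>1\<close> before \<open>t1\<close>, \<open>m\<close> on the arc
  and 0 after \<open>t2\<close>: the boundary terms are its two jumps. Taking \<eta> along
  \<open>p t1\<close> isolates the factor \<open>\<mu>1\<close>.\<close>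

lemma constraint_inequality:
  assumes \<zeta>: "solves S 0 T \<zeta> \<zeta>'" "bcont_off S 0 T \<zeta>'" "\<And>t. t \<in> {t1..t2} \<Longrightarrow> 0 \<le> \<zeta> t"
  shows "integral {0..T} (\<lambda>t. m t * \<zeta>' t) \<le> - \<mu>1 * \<zeta> t1"
proof -
  define \<eta> where "\<eta> = (\<zeta> t1 / (p t1 \<bullet> p t1)) *\<^sub>R p t1"
  have \<eta>: "p t1 \<bullet> \<eta> = \<zeta> t1" using p1 by (simp add: \<eta>_def)
  have "0 \<le> \<xi> t1 \<bullet> \<eta> - integral {0..T} (\<lambda>t. m t * \<zeta>' t + (\<psi>1 t v* B t) \<bullet> 0 + 0 * (\<psi>1 t \<bullet> e t))"
    by (rule decoupled_inequality[OF \<zeta> \<eta>]) (use ok_zero in \<open>auto intro: bcont_off_continuous\<close>)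
  moreover have "\<xi> t1 \<bullet> \<eta> = - \<mu>1 * \<zeta> t1" using \<eta> by (simp add: \<xi>_t1)
  ultimately show ?thesis by simp
qed

text \<open>The primitive of a bump is a smoothed unit step at \<open>s\<close>, a building block
  for \<zeta>; pairing \<open>m\<close> with the bump nearly evaluates it at
  \<open>s\<close>.\<close>

lemma m_bump:
  assumes s: "s \<in> {t1<..<t2}" and "0 < \<epsilon>" "0 < \<rho>"
  shows "\<exists>\<beta>. continuous_on {0..T} \<beta> \<and> (\<forall>t. 0 \<le> \<beta> t) \<and> (\<forall>t. \<rho> \<le> \<bar>t - s\<bar> \<longrightarrow> \<beta> t = 0) \<and>
    solves S 0 T (\<lambda>t. integral {0..t} \<beta>) \<beta> \<and> bcont_off S 0 T \<beta> \<and>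
    (\<forall>t\<in>{0..T}. 0 \<le> integral {0..t} \<beta> \<and> integral {0..t} \<beta> \<le> 1) \<and>
    (\<forall>t. 0 \<le> t \<and> t \<le> s - \<rho> \<longrightarrow> integral {0..t} \<beta> = 0) \<and> integral {0..T} \<beta> = 1 \<and>
    (\<forall>t. s + \<rho> \<le> t \<and> t \<le> T \<longrightarrow> integral {0..t} \<beta> = 1) \<and>
    \<bar>integral {0..T} (\<lambda>t. m t * \<beta> t) - m s\<bar> \<le> \<epsilon>"
proof -
  have s': "s \<in> {0<..<T} - S" using s times by auto
  obtain \<beta> where \<beta>: "continuous_on UNIV \<beta>" "\<forall>t. 0 \<le> \<beta> t" "\<forall>t. \<rho> \<le> \<bar>t - s\<bar> \<longrightarrow> \<beta> t = 0"
    "integral {0..T} \<beta> = 1" "\<bar>integral {0..T} (\<lambda>t. m t * \<beta> t) - m s\<bar> \<le> \<epsilon>"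
    using bump_average[OF finS m_bcont s' \<open>0 < \<epsilon>\<close> \<open>0 < \<rho>\<close>] by blast
  have c: "continuous_on X \<beta>" for X using \<beta>(1) by (rule continuous_on_subset) simp
  have i: "\<beta> integrable_on {a..b}" for a b by (rule integrable_continuous_real[OF c])
  have nn: "0 \<le> integral {a..b} \<beta>" for a b by (rule integral_nonneg[OF i]) (use \<beta>(2) in auto)
  have b: "bcont_off S 0 T \<beta>" by (rule bcont_off_continuous[OF c])
  have sol: "solves S 0 T (\<lambda>t. integral {0..t} \<beta>) \<beta>"
    by (rule solves_of_integral[OF finS b, of _ 0]) simp
  have split: "integral {0..t} \<beta> + integral {t..T} \<beta> = 1" if "t \<in> {0..T}" for t
    using Henstock_Kurzweil_Integration.integral_combine[of 0 t T \<beta>] that i \<beta>(4) by auto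
  have z: "integral {a..b} \<beta> = 0" if "\<And>t. t \<in> {a..b} \<Longrightarrow> \<rho> \<le> \<bar>t - s\<bar>" for a b
  proof -
    have "integral {a..b} \<beta> = integral {a..b} (\<lambda>_. 0)"
      by (rule Henstock_Kurzweil_Integration.integral_cong) (use \<beta>(3) that in auto)
    then show ?thesis by simp
  qed
  have z1: "integral {0..t} \<beta> = 0" if "t \<le> s - \<rho>" for t by (rule z) (use that in auto)
  have z2: "integral {0..t} \<beta> = 1" if "s + \<rho> \<le> t" "t \<le> T" for t
  proof -
    have "integral {t..T} \<beta> = 0" by (rule z) (use that in auto)
    then show ?thesis using split[of t] that s times \<open>0 < \<rho>\<close> by auto
  qed
  have "integral {0..t} \<beta> \<le> 1" if "t \<in> {0..T}" for t using split[OF that] nn[of t T] by linarith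
  then show ?thesis using \<beta> c nn b sol z1 z2 by (intro exI[of _ \<beta>]) simp
qed

text \<open>The test function falls from 1 to 0 near \<open>s\<close>, so it measures the increase
  of \<mu> from before \<open>t1\<close> up to \<open>s\<close>. With the width
  \<open>s - t1\<close> the step has not yet begun at \<open>t1\<close>.\<close>

lemma m_ge_\<mu>1:
  assumes s: "s \<in> {t1<..<t2}" shows "\<mu>1 \<le> m s"
proof (rule field_le_epsilon)
  fix \<epsilon> :: real assume "0 < \<epsilon>"
  define \<rho> where "\<rho> = s - t1"
  have "0 < \<rho>" using s by (simp add: \<rho>_def)
  obtain \<beta> where \<beta>: "continuous_on {0..T} \<beta>" "solves S 0 T (\<lambda>t. integral {0..t} \<beta>) \<beta>" "bcont_off S 0 T \<beta>"
    "\<forall>t\<in>{0..T}. 0 \<le> integral {0..t} \<beta> \<and> integral {0..t} \<beta> \<le> 1"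
    "\<forall>t. 0 \<le> t \<and> t \<le> s - \<rho> \<longrightarrow> integral {0..t} \<beta> = 0"
    "\<bar>integral {0..T} (\<lambda>t. m t * \<beta> t) - m s\<bar> \<le> \<epsilon>"
    using m_bump[OF s \<open>0 < \<epsilon>\<close> \<open>0 < \<rho>\<close>] by blast
  have "integral {0..T} (\<lambda>t. m t * (- \<beta> t)) \<le> - \<mu>1 * (1 - integral {0..t1} \<beta>)"
  proof (rule constraint_inequality)
    show "solves S 0 T (\<lambda>t. 1 - integral {0..t} \<beta>) (\<lambda>t. - \<beta> t)"
      using solves_diff[OF solves_const[of S 0 T 1] \<beta>(2)] by simp
    show "bcont_off S 0 T (\<lambda>t. - \<beta> t)"
      using bcont_off_diff[OF bcont_off_continuous[OF continuous_on_const[of _ 0]] \<beta>(3)] by simp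
    show "0 \<le> 1 - integral {0..t} \<beta>" if "t \<in> {t1..t2}" for t using \<beta>(4) that times by simp
  qed
  moreover have "integral {0..t1} \<beta> = 0" using \<beta>(5) times by (simp add: \<rho>_def)
  ultimately have "\<mu>1 \<le> integral {0..T} (\<lambda>t. m t * \<beta> t)" by simp
  then show "\<mu>1 \<le> m s + \<epsilon>" using \<beta>(6) by linarith
qed

text \<open>The test function rises from 0 to 1 near \<open>s\<close>, so it measures the increase
  of \<mu> from \<open>s\<close> to beyond \<open>t2\<close>, where \<mu> is 0.\<close>

lemma m_nonpos:
  assumes s: "s \<in> {t1<..<t2}" shows "m s \<le> 0"
proof (rule field_le_epsilon)
  fix \<epsilon> :: real assume "0 < \<epsilon>"
  define \<rho> where "\<rho> = s - t1"
  have "0 < \<rho>" using s by (simp add: \<rho>_def)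
  obtain \<beta> where \<beta>: "solves S 0 T (\<lambda>t. integral {0..t} \<beta>) \<beta>" "bcont_off S 0 T \<beta>"
    "\<forall>t\<in>{0..T}. 0 \<le> integral {0..t} \<beta> \<and> integral {0..t} \<beta> \<le> 1"
    "\<forall>t. 0 \<le> t \<and> t \<le> s - \<rho> \<longrightarrow> integral {0..t} \<beta> = 0"
    "\<bar>integral {0..T} (\<lambda>t. m t * \<beta> t) - m s\<bar> \<le> \<epsilon>"
    using m_bump[OF s \<open>0 < \<epsilon>\<close> \<open>0 < \<rho>\<close>] by blast
  have "integral {0..T} (\<lambda>t. m t * \<beta> t) \<le> - \<mu>1 * integral {0..t1} \<beta>"
    by (rule constraint_inequality[OF \<beta>(1,2)]) (use \<beta>(3) times in simp)
  moreover have "integral {0..t1} \<beta> = 0" using \<beta>(4) times by (simp add: \<rho>_def)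
  ultimately show "m s \<le> 0 + \<epsilon>" using \<beta>(5) by (simp add: abs_le_iff)
qed

text \<open>The test function is a smoothed indicator of the interval from \<open>s\<close> to
  \<open>s'\<close>, the difference of two steps.\<close>

lemma m_mono:
  assumes s: "s \<in> {t1<..<t2}" and s': "s' \<in> {t1<..<t2}" and "s < s'"
  shows "m s \<le> m s'"
proof (rule field_le_epsilon)
  fix \<epsilon> :: real assume "0 < \<epsilon>"
  then have e2: "0 < \<epsilon> / 2" by simp
  \<comment> \<open>Half the distance: the first step is complete before the second begins, which
    keeps the difference nonnegative.\<close>
  define \<rho> where "\<rho> = min (s - t1) ((s' - s) / 2)"
  have \<rho>: "0 < \<rho>" "\<rho> \<le> s - t1" "s + \<rho> \<le> s' - \<rho>" using s \<open>s < s'\<close> by (auto simp: \<rho>_def min_def field_simps)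
  obtain \<beta> where \<beta>: "solves S 0 T (\<lambda>t. integral {0..t} \<beta>) \<beta>" "bcont_off S 0 T \<beta>"
    "\<forall>t\<in>{0..T}. 0 \<le> integral {0..t} \<beta> \<and> integral {0..t} \<beta> \<le> 1"
    "\<forall>t. 0 \<le> t \<and> t \<le> s - \<rho> \<longrightarrow> integral {0..t} \<beta> = 0"
    "\<forall>t. s + \<rho> \<le> t \<and> t \<le> T \<longrightarrow> integral {0..t} \<beta> = 1"
    "\<bar>integral {0..T} (\<lambda>t. m t * \<beta> t) - m s\<bar> \<le> \<epsilon> / 2"
    using m_bump[OF s e2 \<rho>(1)] by blast
  obtain \<gamma> where \<gamma>: "solves S 0 T (\<lambda>t. integral {0..t} \<gamma>) \<gamma>" "bcont_off S 0 T \<gamma>"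
    "\<forall>t\<in>{0..T}. 0 \<le> integral {0..t} \<gamma> \<and> integral {0..t} \<gamma> \<le> 1"
    "\<forall>t. 0 \<le> t \<and> t \<le> s' - \<rho> \<longrightarrow> integral {0..t} \<gamma> = 0"
    "\<bar>integral {0..T} (\<lambda>t. m t * \<gamma> t) - m s'\<bar> \<le> \<epsilon> / 2"
    using m_bump[OF s' e2 \<rho>(1)] by blast
  have "integral {0..T} (\<lambda>t. m t * (\<beta> t - \<gamma> t)) \<le> - \<mu>1 * (integral {0..t1} \<beta> - integral {0..t1} \<gamma>)"
  proof (rule constraint_inequality)
    show "solves S 0 T (\<lambda>t. integral {0..t} \<beta> - integral {0..t} \<gamma>) (\<lambda>t. \<beta> t - \<gamma> t)"
      by (rule solves_diff[OF \<beta>(1) \<gamma>(1)])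
    show "bcont_off S 0 T (\<lambda>t. \<beta> t - \<gamma> t)" by (rule bcont_off_diff[OF \<beta>(2) \<gamma>(2)])
    show "0 \<le> integral {0..t} \<beta> - integral {0..t} \<gamma>" if "t \<in> {t1..t2}" for t
    proof -
      have t: "t \<in> {0..T}" using that times by auto
      show ?thesis
      proof (cases "t \<le> s' - \<rho>")
        case True
        then show ?thesis using \<beta>(3) \<gamma>(4) t by simp
      next
        case False
        then have "integral {0..t} \<beta> = 1" using \<beta>(5) t \<rho> by simp
        then show ?thesis using \<gamma>(3) t by simp
      qed
    qed
  qed
  moreover have "integral {0..t1} \<beta> = 0" "integral {0..t1} \<gamma> = 0" using \<beta>(4) \<gamma>(4) \<rho> times \<open>s < s'\<close> by simp_all
  moreover have "integral {0..T} (\<lambda>t. m t * (\<beta> t - \<gamma> t)) = integral {0..T} (\<lambda>t. m t * \<beta> t) - integral {0..T} (\<lambda>t. m t * \<gamma> t)"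
    unfolding right_diff_distrib
    by (rule Henstock_Kurzweil_Integration.integral_diff)
      (rule bcont_off_integrable[OF finS], intro bcont_off_intros m_bcont \<beta>(2) \<gamma>(2))+
  ultimately have "integral {0..T} (\<lambda>t. m t * \<beta> t) \<le> integral {0..T} (\<lambda>t. m t * \<gamma> t)" by simp
  then show "m s \<le> m s' + \<epsilon>" using \<beta>(6) \<gamma>(5) by linarith
qed

end

section \<open>Lipschitz regularity and assembly of the multipliers\<close>

lemma lipschitz_on_bilinear:
  assumes P: "bounded_bilinear P" and f: "\<exists>L. L-lipschitz_on X f" "bounded (f ` X)"
    and g: "\<exists>L. L-lipschitz_on X g" "bounded (g ` X)"
  shows "\<exists>L. L-lipschitz_on X (\<lambda>x. P (f x) (g x))"
proof -
  interpret bounded_bilinear P by fact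
  obtain K where K: "0 \<le> K" "\<And>a b. norm (P a b) \<le> norm a * norm b * K" using nonneg_bounded by blast
  obtain L1 L2 where L: "L1-lipschitz_on X f" "L2-lipschitz_on X g" using f g by blast
  then have L0: "0 \<le> L1" "0 \<le> L2" by (auto dest: lipschitz_on_nonneg)
  obtain F where F: "0 < F" "\<And>x. x \<in> X \<Longrightarrow> norm (f x) \<le> F" using f(2) unfolding bounded_pos by blast
  obtain H where H: "0 < H" "\<And>x. x \<in> X \<Longrightarrow> norm (g x) \<le> H" using g(2) unfolding bounded_pos by blast
  have "((L1 * H + F * L2) * K)-lipschitz_on X (\<lambda>x. P (f x) (g x))"
  proof (rule lipschitz_onI)
    fix x y assume xy: "x \<in> X" "y \<in> X"
    have "P (f x) (g x) - P (f y) (g y) = P (f x - f y) (g x) + P (f y) (g x - g y)"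
      by (simp add: diff_left diff_right)
    then have "norm (P (f x) (g x) - P (f y) (g y)) \<le> norm (P (f x - f y) (g x)) + norm (P (f y) (g x - g y))"
      by (simp add: norm_triangle_ineq)
    also have "\<dots> \<le> norm (f x - f y) * norm (g x) * K + norm (f y) * norm (g x - g y) * K"
      by (intro add_mono K)
    also have "\<dots> \<le> (L1 * dist x y) * H * K + F * (L2 * dist x y) * K"
      using lipschitz_onD[OF L(1) xy] lipschitz_onD[OF L(2) xy] H(2)[OF xy(1)] F(2)[OF xy(2)] K(1) F(1) H(1) L0
      by (intro add_mono mult_right_mono mult_mono) (auto simp: dist_norm[of "f x"] dist_norm[of "g x"])
    also have "\<dots> = (L1 * H + F * L2) * K * dist x y" by (simp add: algebra_simps)
    finally show "dist (P (f x) (g x)) (P (f y) (g y)) \<le> (L1 * H + F * L2) * K * dist x y"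
      by (simp add: dist_norm[of "P (f x) (g x)"])
  qed (use L0 K F H in auto)
  then show ?thesis by blast
qed

lemma lipschitz_on_inverse:
  fixes f :: "'a::metric_space \<Rightarrow> real"
  assumes f: "\<exists>L. L-lipschitz_on X f" and "0 < c" "\<And>x. x \<in> X \<Longrightarrow> c \<le> f x"
  shows "\<exists>L. L-lipschitz_on X (\<lambda>x. inverse (f x))"
proof -
  obtain L where L: "L-lipschitz_on X f" using f by blast
  then have L0: "0 \<le> L" by (rule lipschitz_on_nonneg)
  have "(L / (c * c))-lipschitz_on X (\<lambda>x. inverse (f x))"
  proof (rule lipschitz_onI)
    fix x y assume xy: "x \<in> X" "y \<in> X"
    have p: "0 < f x" "0 < f y" using assms(2) assms(3)[OF xy(1)] assms(3)[OF xy(2)] by linarith+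
    have "inverse (f x) - inverse (f y) = (f y - f x) / (f x * f y)" using p by (simp add: field_simps)
    then have "dist (inverse (f x)) (inverse (f y)) = \<bar>f y - f x\<bar> / (f x * f y)"
      using p by (simp add: dist_real_def abs_divide abs_mult)
    also have "\<dots> \<le> (L * dist x y) / (c * c)"
    proof (rule frac_le)
      show "\<bar>f y - f x\<bar> \<le> L * dist x y" using lipschitz_onD[OF L xy] by (simp add: dist_real_def abs_minus_commute)
      show "c * c \<le> f x * f y" using assms(2) assms(3)[OF xy(1)] assms(3)[OF xy(2)] p by (intro mult_mono) auto
    qed (use assms(2) L0 in auto)
    finally show "dist (inverse (f x)) (inverse (f y)) \<le> L / (c * c) * dist x y" by simp
  qed (use L0 assms(2) in auto)
  then show ?thesis by blast
qed

lemma lipschitz_on_interval_bounded: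
  fixes f :: "real \<Rightarrow> 'b::real_normed_vector"
  assumes "\<exists>L. L-lipschitz_on {a..<b} f"
  shows "bounded (f ` {a..<b})"
proof -
  obtain L where L: "L-lipschitz_on {a..<b} f" using assms by blast
  have "norm (f x) \<le> norm (f a) + L * (b - a)" if x: "x \<in> {a..<b}" for x
  proof -
    have "norm (f x - f a) \<le> L * dist x a" using lipschitz_onD[OF L x, of a] x by (simp add: dist_norm)
    also have "\<dots> \<le> L * (b - a)" using x lipschitz_on_nonneg[OF L] by (intro mult_left_mono) (auto simp: dist_real_def)
    finally show ?thesis using norm_triangle_ineq2[of "f x" "f a"] by linarith
  qed
  then show ?thesis unfolding bounded_iff by blast
qed

lemmas lipschitz_on_bilinear_interval =
  lipschitz_on_bilinear[OF _ _ lipschitz_on_interval_bounded _ lipschitz_on_interval_bounded]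

lemma solves_lipschitz_exists:
  fixes x :: "real \<Rightarrow> 'a::banach"
  assumes S: "finite S" and "solves S a b x g" "bcont_off S a b g"
  shows "\<exists>L. L-lipschitz_on {a..b} x"
proof -
  obtain B where "0 \<le> B" "\<forall>t\<in>{a..b}. norm (g t) \<le> B" using bcont_off_bound[OF assms(3)] by blast
  then show ?thesis using solves_lipschitz[OF S assms(2), of B] by blast
qed

context linear_variation begin

text \<open>\<open>p\<close> and \<open>\<psi>h\<close> are Lipschitz as solutions, \<open>B\<close>
  by assumption, and the division is safe because \<open>g \<bullet> g\<close> is at least
  \<open>c0\<^sup>2\<close>. The interval is half open because nothing is assumed about
  \<open>B\<close> at \<open>t2\<close>.\<close>

lemma m_lipschitz: "\<exists>L. L-lipschitz_on {t1..<t2} m"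
proof -
  have sub: "{t1..<t2} \<subseteq> {0..T}" using times by auto
  have pL: "\<exists>L. L-lipschitz_on {t1..<t2} p"
    using solves_lipschitz_exists[OF finS p q] lipschitz_on_subset[OF _ sub] by blast
  have rhs: "bcont_off S 0 T (\<lambda>t. - (\<psi>h t v* M t))"
    using bcont_off_diff[OF bcont_off_continuous[OF continuous_on_const[of _ 0]]
        bcont_off_bilinear[OF bounded_bilinear_vector_matrix_mult bcont_off_continuous[OF \<psi>h_continuous] M_bcont]]
    by simp
  have \<psi>L: "\<exists>L. L-lipschitz_on {t1..<t2} \<psi>h"
    using solves_lipschitz_exists[OF finS \<psi>h(2) rhs] lipschitz_on_subset[OF _ sub] by blast
  note bil = lipschitz_on_bilinear_interval
  have gL: "\<exists>L. L-lipschitz_on {t1..<t2} g"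
    unfolding g_def by (rule bil[OF bounded_bilinear_vector_matrix_mult pL pL Blip Blip])
  have ggL: "\<exists>L. L-lipschitz_on {t1..<t2} (\<lambda>t. g t \<bullet> g t)"
    by (rule bil[OF bounded_bilinear_inner gL gL gL gL])
  have "c0\<^sup>2 \<le> g t \<bullet> g t" if "t \<in> {t1..<t2}" for t
    using g_pos[OF that] by (simp add: max_def split: if_splits)
  then have iL: "\<exists>L. L-lipschitz_on {t1..<t2} (\<lambda>t. inverse (g t \<bullet> g t))"
    using c0(1) by (intro lipschitz_on_inverse[OF ggL, of "c0\<^sup>2"]) auto
  have giL: "\<exists>L. L-lipschitz_on {t1..<t2} (\<lambda>t. inverse (g t \<bullet> g t) *\<^sub>R g t)"
    by (rule bil[OF bounded_bilinear_scaleR iL iL gL gL])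
  have BgL: "\<exists>L. L-lipschitz_on {t1..<t2} (\<lambda>t. B t *v (inverse (g t \<bullet> g t) *\<^sub>R g t))"
    by (rule bil[OF bounded_bilinear_matrix_vector_mult Blip Blip giL giL])
  have "\<exists>L. L-lipschitz_on {t1..<t2} (\<lambda>t. \<psi>h t \<bullet> (B t *v (inverse (g t \<bullet> g t) *\<^sub>R g t)))"
    by (rule bil[OF bounded_bilinear_inner \<psi>L \<psi>L BgL BgL])
  moreover have "m t = \<psi>h t \<bullet> (B t *v (inverse (g t \<bullet> g t) *\<^sub>R g t))" if "t \<in> {t1..<t2}" for t
    using g_pos[OF that] that by (simp add: m_def gi_def)
  ultimately show ?thesis by (metis (no_types, lifting) lipschitz_on_transform)
qed

text \<open>The bumps reach interior points only; Lipschitz continuity from the right carries the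
  inequalities to \<open>t1\<close>, where \<mu> takes its value \<open>m t1\<close>.\<close>

lemma m_left_endpoint:
  shows "\<mu>1 \<le> m t1" and "s \<in> {t1<..<t2} \<Longrightarrow> m t1 \<le> m s"
proof -
  obtain L where L: "L-lipschitz_on {t1..<t2} m" using m_lipschitz by blast
  have L0: "0 \<le> L" using L by (rule lipschitz_on_nonneg)
  have near: "\<exists>s'. s' \<in> {t1<..<s} \<and> \<bar>m s' - m t1\<bar> \<le> \<epsilon>" if "0 < \<epsilon>" "s \<in> {t1<..<t2}" for \<epsilon> s
  proof -
    define d where "d = min ((s - t1) / 2) (\<epsilon> / (L + 1))"
    have "0 < (s - t1) / 2" "0 < \<epsilon> / (L + 1)" using that L0 by simp_all
    then have d: "0 < d" by (simp add: d_def)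
    have d': "d \<le> (s - t1) / 2" "d \<le> \<epsilon> / (L + 1)"
      unfolding d_def by (rule min.cobounded1, rule min.cobounded2)
    define s' where "s' = t1 + d"
    have s': "s' \<in> {t1<..<s}" "s' - t1 \<le> \<epsilon> / (L + 1)" using d d' that by (auto simp: s'_def)
    have "\<bar>m s' - m t1\<bar> \<le> L * (s' - t1)"
      using lipschitz_onD[OF L, of s' t1] s' that by (auto simp: dist_real_def)
    also have "\<dots> \<le> (L + 1) * (\<epsilon> / (L + 1))" using s' L0 by (intro mult_mono) auto
    also have "\<dots> = \<epsilon>" using L0 by simp
    finally show ?thesis using s' by blast
  qed
  show "\<mu>1 \<le> m t1"
  proof (rule field_le_epsilon)
    fix \<epsilon> :: real assume \<epsilon>: "0 < \<epsilon>"
    have "(t1 + t2) / 2 \<in> {t1<..<t2}" using times by auto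
    from near[OF \<epsilon> this] obtain s' where s': "s' \<in> {t1<..<(t1 + t2) / 2}" "\<bar>m s' - m t1\<bar> \<le> \<epsilon>" by blast
    have "\<mu>1 \<le> m s'" by (rule m_ge_\<mu>1) (use s' in auto)
    then show "\<mu>1 \<le> m t1 + \<epsilon>" using s'(2) by linarith
  qed
  assume s: "s \<in> {t1<..<t2}"
  show "m t1 \<le> m s"
  proof (rule field_le_epsilon)
    fix \<epsilon> :: real assume \<epsilon>: "0 < \<epsilon>"
    from near[OF \<epsilon> s] obtain s' where s': "s' \<in> {t1<..<s}" "\<bar>m s' - m t1\<bar> \<le> \<epsilon>" by blast
    have "m s' \<le> m s" by (rule m_mono) (use s' s in auto)
    then show "m t1 \<le> m s + \<epsilon>" using s'(2) by linarith
  qed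
qed

text \<open>The right continuous version; the normalisation to 0 after \<open>t2\<close> makes both
  jumps nonnegative by the inequalities for \<open>m\<close>.\<close>

definition "\<mu> t = (if t < t1 then \<mu>1 else if t < t2 then m t else 0)"
text \<open>This is \<open>\<psi> + \<mu> p\<close>, the costate with its jumps compensated.\<close>

definition "\<psi>t t = (if t \<le> t1 then \<psi>h t + \<xi> t + \<mu>1 *\<^sub>R p t else \<psi>h t)"

lemma \<mu>_mono: "mono_on {0..T} \<mu>"
proof (rule mono_onI)
  have lo: "\<mu>1 \<le> m t" if "t \<in> {t1..<t2}" for t
    using m_ge_\<mu>1[of t] m_left_endpoint(1) that by (cases "t = t1") auto
  have mm: "m s \<le> m t" if "s \<in> {t1..<t2}" "t \<in> {t1..<t2}" "s \<le> t" for s t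
    using m_mono[of s t] m_left_endpoint(2)[of t] that by (cases "s = t"; cases "s = t1") auto
  have mid: "(t1 + t2) / 2 \<in> {t1<..<t2}" using times by auto
  have hi: "m t \<le> 0" if "t \<in> {t1..<t2}" for t
  proof (cases "t = t1")
    case True
    then show ?thesis using m_left_endpoint(2)[OF mid] m_nonpos[OF mid] by simp
  next
    case False
    then show ?thesis using m_nonpos[of t] that by auto
  qed
  have "t1 \<in> {t1..<t2}" using times by auto
  then have "\<mu>1 \<le> 0" using lo hi order_trans by blast
  fix s t assume "s \<in> {0..T}" "t \<in> {0..T}" "s \<le> t"
  then show "\<mu> s \<le> \<mu> t" using lo mm hi \<open>\<mu>1 \<le> 0\<close> by (simp add: \<mu>_def)
qed

text \<open>At \<open>t1\<close> the two branches agree exactly because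
  \<open>\<xi> t1 = - (\<mu>1 *\<^sub>R p t1)\<close>; so no measure remains and the adjoint
  relation is an ordinary equation in which \<mu> enters as a bounded coefficient.\<close>

lemma \<psi>t_solves: "solves S 0 T \<psi>t (\<lambda>t. \<mu> t *\<^sub>R (q t + p t v* A t) - \<psi>t t v* A t)"
proof -
  have add: "(x + y) v* X = x v* X + y v* X" "(k *\<^sub>R x) v* X = k *\<^sub>R (x v* X)" "x v* (X - Y) = x v* X - x v* Y"
    for x y :: "real^'m" and X Y :: "real^'m^'m" and k
    by (simp_all add: bounded_bilinear.add_left[OF bounded_bilinear_vector_matrix_mult]
        bounded_bilinear.scaleR_left[OF bounded_bilinear_vector_matrix_mult]
        bounded_bilinear.diff_right[OF bounded_bilinear_vector_matrix_mult])
  have h: "- (\<psi>h t v* M t) = m t *\<^sub>R (q t + p t v* A t) - \<psi>h t v* A t" for t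
    by (simp add: M_def add vector_mult_outer_product m_def r_def)
  have "solves S 0 T (\<lambda>t. \<psi>h t + \<xi> t + \<mu>1 *\<^sub>R p t) (\<lambda>t. - (\<psi>h t v* M t) + - (\<xi> t v* A t) + \<mu>1 *\<^sub>R q t)"
    by (intro solves_add solves_scaleR \<psi>h(2) \<xi>(2) p)
  then have 1: "solves S 0 t1 (\<lambda>t. \<psi>h t + \<xi> t + \<mu>1 *\<^sub>R p t) (\<lambda>t. - (\<psi>h t v* M t) + - (\<xi> t v* A t) + \<mu>1 *\<^sub>R q t)"
    by (rule solves_subinterval) (use times in auto)
  have 2: "solves S t1 T \<psi>h (\<lambda>t. - (\<psi>h t v* M t))"
    by (rule solves_subinterval[OF \<psi>h(2)]) (use times in auto)
  have "solves S 0 T (\<lambda>t. if t \<le> t1 then \<psi>h t + \<xi> t + \<mu>1 *\<^sub>R p t else \<psi>h t)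
    (\<lambda>t. \<mu> t *\<^sub>R (q t + p t v* A t) - \<psi>t t v* A t)"
  proof (rule solves_combine[OF 1 2])
    fix t assume t: "t \<in> {0..t1} - S"
    then have "m t = 0" "\<mu> t = \<mu>1" "\<psi>t t = \<psi>h t + \<xi> t + \<mu>1 *\<^sub>R p t"
      by (auto simp: m_outside \<mu>_def \<psi>t_def)
    then show "\<mu> t *\<^sub>R (q t + p t v* A t) - \<psi>t t v* A t = - (\<psi>h t v* M t) + - (\<xi> t v* A t) + \<mu>1 *\<^sub>R q t"
      unfolding h by (simp add: add algebra_simps)
  next
    fix t assume t: "t \<in> {t1..T} - S"
    then have "\<mu> t = m t" "\<psi>t t = \<psi>h t" using times by (auto simp: \<mu>_def \<psi>t_def m_outside)
    then show "\<mu> t *\<^sub>R (q t + p t v* A t) - \<psi>t t v* A t = - (\<psi>h t v* M t)" unfolding h by simp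
  qed (use times \<xi>_t1 in auto)
  then show ?thesis by (simp add: \<psi>t_def[abs_def])
qed

lemma multiplier_\<psi>1:
  "t \<in> {0..T} - S \<Longrightarrow> \<psi>t t - \<mu> t *\<^sub>R p t = \<psi>1 t - (if t \<in> {t1<..<t2} then m t *\<^sub>R p t else 0)"
  using times by (auto simp: \<psi>t_def \<mu>_def \<psi>1_def)

text \<open>The form in which the result is handed on: here \<open>\<psi>\<close> is the compensated
  function, and the costate is \<open>\<psi> - \<mu> p\<close> throughout.\<close>

theorem linear_multipliers:
  "\<exists>\<psi> \<mu> c.
     solves S 0 T \<psi> (\<lambda>t. \<mu> t *\<^sub>R (q t + p t v* A t) - \<psi> t v* A t) \<and>
     mono_on {0..T} \<mu> \<and> (\<exists>L. L-lipschitz_on {t1..<t2} \<mu>) \<and>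
     (\<forall>t\<in>{0..<t1}. \<mu> t = \<mu> 0) \<and> (\<forall>t\<in>{t2..T}. \<mu> t = 0) \<and>
     \<psi> 0 - \<mu> 0 *\<^sub>R p 0 = J0 \<and> \<psi> T = - JT \<and>
     (\<forall>t\<in>{0..T} - S. (\<psi> t - \<mu> t *\<^sub>R p t) \<bullet> e t = c) \<and>
     (\<forall>t\<in>{t1<..<t2}. (\<psi> t - \<mu> t *\<^sub>R p t) v* B t = 0) \<and>
     (\<forall>\<tau>\<in>{0<..<t1} \<union> {t2<..<T}. \<forall>w. strict \<tau> w \<longrightarrow> ((\<psi> \<tau> - \<mu> \<tau> *\<^sub>R p \<tau>) v* B \<tau>) \<bullet> w \<le> 0)"
proof -
  obtain c where c: "\<forall>t\<in>{0..T} - S. \<psi>1 t \<bullet> e t = c" using hamiltonian_constant by blast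
  have H: "(\<psi>t t - \<mu> t *\<^sub>R p t) \<bullet> e t = c" if t: "t \<in> {0..T} - S" for t
    unfolding multiplier_\<psi>1[OF t] using c t pe[of t] by (simp add: inner_diff_left)
  have st: "(\<psi>t t - \<mu> t *\<^sub>R p t) v* B t = 0" if t: "t \<in> {t1<..<t2}" for t
  proof -
    have "t \<in> {0..T} - S" using t times by auto
    then have "(\<psi>t t - \<mu> t *\<^sub>R p t) v* B t = (\<psi>1 t - m t *\<^sub>R p t) v* B t" using multiplier_\<psi>1[of t] t by simp
    also have "\<dots> = \<psi>1 t v* B t - m t *\<^sub>R g t"
      by (simp add: g_def bounded_bilinear.diff_left[OF bounded_bilinear_vector_matrix_mult]
          bounded_bilinear.scaleR_left[OF bounded_bilinear_vector_matrix_mult])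
    finally show ?thesis using stationarity_boundary[OF t] by simp
  qed
  have fr: "((\<psi>t \<tau> - \<mu> \<tau> *\<^sub>R p \<tau>) v* B \<tau>) \<bullet> w \<le> 0" if \<tau>: "\<tau> \<in> {0<..<t1} \<union> {t2<..<T}" "strict \<tau> w" for \<tau> w
  proof -
    have "\<tau> \<in> {0..T} - S" "\<tau> \<notin> {t1<..<t2}" using \<tau>(1) times by auto
    then have "\<psi>t \<tau> - \<mu> \<tau> *\<^sub>R p \<tau> = \<psi>1 \<tau>"
      using multiplier_\<psi>1[of \<tau>] by (simp only: if_False diff_0_right)
    then show ?thesis using stationarity_free[OF \<tau>] by simp
  qed
  obtain L where "L-lipschitz_on {t1..<t2} m" using m_lipschitz by blast
  then have "L-lipschitz_on {t1..<t2} \<mu>"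
    by (rule lipschitz_on_transform) (auto simp: \<mu>_def)
  then have "\<exists>L. L-lipschitz_on {t1..<t2} \<mu>" by blast
  moreover have "\<forall>t\<in>{0..<t1}. \<mu> t = \<mu> 0" "\<forall>t\<in>{t2..T}. \<mu> t = 0" using times by (auto simp: \<mu>_def)
  moreover have "\<psi>t 0 - \<mu> 0 *\<^sub>R p 0 = J0" "\<psi>t T = - JT"
    using times \<xi>(1) \<psi>h(1) by (simp_all add: \<psi>t_def \<mu>_def)
  ultimately show ?thesis using \<psi>t_solves \<mu>_mono H st fr
    by - (rule exI[of _ \<psi>t], rule exI[of _ \<mu>], rule exI[of _ c], intro conjI, assumption+, blast+)
qed

end

section \<open>Control multipliers\<close>

text \<open>The hull is that of a set of vectors, whereas the multipliers belong to indices, and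
  equal vectors may occur at different indices.\<close>

lemma convex_cone_hull_image_explicit:
  assumes "finite I" "a \<in> convex_cone hull (v ` I)"
  shows "\<exists>h. (\<forall>i\<in>I. 0 \<le> h i) \<and> a = (\<Sum>i\<in>I. h i *\<^sub>R v i)"
proof -
  let ?C = "{a. \<exists>h. (\<forall>i\<in>I. 0 \<le> h i) \<and> a = (\<Sum>i\<in>I. h i *\<^sub>R v i)}"
  have "convex_cone ?C"
    unfolding convex_cone_iff
  proof (intro conjI ballI allI impI)
    show "0 \<in> ?C" by (auto intro: exI[of _ "\<lambda>_. 0"])
    fix x y assume "x \<in> ?C" "y \<in> ?C"
    then obtain h k where "\<forall>i\<in>I. 0 \<le> h i" "x = (\<Sum>i\<in>I. h i *\<^sub>R v i)" "\<forall>i\<in>I. 0 \<le> k i" "y = (\<Sum>i\<in>I. k i *\<^sub>R v i)" by auto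
    then show "x + y \<in> ?C"
      by (auto intro!: exI[of _ "\<lambda>i. h i + k i"] simp: scaleR_add_left sum.distrib)
  next
    fix x and c :: real assume "x \<in> ?C" "0 \<le> c"
    then obtain h where "\<forall>i\<in>I. 0 \<le> h i" "x = (\<Sum>i\<in>I. h i *\<^sub>R v i)" by auto
    then show "c *\<^sub>R x \<in> ?C" using \<open>0 \<le> c\<close>
      by (auto intro!: exI[of _ "\<lambda>i. c * h i"] simp: scaleR_sum_right)
  qed
  moreover have "v i \<in> ?C" if "i \<in> I" for i
  proof -
    have "v i = (\<Sum>j\<in>I. (if j = i then 1 else 0) *\<^sub>R v j)"
      using assms(1) that by (simp add: if_distrib[of "\<lambda>c. c *\<^sub>R _"] cong: if_cong)
    then show ?thesis by (auto intro!: exI[of _ "\<lambda>j. if j = i then 1 else 0"])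
  qed
  ultimately have "convex_cone hull (v ` I) \<subseteq> ?C" by (intro hull_minimal) auto
  then show ?thesis using assms(2) by blast
qed

text \<open>Gordan's alternative: positive independence keeps 0 out of the compact convex hull of
  the vectors, and a strictly separating functional, negated, is the direction.\<close>

lemma positively_independent_strict_direction:
  fixes v :: "'i \<Rightarrow> 'a::euclidean_space"
  assumes "finite I" "positively_independent I v"
  shows "\<exists>w. \<forall>i\<in>I. v i \<bullet> w < 0"
proof -
  let ?C = "{a. \<exists>h. (\<forall>i\<in>I. 0 \<le> h i) \<and> sum h I = 1 \<and> a = (\<Sum>i\<in>I. h i *\<^sub>R v i)}"
  have "convex ?C"
  proof (rule convexI)
    fix x y and s t :: real assume "x \<in> ?C" "y \<in> ?C" and st: "0 \<le> s" "0 \<le> t" "s + t = 1"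
    then obtain h k where hk: "\<forall>i\<in>I. 0 \<le> h i" "sum h I = 1" "x = (\<Sum>i\<in>I. h i *\<^sub>R v i)"
      "\<forall>i\<in>I. 0 \<le> k i" "sum k I = 1" "y = (\<Sum>i\<in>I. k i *\<^sub>R v i)" by auto
    have "(\<Sum>i\<in>I. s * h i + t * k i) = 1"
      using hk st by (simp add: sum.distrib sum_distrib_left[symmetric])
    moreover have "s *\<^sub>R x + t *\<^sub>R y = (\<Sum>i\<in>I. (s * h i + t * k i) *\<^sub>R v i)"
      using hk by (simp add: scaleR_sum_right scaleR_add_left sum.distrib)
    ultimately show "s *\<^sub>R x + t *\<^sub>R y \<in> ?C"
      using hk st by (auto intro!: exI[of _ "\<lambda>i. s * h i + t * k i"])
  qed
  moreover have vC: "v i \<in> ?C" if "i \<in> I" for i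
  proof -
    have "v i = (\<Sum>j\<in>I. (if j = i then 1 else 0) *\<^sub>R v j)"
      using assms(1) that by (simp add: if_distrib[of "\<lambda>c. c *\<^sub>R _"] cong: if_cong)
    then show ?thesis using assms(1) that by (auto intro!: exI[of _ "\<lambda>j. if j = i then 1 else 0"])
  qed
  ultimately have "convex hull (v ` I) \<subseteq> ?C" by (intro hull_minimal) auto
  moreover have "0 \<notin> ?C"
  proof
    assume "0 \<in> ?C"
    then obtain h where h: "\<forall>i\<in>I. 0 \<le> h i" "sum h I = 1" "(\<Sum>i\<in>I. h i *\<^sub>R v i) = 0" by auto
    then have "\<forall>i\<in>I. h i = 0" using assms(2) unfolding positively_independent_def by blast
    then show False using h(2) by simp
  qed
  ultimately have "0 \<notin> convex hull (v ` I)" by blast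
  moreover have "closed (convex hull (v ` I))"
    using assms(1) by (intro compact_imp_closed finite_imp_compact_convex_hull finite_imageI)
  ultimately obtain a b where "0 < b" "\<forall>x\<in>convex hull (v ` I). a \<bullet> x > b"
    using separating_hyperplane_closed_0[OF convex_convex_hull] by blast
  then have "\<forall>i\<in>I. 0 < a \<bullet> v i" using hull_inc[of _ "v ` I"] by (meson imageI less_trans)
  then show ?thesis by (intro exI[of _ "- a"]) (simp add: inner_commute)
qed

text \<open>If \<open>a\<close> is outside the closed cone, a separating \<open>w\<close> has
  \<open>a \<bullet> w < 0\<close> and \<open>v i \<bullet> w \<ge> 0\<close>. Only strict
  directions may be tested, so \<open>- w\<close> is tilted slightly by a strict direction
  \<open>w0\<close>.\<close>

lemma farkas_strict:
  fixes v :: "'i \<Rightarrow> 'a::euclidean_space"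
  assumes I: "finite I" and pos: "positively_independent I v"
    and a: "\<And>w. (\<forall>i\<in>I. v i \<bullet> w < 0) \<Longrightarrow> a \<bullet> w \<le> 0"
  shows "\<exists>h. (\<forall>i\<in>I. 0 \<le> h i) \<and> a = (\<Sum>i\<in>I. h i *\<^sub>R v i)"
proof (rule convex_cone_hull_image_explicit[OF I], rule ccontr)
  let ?C = "convex_cone hull (v ` I)"
  assume "a \<notin> ?C"
  moreover have "closed ?C" using I by (intro closed_convex_cone_hull finite_imageI)
  ultimately obtain w b where w: "w \<bullet> a < b" "\<forall>x\<in>?C. w \<bullet> x > b"
    using separating_hyperplane_closed_point[OF convex_convex_cone_hull] by blast
  have "b < 0" using w(2) convex_cone_hull_contains_0[of "v ` I"] by force
  have nn: "0 \<le> w \<bullet> x" if x: "x \<in> ?C" for x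
  proof (rule ccontr)
    assume "\<not> 0 \<le> w \<bullet> x"
    then have neg: "w \<bullet> x < 0" by simp
    have "(b / (w \<bullet> x)) *\<^sub>R x \<in> ?C" using x \<open>b < 0\<close> neg by (intro convex_cone_hull_mul) (auto simp: divide_nonpos_neg)
    then have "w \<bullet> ((b / (w \<bullet> x)) *\<^sub>R x) > b" using w(2) by blast
    then show False using neg by simp
  qed
  obtain w0 where w0: "\<forall>i\<in>I. v i \<bullet> w0 < 0" using positively_independent_strict_direction[OF I pos] by blast
  \<comment> \<open>The tilt uses up at most half of the gap
    \<open>- (a \<bullet> w)\<close>.\<close>
  define \<epsilon> where "\<epsilon> = (- (a \<bullet> w) / 2) / (\<bar>a \<bullet> w0\<bar> + 1)"
  have aw: "a \<bullet> w < 0" using w(1) \<open>b < 0\<close> by (simp add: inner_commute)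
  have \<epsilon>: "0 < \<epsilon>" using aw by (simp add: \<epsilon>_def add_nonneg_pos divide_neg_pos)
  have "a \<bullet> (\<epsilon> *\<^sub>R w0 - w) \<le> 0"
  proof (rule a, rule ballI)
    fix i assume i: "i \<in> I"
    have "0 \<le> v i \<bullet> w" using nn[of "v i"] i by (simp add: hull_inc inner_commute)
    moreover have "\<epsilon> * (v i \<bullet> w0) < 0" using w0 i \<epsilon> by (simp add: mult_pos_neg)
    ultimately show "v i \<bullet> (\<epsilon> *\<^sub>R w0 - w) < 0" by (simp add: inner_diff_right)
  qed
  then have "\<epsilon> * (a \<bullet> w0) \<le> a \<bullet> w" by (simp add: inner_diff_right)
  moreover have "a \<bullet> w < \<epsilon> * (a \<bullet> w0)"
  proof -
    have "- (\<epsilon> * (a \<bullet> w0)) \<le> \<epsilon> * (\<bar>a \<bullet> w0\<bar> + 1)"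
      using mult_left_mono[of "- (a \<bullet> w0)" "\<bar>a \<bullet> w0\<bar> + 1" \<epsilon>] \<epsilon> by simp
    also have "\<dots> = - (a \<bullet> w) / 2"
    proof -
      have "\<bar>a \<bullet> w0\<bar> + 1 \<noteq> 0" by linarith
      moreover have "x / y * y = x" if "y \<noteq> 0" for x y :: real using that by simp
      ultimately show ?thesis unfolding \<epsilon>_def by blast
    qed
    finally show ?thesis using aw by linarith
  qed
  ultimately show False by linarith
qed

text \<open>The element of least norm is a Borel selection: it lies in a closed set \<open>C\<close> iff for every rational
  \<open>q\<close> at least the least norm, \<open>C\<close> meets the section within the ball of radius \<open>q\<close>.\<close>

lemma compact_graph_selection:
  fixes G :: "(real \<times> 'a::euclidean_space) set"
  assumes G: "compact G" and conv: "\<And>t. convex {h. (t, h) \<in> G}"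
  shows "\<exists>h. h \<in> borel_measurable borel \<and> (\<forall>t\<in>fst ` G. (t, h t) \<in> G) \<and> (\<forall>t. t \<notin> fst ` G \<longrightarrow> h t = 0)"
proof -
  let ?K = "\<lambda>t. {h. (t, h) \<in> G}"
  have Kc: "closed (?K t)" for t
  proof -
    have "closed (Pair t -` G)"
      by (intro continuous_closed_vimage compact_imp_closed G) (auto intro: continuous_intros)
    then show ?thesis by (simp add: vimage_def)
  qed
  define h where "h t = (if t \<in> fst ` G then closest_point (?K t) 0 else 0)" for t
  have hK: "(t, h t) \<in> G" "\<And>k. (t, k) \<in> G \<Longrightarrow> norm (h t) \<le> norm k" if "t \<in> fst ` G" for t
  proof -
    have ne: "?K t \<noteq> {}" using that by force
    show "(t, h t) \<in> G" using closest_point_in_set[OF Kc ne, of 0] that by (simp add: h_def)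
    show "norm (h t) \<le> norm k" if "(t, k) \<in> G" for k
      using closest_point_le[OF Kc, of k t 0] \<open>t \<in> fst ` G\<close> that by (simp add: h_def)
  qed
  have huniq: "k = h t" if "(t, k) \<in> G" "norm k \<le> norm (h t)" for t k
  proof -
    have t: "t \<in> fst ` G" using that by force
    have "\<forall>z\<in>?K t. dist 0 k \<le> dist 0 z" using that(2) hK(2)[OF t] by (auto intro: order_trans)
    then show ?thesis using closest_point_unique[OF conv[of t] Kc, of k 0] that(1) t by (simp add: h_def)
  qed
  \<comment> \<open>The times at which the section meets \<open>C\<close> within radius
    \<open>q\<close>; as a projection of a compact set it is closed for closed
    \<open>C\<close>.\<close>
  define E where "E C q = fst ` (G \<inter> UNIV \<times> (C \<inter> cball 0 q))" for C and q :: real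
  have Ec: "closed (E C q)" if "closed C" for C q
  proof -
    have "compact (G \<inter> UNIV \<times> (C \<inter> cball 0 q))"
      by (intro compact_Int_closed G closed_Times closed_Int that) auto
    then show ?thesis unfolding E_def by (intro compact_imp_closed compact_continuous_image continuous_intros)
  qed
  have key: "h t \<in> C \<longleftrightarrow> (\<forall>q\<in>\<rat>. t \<in> E UNIV q \<longrightarrow> t \<in> E C q)" if t: "t \<in> fst ` G" and C: "closed C" for t C
  proof
    assume hC: "h t \<in> C"
    show "\<forall>q\<in>\<rat>. t \<in> E UNIV q \<longrightarrow> t \<in> E C q"
    proof (intro ballI impI)
      fix q assume "t \<in> E UNIV q"
      then obtain k where "(t, k) \<in> G" "norm k \<le> q" by (auto simp: E_def)
      then have "norm (h t) \<le> q" using hK(2)[OF t] order_trans by blast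
      then have "(t, h t) \<in> G \<inter> UNIV \<times> (C \<inter> cball 0 q)" using hK(1)[OF t] hC by simp
      then show "t \<in> E C q" unfolding E_def by force
    qed
  next
    assume *: "\<forall>q\<in>\<rat>. t \<in> E UNIV q \<longrightarrow> t \<in> E C q"
    let ?F = "?K t \<inter> C"
    have F: "\<exists>k\<in>?F. norm k \<le> norm (h t) + e" if "0 < e" for e
    proof -
      have "norm (h t) < norm (h t) + e" using that by simp
      from Rats_dense_in_real[OF this]
      obtain q where q: "q \<in> \<rat>" "norm (h t) < q" "q < norm (h t) + e" by blast
      have "(t, h t) \<in> G \<inter> UNIV \<times> (UNIV \<inter> cball 0 q)" using hK(1)[OF t] q by simp
      then have "t \<in> E UNIV q" unfolding E_def by force
      then have "t \<in> E C q" using * q(1) by blast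
      then obtain k where "(t, k) \<in> G" "k \<in> C" "norm k \<le> q" by (auto simp: E_def)
      then show ?thesis using q(3) by force
    qed
    have "?F \<noteq> {}" using F[of 1] by auto
    moreover have Fc: "closed ?F" using Kc C by (rule closed_Int)
    ultimately have c: "closest_point ?F 0 \<in> ?F" by (intro closest_point_in_set)
    have "norm (closest_point ?F 0) \<le> norm (h t)"
    proof (rule field_le_epsilon)
      fix e :: real assume "0 < e"
      then obtain k where k: "k \<in> ?F" "norm k \<le> norm (h t) + e" using F by blast
      then show "norm (closest_point ?F 0) \<le> norm (h t) + e"
        using closest_point_le[OF Fc k(1), of 0] by simp
    qed
    then have "closest_point ?F 0 = h t" using huniq c by blast
    then show "h t \<in> C" using c by simp
  qed
  define D where "D = fst ` G"
  have h0: "h t = 0" if "t \<notin> D" for t using that by (simp add: h_def D_def)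
  have D: "closed D" unfolding D_def by (intro compact_imp_closed compact_continuous_image continuous_intros G)
  have closed_meas: "h -` C \<in> sets borel" if C: "closed C" for C
  proof -
    have "h t \<in> C \<longleftrightarrow> (\<forall>q\<in>\<rat>. t \<in> E UNIV q \<longrightarrow> t \<in> E C q)" if "t \<in> D" for t
      using key[OF _ C] that by (simp add: D_def)
    then have "t \<in> h -` C \<longleftrightarrow> t \<in> (D \<inter> (\<Inter>q\<in>\<rat>. - E UNIV q \<union> E C q)) \<union> (if 0 \<in> C then - D else {})" for t
      using h0 by (cases "t \<in> D") auto
    then have "h -` C = (D \<inter> (\<Inter>q\<in>\<rat>. - E UNIV q \<union> E C q)) \<union> (if 0 \<in> C then - D else {})" by blast
    moreover have "(\<Inter>q\<in>\<rat>. - E UNIV q \<union> E C q) \<in> sets borel"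
      using Ec[OF C] Ec[OF closed_UNIV] countable_rat
      by (intro sets.countable_INT') auto
    ultimately show ?thesis using D by auto
  qed
  have "h \<in> borel_measurable borel"
  proof (rule borel_measurableI)
    fix S :: "'a set" assume "open S"
    then have "h -` (- S) \<in> sets borel" by (intro closed_meas) auto
    moreover have "h -` S = - (h -` (- S))" by auto
    ultimately show "h -` S \<inter> space borel \<in> sets borel" by auto
  qed
  then show ?thesis using hK(1) by (intro exI[of _ h]) (auto simp: h_def)
qed

section \<open>Integration by parts for Riemann--Stieltjes integrals\<close>

text \<open>A weak bound by a fixed multiple of \<epsilon> suffices, so estimates can be added
  without rescaling.\<close>

lemma has_RS_integralI:
  assumes "\<And>\<epsilon>. 0 < \<epsilon> \<Longrightarrow> \<exists>\<delta>>0. \<forall>p. p tagged_division_of {a..b} \<longrightarrow> (\<lambda>x. ball x \<delta>) fine p \<longrightarrow>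
    \<bar>(\<Sum>(x, K)\<in>p. g x * (\<mu> (Sup K) - \<mu> (Inf K))) - I\<bar> \<le> C * \<epsilon>" and "0 \<le> C"
  shows "has_RS_integral g \<mu> a b I"
  unfolding has_RS_integral_def
proof (intro allI impI)
  fix \<epsilon> :: real assume "0 < \<epsilon>"
  have C: "0 < C + 1" using \<open>0 \<le> C\<close> by simp
  then have "0 < \<epsilon> / (C + 1)" using \<open>0 < \<epsilon>\<close> by simp
  from assms(1)[OF this] obtain \<delta> where \<delta>: "0 < \<delta>" "\<And>p. p tagged_division_of {a..b} \<Longrightarrow> (\<lambda>x. ball x \<delta>) fine p \<Longrightarrow>
    \<bar>(\<Sum>(x, K)\<in>p. g x * (\<mu> (Sup K) - \<mu> (Inf K))) - I\<bar> \<le> C * (\<epsilon> / (C + 1))" by blast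
  have "C * (\<epsilon> / (C + 1)) < (C + 1) * (\<epsilon> / (C + 1))" using C \<open>0 < \<epsilon>\<close> by (intro mult_strict_right_mono) auto
  also have "\<dots> = \<epsilon>" using C by simp
  finally have "C * (\<epsilon> / (C + 1)) < \<epsilon>" .
  then show "\<exists>\<delta>>0. \<forall>p. p tagged_division_of {a..b} \<and> (\<lambda>x. ball x \<delta>) fine p \<longrightarrow>
      \<bar>(\<Sum>(x, K)\<in>p. g x * (\<mu> (Sup K) - \<mu> (Inf K))) - I\<bar> < \<epsilon>"
    using \<delta> by (intro exI[of _ \<delta>]) (auto intro: le_less_trans)
qed

text \<open>The jumps of \<open>\<mu>\<close> need no separate treatment: on a short interval \<open>K\<close> the error in replacing
  \<open>d(\<mu> p)\<close> by \<open>p d\<mu> + \<mu> dp\<close> is at most the length of \<open>K\<close> times the increment of \<open>\<mu>\<close>.\<close>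

lemma RS_integral_product:
  fixes \<psi> \<mu> p \<alpha> q :: "real \<Rightarrow> real"
  assumes S: "finite S" and ab: "a \<le> b" and mono: "mono_on {a..b} \<mu>"
    and \<psi>: "solves S a b \<psi> (\<lambda>t. \<mu> t * q t - \<alpha> t)" and p: "solves S a b p q"
    and \<mu>: "bcont_off S a b \<mu>" and q: "bcont_off S a b q" and \<alpha>: "bcont_off S a b \<alpha>"
    and g: "continuous_on {a..b} g" and B: "has_RS_integral (\<lambda>t. g t * p t) \<mu> a b B"
  shows "has_RS_integral g (\<lambda>t. \<psi> t - \<mu> t * p t) a b (- integral {a..b} (\<lambda>t. g t * \<alpha> t) - B)"
proof -
  obtain Cq where Cq: "0 \<le> Cq" "\<And>t. t \<in> {a..b} \<Longrightarrow> \<bar>q t\<bar> \<le> Cq" using bcont_off_bound[OF q] by auto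
  obtain C\<alpha> where C\<alpha>: "0 \<le> C\<alpha>" "\<And>t. t \<in> {a..b} \<Longrightarrow> \<bar>\<alpha> t\<bar> \<le> C\<alpha>" using bcont_off_bound[OF \<alpha>] by auto
  obtain Cg where Cg: "0 \<le> Cg" "\<And>t. t \<in> {a..b} \<Longrightarrow> \<bar>g t\<bar> \<le> Cg"
    using bcont_off_bound[OF bcont_off_continuous[OF g, of S]] by auto
  define V where "V = \<mu> b - \<mu> a"
  have V: "0 \<le> V" using mono ab by (auto simp: V_def mono_on_def)
  have ga: "bcont_off S a b (\<lambda>t. g t * \<alpha> t)" by (intro bcont_off_intros \<alpha> bcont_off_continuous[OF g])
  define I where "I = integral {a..b} (\<lambda>t. g t * \<alpha> t)"
  define Ga where "Ga t = integral {a..t} (\<lambda>t. g t * \<alpha> t)" for t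
  have Gas: "solves S a b Ga (\<lambda>t. g t * \<alpha> t)"
    by (rule solves_of_integral[OF S ga, of _ 0]) (simp add: Ga_def)
  show ?thesis
  proof (rule has_RS_integralI[where C = "Cg * (2 * Cq * V) + C\<alpha> * (b - a) + 1"])
    fix \<epsilon> :: real assume "0 < \<epsilon>"
    have "uniformly_continuous_on {a..b} g" using g by (rule compact_uniformly_continuous) simp
    then obtain \<delta>1 where \<delta>1: "0 < \<delta>1" "\<And>s t. s \<in> {a..b} \<Longrightarrow> t \<in> {a..b} \<Longrightarrow> \<bar>s - t\<bar> < \<delta>1 \<Longrightarrow> \<bar>g s - g t\<bar> < \<epsilon>"
      using \<open>0 < \<epsilon>\<close> unfolding uniformly_continuous_on_def dist_real_def by metis
    from B[unfolded has_RS_integral_def, THEN spec[of _ \<epsilon>], THEN mp, OF \<open>0 < \<epsilon>\<close>]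
    obtain \<delta>2 where \<delta>2: "0 < \<delta>2" "\<forall>P. P tagged_division_of {a..b} \<and> (\<lambda>x. ball x \<delta>2) fine P \<longrightarrow>
       \<bar>(\<Sum>(x, K)\<in>P. g x * p x * (\<mu> (Sup K) - \<mu> (Inf K))) - B\<bar> < \<epsilon>"
      by (elim exE conjE) (rule that)
    define \<delta> where "\<delta> = min \<epsilon> (min \<delta>1 \<delta>2)"
    have \<delta>: "0 < \<delta>" "\<delta> \<le> \<epsilon>" "\<delta> \<le> \<delta>1" "\<delta> \<le> \<delta>2" using \<open>0 < \<epsilon>\<close> \<delta>1(1) \<delta>2(1) by (auto simp: \<delta>_def)
    have main: "\<bar>(\<Sum>(x, K)\<in>P. g x * ((\<psi> (Sup K) - \<mu> (Sup K) * p (Sup K)) - (\<psi> (Inf K) - \<mu> (Inf K) * p (Inf K)))) - (- I - B)\<bar>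
        \<le> (Cg * (2 * Cq * V) + C\<alpha> * (b - a) + 1) * \<epsilon>"
      if P: "P tagged_division_of {a..b}" and fine: "(\<lambda>x. ball x \<delta>) fine P" for P
    proof -
      \<comment> \<open>The error of one cell in the identity d(\<psi> - \<mu> p) = - \<alpha> dt -
        p d\<mu> weighted with \<open>g\<close>, the integral of \<open>g * \<alpha>\<close> being
        taken exactly.\<close>
      define d where "d x K = g x * ((\<psi> (Sup K) - \<mu> (Sup K) * p (Sup K)) - (\<psi> (Inf K) - \<mu> (Inf K) * p (Inf K)))
          + g x * p x * (\<mu> (Sup K) - \<mu> (Inf K)) + (Ga (Sup K) - Ga (Inf K))" for x K
      have fine2: "(\<lambda>x. ball x \<delta>2) fine P"
        unfolding fine_def
      proof clarify
        fix x K y assume "(x, K) \<in> P" "y \<in> K"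
        then have "y \<in> ball x \<delta>" using fineD[OF fine] by blast
        then show "y \<in> ball x \<delta>2" using \<delta>(4) by simp
      qed
      have each: "\<bar>d x K\<bar> \<le> Cg * (2 * Cq * \<epsilon>) * (\<mu> (Sup K) - \<mu> (Inf K)) + \<epsilon> * C\<alpha> * (Sup K - Inf K)" if xK: "(x, K) \<in> P" for x K
      proof -
        obtain u v where uv: "K = {u..v}" "a \<le> u" "u \<le> x" "x \<le> v" "v \<le> b" "Inf K = u" "Sup K = v"
          using tagged_division_interval[OF P xK] by blast
        have dl: "\<bar>v - x\<bar> < \<delta>" "\<bar>u - x\<bar> < \<delta>" using fine_ball_interval[OF P xK fine] uv by auto
        have uvle: "u \<le> v" using uv by simp
        have sub: "bcont_off S u v h" if "bcont_off S a b h" for h :: "real \<Rightarrow> real"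
          using bcont_off_subinterval[OF that] uv by auto
        have i\<mu>q: "(\<lambda>t. \<mu> t * q t) integrable_on {u..v}"
          by (rule bcont_off_integrable[OF S sub]) (intro bcont_off_intros \<mu> q)
        have i\<alpha>: "\<alpha> integrable_on {u..v}" by (rule bcont_off_integrable[OF S sub[OF \<alpha>]])
        have iga: "(\<lambda>t. g t * \<alpha> t) integrable_on {u..v}" by (rule bcont_off_integrable[OF S sub[OF ga]])
        have \<psi>d: "((\<lambda>t. \<mu> t * q t - \<alpha> t) has_integral (\<psi> v - \<psi> u)) {u..v}"
          by (rule solves_has_integral[OF S \<psi>]) (use uv in auto)
        have pd: "(q has_integral (p v - p x)) {x..v}" "(q has_integral (p x - p u)) {u..x}"
          by (rule solves_has_integral[OF S p]; use uv in simp)+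
        have gd: "((\<lambda>t. g t * \<alpha> t) has_integral (Ga v - Ga u)) {u..v}"
          by (rule solves_has_integral[OF S Gas]) (use uv in auto)
        have m1: "\<mu> u \<le> \<mu> t" "\<mu> t \<le> \<mu> v" if "t \<in> {u..v}" for t
          using mono that uv by (auto simp: mono_on_def)
        define mq where "mq t = (if t \<le> x then (\<mu> t - \<mu> u) * q t else (\<mu> t - \<mu> v) * q t)" for t
        \<comment> \<open>Splitting at the tag, \<open>\<mu> v * p v - \<mu> u * p u = p x * (\<mu>
          v - \<mu> u) + \<mu> u * (p x - p u) + \<mu> v * (p v - p x)\<close>. The last two terms
          are compared with the integrals of \<open>\<mu> * q\<close> left and right of
          \<open>x\<close>, where \<mu> differs from \<open>\<mu> u\<close> and
          \<open>\<mu> v\<close> by at most its increment over the cell.\<close>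
        have h1: "((\<lambda>t. (\<mu> t - \<mu> u) * q t) has_integral (integral {u..x} (\<lambda>t. \<mu> t * q t) - \<mu> u * (p x - p u))) {u..x}"
        proof -
          have "(\<lambda>t. \<mu> t * q t) integrable_on {u..x}" using i\<mu>q by (rule integrable_on_subinterval) (use uv in auto)
          from has_integral_diff[OF integrable_integral[OF this] has_integral_mult_right[OF pd(2), of "\<mu> u"]]
          show ?thesis by (simp add: left_diff_distrib)
        qed
        have h2: "((\<lambda>t. (\<mu> t - \<mu> v) * q t) has_integral (integral {x..v} (\<lambda>t. \<mu> t * q t) - \<mu> v * (p v - p x))) {x..v}"
        proof -
          have "(\<lambda>t. \<mu> t * q t) integrable_on {x..v}" using i\<mu>q by (rule integrable_on_subinterval) (use uv in auto)
          from has_integral_diff[OF integrable_integral[OF this] has_integral_mult_right[OF pd(1), of "\<mu> v"]]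
          show ?thesis by (simp add: left_diff_distrib)
        qed
        have b1: "\<bar>integral {u..x} (\<lambda>t. \<mu> t * q t) - \<mu> u * (p x - p u)\<bar> \<le> (\<mu> v - \<mu> u) * Cq * (x - u)"
        proof -
          have "norm (integral {u..x} (\<lambda>t. \<mu> t * q t) - \<mu> u * (p x - p u)) \<le> ((\<mu> v - \<mu> u) * Cq) * measure lborel (cbox u x)"
          proof (rule has_integral_bound[of _ "\<lambda>t. (\<mu> t - \<mu> u) * q t"])
            show "0 \<le> (\<mu> v - \<mu> u) * Cq" using m1(1)[of v] uvle Cq by simp
            show "((\<lambda>t. (\<mu> t - \<mu> u) * q t) has_integral (integral {u..x} (\<lambda>t. \<mu> t * q t) - \<mu> u * (p x - p u))) (cbox u x)"
              using h1 by simp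
            fix t assume "t \<in> cbox u x"
            then have t: "t \<in> {u..v}" "t \<in> {a..b}" using uv by auto
            have "\<bar>\<mu> t - \<mu> u\<bar> * \<bar>q t\<bar> \<le> (\<mu> v - \<mu> u) * Cq"
              using m1[OF t(1)] Cq(2)[OF t(2)] by (intro mult_mono) auto
            then show "norm ((\<mu> t - \<mu> u) * q t) \<le> (\<mu> v - \<mu> u) * Cq" by (simp add: abs_mult)
          qed
          then show ?thesis using uv by simp
        qed
        have b2: "\<bar>integral {x..v} (\<lambda>t. \<mu> t * q t) - \<mu> v * (p v - p x)\<bar> \<le> (\<mu> v - \<mu> u) * Cq * (v - x)"
        proof -
          have "norm (integral {x..v} (\<lambda>t. \<mu> t * q t) - \<mu> v * (p v - p x)) \<le> ((\<mu> v - \<mu> u) * Cq) * measure lborel (cbox x v)"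
          proof (rule has_integral_bound[of _ "\<lambda>t. (\<mu> t - \<mu> v) * q t"])
            show "0 \<le> (\<mu> v - \<mu> u) * Cq" using m1(1)[of v] uvle Cq by simp
            show "((\<lambda>t. (\<mu> t - \<mu> v) * q t) has_integral (integral {x..v} (\<lambda>t. \<mu> t * q t) - \<mu> v * (p v - p x))) (cbox x v)"
              using h2 by simp
            fix t assume "t \<in> cbox x v"
            then have t: "t \<in> {u..v}" "t \<in> {a..b}" using uv by auto
            have "\<bar>\<mu> t - \<mu> v\<bar> * \<bar>q t\<bar> \<le> (\<mu> v - \<mu> u) * Cq"
              using m1[OF t(1)] Cq(2)[OF t(2)] by (intro mult_mono) auto
            then show "norm ((\<mu> t - \<mu> v) * q t) \<le> (\<mu> v - \<mu> u) * Cq" by (simp add: abs_mult)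
          qed
          then show ?thesis using uv by simp
        qed
        have comb: "integral {u..v} (\<lambda>t. \<mu> t * q t) = integral {u..x} (\<lambda>t. \<mu> t * q t) + integral {x..v} (\<lambda>t. \<mu> t * q t)"
          using Henstock_Kurzweil_Integration.integral_combine[OF uv(3,4) i\<mu>q] by simp
        have \<psi>v: "\<psi> v - \<psi> u = integral {u..v} (\<lambda>t. \<mu> t * q t) - integral {u..v} \<alpha>"
          using has_integral_unique[OF \<psi>d has_integral_diff[OF integrable_integral[OF i\<mu>q] integrable_integral[OF i\<alpha>]]] .
        define err where "err = (integral {u..x} (\<lambda>t. \<mu> t * q t) - \<mu> u * (p x - p u))
           + (integral {x..v} (\<lambda>t. \<mu> t * q t) - \<mu> v * (p v - p x))"
        have e1: "(\<psi> v - \<mu> v * p v) - (\<psi> u - \<mu> u * p u) + p x * (\<mu> v - \<mu> u) = err - integral {u..v} \<alpha>"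
          unfolding err_def using \<psi>v comb by (simp add: algebra_simps)
        have "\<bar>err\<bar> \<le> (\<mu> v - \<mu> u) * Cq * (x - u) + (\<mu> v - \<mu> u) * Cq * (v - x)"
          unfolding err_def using b1 b2 by linarith
        also have "\<dots> = (\<mu> v - \<mu> u) * Cq * (v - u)" by (simp add: algebra_simps)
        also have "\<dots> \<le> (\<mu> v - \<mu> u) * Cq * (2 * \<epsilon>)"
          using dl \<delta>(2) m1(1)[of v] uvle Cq(1) by (intro mult_left_mono) auto
        finally have ebd: "\<bar>err\<bar> \<le> (\<mu> v - \<mu> u) * Cq * (2 * \<epsilon>)" .
        have gxb: "\<bar>g x\<bar> \<le> Cg" using Cg(2)[of x] uv by auto
        have a2: "\<bar>(Ga v - Ga u) - g x * integral {u..v} \<alpha>\<bar> \<le> \<epsilon> * C\<alpha> * (v - u)"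
        proof -
          have "((\<lambda>t. g t * \<alpha> t - g x * \<alpha> t) has_integral ((Ga v - Ga u) - g x * integral {u..v} \<alpha>)) {u..v}"
            by (rule has_integral_diff[OF gd has_integral_mult_right[OF integrable_integral[OF i\<alpha>]]])
          then have "norm ((Ga v - Ga u) - g x * integral {u..v} \<alpha>) \<le> (\<epsilon> * C\<alpha>) * measure lborel (cbox u v)"
          proof (intro has_integral_bound[of "\<epsilon> * C\<alpha>" "\<lambda>t. g t * \<alpha> t - g x * \<alpha> t"])
            fix t assume "t \<in> cbox u v"
            then have t: "t \<in> {a..b}" "x \<in> {a..b}" "\<bar>t - x\<bar> < \<delta>1" using uv dl \<delta>(3) by auto
            have "\<bar>g t - g x\<bar> * \<bar>\<alpha> t\<bar> \<le> \<epsilon> * C\<alpha>"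
              using \<delta>1(2)[OF t] C\<alpha>(2)[OF t(1)] \<open>0 < \<epsilon>\<close> by (intro mult_mono) auto
            then show "norm (g t * \<alpha> t - g x * \<alpha> t) \<le> \<epsilon> * C\<alpha>" by (simp add: left_diff_distrib[symmetric] abs_mult)
          qed (use C\<alpha>(1) \<open>0 < \<epsilon>\<close> in auto)
          then show ?thesis using uvle by simp
        qed
        have "d x K = g x * err + ((Ga v - Ga u) - g x * integral {u..v} \<alpha>)"
        proof -
          have "d x K = g x * ((\<psi> v - \<mu> v * p v) - (\<psi> u - \<mu> u * p u) + p x * (\<mu> v - \<mu> u)) + (Ga v - Ga u)"
            unfolding d_def uv(6,7) by (simp add: algebra_simps)
          then show ?thesis unfolding e1 by (simp add: algebra_simps)
        qed
        then have "\<bar>d x K\<bar> \<le> \<bar>g x * err\<bar> + \<bar>(Ga v - Ga u) - g x * integral {u..v} \<alpha>\<bar>" by (simp only: abs_triangle_ineq)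
        also have "\<bar>g x * err\<bar> \<le> Cg * ((\<mu> v - \<mu> u) * Cq * (2 * \<epsilon>))"
          unfolding abs_mult using gxb ebd Cg(1) by (intro mult_mono) auto
        finally have "\<bar>d x K\<bar> \<le> Cg * ((\<mu> v - \<mu> u) * Cq * (2 * \<epsilon>)) + \<epsilon> * C\<alpha> * (v - u)" using a2 by linarith
        then show ?thesis unfolding uv(6,7) by (simp add: algebra_simps)
      qed
      have tel: "(\<Sum>(x, K)\<in>P. Ga (Sup K) - Ga (Inf K)) = I"
        using RS_sum_telescope[OF ab P, of Ga] by (simp add: Ga_def I_def)
      let ?R = "(\<Sum>(x, K)\<in>P. g x * ((\<psi> (Sup K) - \<mu> (Sup K) * p (Sup K)) - (\<psi> (Inf K) - \<mu> (Inf K) * p (Inf K))))"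
      let ?M = "(\<Sum>(x, K)\<in>P. g x * p x * (\<mu> (Sup K) - \<mu> (Inf K)))"
      have split: "?R + ?M + I = (\<Sum>(x, K)\<in>P. d x K)"
        unfolding d_def tel[symmetric] by (simp add: sum.distrib case_prod_unfold)
      have "\<bar>\<Sum>(x, K)\<in>P. d x K\<bar> \<le> (\<Sum>(x, K)\<in>P. Cg * (2 * Cq * \<epsilon>) * (\<mu> (Sup K) - \<mu> (Inf K)) + \<epsilon> * C\<alpha> * (Sup K - Inf K))"
        by (rule order_trans[OF sum_abs sum_mono]) (use each in auto)
      also have "\<dots> = Cg * (2 * Cq * \<epsilon>) * (\<Sum>(x, K)\<in>P. \<mu> (Sup K) - \<mu> (Inf K)) + \<epsilon> * C\<alpha> * (\<Sum>(x, K)\<in>P. Sup K - Inf K)"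
        by (simp add: sum.distrib sum_distrib_left case_prod_unfold)
      also have "\<dots> = Cg * (2 * Cq * \<epsilon>) * V + \<epsilon> * C\<alpha> * (b - a)"
        unfolding RS_sum_telescope[OF ab P, of \<mu>] RS_sum_telescope[OF ab P, of "\<lambda>x. x"] V_def by simp
      finally have "\<bar>?R + ?M + I\<bar> \<le> Cg * (2 * Cq * \<epsilon>) * V + \<epsilon> * C\<alpha> * (b - a)" unfolding split .
      moreover have "\<bar>?M - B\<bar> < \<epsilon>" using \<delta>2(2) P fine2 by blast
      ultimately have "\<bar>?R - (- I - B)\<bar> \<le> Cg * (2 * Cq * \<epsilon>) * V + \<epsilon> * C\<alpha> * (b - a) + \<epsilon>" by linarith
      then show ?thesis by (simp add: algebra_simps)
    qed
    show "\<exists>\<delta>>0. \<forall>P. P tagged_division_of {a..b} \<longrightarrow> (\<lambda>x. ball x \<delta>) fine P \<longrightarrow>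
      \<bar>(\<Sum>(x, K)\<in>P. g x * ((\<psi> (Sup K) - \<mu> (Sup K) * p (Sup K)) - (\<psi> (Inf K) - \<mu> (Inf K) * p (Inf K)))) -
        (- integral {a..b} (\<lambda>t. g t * \<alpha> t) - B)\<bar> \<le> (Cg * (2 * Cq * V) + C\<alpha> * (b - a) + 1) * \<epsilon>"
      using main \<delta>(1) unfolding I_def by (intro exI[of _ \<delta>]) blast
  qed (use Cg Cq V C\<alpha> ab in auto)
qed

text \<open>A cell that misses \<open>{c..d}\<close> carries no increment of \<mu>; in a short cell
  that meets it the integrand is small, because \<beta> vanishes at a point of the cell.\<close>

lemma RS_integral_complementary:
  fixes \<mu> \<beta> :: "real \<Rightarrow> real"
  assumes ab: "a \<le> b" and mono: "mono_on {a..b} \<mu>" and \<beta>: "continuous_on {a..b} \<beta>"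
    and zero: "\<And>t. t \<in> {c..d} \<Longrightarrow> \<beta> t = 0" and sub: "{c..d} \<subseteq> {a..b}"
    and const: "\<And>u v. a \<le> u \<Longrightarrow> u \<le> v \<Longrightarrow> v \<le> b \<Longrightarrow> {u..v} \<inter> {c..d} = {} \<Longrightarrow> \<mu> u = \<mu> v"
    and g: "continuous_on {a..b} g"
  shows "has_RS_integral (\<lambda>t. g t * \<beta> t) \<mu> a b 0"
proof (rule has_RS_integralI[where C = "\<mu> b - \<mu> a"])
  show "0 \<le> \<mu> b - \<mu> a" using mono ab by (auto simp: mono_on_def)
  fix \<epsilon> :: real assume "0 < \<epsilon>"
  have "uniformly_continuous_on {a..b} (\<lambda>t. g t * \<beta> t)"
    by (intro compact_uniformly_continuous continuous_on_mult g \<beta>) simp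
  then obtain \<delta> where \<delta>: "0 < \<delta>" "\<And>s t. s \<in> {a..b} \<Longrightarrow> t \<in> {a..b} \<Longrightarrow> \<bar>s - t\<bar> < \<delta> \<Longrightarrow> \<bar>g s * \<beta> s - g t * \<beta> t\<bar> < \<epsilon>"
    using \<open>0 < \<epsilon>\<close> unfolding uniformly_continuous_on_def dist_real_def by metis
  have main: "\<bar>(\<Sum>(x, K)\<in>P. g x * \<beta> x * (\<mu> (Sup K) - \<mu> (Inf K))) - 0\<bar> \<le> (\<mu> b - \<mu> a) * \<epsilon>"
    if P: "P tagged_division_of {a..b}" and fine: "(\<lambda>x. ball x \<delta>) fine P" for P
  proof -
    have "\<bar>\<Sum>(x, K)\<in>P. g x * \<beta> x * (\<mu> (Sup K) - \<mu> (Inf K))\<bar> \<le> (\<Sum>(x, K)\<in>P. \<epsilon> * (\<mu> (Sup K) - \<mu> (Inf K)))"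
    proof (rule order_trans[OF sum_abs sum_mono], clarify)
      fix x K assume xK: "(x, K) \<in> P"
      obtain u v where uv: "K = {u..v}" "a \<le> u" "u \<le> x" "x \<le> v" "v \<le> b" "Inf K = u" "Sup K = v"
        using tagged_division_interval[OF P xK] by blast
      have dl: "\<bar>v - x\<bar> < \<delta>" "\<bar>u - x\<bar> < \<delta>" using fine_ball_interval[OF P xK fine] uv by auto
      have m: "0 \<le> \<mu> v - \<mu> u" using mono uv by (auto simp: mono_on_def)
      show "\<bar>g x * \<beta> x * (\<mu> (Sup K) - \<mu> (Inf K))\<bar> \<le> \<epsilon> * (\<mu> (Sup K) - \<mu> (Inf K))"
      proof (cases "{u..v} \<inter> {c..d} = {}")
        case True
        then show ?thesis using const[of u v] uv by simp
      next
        case False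
        then obtain t where t: "t \<in> {u..v}" "t \<in> {c..d}" by blast
        have "\<bar>g x * \<beta> x - g t * \<beta> t\<bar> < \<epsilon>" using t uv dl by (intro \<delta>(2)) auto
        then have "\<bar>g x * \<beta> x\<bar> \<le> \<epsilon>" using zero[OF t(2)] by simp
        then have "\<bar>g x * \<beta> x\<bar> * \<bar>\<mu> v - \<mu> u\<bar> \<le> \<epsilon> * (\<mu> v - \<mu> u)"
          using m \<open>0 < \<epsilon>\<close> by (intro mult_mono) auto
        then show ?thesis using uv by (simp add: abs_mult)
      qed
    qed
    also have "\<dots> = \<epsilon> * (\<mu> b - \<mu> a)"
      unfolding RS_sum_telescope[OF ab P, of \<mu>, symmetric] by (simp add: sum_distrib_left case_prod_unfold)
    finally show ?thesis by (simp add: mult.commute)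
  qed
  show "\<exists>\<delta>>0. \<forall>P. P tagged_division_of {a..b} \<longrightarrow> (\<lambda>x. ball x \<delta>) fine P \<longrightarrow>
      \<bar>(\<Sum>(x, K)\<in>P. g x * \<beta> x * (\<mu> (Sup K) - \<mu> (Inf K))) - 0\<bar> \<le> (\<mu> b - \<mu> a) * \<epsilon>"
    using main \<delta>(1) by (intro exI[of _ \<delta>]) blast
qed

section \<open>Piecewise defined controls and partial derivatives\<close>

text \<open>Farkas' lemma gives multipliers at each interior time, but the active set varies
  discontinuously. Encoding it by \<open>h \<bullet> b t = 0\<close> makes the graph of all
  multipliers closed, and positive independence bounds it, so the selection lemma for compact graphs
  applies.\<close>

lemma control_multiplier_selection:
  fixes D :: "real \<Rightarrow> real^'k::finite^'d::finite" and b :: "real \<Rightarrow> real^'d" and a :: "real \<Rightarrow> real^'k"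
  assumes cont: "continuous_on {c..d} D" "continuous_on {c..d} b" "continuous_on {c..d} a"
    and b: "\<And>t s. t \<in> {c..d} \<Longrightarrow> b t $ s \<le> 0"
    and pos: "\<And>t. t \<in> {c..d} \<Longrightarrow> positively_independent {s. b t $ s = 0} (\<lambda>s. D t $ s)"
    and a: "\<And>t w. t \<in> {c<..<d} \<Longrightarrow> (\<forall>s. b t $ s = 0 \<longrightarrow> D t $ s \<bullet> w < 0) \<Longrightarrow> a t \<bullet> w \<le> 0"
  shows "\<exists>h \<in> borel_measurable borel. bounded (range h) \<and>
    (\<forall>t\<in>{c<..<d}. (\<forall>s. 0 \<le> h t $ s) \<and> h t \<bullet> b t = 0 \<and> h t v* D t = a t)"
proof -
  have vm: "h v* X = (\<Sum>s\<in>UNIV. h $ s *\<^sub>R X $ s)" for h :: "real^'d" and X :: "real^'k^'d"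
    by (simp add: vec_eq_iff vector_matrix_mult_def algebra_simps)
  have slack: "h $ s = 0" if "\<And>s. 0 \<le> h $ s" "h \<bullet> b t = 0" "b t $ s \<noteq> 0" "t \<in> {c..d}" for h :: "real^'d" and t s
  proof -
    have "(\<Sum>s\<in>UNIV. - (h $ s * b t $ s)) = 0" using that(2) by (simp add: inner_vec_def sum_negf)
    moreover have "0 \<le> - (h $ s * b t $ s)" for s using that(1)[of s] b[OF that(4), of s] by (simp add: mult_nonneg_nonpos)
    ultimately have "- (h $ s * b t $ s) = 0" by (simp add: sum_nonneg_eq_0_iff)
    then show ?thesis using that(3) by simp
  qed
  define \<Delta> where "\<Delta> = {h :: real^'d. (\<forall>s. 0 \<le> h $ s) \<and> norm h = 1}"
  have cl\<Delta>: "closed {h :: real^'d. \<forall>s. 0 \<le> h $ s}"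
    by (intro closed_Collect_all closed_Collect_le continuous_intros)
  have \<Delta>: "compact \<Delta>"
  proof -
    have "\<Delta> = sphere 0 1 \<inter> {h. \<forall>s. 0 \<le> h $ s}" by (auto simp: \<Delta>_def)
    then show ?thesis using cl\<Delta> by (simp add: compact_Int_closed)
  qed
  \<comment> \<open>For \<open>h \<ge> 0\<close> of norm 1 this is positive: the second summand
    vanishes only if \<open>h\<close> is supported on the active indices, and then positive
    independence forbids that the first vanishes. Being continuous on a compact set it has a
    positive minimum \<open>R\<close>, uniform in time.\<close>
  let ?N = "\<lambda>(t, h). norm (h v* D t) + \<bar>h \<bullet> b t\<bar>"
  have fst_c: "continuous_on X (\<lambda>x. g (fst x))" if "continuous_on {c..d} g" "fst ` X \<subseteq> {c..d}"
    for g :: "real \<Rightarrow> 'z::real_normed_vector" and X :: "(real \<times> (real^'d)) set"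
    using continuous_on_compose2[OF that(1) continuous_on_fst[OF continuous_on_id] that(2)] .
  have Nc: "continuous_on ({c..d} \<times> \<Delta>) ?N"
    unfolding case_prod_unfold
    by (intro continuous_on_add continuous_on_norm continuous_on_rabs continuous_on_inner
        bounded_bilinear.continuous_on[OF bounded_bilinear_vector_matrix_mult] fst_c cont continuous_on_snd continuous_on_id) auto
  obtain R where R: "0 < R" "\<And>t h. t \<in> {c..d} \<Longrightarrow> h \<in> \<Delta> \<Longrightarrow> R \<le> ?N (t, h)"
  proof (cases "{c..d} \<times> \<Delta> = {}")
    case True
    then show thesis by (intro that[of 1]) auto
  next
    case False
    obtain x where x: "x \<in> {c..d} \<times> \<Delta>" "\<forall>y\<in>{c..d} \<times> \<Delta>. ?N x \<le> ?N y"
      using continuous_attains_inf[OF compact_Times[OF compact_Icc \<Delta>] False Nc] by blast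
    obtain t h where th: "x = (t, h)" "t \<in> {c..d}" "h \<in> \<Delta>" using x(1) by auto
    have "0 < ?N x"
    proof (rule ccontr)
      assume "\<not> 0 < ?N x"
      then have "norm (h v* D t) + \<bar>h \<bullet> b t\<bar> \<le> 0" by (simp add: th(1))
      then have "norm (h v* D t) = 0" "\<bar>h \<bullet> b t\<bar> = 0"
        using norm_ge_zero[of "h v* D t"] abs_ge_zero[of "h \<bullet> b t"] by linarith+
      then have z: "h v* D t = 0" "h \<bullet> b t = 0" by simp_all
      have hn: "\<And>s. 0 \<le> h $ s" "norm h = 1" using th(3) by (auto simp: \<Delta>_def)
      have "(\<Sum>s\<in>{s. b t $ s = 0}. h $ s *\<^sub>R D t $ s) = h v* D t"
        unfolding vm by (rule sum.mono_neutral_left) (use slack[OF hn(1) z(2) _ th(2)] in auto)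
      then have "\<forall>s\<in>{s. b t $ s = 0}. h $ s = 0"
        using spec[OF pos[OF th(2), unfolded positively_independent_def], of "\<lambda>s. h $ s"] hn(1)
        unfolding z(1) by blast
      then have hz: "h $ s = 0" if "b t $ s = 0" for s using that by blast
      have "h $ s = 0" for s
      proof (cases "b t $ s = 0")
        case True then show ?thesis by (rule hz)
      next
        case False then show ?thesis by (rule slack[OF hn(1) z(2) _ th(2)])
      qed
      then have "h = 0" by (simp add: vec_eq_iff)
      then show False using hn(2) by simp
    qed
    then show thesis using x(2) by (intro that[of "?N x"]) auto
  qed
  have bound: "R * norm h \<le> norm (h v* D t)" if t: "t \<in> {c..d}" and h: "\<And>s. 0 \<le> h $ s" "h \<bullet> b t = 0" for t h
  proof (cases "h = 0")
    case False
    define k where "k = inverse (norm h) *\<^sub>R h"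
    have "k \<in> \<Delta>" using False h(1) by (simp add: k_def \<Delta>_def)
    then have "R \<le> norm (k v* D t) + \<bar>k \<bullet> b t\<bar>" using R(2)[OF t] by auto
    also have "\<dots> = inverse (norm h) * norm (h v* D t)"
      using h(2) by (simp add: k_def bounded_bilinear.scaleR_left[OF bounded_bilinear_vector_matrix_mult])
    finally show ?thesis using False by (simp add: field_simps)
  qed simp
  obtain Ca where Ca: "0 \<le> Ca" "\<forall>t\<in>{c..d}. norm (a t) \<le> Ca"
    using bcont_off_bound[OF bcont_off_continuous[OF cont(3), of "{}"]] by blast
  \<comment> \<open>The radius \<open>Ca / R\<close> excludes no multiplier, since
    \<open>R * norm h\<close> is at most the norm of \<open>a t\<close>. The open interval is shown
    to lie in the projection of \<open>G\<close>; elsewhere the selection may be 0.\<close>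
  define G where "G = {x \<in> {c..d} \<times> cball 0 (Ca / R). (\<forall>s. 0 \<le> snd x $ s) \<and> snd x \<bullet> b (fst x) = 0 \<and> snd x v* D (fst x) = a (fst x)}"
  have G: "compact G"
  proof -
    let ?X = "{c..d} \<times> cball 0 (Ca / R) :: (real \<times> (real^'d)) set"
    have clX: "closed ?X" by (intro closed_Times) auto
    have e1: "closed {x \<in> ?X. snd x \<bullet> b (fst x) = 0}"
      by (rule continuous_closed_preimage_constant[OF _ clX])
        (intro continuous_on_inner fst_c cont continuous_on_snd continuous_on_id, auto)
    have e2: "closed {x \<in> ?X. snd x v* D (fst x) - a (fst x) = 0}"
      by (rule continuous_closed_preimage_constant[OF _ clX])
        (intro continuous_on_diff bounded_bilinear.continuous_on[OF bounded_bilinear_vector_matrix_mult]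
          fst_c cont continuous_on_snd continuous_on_id, auto)
    have e3: "closed {x :: real \<times> (real^'d). \<forall>s. 0 \<le> snd x $ s}"
      by (intro closed_Collect_all closed_Collect_le continuous_intros)
    have "G = ?X \<inter> ({x \<in> ?X. snd x \<bullet> b (fst x) = 0} \<inter> {x \<in> ?X. snd x v* D (fst x) - a (fst x) = 0} \<inter> {x. \<forall>s. 0 \<le> snd x $ s})"
      by (auto simp: G_def)
    moreover have "compact ?X" by (intro compact_Times compact_Icc compact_cball)
    ultimately show ?thesis using e1 e2 e3 by (simp only: compact_Int_closed closed_Int)
  qed
  have conv: "convex {h. (t, h) \<in> G}" for t
  proof (rule convexI)
    fix h k and \<alpha> \<beta> :: real
    assume hk: "h \<in> {h. (t, h) \<in> G}" "k \<in> {h. (t, h) \<in> G}" and ab: "0 \<le> \<alpha>" "0 \<le> \<beta>" "\<alpha> + \<beta> = 1"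
    have "\<alpha> *\<^sub>R h + \<beta> *\<^sub>R k \<in> cball 0 (Ca / R)"
      using convexD[OF convex_cball, of h 0 "Ca / R" k \<alpha> \<beta>] hk ab by (auto simp: G_def)
    moreover have "(\<alpha> *\<^sub>R h + \<beta> *\<^sub>R k) v* D t = a t"
    proof -
      have "(\<alpha> *\<^sub>R h + \<beta> *\<^sub>R k) v* D t = \<alpha> *\<^sub>R (h v* D t) + \<beta> *\<^sub>R (k v* D t)"
        by (simp add: bounded_bilinear.scaleR_left[OF bounded_bilinear_vector_matrix_mult]
            bounded_bilinear.add_left[OF bounded_bilinear_vector_matrix_mult])
      also have "\<dots> = (\<alpha> + \<beta>) *\<^sub>R a t" using hk by (simp add: G_def scaleR_add_left)
      finally show ?thesis using ab by simp
    qed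
    ultimately show "\<alpha> *\<^sub>R h + \<beta> *\<^sub>R k \<in> {h. (t, h) \<in> G}"
      using hk ab by (simp add: G_def inner_add_left)
  qed
  obtain h where h: "h \<in> borel_measurable borel" "\<forall>t\<in>fst ` G. (t, h t) \<in> G" "\<forall>t. t \<notin> fst ` G \<longrightarrow> h t = 0"
    using compact_graph_selection[OF G conv] by blast
  have "norm (h t) \<le> Ca / R" for t
  proof (cases "t \<in> fst ` G")
    case True
    then have "(t, h t) \<in> G" using h(2) by blast
    then show ?thesis by (simp add: G_def)
  next
    case False
    then have "h t = 0" using h(3) by blast
    then show ?thesis using Ca(1) R(1) by simp
  qed
  then have bd: "bounded (range h)" unfolding bounded_iff by auto
  have "(t, h t) \<in> G" if t: "t \<in> {c<..<d}" for t
  proof -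
    have t': "t \<in> {c..d}" using t by auto
    obtain k where k: "\<forall>s\<in>{s. b t $ s = 0}. 0 \<le> k s" "a t = (\<Sum>s\<in>{s. b t $ s = 0}. k s *\<^sub>R D t $ s)"
      using farkas_strict[OF _ pos[OF t'], of "a t"] a[OF t] by auto
    define k' where "k' = (\<chi> s. if b t $ s = 0 then k s else 0)"
    have kn: "\<And>s. 0 \<le> k' $ s" using k(1) by (simp add: k'_def)
    have kb: "k' \<bullet> b t = 0" unfolding inner_vec_def by (intro sum.neutral) (simp add: k'_def)
    have "k' v* D t = (\<Sum>s\<in>{s. b t $ s = 0}. k s *\<^sub>R D t $ s)"
      unfolding vm by (rule sum.mono_neutral_cong_right) (auto simp: k'_def)
    then have ka: "k' v* D t = a t" using k(2) by simp
    have "R * norm k' \<le> Ca" using bound[OF t' kn kb] ka Ca(2) t' by force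
    then have "norm k' \<le> Ca / R" using R(1) by (simp add: pos_le_divide_eq mult.commute)
    then have "(t, k') \<in> G" using kn kb ka t' by (simp add: G_def)
    then show ?thesis using h(2) by force
  qed
  then show ?thesis using h(1) bd by (intro bexI[of _ h] conjI) (auto simp: G_def)
qed

section \<open>One-sided values and functions given piece by piece\<close>

lemma left_value_eq:
  fixes g :: "real \<Rightarrow> 'a::real_normed_vector"
  assumes "a < t" "continuous_on {a..t} g" "\<And>s. s \<in> {a<..<t} \<Longrightarrow> f s = g s"
  shows "left_value f t = g t"
proof -
  have "(g \<longlongrightarrow> g t) (at t within {a..t})" using assms by (simp add: continuous_on)
  then have "(g \<longlongrightarrow> g t) (at_left t)" using assms(1) by (simp add: at_within_Icc_at_left)
  moreover have "\<forall>\<^sub>F s in at_left t. f s = g s"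
    using assms(1,3) by (auto simp: eventually_at_left intro!: exI[of _ a])
  ultimately have "(f \<longlongrightarrow> g t) (at_left t)" by (simp add: tendsto_cong)
  then show ?thesis unfolding left_value_def by (intro tendsto_Lim) simp_all
qed

lemma right_value_eq:
  fixes g :: "real \<Rightarrow> 'a::real_normed_vector"
  assumes "t < b" "continuous_on {t..b} g" "\<And>s. s \<in> {t<..<b} \<Longrightarrow> f s = g s"
  shows "right_value f t = g t"
proof -
  have "(g \<longlongrightarrow> g t) (at t within {t..b})" using assms by (simp add: continuous_on)
  then have "(g \<longlongrightarrow> g t) (at_right t)" using assms(1) by (simp add: at_within_Icc_at_right)
  moreover have "\<forall>\<^sub>F s in at_right t. f s = g s"
    using assms(1,3) by (auto simp: eventually_at_right intro!: exI[of _ b])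
  ultimately have "(f \<longlongrightarrow> g t) (at_right t)" by (simp add: tendsto_cong)
  then show ?thesis unfolding right_value_def by (intro tendsto_Lim) simp_all
qed

lemma piecewise_bcont_off:
  fixes g :: "real \<Rightarrow> 'a::real_normed_vector"
  assumes "a < t1" "t1 < t2" "t2 < b"
    and c: "continuous_on {a..t1} g1" "continuous_on {t1..t2} g2" "continuous_on {t2..b} g3"
    and g: "\<And>t. t \<in> {a..<t1} \<Longrightarrow> g t = g1 t" "\<And>t. t \<in> {t1<..<t2} \<Longrightarrow> g t = g2 t" "\<And>t. t \<in> {t2<..b} \<Longrightarrow> g t = g3 t"
  shows "bcont_off {t1, t2} a b g"
proof -
  have "g ` {a..b} \<subseteq> g1 ` {a..t1} \<union> g2 ` {t1..t2} \<union> g3 ` {t2..b} \<union> {g t1, g t2}" (is "_ \<subseteq> ?U")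
  proof
    fix z assume "z \<in> g ` {a..b}"
    then obtain t where t: "t \<in> {a..b}" "z = g t" by blast
    consider "t \<in> {a..<t1}" | "t = t1" | "t \<in> {t1<..<t2}" | "t = t2" | "t \<in> {t2<..b}" using t(1) by force
    then show "z \<in> ?U" using t(2) g by cases force+
  qed
  moreover have "bounded ?U"
    using c by (auto intro!: compact_imp_bounded compact_continuous_image)
  ultimately have "bounded (g ` {a..b})" by (rule bounded_subset[rotated])
  moreover have "continuous_on ({a..b} - {t1, t2}) g"
    unfolding continuous_on_eq_continuous_within
  proof
    fix t assume t: "t \<in> {a..b} - {t1, t2}"
    have loc: "continuous (at t within ({a..b} - {t1, t2})) g"
      if "open V" "t \<in> V" "continuous_on X k" "({a..b} - {t1, t2}) \<inter> V \<subseteq> X" "\<And>s. s \<in> ({a..b} - {t1, t2}) \<inter> V \<Longrightarrow> g s = k s" for V X k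
    proof -
      have "continuous (at t within (({a..b} - {t1, t2}) \<inter> V)) k"
        using continuous_on_subset[OF that(3,4)] t that(2) by (simp add: continuous_on_eq_continuous_within)
      then have "continuous (at t within ({a..b} - {t1, t2})) k"
        using at_within_nhd[of t V "({a..b} - {t1, t2}) \<inter> V" "{a..b} - {t1, t2}"] that(1,2) by (simp add: Int_assoc)
      then show ?thesis
        by (rule continuous_transform_within_openin[of _ _ _ "({a..b} - {t1, t2}) \<inter> V"])
          (use that t in auto)
    qed
    consider "t < t1" | "t1 < t" "t < t2" | "t2 < t" using t by force
    then show "continuous (at t within ({a..b} - {t1, t2})) g"
    proof cases
      case 1 then show ?thesis by (intro loc[of "{..<t1}" _ g1, OF _ _ c(1)]) (use g(1) in auto)
    next
      case 2 then show ?thesis by (intro loc[of "{t1<..<t2}" _ g2, OF _ _ c(2)]) (use g(2) in auto)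
    next
      case 3 then show ?thesis by (intro loc[of "{t2<..}" _ g3, OF _ _ c(3)]) (use g(3) in auto)
    qed
  qed
  ultimately show ?thesis unfolding bcont_off_def by blast
qed

section \<open>Regularity of absolutely continuous solutions, and feasible directions\<close>

lemma absolutely_continuous_fun_subinterval:
  assumes "absolutely_continuous_fun a b y" "c \<le> b"
  shows "absolutely_continuous_fun a c y"
  unfolding absolutely_continuous_fun_def
proof (intro allI impI)
  fix e :: real assume "0 < e"
  from assms(1)[unfolded absolutely_continuous_fun_def, THEN spec[of _ e], THEN mp, OF this]
  obtain \<delta> where \<delta>: "0 < \<delta>" "\<forall>D. finite D \<and> (\<forall>(s, t)\<in>D. a \<le> s \<and> s \<le> t \<and> t \<le> b) \<and>
        pairwise (\<lambda>(s, t) (s', t'). {s<..<t} \<inter> {s'<..<t'} = {}) D \<and>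
        (\<Sum>(s, t)\<in>D. t - s) < \<delta> \<longrightarrow> (\<Sum>(s, t)\<in>D. norm (y t - y s)) < e"
    by (elim exE conjE) (rule that)
  show "\<exists>\<delta>>0. \<forall>D. finite D \<and> (\<forall>(s, t)\<in>D. a \<le> s \<and> s \<le> t \<and> t \<le> c) \<and>
        pairwise (\<lambda>(s, t) (s', t'). {s<..<t} \<inter> {s'<..<t'} = {}) D \<and>
        (\<Sum>(s, t)\<in>D. t - s) < \<delta> \<longrightarrow> (\<Sum>(s, t)\<in>D. norm (y t - y s)) < e"
  proof (intro exI[of _ \<delta>] conjI \<delta>(1) allI impI)
    fix D :: "(real \<times> real) set"
    assume D: "finite D \<and> (\<forall>(s, t)\<in>D. a \<le> s \<and> s \<le> t \<and> t \<le> c) \<and>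
        pairwise (\<lambda>(s, t) (s', t'). {s<..<t} \<inter> {s'<..<t'} = {}) D \<and> (\<Sum>(s, t)\<in>D. t - s) < \<delta>"
    then have "\<forall>(s, t)\<in>D. a \<le> s \<and> s \<le> t \<and> t \<le> b" using assms(2) by fastforce
    then show "(\<Sum>(s, t)\<in>D. norm (y t - y s)) < e" using \<delta>(2) D by blast
  qed
qed

text \<open>The difference of \<open>y\<close> and the primitive of \<open>g\<close> is absolutely
  continuous with derivative 0 almost everywhere, hence constant; so an equation valid almost
  everywhere holds at every interior point off \<open>S\<close>.\<close>

lemma absolutely_continuous_solves:
  fixes y :: "real \<Rightarrow> 'a::euclidean_space"
  assumes S: "finite S" and g: "bcont_off S a b g" and y: "absolutely_continuous_fun a b y"
    and deriv: "AE t in lebesgue_on {a..b}. t \<notin> S \<longrightarrow> (y has_vector_derivative g t) (at t)"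
  shows "solves S a b y g"
proof -
  define z where "z t = y a + integral {a..t} g" for t
  have zs: "solves S a b z g" by (rule solves_of_integral[OF S g]) (simp add: z_def)
  obtain B where B: "0 \<le> B" "\<forall>t\<in>{a..b}. norm (g t) \<le> B" using bcont_off_bound[OF g] by blast
  have zac: "absolutely_continuous_fun a b z"
    by (rule lipschitz_imp_absolutely_continuous_fun[OF solves_lipschitz[OF S zs]]) (use B in auto)
  have "y t = z t" if t: "t \<in> {a..b}" for t
  proof -
    have "absolutely_continuous_fun a t (\<lambda>t. y t - z t)"
      using absolutely_continuous_fun_subinterval[OF absolutely_continuous_fun_diff[OF y zac]] t by simp
    moreover have "AE s in lebesgue_on {a..t}. ((\<lambda>t. y t - z t) has_vector_derivative 0) (at s)"
    proof -
      have "AE s in lebesgue. s \<notin> S \<union> {a, b}"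
        using S by (intro AE_not_in) (simp add: negligible_iff_null_sets[symmetric] negligible_finite)
      moreover have "AE s in lebesgue. s \<in> {a..b} \<longrightarrow> s \<notin> S \<longrightarrow> (y has_vector_derivative g s) (at s)"
        using deriv by (simp add: AE_restrict_space_iff)
      ultimately have "AE s in lebesgue. s \<in> {a..t} \<longrightarrow> ((\<lambda>t. y t - z t) has_vector_derivative 0) (at s)"
      proof eventually_elim
        case (elim s)
        show ?case
        proof
          assume "s \<in> {a..t}"
          then have s: "s \<in> {a<..<b} - S" using t elim(1) by auto
          have "(z has_vector_derivative g s) (at s)" using zs s by (simp add: solves_def)
          moreover have "(y has_vector_derivative g s) (at s)" using elim s by auto
          ultimately show "((\<lambda>t. y t - z t) has_vector_derivative 0) (at s)"
            using has_vector_derivative_diff by force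
        qed
      qed
      then show ?thesis by (simp add: AE_restrict_space_iff)
    qed
    ultimately have e: "y t - z t = y a - z a"
      using absolutely_continuous_fun_zero_derivative[of a t "\<lambda>t. y t - z t"] t by auto
    have "z a = y a" by (simp add: z_def)
    then show ?thesis using e by (simp only: right_minus_eq cancel_comm_monoid_add_class.diff_cancel)
  qed
  then have "\<And>t. t \<in> {a..b} \<Longrightarrow> y t = y a + integral {a..t} g" unfolding z_def .
  then show ?thesis by (rule solves_of_integral[OF S g, of y "y a"])
qed

text \<open>Near \<open>v0\<close> each component is either negative throughout or strictly
  decreasing along \<open>w\<close>, so a short step from any nearby feasible point remains
  feasible. Uniformity in the base point is what a bump of positive width requires.\<close>

lemma strict_direction_feasible:
  fixes \<phi> :: "real^'k::finite \<Rightarrow> real^'d::finite" and \<phi>' :: "real^'k \<Rightarrow> (real^'k) \<Rightarrow>\<^sub>L (real^'d)"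
  assumes W: "open W" "v0 \<in> W" and d: "\<And>v. v \<in> W \<Longrightarrow> (\<phi> has_derivative blinfun_apply (\<phi>' v)) (at v)"
    and c: "continuous_on W \<phi>'" and neg: "\<And>s. \<phi> v0 $ s \<le> 0"
    and act: "\<And>s. \<phi> v0 $ s = 0 \<Longrightarrow> \<phi>' v0 w $ s < 0"
  shows "\<exists>r>0. \<exists>k0>0. \<forall>v k. dist v v0 < r \<and> (\<forall>s. \<phi> v $ s \<le> 0) \<and> 0 \<le> k \<and> k \<le> k0 \<longrightarrow>
    (\<forall>s. \<phi> (v + k *\<^sub>R w) $ s \<le> 0)"
proof -
  have cphi: "continuous_on W \<phi>"
    by (rule has_derivative_continuous_on[where f' = "\<lambda>v. blinfun_apply (\<phi>' v)"])
      (rule has_derivative_at_withinI[OF d])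
  have ex: "\<exists>r>0. ball v0 r \<subseteq> W \<and> ((\<forall>v\<in>ball v0 r. \<phi>' v w $ s < 0) \<or> (\<forall>v\<in>ball v0 r. \<phi> v $ s < 0))" for s
  proof -
    have o: "\<exists>r>0. \<forall>v\<in>ball v0 r. v \<in> W \<and> h v < 0" if h: "continuous_on W h" "h v0 < 0" for h :: "real^'k \<Rightarrow> real"
    proof -
      have "open (W \<inter> h -` {..<0})" using continuous_open_preimage[OF h(1) W(1) open_lessThan] .
      then show ?thesis using h(2) W(2) unfolding open_contains_ball by blast
    qed
    show ?thesis
    proof (cases "\<phi> v0 $ s = 0")
      case True
      have "continuous_on W (\<lambda>v. \<phi>' v w $ s)" by (intro continuous_intros c)
      from o[OF this act[OF True]] show ?thesis by blast
    next
      case False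
      have "continuous_on W (\<lambda>v. \<phi> v $ s)" by (intro continuous_intros cphi)
      moreover have "\<phi> v0 $ s < 0" using neg[of s] False by simp
      ultimately show ?thesis using o by blast
    qed
  qed
  then have "\<forall>s. \<exists>r. 0 < r \<and> ball v0 r \<subseteq> W \<and> ((\<forall>v\<in>ball v0 r. \<phi>' v w $ s < 0) \<or> (\<forall>v\<in>ball v0 r. \<phi> v $ s < 0))" by blast
  from choice[OF this] obtain \<rho> where \<rho>: "\<And>s. 0 < \<rho> s" "\<And>s. ball v0 (\<rho> s) \<subseteq> W"
    "\<And>s. (\<forall>v\<in>ball v0 (\<rho> s). \<phi>' v w $ s < 0) \<or> (\<forall>v\<in>ball v0 (\<rho> s). \<phi> v $ s < 0)" by blast
  define r where "r = Min (range \<rho>)"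
  have r: "0 < r" "\<And>s. r \<le> \<rho> s" using \<rho>(1) by (auto simp: r_def)
  \<comment> \<open>Half of the radius is left for the base point, half for the step along
    \<open>w\<close>.\<close>
  define k0 where "k0 = r / (2 * (norm w + 1))"
  have nw: "0 < norm w + 1" using norm_ge_zero[of w] by linarith
  have k0: "0 < k0" using r(1) nw by (simp add: k0_def)
  have inball: "v + k *\<^sub>R w \<in> ball v0 r" if "dist v v0 < r / 2" "0 \<le> k" "k \<le> k0" for v k
  proof -
    have "k * norm w \<le> k0 * (norm w + 1)" using that k0 by (intro mult_mono) auto
    also have "\<dots> = r / 2" using nw unfolding k0_def by (auto simp: divide_simps)
    finally have "norm (k *\<^sub>R w) \<le> r / 2" using that by simp
    moreover have "dist v0 (v + k *\<^sub>R w) \<le> dist v v0 + norm (k *\<^sub>R w)"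
      using norm_triangle_ineq[of "v - v0" "k *\<^sub>R w"] by (simp add: dist_norm norm_minus_commute algebra_simps)
    ultimately show ?thesis using that(1) by (auto simp: mem_ball)
  qed
  have main: "\<phi> (v + k *\<^sub>R w) $ s \<le> 0"
    if v: "dist v v0 < r / 2" "\<forall>s. \<phi> v $ s \<le> 0" and k: "0 \<le> k" "k \<le> k0" for v k s
  proof (cases "\<forall>v\<in>ball v0 (\<rho> s). \<phi> v $ s < 0")
    case True
    have "v + k *\<^sub>R w \<in> ball v0 (\<rho> s)" using inball[OF v(1) k] r(2)[of s] by (auto simp: mem_ball)
    then show ?thesis using True by force
  next
    case False
    then have neg': "\<forall>v\<in>ball v0 (\<rho> s). \<phi>' v w $ s < 0" using \<rho>(3) by blast
    have "\<phi> (v + k *\<^sub>R w) $ s \<le> \<phi> (v + 0 *\<^sub>R w) $ s"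
    proof (rule DERIV_nonpos_imp_nonincreasing[OF k(1), where f = "\<lambda>\<kappa>. \<phi> (v + \<kappa> *\<^sub>R w) $ s"])
      fix \<kappa> assume \<kappa>: "0 \<le> \<kappa>" "\<kappa> \<le> k"
      have b: "v + \<kappa> *\<^sub>R w \<in> ball v0 (\<rho> s)"
        using inball[OF v(1) \<kappa>(1)] \<kappa> k r(2)[of s] by (auto simp: mem_ball)
      have l: "((\<lambda>\<kappa>. v + \<kappa> *\<^sub>R w) has_derivative (\<lambda>h. h *\<^sub>R w)) (at \<kappa>)"
        by (auto intro!: derivative_eq_intros)
      have "(\<phi> has_derivative blinfun_apply (\<phi>' (v + \<kappa> *\<^sub>R w))) (at (v + \<kappa> *\<^sub>R w))"
        by (rule d) (use b \<rho>(2) in blast)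
      from has_derivative_compose[OF l this]
      have "((\<lambda>\<kappa>. \<phi> (v + \<kappa> *\<^sub>R w)) has_derivative (\<lambda>h. \<phi>' (v + \<kappa> *\<^sub>R w) (h *\<^sub>R w))) (at \<kappa>)" .
      then have "((\<lambda>\<kappa>. \<phi> (v + \<kappa> *\<^sub>R w) $ s) has_derivative (\<lambda>h. \<phi>' (v + \<kappa> *\<^sub>R w) (h *\<^sub>R w) $ s)) (at \<kappa>)"
        by (rule bounded_linear.has_derivative[OF bounded_linear_vec_nth])
      then have "((\<lambda>\<kappa>. \<phi> (v + \<kappa> *\<^sub>R w) $ s) has_real_derivative \<phi>' (v + \<kappa> *\<^sub>R w) w $ s) (at \<kappa>)"
        by (simp add: has_field_derivative_def blinfun.scaleR_right mult.commute[of _ "\<phi>' (v + \<kappa> *\<^sub>R w) w $ s"])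
      then show "\<exists>y. ((\<lambda>\<kappa>. \<phi> (v + \<kappa> *\<^sub>R w) $ s) has_real_derivative y) (at \<kappa>) \<and> y \<le> 0"
        using neg' b by (intro exI[of _ "\<phi>' (v + \<kappa> *\<^sub>R w) w $ s"]) (auto intro: less_imp_le)
    qed
    then show ?thesis using v(2) by (metis add.right_neutral order_trans scaleR_zero_left)
  qed
  show ?thesis using r(1) k0 main by (intro exI[of _ "r / 2"] conjI exI[of _ k0]) auto
qed

section \<open>Partial Jacobians and gradients\<close>

lemma bounded_linear_vecI:
  fixes f :: "'a::real_normed_vector \<Rightarrow> 'b::euclidean_space^'n::finite"
  assumes "\<And>i. bounded_linear (\<lambda>x. f x $ i)"
  shows "bounded_linear f"
proof (rule bounded_linear_componentwise_iff[THEN iffD2], rule ballI)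
  fix b :: "'b^'n" assume "b \<in> Basis"
  then obtain i c where b: "b = axis i c" by (auto simp: Basis_vec_def)
  have "bounded_linear (\<lambda>x. f x $ i \<bullet> c)" by (rule bounded_linear_inner_left_comp[OF assms])
  then show "bounded_linear (\<lambda>x. f x \<bullet> b)" by (simp add: b inner_axis)
qed

definition partial1 :: "(((real^'m) \<times> (real^'k)) \<Rightarrow>\<^sub>L (real^'n)) \<Rightarrow> real^'m^'n" where
  "partial1 F = matrix (\<lambda>x. F (x, 0))"

definition partial2 :: "(((real^'m) \<times> (real^'k)) \<Rightarrow>\<^sub>L (real^'n)) \<Rightarrow> real^'k^'n" where
  "partial2 F = matrix (\<lambda>w. F (0, w))"

lemma bounded_linear_partial1: "bounded_linear (partial1 :: (((real^'m::finite) \<times> (real^'k::finite)) \<Rightarrow>\<^sub>L (real^'n::finite)) \<Rightarrow> _)"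
proof (intro bounded_linear_vecI)
  fix i :: 'n and j :: 'm
  have "bounded_linear (\<lambda>F :: ((real^'m) \<times> (real^'k)) \<Rightarrow>\<^sub>L (real^'n). F (axis j 1, 0) $ i)"
    by (intro bounded_linear_vec_nth[THEN bounded_linear_compose] blinfun.bounded_linear_left)
  then show "bounded_linear (\<lambda>F :: ((real^'m) \<times> (real^'k)) \<Rightarrow>\<^sub>L (real^'n). partial1 F $ i $ j)"
    by (simp add: partial1_def matrix_def)
qed

lemma bounded_linear_partial2: "bounded_linear (partial2 :: (((real^'m::finite) \<times> (real^'k::finite)) \<Rightarrow>\<^sub>L (real^'n::finite)) \<Rightarrow> _)"
proof (intro bounded_linear_vecI)
  fix i :: 'n and j :: 'k
  have "bounded_linear (\<lambda>F :: ((real^'m) \<times> (real^'k)) \<Rightarrow>\<^sub>L (real^'n). F (0, axis j 1) $ i)"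
    by (intro bounded_linear_vec_nth[THEN bounded_linear_compose] blinfun.bounded_linear_left)
  then show "bounded_linear (\<lambda>F :: ((real^'m) \<times> (real^'k)) \<Rightarrow>\<^sub>L (real^'n). partial2 F $ i $ j)"
    by (simp add: partial2_def matrix_def)
qed

lemma partial1_mult: "partial1 F *v x = F (x, 0)" and partial2_mult: "partial2 F *v w = F (0, w)"
proof -
  have "linear (\<lambda>x. F (x, 0))"
    by (rule linearI) (simp_all flip: blinfun.add_right blinfun.scaleR_right)
  then show "partial1 F *v x = F (x, 0)" by (simp add: partial1_def matrix_works)
  have "linear (\<lambda>w. F (0, w))"
    by (rule linearI) (simp_all flip: blinfun.add_right blinfun.scaleR_right)
  then show "partial2 F *v w = F (0, w)" by (simp add: partial2_def matrix_works)
qed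

lemma partial_sum: "partial1 F *v x + partial2 F *v w = F (x, w)"
  by (simp add: partial1_mult partial2_mult flip: blinfun.add_right)

lemma has_derivative_fst_partial:
  fixes f :: "'a::real_normed_vector \<Rightarrow> 'b::real_normed_vector \<Rightarrow> 'c::real_normed_vector"
  assumes "((\<lambda>(y, v). f y v) has_derivative F) (at (y, v))"
  shows "((\<lambda>y. f y v) has_derivative (\<lambda>h. F (h, 0))) (at y)"
proof -
  have "((\<lambda>y. (y, v)) has_derivative (\<lambda>h. (h, 0))) (at y)" by (auto intro!: derivative_eq_intros)
  from has_derivative_compose[OF this assms] show ?thesis by simp
qed

lemma has_derivative_snd_partial:
  fixes f :: "'a::real_normed_vector \<Rightarrow> 'b::real_normed_vector \<Rightarrow> 'c::real_normed_vector"
  assumes "((\<lambda>(y, v). f y v) has_derivative F) (at (y, v))"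
  shows "((\<lambda>v. f y v) has_derivative (\<lambda>h. F (0, h))) (at v)"
proof -
  have "((\<lambda>v. (y, v)) has_derivative (\<lambda>h. (0, h))) (at v)" by (auto intro!: derivative_eq_intros)
  from has_derivative_compose[OF this assms] show ?thesis by simp
qed

lemma jacobian_partial1:
  assumes "((\<lambda>(y, v). f y v) has_derivative blinfun_apply F) (at (y, v))"
  shows "jacobian (\<lambda>y. f y v) (at y) = partial1 F"
  using frechet_derivative_at[OF has_derivative_fst_partial[OF assms]]
  by (simp add: jacobian_def partial1_def)

lemma jacobian_partial2:
  assumes "((\<lambda>(y, v). f y v) has_derivative blinfun_apply F) (at (y, v))"
  shows "jacobian (f y) (at v) = partial2 F"
  using frechet_derivative_at[OF has_derivative_snd_partial[OF assms]]
  by (simp add: jacobian_def partial2_def)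

lemma grad_eq:
  assumes "(g has_derivative D) (at x)"
  shows "grad g x = (\<chi> i. D (axis i 1))"
  using frechet_derivative_at[OF assms] by (simp add: grad_def)

lemma grad_inner:
  assumes "(g has_derivative D) (at x)"
  shows "grad g x \<bullet> h = D h"
proof -
  have l: "linear D" using assms by (rule has_derivative_linear)
  have "D h = D (\<Sum>i\<in>UNIV. h $ i *\<^sub>R axis i 1)"
    using basis_expansion[of h] by (simp add: scalar_mult_eq_scaleR)
  also have "\<dots> = (\<Sum>i\<in>UNIV. h $ i * D (axis i 1))"
    by (simp add: linear_sum[OF l] linear_scale[OF l])
  finally show ?thesis by (simp add: grad_eq[OF assms] inner_vec_def mult.commute)
qed

lemma grad_eq_inner:
  assumes "(g has_derivative (\<lambda>h. a \<bullet> h)) (at x)"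
  shows "grad g x = a"
  by (simp add: grad_eq[OF assms] vec_eq_iff inner_axis)

lemma absolutely_continuous_fun_continuous:
  fixes y :: "real \<Rightarrow> 'a::real_normed_vector"
  assumes "absolutely_continuous_fun a b y"
  shows "continuous_on {a..b} y"
  unfolding continuous_on_iff
proof (intro ballI allI impI)
  fix t e :: real assume t: "t \<in> {a..b}" and "0 < e"
  then obtain d where d: "0 < d" "\<And>D :: (real \<times> real) set. finite D \<and> (\<forall>(s, t)\<in>D. a \<le> s \<and> s \<le> t \<and> t \<le> b) \<and>
      pairwise (\<lambda>(s, t) (s', t'). {s<..<t} \<inter> {s'<..<t'} = {}) D \<and> (\<Sum>(s, t)\<in>D. t - s) < d \<Longrightarrow>
      (\<Sum>(s, t)\<in>D. norm (y t - y s)) < e"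
    using assms unfolding absolutely_continuous_fun_def by meson
  have k: "norm (y s' - y t') < e" if "s' \<in> {a..b}" "t' \<in> {a..b}" "t' \<le> s'" "s' - t' < d" for s' t'
    using d(2)[of "{(t', s')}"] that by (simp add: pairwise_def)
  then have "dist (y s) (y t) < e" if "s \<in> {a..b}" "dist s t < d" for s
    using k[of s t] k[of t s] that t by (cases "t \<le> s") (auto simp: dist_norm norm_minus_commute[of "y s" "y t"] dist_real_def)
  then show "\<exists>d>0. \<forall>x'\<in>{a..b}. dist x' t < d \<longrightarrow> dist (y x') (y t) < e" using d(1) by blast
qed

text \<open>The complement of a null set is dense in the interval and weak inequalities pass to the
  closure. This yields the control constraints at every time, the one-sided values included.\<close>

lemma AE_continuous_nonpos:
  fixes g :: "real \<Rightarrow> real"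
  assumes "a < b" and g: "continuous_on {a..b} g" and ae: "AE t in lebesgue_on {a..b}. t \<in> {a<..<b} \<longrightarrow> g t \<le> 0"
    and t: "t \<in> {a..b}"
  shows "g t \<le> 0"
proof -
  let ?P = "{s\<in>{a<..<b}. g s \<le> 0}"
  have neg: "negligible ({a<..<b} - ?P)"
  proof -
    have "AE t in lebesgue. t \<in> {a..b} \<longrightarrow> t \<in> {a<..<b} \<longrightarrow> g t \<le> 0" using ae by (simp add: AE_restrict_space_iff)
    then obtain N where N: "N \<in> null_sets lebesgue" "{t. \<not> (t \<in> {a..b} \<longrightarrow> t \<in> {a<..<b} \<longrightarrow> g t \<le> 0)} \<subseteq> N"
      unfolding eventually_ae_filter by auto
    then have "negligible N" by (simp add: negligible_iff_null_sets)
    then show ?thesis by (rule negligible_subset) (use N(2) in \<open>auto simp: subset_iff\<close>)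
  qed
  have "{a<..<b} \<subseteq> closure ?P"
  proof
    fix s assume s: "s \<in> {a<..<b}"
    show "s \<in> closure ?P"
    proof (rule ccontr)
      assume n: "s \<notin> closure ?P"
      then have "{a<..<b} - closure ?P \<noteq> {}" using s by blast
      moreover have "open ({a<..<b} - closure ?P)" by (intro open_Diff) auto
      moreover have "negligible ({a<..<b} - closure ?P)"
        by (rule negligible_subset[OF neg]) (use closure_subset[of ?P] in blast)
      ultimately show False using open_not_negligible by blast
    qed
  qed
  then have "closure {a<..<b} \<subseteq> closure ?P" by (simp add: closure_minimal)
  then have 1: "{a..b} \<subseteq> closure ?P" using assms(1) by simp
  have 2: "closure ?P \<subseteq> {a..b}" by (intro closure_minimal) auto
  show ?thesis
    by (rule continuous_le_on_closure[of ?P g t 0]) (use 1 2 g t in \<open>auto intro: continuous_on_subset\<close>)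
qed

text \<open>Points at distance at most \<open>r\<close> are covered by the estimate on balls; for
  points further apart the bound \<open>2 * M\<close> on the difference of values is divided by
  \<open>r\<close>. So \<open>K\<close> may fail to be convex or connected.\<close>

lemma C1_lipschitz_compact:
  fixes g :: "'a::euclidean_space \<Rightarrow> 'b::euclidean_space" and g' :: "'a \<Rightarrow> 'a \<Rightarrow>\<^sub>L 'b"
  assumes K: "compact K" "open Q" "K \<subseteq> Q"
    and g: "\<And>x. x \<in> Q \<Longrightarrow> (g has_derivative blinfun_apply (g' x)) (at x)" "continuous_on Q g'"
  shows "\<exists>L. L-lipschitz_on K g"
proof -
  have "\<exists>r>0. \<exists>L\<ge>0. compact (\<Union>x\<in>K. cball x r) \<and> (\<Union>x\<in>K. cball x r) \<subseteq> Q \<and>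
    (\<forall>x\<in>K. \<forall>y\<in>cball x r. norm (g' y) \<le> L) \<and>
    (\<forall>x\<in>K. \<forall>y\<in>cball x r. \<forall>z\<in>cball x r. norm (g y - g z) \<le> L * norm (y - z))"
    by (rule C1_uniform_lipschitz[OF K g])
  then obtain r L where r: "0 < r" "0 \<le> L" and
    L: "\<forall>x\<in>K. \<forall>y\<in>cball x r. \<forall>z\<in>cball x r. norm (g y - g z) \<le> L * norm (y - z)"
    by (elim exE conjE) (rule that)
  have "continuous_on Q g" by (rule has_derivative_continuous_on) (rule has_derivative_at_withinI[OF g(1)])
  then have "compact (g ` K)" using K by (intro compact_continuous_image) (auto elim: continuous_on_subset)
  then have "bounded (g ` K)" by (rule compact_imp_bounded)
  then obtain M where M: "0 < M" "\<forall>x\<in>K. norm (g x) \<le> M" unfolding bounded_pos by auto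
  have "norm (g x - g y) \<le> max L (2 * M / r) * norm (x - y)" if xy: "x \<in> K" "y \<in> K" for x y
  proof (cases "dist x y \<le> r")
    case True
    then have "norm (g x - g y) \<le> L * norm (x - y)" using L r(1) xy by auto
    also have "\<dots> \<le> max L (2 * M / r) * norm (x - y)" by (intro mult_right_mono) auto
    finally show ?thesis .
  next
    case False
    have "norm (g x - g y) \<le> norm (g x) + norm (g y)" by (rule norm_triangle_ineq4)
    also have "\<dots> \<le> 2 * M" using M(2)[rule_format, OF xy(1)] M(2)[rule_format, OF xy(2)] by linarith
    also have "\<dots> = (2 * M / r) * r" using r(1) by simp
    also have "\<dots> \<le> max L (2 * M / r) * norm (x - y)"
      using False r M(1) by (intro mult_mono) (auto simp: dist_norm le_max_iff_disj)
    finally show ?thesis .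
  qed
  then have "(max L (2 * M / r))-lipschitz_on K g" using r(2) by (intro lipschitz_onI) (auto simp: dist_norm)
  then show ?thesis by blast
qed

section \<open>The reference process of Problem C\<close>

locale regular_reference =
  fixes T t1 t2 :: real
    and Q :: "((real ^ 'm::finite) \<times> (real ^ 'k::finite)) set"
    and f :: "real ^ 'm \<Rightarrow> real ^ 'k \<Rightarrow> real ^ 'm"
    and f' :: "(real ^ 'm) \<times> (real ^ 'k) \<Rightarrow> ((real ^ 'm) \<times> (real ^ 'k)) \<Rightarrow>\<^sub>L (real ^ 'm)"
    and f'' :: "(real ^ 'm) \<times> (real ^ 'k) \<Rightarrow> ((real ^ 'm) \<times> (real ^ 'k)) \<Rightarrow>\<^sub>L (((real ^ 'm) \<times> (real ^ 'k)) \<Rightarrow>\<^sub>L (real ^ 'm))"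
    and \<phi> :: "real ^ 'k \<Rightarrow> real ^ 'd::finite"
    and \<phi>' :: "(real ^ 'm) \<times> (real ^ 'k) \<Rightarrow> ((real ^ 'm) \<times> (real ^ 'k)) \<Rightarrow>\<^sub>L (real ^ 'd)"
    and \<Phi> :: "real ^ 'm \<Rightarrow> real"
    and \<Phi>' :: "(real ^ 'm) \<times> (real ^ 'k) \<Rightarrow> ((real ^ 'm) \<times> (real ^ 'k)) \<Rightarrow>\<^sub>L real"
    and \<Phi>'' :: "(real ^ 'm) \<times> (real ^ 'k) \<Rightarrow> ((real ^ 'm) \<times> (real ^ 'k)) \<Rightarrow>\<^sub>L (((real ^ 'm) \<times> (real ^ 'k)) \<Rightarrow>\<^sub>L real)"
    and J :: "real ^ 'm \<Rightarrow> real ^ 'm \<Rightarrow> real"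
    and J' :: "(real ^ 'm) \<times> (real ^ 'm) \<Rightarrow> real"
    and y0 :: "real \<Rightarrow> real ^ 'm"
    and u0 :: "real \<Rightarrow> real ^ 'k"
  assumes times: "0 < t1" "t1 < t2" "t2 < T"
    and openQ: "open Q"
    and df: "\<And>x. x \<in> Q \<Longrightarrow> ((\<lambda>(y, v). f y v) has_derivative blinfun_apply (f' x)) (at x)"
    and df': "\<And>x. x \<in> Q \<Longrightarrow> (f' has_derivative blinfun_apply (f'' x)) (at x)"
    and cf'': "continuous_on Q f''"
    and dphi: "\<And>x. x \<in> Q \<Longrightarrow> ((\<lambda>(y, v). \<phi> v) has_derivative blinfun_apply (\<phi>' x)) (at x)"
    and cphi': "continuous_on Q \<phi>'"
    and dPhi: "\<And>x. x \<in> Q \<Longrightarrow> ((\<lambda>(y, v). \<Phi> y) has_derivative blinfun_apply (\<Phi>' x)) (at x)"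
    and dPhi': "\<And>x. x \<in> Q \<Longrightarrow> (\<Phi>' has_derivative blinfun_apply (\<Phi>'' x)) (at x)"
    and cPhi'': "continuous_on Q \<Phi>''"
    and dJ: "((\<lambda>(a, b). J a b) has_derivative J') (at (y0 0, y0 T))"
    and inQ: "\<And>t. t \<in> {0..t1} \<Longrightarrow> (y0 t, piece1 t1 u0 t) \<in> Q"
      "\<And>t. t \<in> {t1..t2} \<Longrightarrow> (y0 t, piece2 t1 t2 u0 t) \<in> Q"
      "\<And>t. t \<in> {t2..T} \<Longrightarrow> (y0 t, piece3 t2 u0 t) \<in> Q"
    and Phi0: "\<And>t. t \<in> {t1..t2} \<Longrightarrow> \<Phi> (y0 t) = 0" "\<And>t. t \<in> {0..T} - {t1..t2} \<Longrightarrow> 0 < \<Phi> (y0 t)"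
    and control: "continuous_on {0..t1} (piece1 t1 u0)" "\<exists>L. L-lipschitz_on {t1..t2} (piece2 t1 t2 u0)"
      "continuous_on {t2..T} (piece3 t2 u0)"
    and phi2: "\<And>t s. t \<in> {t1..t2} \<Longrightarrow> \<phi> (piece2 t1 t2 u0 t) $ s < 0"
    and nondegenerate: "\<And>t. t \<in> {t1..t2} \<Longrightarrow>
      grad \<Phi> (y0 t) v* jacobian (f (y0 t)) (at (piece2 t1 t2 u0 t)) \<noteq> 0"
    and gradients: "\<And>t. t \<in> {0..t1} \<Longrightarrow> active_gradients_positively_independent \<phi> (piece1 t1 u0 t)"
      "\<And>t. t \<in> {t2..T} \<Longrightarrow> active_gradients_positively_independent \<phi> (piece3 t2 u0 t)"
    and minimal: "extended_weak_minimum T Q f \<phi> \<Phi> J y0 u0"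
begin

abbreviation "u1 \<equiv> piece1 t1 u0"
abbreviation "u2 \<equiv> piece2 t1 t2 u0"
abbreviation "u3 \<equiv> piece3 t2 u0"

text \<open>At the switching times the value from the right is taken, so the pair with
  \<open>y0\<close> stays in a compact subset of \<open>Q\<close> at all times, whatever
  \<open>u0\<close> is there.\<close>

definition "u t = (if t < t1 then u1 t else if t < t2 then u2 t else u3 t)"
definition "p t = grad \<Phi> (y0 t)"
definition "e t = f (y0 t) (u t)"
definition "A t = partial1 (f' (y0 t, u t))"
definition "B t = partial2 (f' (y0 t, u t))"
text \<open>\<Phi> is differentiated as a function of state and control; this extracts the state
  gradient as a vector, linearly in the derivative.\<close>

definition "gradPhi F = (\<chi> i. blinfun_apply F (axis i 1, 0 :: real^'k))" for F :: "((real ^ 'm) \<times> (real ^ 'k)) \<Rightarrow>\<^sub>L real"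
text \<open>The Hessian of \<Phi> applied to the velocity, that is, the time derivative of
  \<open>p\<close>.\<close>

definition "q t = gradPhi (\<Phi>'' (y0 t, u t) (e t, 0))"
definition "J0 = grad (\<lambda>a. J a (y0 T)) (y0 0)"
definition "JT = grad (\<lambda>b. J (y0 0) b) (y0 T)"

lemma u_eq: "t < t1 \<Longrightarrow> u t = u1 t" "t \<in> {t1..<t2} \<Longrightarrow> u t = u2 t" "t2 \<le> t \<Longrightarrow> u t = u3 t"
  using times by (auto simp: u_def)

lemma u_u0: "t \<in> {0..T} - {t1, t2} \<Longrightarrow> u t = u0 t"
  using times by (auto simp: u_def piece1_def piece2_def piece3_def)

lemma y0_ac: "absolutely_continuous_fun 0 T y0"
  using minimal by (simp add: extended_weak_minimum_def admissible_def is_process_def)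

lemma y0_continuous: "continuous_on {0..T} y0"
  by (rule absolutely_continuous_fun_continuous[OF y0_ac])

lemma x_continuous: "continuous_on {0..t1} (\<lambda>t. (y0 t, u1 t))" "continuous_on {t1..t2} (\<lambda>t. (y0 t, u2 t))"
  "continuous_on {t2..T} (\<lambda>t. (y0 t, u3 t))"
proof -
  have "continuous_on {t1..t2} u2" using control(2) lipschitz_on_continuous_on by blast
  moreover have "continuous_on {0..t1} y0" "continuous_on {t1..t2} y0" "continuous_on {t2..T} y0"
    by (rule continuous_on_subset[OF y0_continuous], use times in force)+
  ultimately show "continuous_on {0..t1} (\<lambda>t. (y0 t, u1 t))" "continuous_on {t1..t2} (\<lambda>t. (y0 t, u2 t))"
    "continuous_on {t2..T} (\<lambda>t. (y0 t, u3 t))" using control(1,3) by (auto intro!: continuous_on_Pair)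
qed

definition "K = (\<lambda>t. (y0 t, u1 t)) ` {0..t1} \<union> (\<lambda>t. (y0 t, u2 t)) ` {t1..t2} \<union> (\<lambda>t. (y0 t, u3 t)) ` {t2..T}"

lemma K: "compact K" "K \<subseteq> Q" "t \<in> {0..T} \<Longrightarrow> (y0 t, u t) \<in> K"
proof -
  show "compact K" unfolding K_def
    by (intro compact_Un compact_continuous_image x_continuous compact_Icc)
  show "K \<subseteq> Q" unfolding K_def using inQ by blast
  assume "t \<in> {0..T}"
  then consider "t \<in> {0..<t1}" | "t \<in> {t1..<t2}" | "t \<in> {t2..T}" by force
  then show "(y0 t, u t) \<in> K"
    by cases (use u_eq[of t] in \<open>auto simp: K_def\<close>)
qed

lemma reference_mem: "t \<in> {0..T} \<Longrightarrow> (y0 t, u t) \<in> Q" using K by blast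

lemma u_bcont: "bcont_off {t1, t2} 0 T u"
  by (rule piecewise_bcont_off[OF times control(1) _ control(3)])
    (use u_eq control(2) in \<open>auto intro: lipschitz_on_continuous_on\<close>)

lemma state_bcont:
  assumes "continuous_on Q h"
  shows "bcont_off {t1, t2} 0 T (\<lambda>t. h (y0 t, u t))"
  by (rule bcont_off_compose[OF _ continuous_on_subset[OF assms K(2)] K(1) K(3)])
    (intro bcont_off_Pair bcont_off_continuous y0_continuous u_bcont)

lemma continuous_Q: "continuous_on Q (\<lambda>(y, v). f y v)" "continuous_on Q f'" "continuous_on Q (\<lambda>(y, v). \<phi> v)"
  "continuous_on Q \<Phi>'"
  by (rule has_derivative_continuous_on, rule has_derivative_at_withinI, erule df df' dphi dPhi')+

lemma e_bcont: "bcont_off {t1, t2} 0 T e"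
  using state_bcont[OF continuous_Q(1)] by (simp add: e_def[abs_def])

lemma A_bcont: "bcont_off {t1, t2} 0 T A"
  unfolding A_def[abs_def] by (rule state_bcont, rule bounded_linear.continuous_on[OF bounded_linear_partial1 continuous_Q(2)])

lemma B_bcont: "bcont_off {t1, t2} 0 T B"
  unfolding B_def[abs_def] by (rule state_bcont, rule bounded_linear.continuous_on[OF bounded_linear_partial2 continuous_Q(2)])

lemma bounded_linear_gradPhi: "bounded_linear gradPhi"
  by (rule bounded_linear_vecI) (simp add: gradPhi_def blinfun.bounded_linear_left)

lemma q_bcont: "bcont_off {t1, t2} 0 T q"
proof -
  have 1: "bcont_off {t1, t2} 0 T (\<lambda>t. \<Phi>'' (y0 t, u t))" by (rule state_bcont[OF cPhi''])
  have 2: "bcont_off {t1, t2} 0 T (\<lambda>t. blinfun_apply (\<Phi>'' (y0 t, u t)) (e t, 0))"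
    by (rule bcont_off_bilinear[OF bounded_bilinear_blinfun_apply 1])
      (intro bcont_off_Pair e_bcont bcont_off_continuous continuous_on_const)
  show ?thesis
    unfolding q_def[abs_def] by (rule bcont_off_linear[OF bounded_linear_gradPhi 2])
qed

lemma grad_Phi:
  assumes "(y, v) \<in> Q"
  shows "grad \<Phi> y = gradPhi (\<Phi>' (y, v))" "(\<Phi> has_derivative (\<lambda>h. grad \<Phi> y \<bullet> h)) (at y)"
proof -
  have d: "(\<Phi> has_derivative (\<lambda>h. \<Phi>' (y, v) (h, 0))) (at y)"
    using has_derivative_fst_partial[of "\<lambda>y v. \<Phi> y"] dPhi[OF assms] by blast
  show "grad \<Phi> y = gradPhi (\<Phi>' (y, v))" by (simp add: grad_eq[OF d] gradPhi_def)
  show "(\<Phi> has_derivative (\<lambda>h. grad \<Phi> y \<bullet> h)) (at y)" by (simp add: grad_inner[OF d] d)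
qed

lemma Phi_has_derivative: "y \<in> fst ` Q \<Longrightarrow> (\<Phi> has_derivative (\<lambda>h. grad \<Phi> y \<bullet> h)) (at y)"
  using grad_Phi(2) by force

text \<open>The derivative is given at pairs, and no continuous choice of a control above each state
  is at hand; for continuity at \<open>y\<close> one control above \<open>y\<close> is frozen, which
  by openness serves a neighbourhood.\<close>

lemma grad_Phi_continuous: "continuous_on (fst ` Q) (grad \<Phi>)"
proof (rule continuous_at_imp_continuous_on, rule ballI)
  fix y assume "y \<in> fst ` Q"
  then obtain v where v: "(y, v) \<in> Q" by auto
  let ?V = "(\<lambda>z. (z, v)) -` Q"
  have V: "open ?V" by (rule continuous_open_vimage[OF openQ]) (intro continuous_intros)
  have "continuous_on ?V (\<lambda>z. gradPhi (\<Phi>' (z, v)))"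
    by (intro bounded_linear.continuous_on[OF bounded_linear_gradPhi] continuous_on_compose2[OF continuous_Q(4)])
      (auto intro!: continuous_intros)
  then have "continuous_on ?V (grad \<Phi>)" by (rule continuous_on_eq) (simp add: grad_Phi(1))
  then show "isCont (grad \<Phi>) y" using V v by (simp add: continuous_on_eq_continuous_at)
qed

lemma y0_fst: "t \<in> {0..T} \<Longrightarrow> y0 t \<in> fst ` Q" using reference_mem by force

lemma y0_solves: "solves {t1, t2} 0 T y0 e"
proof (rule absolutely_continuous_solves[OF _ e_bcont y0_ac])
  have "AE t in lebesgue_on {0..T}. (y0 has_vector_derivative f (y0 t) (u0 t)) (at t)"
    using minimal by (simp add: extended_weak_minimum_def admissible_def is_process_def)
  then show "AE t in lebesgue_on {0..T}. t \<notin> {t1, t2} \<longrightarrow> (y0 has_vector_derivative e t) (at t)"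
    by (rule AE_mp) (rule AE_I2, use u_u0 in \<open>auto simp: e_def\<close>)
qed simp

lemma p_continuous: "continuous_on {0..T} p"
  unfolding p_def[abs_def] by (rule continuous_on_compose2[OF grad_Phi_continuous y0_continuous]) (use y0_fst in blast)

lemma p_solves: "solves {t1, t2} 0 T p q"
  unfolding solves_def
proof (intro conjI ballI p_continuous)
  fix t assume t: "t \<in> {0<..<T} - {t1, t2}"
  let ?x = "(y0 t, u t)"
  have y: "(y0 has_vector_derivative e t) (at t)" using y0_solves t by (simp add: solves_def)
  have x: "?x \<in> Q" using reference_mem t by simp
  \<comment> \<open>The control coordinate is frozen at time \<open>t\<close>: the gradient of
    \<Phi> does not depend on it, and \<open>u\<close> need not be differentiable.\<close>
  have "((\<lambda>s. (y0 s, u t)) has_derivative (\<lambda>h. (h *\<^sub>R e t, 0))) (at t)"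
    using y unfolding has_vector_derivative_def by (auto intro!: derivative_eq_intros)
  from has_derivative_compose[OF this dPhi'[OF x]]
  have "((\<lambda>s. \<Phi>' (y0 s, u t)) has_derivative (\<lambda>h. \<Phi>'' ?x (h *\<^sub>R e t, 0))) (at t)" .
  from bounded_linear.has_derivative[OF bounded_linear_gradPhi this]
  have d: "((\<lambda>s. gradPhi (\<Phi>' (y0 s, u t))) has_derivative (\<lambda>h. gradPhi (\<Phi>'' ?x (h *\<^sub>R e t, 0)))) (at t)" .
  have "gradPhi (\<Phi>'' ?x (h *\<^sub>R e t, 0)) = h *\<^sub>R q t" for h
    using blinfun.scaleR_right[of "\<Phi>'' ?x" h "(e t, 0)"] bounded_linear.linear[OF bounded_linear_gradPhi]
    by (simp add: q_def linear_scale)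
  with d have d: "((\<lambda>s. gradPhi (\<Phi>' (y0 s, u t))) has_derivative (\<lambda>h. h *\<^sub>R q t)) (at t)" by simp
  have cy: "isCont (\<lambda>s. (y0 s, u t)) t"
    using has_vector_derivative_continuous[OF y] by (intro continuous_intros)
  have "\<forall>\<^sub>F s in nhds t. (y0 s, u t) \<in> Q"
    using topological_tendstoD[OF cy[unfolded isCont_def, THEN tendsto_at_iff_tendsto_nhds[THEN iffD1]] openQ x] .
  then have ev: "\<forall>\<^sub>F s in nhds t. gradPhi (\<Phi>' (y0 s, u t)) = p s"
    by (rule eventually_mono) (simp add: p_def grad_Phi(1))
  have "((\<lambda>s. gradPhi (\<Phi>' (y0 s, u t))) has_vector_derivative q t) (at t)" using d by (simp add: has_vector_derivative_def)
  then have d: "((\<lambda>s. gradPhi (\<Phi>' (y0 s, u t))) has_vector_derivative q t) (at t within UNIV)" .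
  obtain U where U: "open U" "t \<in> U" "\<And>s. s \<in> U \<Longrightarrow> gradPhi (\<Phi>' (y0 s, u t)) = p s"
    using ev unfolding eventually_nhds by blast
  show "(p has_vector_derivative q t) (at t)"
    by (rule has_vector_derivative_transform_within_open[OF d U])
qed

text \<open>Differentiation of \<Phi>(y0) = 0 inside the arc. It makes time dilations invisible to
  the linearised state constraint there.\<close>

lemma pe: assumes "t \<in> {t1<..<t2}" shows "p t \<bullet> e t = 0"
proof -
  have t: "t \<in> {0<..<T} - {t1, t2}" using assms times by auto
  then have y: "(y0 has_derivative (\<lambda>h. h *\<^sub>R e t)) (at t)"
    using y0_solves by (simp add: solves_def has_vector_derivative_def)
  have "y0 t \<in> fst ` Q" using t by (intro y0_fst) auto
  from has_derivative_compose[OF y Phi_has_derivative[OF this]]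
  have "((\<lambda>s. \<Phi> (y0 s)) has_derivative (\<lambda>h. h * (p t \<bullet> e t))) (at t)" by (simp add: p_def)
  then have "((\<lambda>s. \<Phi> (y0 s)) has_real_derivative (p t \<bullet> e t)) (at t)"
    by (simp add: has_field_derivative_def mult_commute_abs)
  moreover have "((\<lambda>s. \<Phi> (y0 s)) has_real_derivative 0) (at t)"
    by (rule has_field_derivative_transform_within_open[of "\<lambda>_. 0" 0 t "{t1<..<t2}"]) (use assms Phi0(1) in auto)
  ultimately show ?thesis by (rule DERIV_unique)
qed

lemma jacobian_partials: assumes "(y, v) \<in> Q"
  shows "jacobian (\<lambda>y. f y v) (at y) = partial1 (f' (y, v))" "jacobian (f y) (at v) = partial2 (f' (y, v))"
  using jacobian_partial1[OF df[OF assms]] jacobian_partial2[OF df[OF assms]] by auto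

text \<open>Compactness of the closed arc for the control with its one-sided values. The bound is
  claimed before \<open>t2\<close> only, because \<open>u t2\<close> belongs to the third
  arc.\<close>

lemma pB_bound: "\<exists>c0>0. \<forall>t\<in>{t1..<t2}. c0 \<le> norm (p t v* B t)"
proof -
  let ?h = "\<lambda>t. norm (p t v* partial2 (f' (y0 t, u2 t)))"
  have c: "continuous_on {t1..t2} ?h"
  proof (rule continuous_on_norm, rule bounded_bilinear.continuous_on[OF bounded_bilinear_vector_matrix_mult])
    show "continuous_on {t1..t2} p" by (rule continuous_on_subset[OF p_continuous]) (use times in auto)
    show "continuous_on {t1..t2} (\<lambda>t. partial2 (f' (y0 t, u2 t)))"
      by (intro bounded_linear.continuous_on[OF bounded_linear_partial2] continuous_on_compose2[OF continuous_Q(2) x_continuous(2)])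
        (use inQ in auto)
  qed
  obtain s where s: "s \<in> {t1..t2}" "\<forall>t\<in>{t1..t2}. ?h s \<le> ?h t"
    using continuous_attains_inf[OF compact_Icc _ c] times by auto
  have "0 < ?h s" using nondegenerate[OF s(1)] by (simp add: jacobian_partials(2)[OF inQ(2)[OF s(1)]] p_def)
  moreover have "?h s \<le> norm (p t v* B t)" if "t \<in> {t1..<t2}" for t
    using s(2) that u_eq(2)[OF that] by (auto simp: B_def)
  ultimately show ?thesis by blast
qed

lemma p_t1: "p t1 \<noteq> 0"
proof
  assume "p t1 = 0"
  then have "p t1 v* B t1 = 0" by (simp add: bounded_bilinear.zero_left[OF bounded_bilinear_vector_matrix_mult])
  then show False using pB_bound times by force
qed

text \<open>On the arc \<open>y0\<close> and the control are Lipschitz, and the derivative of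
  \<open>f\<close>, being continuously differentiable, is Lipschitz on the compact image.\<close>

lemma B_lipschitz: "\<exists>L. L-lipschitz_on {t1..<t2} B"
proof -
  obtain L1 where L1: "L1-lipschitz_on {t1..t2} u2" using control(2) by blast
  obtain C where C: "0 \<le> C" "\<And>t. t \<in> {0..T} \<Longrightarrow> norm (e t) \<le> C" using bcont_off_bound[OF e_bcont] by blast
  have "C-lipschitz_on {0..T} y0"
    by (rule solves_lipschitz[OF _ y0_solves]) (use C in auto)
  then have y: "C-lipschitz_on {t1..t2} y0" by (rule lipschitz_on_subset) (use times in auto)
  have x: "(sqrt (C\<^sup>2 + L1\<^sup>2))-lipschitz_on {t1..t2} (\<lambda>t. (y0 t, u2 t))"
    by (rule lipschitz_on_Pair[OF y L1])
  have K2: "compact ((\<lambda>t. (y0 t, u2 t)) ` {t1..t2})" by (intro compact_continuous_image x_continuous compact_Icc)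
  have K2Q: "(\<lambda>t. (y0 t, u2 t)) ` {t1..t2} \<subseteq> Q" using inQ(2) by blast
  have "\<exists>L. L-lipschitz_on ((\<lambda>t. (y0 t, u2 t)) ` {t1..t2}) (\<lambda>x. partial2 (f' x))"
  proof (rule C1_lipschitz_compact[OF K2 openQ K2Q, where g' = "\<lambda>x. Blinfun partial2 o\<^sub>L f'' x"])
    fix x assume "x \<in> Q"
    from bounded_linear.has_derivative[OF bounded_linear_partial2 df'[OF this]]
    show "((\<lambda>x. partial2 (f' x)) has_derivative blinfun_apply (Blinfun partial2 o\<^sub>L f'' x)) (at x)"
      by (rule has_derivative_eq_rhs) (simp add: fun_eq_iff bounded_linear_Blinfun_apply[OF bounded_linear_partial2])
  qed (intro continuous_intros cf'')
  then obtain L2 where L2: "L2-lipschitz_on ((\<lambda>t. (y0 t, u2 t)) ` {t1..t2}) (\<lambda>x. partial2 (f' x))" by blast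
  have "(L2 * sqrt (C\<^sup>2 + L1\<^sup>2))-lipschitz_on {t1..t2} (\<lambda>t. partial2 (f' (y0 t, u2 t)))"
    using lipschitz_on_compose[OF x L2] by (simp add: o_def)
  then have "(L2 * sqrt (C\<^sup>2 + L1\<^sup>2))-lipschitz_on {t1..<t2} (\<lambda>t. partial2 (f' (y0 t, u2 t)))"
    by (rule lipschitz_on_subset) auto
  then have "(L2 * sqrt (C\<^sup>2 + L1\<^sup>2))-lipschitz_on {t1..<t2} B"
    by (rule lipschitz_on_transform) (use u_eq(2) in \<open>simp add: B_def\<close>)
  then show ?thesis by blast
qed

lemma J_derivative: "J' (a, b) = J0 \<bullet> a + JT \<bullet> b"
proof -
  have "J' (a, b) = J' (a, 0) + J' (0, b)"
    using linear_add[OF has_derivative_linear[OF dJ], of "(a, 0)" "(0, b)"] by simp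
  then show ?thesis
    unfolding J0_def JT_def
    by (simp add: grad_inner[OF has_derivative_fst_partial[OF dJ]] grad_inner[OF has_derivative_snd_partial[OF dJ]])
qed

text \<open>The constraint is known for almost all times; continuity on the closed arcs extends it
  to all of them and to the one-sided limits.\<close>

lemma phi_nonpos: "t \<in> {0..t1} \<Longrightarrow> \<phi> (u1 t) $ s \<le> 0" "t \<in> {t2..T} \<Longrightarrow> \<phi> (u3 t) $ s \<le> 0"
proof -
  have ae: "AE t in lebesgue_on {0..T}. \<forall>s. \<phi> (u0 t) $ s \<le> 0"
    using minimal by (simp add: extended_weak_minimum_def admissible_def)
  have c: "continuous_on X (\<lambda>t. \<phi> (v t) $ s)" if "continuous_on X (\<lambda>t. (y0 t, v t))" "\<And>t. t \<in> X \<Longrightarrow> (y0 t, v t) \<in> Q" for X v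
    using continuous_on_compose2[OF continuous_Q(3) that(1)] that(2) by (auto intro!: continuous_on_component)
  show "\<phi> (u1 t) $ s \<le> 0" if "t \<in> {0..t1}"
  proof (rule AE_continuous_nonpos[OF times(1) c[OF x_continuous(1) inQ(1)] _ that])
    show "AE t in lebesgue_on {0..t1}. t \<in> {0<..<t1} \<longrightarrow> \<phi> (u1 t) $ s \<le> 0"
      using ae times by (auto simp: AE_restrict_space_iff piece1_def elim!: eventually_mono)
  qed
  show "\<phi> (u3 t) $ s \<le> 0" if "t \<in> {t2..T}"
  proof (rule AE_continuous_nonpos[OF times(3) c[OF x_continuous(3) inQ(3)] _ that])
    show "AE t in lebesgue_on {t2..T}. t \<in> {t2<..<T} \<longrightarrow> \<phi> (u3 t) $ s \<le> 0"
      using ae times by (auto simp: AE_restrict_space_iff piece3_def elim!: eventually_mono)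
  qed
qed

lemma phi_u_nonpos: "t \<in> {0..T} \<Longrightarrow> \<phi> (u t) $ s \<le> 0"
proof -
  assume t: "t \<in> {0..T}"
  then consider "t \<in> {0..<t1}" | "t \<in> {t1..<t2}" | "t \<in> {t2..T}" by force
  then show ?thesis
    by cases (use u_eq[of t] phi_nonpos phi2[of t] in \<open>auto intro: less_imp_le\<close>)
qed

section \<open>Feasible control variations and the linear problem\<close>

definition "feasible W \<longleftrightarrow> (\<exists>\<epsilon>0>0. \<forall>\<epsilon>. 0 < \<epsilon> \<and> \<epsilon> < \<epsilon>0 \<longrightarrow> (\<forall>t\<in>{0..T} - {t1, t2}. \<forall>s. \<phi> (u t + \<epsilon> *\<^sub>R W t) $ s \<le> 0))"

definition "D t = partial2 (\<phi>' (y0 t, u t))"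

definition "strict \<tau> w \<longleftrightarrow> (\<forall>s. \<phi> (u \<tau>) $ s = 0 \<longrightarrow> D \<tau> $ s \<bullet> w < 0)"

lemma feasible_zero: "feasible (\<lambda>_. 0)"
  unfolding feasible_def by (intro exI[of _ 1]) (use phi_u_nonpos in auto)

text \<open>On the boundary arc the control constraints are strict, with a uniform margin by
  compactness, so any bounded variation is feasible there for small multiples.\<close>

lemma feasible_modify:
  assumes ok: "feasible W" and W': "bcont_off {t1, t2} 0 T W'" and eq: "\<And>t. t \<in> {0..T} - {t1..t2} \<Longrightarrow> W' t = W t"
  shows "feasible W'"
proof -
  obtain \<epsilon>0 where e0: "0 < \<epsilon>0" "\<And>\<epsilon> t s. 0 < \<epsilon> \<Longrightarrow> \<epsilon> < \<epsilon>0 \<Longrightarrow> t \<in> {0..T} - {t1, t2} \<Longrightarrow> \<phi> (u t + \<epsilon> *\<^sub>R W t) $ s \<le> 0"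
    using ok unfolding feasible_def by blast
  obtain C where C: "0 \<le> C" "\<And>t. t \<in> {0..T} \<Longrightarrow> norm (W' t) \<le> C" using bcont_off_bound[OF W'] by blast
  define Q' where "Q' = Q \<inter> (\<lambda>(y, v). \<phi> v) -` {z. \<forall>s. z $ s < 0}"
  have o: "open {z :: real^'d. \<forall>s. z $ s < 0}"
    by (simp only: Collect_all_eq) (intro open_INT ballI open_Collect_less continuous_intros, simp_all)
  have "open Q'" unfolding Q'_def by (rule continuous_open_preimage[OF continuous_Q(3) openQ o])
  moreover have "compact ((\<lambda>t. (y0 t, u2 t)) ` {t1..t2})" by (intro compact_continuous_image x_continuous compact_Icc)
  moreover have "(\<lambda>t. (y0 t, u2 t)) ` {t1..t2} \<subseteq> Q'" using inQ(2) phi2 by (auto simp: Q'_def)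
  ultimately obtain r where r: "0 < r" "(\<Union>x\<in>(\<lambda>t. (y0 t, u2 t)) ` {t1..t2}. cball x r) \<subseteq> Q'"
    using compact_subset_open_imp_cball_epsilon_subset by blast
  define \<epsilon>1 where "\<epsilon>1 = min \<epsilon>0 (r / (C + 1))"
  have "0 < \<epsilon>1" using e0 r C by (simp add: \<epsilon>1_def)
  moreover have "\<phi> (u t + \<epsilon> *\<^sub>R W' t) $ s \<le> 0" if \<epsilon>: "0 < \<epsilon>" "\<epsilon> < \<epsilon>1" and t: "t \<in> {0..T} - {t1, t2}" for \<epsilon> t s
  proof (cases "t \<in> {t1..t2}")
    case True
    then have t2: "t \<in> {t1..<t2}" using t by auto
    have "norm (\<epsilon> *\<^sub>R W' t) \<le> r / (C + 1) * (C + 1)"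
      unfolding norm_scaleR using \<epsilon> C(2)[of t] t C(1) r(1) by (intro mult_mono) (auto simp: \<epsilon>1_def)
    also have "\<dots> = r" using C(1) by simp
    finally have "(y0 t, u2 t + \<epsilon> *\<^sub>R W' t) \<in> cball (y0 t, u2 t) r"
      by (simp add: dist_Pair_Pair dist_norm)
    then have "(y0 t, u2 t + \<epsilon> *\<^sub>R W' t) \<in> Q'" using r(2) True by blast
    then have "\<phi> (u2 t + \<epsilon> *\<^sub>R W' t) $ s < 0" by (simp add: Q'_def)
    then show ?thesis by (simp add: u_eq(2)[OF t2])
  next
    case False
    then show ?thesis using eq[of t] e0(2)[of \<epsilon> t s] \<epsilon> t by (simp add: \<epsilon>1_def)
  qed
  ultimately show ?thesis unfolding feasible_def by blast
qed

lemma phi_derivative: "(y, v) \<in> Q \<Longrightarrow> (\<phi> has_derivative (\<lambda>h. \<phi>' (y, v) (0, h))) (at v)"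
  using has_derivative_snd_partial[of "\<lambda>y v. \<phi> v"] dphi by blast

text \<open>Feasibility of steps along \<open>w\<close> is uniform near \<open>u \<tau>\<close>, and
  \<open>u\<close> is continuous at \<tau>, so a bump of small support only takes steps from points
  in that neighbourhood.\<close>

lemma feasible_bump:
  assumes \<tau>: "\<tau> \<in> {0<..<t1} \<union> {t2<..<T}" and w: "strict \<tau> w"
  shows "\<exists>\<rho>>0. \<forall>\<beta>. continuous_on UNIV \<beta> \<and> (\<forall>t. 0 \<le> \<beta> t) \<and> (\<forall>t. \<rho> \<le> \<bar>t - \<tau>\<bar> \<longrightarrow> \<beta> t = 0) \<longrightarrow>
        feasible (\<lambda>t. \<beta> t *\<^sub>R w)"
proof -
  have \<tau>': "\<tau> \<in> {0..T}" "\<tau> \<in> {0<..<T} - {t1, t2}" using \<tau> times by auto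
  define V where "V = (\<lambda>v. (y0 \<tau>, v)) -` Q"
  define i2 where "i2 = Blinfun (\<lambda>h. (0 :: real^'m, h :: real^'k))"
  have i2: "blinfun_apply i2 = (\<lambda>h. (0, h))"
    unfolding i2_def by (rule bounded_linear_Blinfun_apply) (intro bounded_linear_Pair bounded_linear_zero bounded_linear_ident)
  have V: "open V" unfolding V_def by (rule continuous_open_vimage[OF openQ]) (intro continuous_intros)
  have uV: "u \<tau> \<in> V" using reference_mem[OF \<tau>'(1)] by (simp add: V_def)
  have "\<exists>r>0. \<exists>k0>0. \<forall>v k. dist v (u \<tau>) < r \<and> (\<forall>s. \<phi> v $ s \<le> 0) \<and> 0 \<le> k \<and> k \<le> k0 \<longrightarrow>
    (\<forall>s. \<phi> (v + k *\<^sub>R w) $ s \<le> 0)"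
  proof (rule strict_direction_feasible[OF V uV, where \<phi>' = "\<lambda>v. \<phi>' (y0 \<tau>, v) o\<^sub>L i2"])
    fix v assume "v \<in> V"
    then show "(\<phi> has_derivative blinfun_apply (\<phi>' (y0 \<tau>, v) o\<^sub>L i2)) (at v)"
      by (intro has_derivative_eq_rhs[OF phi_derivative[of "y0 \<tau>" v]]) (simp_all add: V_def i2 fun_eq_iff)
  next
    have "continuous_on V (\<lambda>v. \<phi>' (y0 \<tau>, v))"
      by (rule continuous_on_compose2[OF cphi']) (auto simp: V_def intro!: continuous_intros)
    then show "continuous_on V (\<lambda>v. \<phi>' (y0 \<tau>, v) o\<^sub>L i2)" by (intro continuous_intros)
  next
    fix s show "\<phi> (u \<tau>) $ s \<le> 0" by (rule phi_u_nonpos[OF \<tau>'(1)])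
  next
    fix s assume "\<phi> (u \<tau>) $ s = 0"
    then have "(D \<tau> *v w) $ s < 0" using w by (simp add: strict_def matrix_vector_mul_component)
    then show "blinfun_apply (\<phi>' (y0 \<tau>, u \<tau>) o\<^sub>L i2) w $ s < 0" by (simp add: D_def partial2_mult i2)
  qed
  then obtain r k0 where r: "0 < r" "0 < k0" and
    rk: "\<And>v k s. dist v (u \<tau>) < r \<Longrightarrow> (\<And>s. \<phi> v $ s \<le> 0) \<Longrightarrow> 0 \<le> k \<Longrightarrow> k \<le> k0 \<Longrightarrow> \<phi> (v + k *\<^sub>R w) $ s \<le> 0"
    by blast
  have "continuous_on ({0..T} - {t1, t2}) u" using u_bcont by (simp add: bcont_off_def)
  then obtain \<rho> where \<rho>: "0 < \<rho>" "\<And>t. t \<in> {0..T} - {t1, t2} \<Longrightarrow> dist t \<tau> < \<rho> \<Longrightarrow> dist (u t) (u \<tau>) < r"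
    unfolding continuous_on_iff using r(1) \<tau>' by (metis Diff_iff)
  have "feasible (\<lambda>t. \<beta> t *\<^sub>R w)"
    if \<beta>: "continuous_on UNIV \<beta>" "\<And>t. 0 \<le> \<beta> t" "\<And>t. \<rho> \<le> \<bar>t - \<tau>\<bar> \<Longrightarrow> \<beta> t = 0" for \<beta>
  proof -
    have "bounded (\<beta> ` {0..T})"
      using \<beta>(1) by (intro compact_imp_bounded compact_continuous_image) (auto elim: continuous_on_subset)
    then obtain M where M: "0 < M" "\<And>t. t \<in> {0..T} \<Longrightarrow> \<bar>\<beta> t\<bar> \<le> M" unfolding bounded_pos by auto
    \<comment> \<open>\<open>M\<close> bounds the bump, so multiples below \<open>k0 / M\<close>
      keep every step length below \<open>k0\<close>.\<close>
    have "\<phi> (u t + \<epsilon> *\<^sub>R \<beta> t *\<^sub>R w) $ s \<le> 0" if \<epsilon>: "0 < \<epsilon>" "\<epsilon> < k0 / M" and t: "t \<in> {0..T} - {t1, t2}" for \<epsilon> t s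
    proof (cases "\<rho> \<le> \<bar>t - \<tau>\<bar>")
      case True
      then show ?thesis using \<beta>(3) phi_u_nonpos[of t s] t by simp
    next
      case False
      have "\<epsilon> * \<beta> t \<le> k0 / M * M" using \<epsilon> M(1) M(2)[of t] t \<beta>(2)[of t] r by (intro mult_mono) auto
      then have k: "\<epsilon> * \<beta> t \<le> k0" "0 \<le> \<epsilon> * \<beta> t" using M(1) \<epsilon> \<beta>(2)[of t] by auto
      have "dist t \<tau> < \<rho>" using False by (simp add: dist_real_def)
      then have "dist (u t) (u \<tau>) < r" by (rule \<rho>(2)[OF t])
      then have "\<phi> (u t + (\<epsilon> * \<beta> t) *\<^sub>R w) $ s \<le> 0"
        by (rule rk) (use phi_u_nonpos t k in auto)
      then show ?thesis by simp
    qed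
    moreover have "0 < k0 / M" using r M by simp
    ultimately show ?thesis unfolding feasible_def by blast
  qed
  then show ?thesis using \<rho>(1) by blast
qed

lemma variation_inequality:
  assumes "solves {t1, t2} 0 T Yb (\<lambda>t. A t *v Yb t + B t *v Ub t + vb t *\<^sub>R e t)"
    and "bcont_off {t1, t2} 0 T Ub" "bcont_off {t1, t2} 0 T vb" "integral {0..T} vb = 0"
    and "\<And>t. t \<in> {t1..t2} \<Longrightarrow> 0 < p t \<bullet> Yb t" "feasible Ub"
  shows "0 \<le> J0 \<bullet> Yb 0 + JT \<bullet> Yb T"
proof -
  interpret reference_process T t1 t2 Q f f' \<phi> \<Phi> "grad \<Phi>" J J0 JT y0 u0 u K
  proof
    have "J' = (\<lambda>(a, b). J0 \<bullet> a + JT \<bullet> b)" using J_derivative by (simp add: fun_eq_iff)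
    then show "((\<lambda>(a, b). J a b) has_derivative (\<lambda>(a, b). J0 \<bullet> a + JT \<bullet> b)) (at (y0 0, y0 T))" using dJ by simp
    show "solves {t1, t2} 0 T y0 (\<lambda>t. f (y0 t) (u t))" using y0_solves by (simp add: e_def[abs_def])
  qed (fact times openQ df continuous_Q(2) Phi_has_derivative grad_Phi_continuous K u_bcont u_u0 Phi0 minimal)+
  show ?thesis
    by (rule variation_inequality[OF _ assms(2-4), where Yb = Yb])
      (use assms in \<open>simp_all add: A_def B_def partial_sum e_def p_def feasible_def\<close>)
qed

lemma linear_multipliers:
  "\<exists>\<psi> \<mu> c.
     solves {t1, t2} 0 T \<psi> (\<lambda>t. \<mu> t *\<^sub>R (q t + p t v* A t) - \<psi> t v* A t) \<and>
     mono_on {0..T} \<mu> \<and> (\<exists>L. L-lipschitz_on {t1..<t2} \<mu>) \<and>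
     (\<forall>t\<in>{0..<t1}. \<mu> t = \<mu> 0) \<and> (\<forall>t\<in>{t2..T}. \<mu> t = 0) \<and>
     \<psi> 0 - \<mu> 0 *\<^sub>R p 0 = J0 \<and> \<psi> T = - JT \<and>
     (\<forall>t\<in>{0..T} - {t1, t2}. (\<psi> t - \<mu> t *\<^sub>R p t) \<bullet> e t = c) \<and>
     (\<forall>t\<in>{t1<..<t2}. (\<psi> t - \<mu> t *\<^sub>R p t) v* B t = 0) \<and>
     (\<forall>\<tau>\<in>{0<..<t1} \<union> {t2<..<T}. \<forall>w. strict \<tau> w \<longrightarrow> ((\<psi> \<tau> - \<mu> \<tau> *\<^sub>R p \<tau>) v* B \<tau>) \<bullet> w \<le> 0)"
proof -
  obtain c0 where c0: "0 < c0" "\<And>t. t \<in> {t1..<t2} \<Longrightarrow> c0 \<le> norm (p t v* B t)" using pB_bound by blast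
  interpret linear_variation T t1 t2 A B e p q J0 JT c0 feasible strict
    by unfold_locales (fact times A_bcont B_bcont e_bcont q_bcont p_solves pe p_t1 c0 B_lipschitz
        variation_inequality feasible_zero feasible_modify feasible_bump)+
  show ?thesis by (rule linear_multipliers)
qed

end

section \<open>From the linear multipliers to the conditions of the maximum principle\<close>

lemma piece_values:
  fixes f :: "real \<Rightarrow> 'a::real_normed_vector"
  assumes t: "0 < t1" "t1 < t2" "t2 < T"
    and g: "continuous_on {0..t1} g1" "continuous_on {t1..t2} g2" "continuous_on {t2..T} g3"
    and f: "\<And>t. t \<in> {0..<t1} \<Longrightarrow> f t = g1 t" "\<And>t. t \<in> {t1<..<t2} \<Longrightarrow> f t = g2 t" "\<And>t. t \<in> {t2<..T} \<Longrightarrow> f t = g3 t"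
  shows "\<And>t. t \<in> {0..t1} \<Longrightarrow> piece1 t1 f t = g1 t" "\<And>t. t \<in> {t1..t2} \<Longrightarrow> piece2 t1 t2 f t = g2 t"
    "\<And>t. t \<in> {t2..T} \<Longrightarrow> piece3 t2 f t = g3 t" "jump f t1 = g2 t1 - g1 t1" "jump f t2 = g3 t2 - g2 t2"
proof -
  have l1: "left_value f t1 = g1 t1" by (rule left_value_eq[OF t(1) g(1)]) (use f in auto)
  have r1: "right_value f t1 = g2 t1" by (rule right_value_eq[OF t(2) g(2)]) (use f in auto)
  have l2: "left_value f t2 = g2 t2" by (rule left_value_eq[OF t(2) g(2)]) (use f in auto)
  have r2: "right_value f t2 = g3 t2" by (rule right_value_eq[OF t(3) g(3)]) (use f in auto)
  show "jump f t1 = g2 t1 - g1 t1" "jump f t2 = g3 t2 - g2 t2" by (simp_all add: jump_def l1 l2 r1 r2)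
  show "piece1 t1 f t = g1 t" if "t \<in> {0..t1}" for t
    using that f(1)[of t] l1 by (cases "t = t1") (auto simp: piece1_def)
  show "piece2 t1 t2 f t = g2 t" if "t \<in> {t1..t2}" for t
    using that f(2)[of t] r1 l2 t by (cases "t = t1 \<or> t = t2") (auto simp: piece2_def)
  show "piece3 t2 f t = g3 t" if "t \<in> {t2..T}" for t
    using that f(3)[of t] r2 by (cases "t = t2") (auto simp: piece3_def)
qed

lemma bcont_off_lebesgue_integrable:
  fixes g :: "real \<Rightarrow> 'a::euclidean_space"
  assumes S: "finite S" and g: "bcont_off S a b g"
  shows "integrable (lebesgue_on {a..b}) g"
proof -
  obtain C where C: "\<And>t. t \<in> {a..b} \<Longrightarrow> norm (g t) \<le> C" using bcont_off_bound[OF g] by blast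
  have "integrable (lebesgue_on {a..b}) (\<lambda>_. C)" by (intro continuous_imp_integrable_real continuous_on_const)
  then show ?thesis
    by (rule measurable_bounded_by_integrable_imp_lebesgue_integrable[OF bcont_off_measurable[OF S g]]) (use C in auto)
qed

lemma continuous_const_Icc:
  fixes f :: "real \<Rightarrow> real"
  assumes "a < b" "continuous_on {a..b} f" "\<And>t. t \<in> {a<..<b} \<Longrightarrow> f t = c" "t \<in> {a..b}"
  shows "f t = c"
  by (rule continuous_constant_on_closure[of "{a<..<b}"]) (use assms in auto)

text \<open>\<open>\<psi>t\<close> is the compensated function \<open>\<psi> + \<mu> p\<close>; the
  conditions for the costate are recovered by subtracting \<open>\<mu> p\<close>.\<close>

locale reference_multipliers = regular_reference +
  fixes \<psi>t :: "real \<Rightarrow> real^'a" and \<mu> :: "real \<Rightarrow> real" and c :: real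
  assumes \<psi>t: "solves {t1, t2} 0 T \<psi>t (\<lambda>t. \<mu> t *\<^sub>R (q t + p t v* A t) - \<psi>t t v* A t)"
    and \<mu>_mono: "mono_on {0..T} \<mu>" and \<mu>_lip: "\<exists>L. L-lipschitz_on {t1..<t2} \<mu>"
    and \<mu>_left: "\<And>t. t \<in> {0..<t1} \<Longrightarrow> \<mu> t = \<mu> 0" and \<mu>_right: "\<And>t. t \<in> {t2..T} \<Longrightarrow> \<mu> t = 0"
    and \<psi>t_0: "\<psi>t 0 - \<mu> 0 *\<^sub>R p 0 = J0" and \<psi>t_T: "\<psi>t T = - JT"
    and energy: "\<And>t. t \<in> {0..T} - {t1, t2} \<Longrightarrow> (\<psi>t t - \<mu> t *\<^sub>R p t) \<bullet> e t = c"
    and stationary_mid: "\<And>t. t \<in> {t1<..<t2} \<Longrightarrow> (\<psi>t t - \<mu> t *\<^sub>R p t) v* B t = 0"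
    and stationary: "\<And>\<tau> w. \<tau> \<in> {0<..<t1} \<union> {t2<..<T} \<Longrightarrow> strict \<tau> w \<Longrightarrow> ((\<psi>t \<tau> - \<mu> \<tau> *\<^sub>R p \<tau>) v* B \<tau>) \<bullet> w \<le> 0"
begin

definition "\<psi> t = \<psi>t t - \<mu> t *\<^sub>R p t"

text \<open>A Lipschitz function extends to the closure of its domain with the same constant, so
  \<mu> has a limit at \<open>t2\<close> from the left.\<close>

lemma \<mu>_extension: "\<exists>g. (\<exists>L. L-lipschitz_on {t1..t2} g) \<and> (\<forall>t\<in>{t1..<t2}. g t = \<mu> t)"
proof -
  obtain L where "L-lipschitz_on {t1..<t2} \<mu>" using \<mu>_lip by blast
  from lipschitz_extend_closure[OF this] show ?thesis using times by auto
qed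

text \<open>At \<open>t2\<close> this is the left limit of \<mu>, whereas \<mu> itself is 0 there;
  the difference is the second jump.\<close>

definition "\<mu>2 = (SOME g. (\<exists>L. L-lipschitz_on {t1..t2} g) \<and> (\<forall>t\<in>{t1..<t2}. g t = \<mu> t))"

lemma \<mu>2: "\<exists>L. L-lipschitz_on {t1..t2} \<mu>2" "t \<in> {t1..<t2} \<Longrightarrow> \<mu>2 t = \<mu> t"
  using someI_ex[OF \<mu>_extension] unfolding \<mu>2_def by blast+

lemma \<mu>2_continuous: "continuous_on {t1..t2} \<mu>2" using \<mu>2(1) lipschitz_on_continuous_on by blast

lemma \<mu>_le: "0 \<le> s \<Longrightarrow> s \<le> t \<Longrightarrow> t \<le> T \<Longrightarrow> \<mu> s \<le> \<mu> t"
  using \<mu>_mono unfolding mono_on_def by auto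

lemma \<mu>2_le_end: "s \<in> {t1..<t2} \<Longrightarrow> \<mu>2 s \<le> \<mu>2 t2"
proof -
  assume s: "s \<in> {t1..<t2}"
  have "\<mu>2 s - \<mu>2 t2 \<le> 0"
  proof (rule continuous_le_on_closure[of "{s<..<t2}" "\<lambda>t. \<mu>2 s - \<mu>2 t" t2 0])
    show "continuous_on (closure {s<..<t2}) (\<lambda>t. \<mu>2 s - \<mu>2 t)"
      using s by (intro continuous_intros) (auto intro: continuous_on_subset[OF \<mu>2_continuous])
    show "\<mu>2 s - \<mu>2 t \<le> 0" if "t \<in> {s<..<t2}" for t
      using \<mu>_le[of s t] that s times by (simp add: \<mu>2(2))
  qed (use s in auto)
  then show ?thesis by simp
qed

lemma \<mu>2_end_nonpos: "\<mu>2 t2 \<le> 0"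
proof (rule continuous_le_on_closure[of "{t1<..<t2}" \<mu>2 t2 0])
  show "\<mu>2 t \<le> 0" if "t \<in> {t1<..<t2}" for t
    using \<mu>_le[of t t2] \<mu>_right[of t2] that times by (simp add: \<mu>2(2))
qed (use \<mu>2_continuous times in auto)

lemma \<mu>2_mono: "mono_on {t1..t2} \<mu>2"
proof (rule mono_onI)
  fix s t assume st: "s \<in> {t1..t2}" "t \<in> {t1..t2}" "s \<le> t"
  show "\<mu>2 s \<le> \<mu>2 t"
  proof (cases "t = t2")
    case True
    then show ?thesis using \<mu>2_le_end[of s] st by (cases "s = t2") auto
  next
    case False
    then show ?thesis using st times \<mu>_le[of s t] by (simp add: \<mu>2(2))
  qed
qed

definition "\<mu>1 = \<mu> 0"
definition "\<psi>1 t = \<psi>t t - \<mu>1 *\<^sub>R p t"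
definition "\<psi>2 t = \<psi>t t - \<mu>2 t *\<^sub>R p t"

lemma \<mu>_pieces: "t \<in> {0..<t1} \<Longrightarrow> \<mu> t = \<mu>1" "t \<in> {t1<..<t2} \<Longrightarrow> \<mu> t = \<mu>2 t" "t \<in> {t2<..T} \<Longrightarrow> \<mu> t = 0"
  using \<mu>_left[of t] \<mu>2(2)[of t] \<mu>_right[of t] by (auto simp: \<mu>1_def)

lemma \<mu>_bcont: "bcont_off {t1, t2} 0 T \<mu>"
  by (rule piecewise_bcont_off[OF times continuous_on_const \<mu>2_continuous continuous_on_const]) (use \<mu>_pieces in auto)

lemma p_bcont: "bcont_off {t1, t2} 0 T p" by (rule bcont_off_continuous[OF p_continuous])

lemma \<psi>t_continuous: "continuous_on {0..T} \<psi>t" using \<psi>t by (simp add: solves_def)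

lemma \<psi>_bcont: "bcont_off {t1, t2} 0 T \<psi>"
  unfolding \<psi>_def[abs_def] by (intro bcont_off_intros \<mu>_bcont p_bcont bcont_off_continuous \<psi>t_continuous)

lemma \<psi>t_lipschitz: "\<exists>L. L-lipschitz_on {0..T} \<psi>t"
  by (rule solves_lipschitz_exists[OF _ \<psi>t])
    (simp, intro bcont_off_intros \<mu>_bcont p_bcont A_bcont q_bcont bcont_off_continuous[OF \<psi>t_continuous])

lemma p_lipschitz: "\<exists>L. L-lipschitz_on {0..T} p"
  by (rule solves_lipschitz_exists[OF _ p_solves q_bcont]) simp

lemma \<psi>_pieces_lipschitz: "\<exists>L. L-lipschitz_on {0..t1} \<psi>1" "\<exists>L. L-lipschitz_on {t1..t2} \<psi>2" "\<exists>L. L-lipschitz_on {t2..T} \<psi>t"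
proof -
  have sub: "\<exists>L. L-lipschitz_on X g" if "\<exists>L. L-lipschitz_on {0..T} g" "X \<subseteq> {0..T}" for g :: "real \<Rightarrow> real^'a" and X
    using that lipschitz_on_subset by blast
  have diff: "\<exists>L. L-lipschitz_on X (\<lambda>t. g t - h t)" if "\<exists>L. L-lipschitz_on X g" "\<exists>L. L-lipschitz_on X h" for g h :: "real \<Rightarrow> real^'a" and X
    using that lipschitz_on_diff by blast
  have prod: "\<exists>L. L-lipschitz_on X (\<lambda>t. g t *\<^sub>R p t)"
    if "X \<subseteq> {0..T}" "compact X" "\<exists>L. L-lipschitz_on X g" for g :: "real \<Rightarrow> real" and X
  proof (rule lipschitz_on_bilinear[OF bounded_bilinear_scaleR that(3) _ sub[OF p_lipschitz that(1)]])
    show "bounded (g ` X)"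
      using that(2,3) by (auto intro!: compact_imp_bounded compact_continuous_image lipschitz_on_continuous_on)
    show "bounded (p ` X)"
      by (intro compact_imp_bounded compact_continuous_image that(2) continuous_on_subset[OF p_continuous that(1)])
  qed
  have const: "\<exists>L. L-lipschitz_on {0..t1} (\<lambda>t. \<mu>1)" using lipschitz_on_constant by blast
  show "\<exists>L. L-lipschitz_on {0..t1} \<psi>1" unfolding \<psi>1_def[abs_def]
    by (intro diff sub[OF \<psi>t_lipschitz] prod const) (use times in auto)
  show "\<exists>L. L-lipschitz_on {t1..t2} \<psi>2" unfolding \<psi>2_def[abs_def]
    by (intro diff sub[OF \<psi>t_lipschitz] prod \<mu>2) (use times in auto)
  show "\<exists>L. L-lipschitz_on {t2..T} \<psi>t" by (intro sub[OF \<psi>t_lipschitz]) (use times in auto)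
qed

lemma \<psi>_pieces: "t \<in> {0..<t1} \<Longrightarrow> \<psi> t = \<psi>1 t" "t \<in> {t1<..<t2} \<Longrightarrow> \<psi> t = \<psi>2 t" "t \<in> {t2<..T} \<Longrightarrow> \<psi> t = \<psi>t t"
  using \<mu>_pieces[of t] by (auto simp: \<psi>_def \<psi>1_def \<psi>2_def)

lemma lipschitz_continuous: "\<exists>L. L-lipschitz_on X g \<Longrightarrow> continuous_on X g"
  using lipschitz_on_continuous_on by blast

lemma \<psi>_values: "t \<in> {0..t1} \<Longrightarrow> piece1 t1 \<psi> t = \<psi>1 t" "t \<in> {t1..t2} \<Longrightarrow> piece2 t1 t2 \<psi> t = \<psi>2 t"
    "t \<in> {t2..T} \<Longrightarrow> piece3 t2 \<psi> t = \<psi>t t" "jump \<psi> t1 = \<psi>2 t1 - \<psi>1 t1" "jump \<psi> t2 = \<psi>t t2 - \<psi>2 t2"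
  by (rule piece_values[OF times \<psi>_pieces_lipschitz[THEN lipschitz_continuous]]; (rule \<psi>_pieces)?; assumption)+

lemma \<mu>_values: "t \<in> {0..t1} \<Longrightarrow> piece1 t1 \<mu> t = \<mu>1" "t \<in> {t1..t2} \<Longrightarrow> piece2 t1 t2 \<mu> t = \<mu>2 t"
    "t \<in> {t2..T} \<Longrightarrow> piece3 t2 \<mu> t = 0" "jump \<mu> t1 = \<mu>2 t1 - \<mu>1" "jump \<mu> t2 = 0 - \<mu>2 t2"
  by (rule piece_values[OF times continuous_on_const \<mu>2_continuous continuous_on_const]; (rule \<mu>_pieces)?; assumption)+

lemma piecewise_lipschitz: "piecewise_Lipschitz T t1 t2 \<psi>" "piecewise_Lipschitz T t1 t2 \<mu>"
proof -
  have tr: "\<exists>L. L-lipschitz_on X f" if "\<exists>L. L-lipschitz_on X g" "\<And>t. t \<in> X \<Longrightarrow> f t = g t" for X and f g :: "real \<Rightarrow> 'z::metric_space"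
    using that lipschitz_on_transform by blast
  show "piecewise_Lipschitz T t1 t2 \<psi>" unfolding piecewise_Lipschitz_def
    by (intro conjI tr[OF \<psi>_pieces_lipschitz(1)] tr[OF \<psi>_pieces_lipschitz(2)] tr[OF \<psi>_pieces_lipschitz(3)]) (simp_all add: \<psi>_values)
  have const: "\<exists>L. L-lipschitz_on X (\<lambda>t. k)" for X :: "real set" and k :: real using lipschitz_on_constant by blast
  show "piecewise_Lipschitz T t1 t2 \<mu>" unfolding piecewise_Lipschitz_def
    by (intro conjI tr[OF const[of "{0..t1}" "\<mu>1"]] tr[OF \<mu>2(1)] tr[OF const[of "{t2..T}" 0]]) (simp_all add: \<mu>_values)
qed

text \<open>\<open>\<psi>t\<close> and \<open>p\<close> are continuous, so the jumps of
  \<open>\<psi>\<close> come from \<mu> alone and are multiples of \<open>p\<close>.\<close>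

lemma jumps: "0 \<le> jump \<mu> t1" "0 \<le> jump \<mu> t2"
  "jump \<psi> t1 = - jump \<mu> t1 *\<^sub>R p t1" "jump \<psi> t2 = - jump \<mu> t2 *\<^sub>R p t2"
  using \<mu>_le[of 0 t1] \<mu>2(2)[of t1] \<mu>2_end_nonpos times
  by (simp_all add: \<psi>_values \<mu>_values \<psi>1_def \<psi>2_def \<mu>1_def algebra_simps)

text \<open>Outside the arc \<mu> is locally constant; inside, the result for monotone Lipschitz
  functions applies to \<open>\<mu>2\<close>, which agrees with \<mu> near every interior
  time.\<close>

lemma \<mu>_derivative: "\<exists>N. negligible N \<and> (\<forall>t\<in>{0..T} - N. \<exists>m\<ge>0. (\<mu> has_real_derivative m) (at t))"
proof -
  obtain L where L: "L-lipschitz_on {t1..t2} \<mu>2" using \<mu>2(1) by blast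
  define N where "N = {x \<in> {t1..t2}. \<not> (\<exists>m\<ge>0. (\<mu>2 has_real_derivative m) (at x))} \<union> {0, t1, t2, T}"
  have "negligible N" unfolding N_def
    by (intro negligible_Un lipschitz_mono_differentiable_ae[OF L \<mu>2_mono times(2)] negligible_finite) simp
  moreover have "\<exists>m\<ge>0. (\<mu> has_real_derivative m) (at t)" if t: "t \<in> {0..T} - N" for t
  proof -
    consider "t \<in> {0<..<t1}" | "t \<in> {t1<..<t2}" | "t \<in> {t2<..<T}" using t by (auto simp: N_def) force
    then show ?thesis
    proof cases
      case 1
      have "(\<mu> has_real_derivative 0) (at t)"
        by (rule has_field_derivative_transform_within_open[OF DERIV_const open_greaterThanLessThan 1]) (use \<mu>_pieces(1) in force)
      then show ?thesis by blast
    next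
      case 2
      then obtain m where m: "0 \<le> m" "(\<mu>2 has_real_derivative m) (at t)" using t by (auto simp: N_def)
      have "(\<mu> has_real_derivative m) (at t)"
        by (rule has_field_derivative_transform_within_open[OF m(2) open_greaterThanLessThan 2]) (use \<mu>_pieces(2) in force)
      then show ?thesis using m(1) by blast
    next
      case 3
      have "(\<mu> has_real_derivative 0) (at t)"
        by (rule has_field_derivative_transform_within_open[OF DERIV_const open_greaterThanLessThan 3]) (use \<mu>_pieces(3) in force)
      then show ?thesis by blast
    qed
  qed
  ultimately show ?thesis by blast
qed

lemma complementary: "RS_measure_zero T (\<lambda>t. \<Phi> (y0 t)) \<mu>"
  unfolding RS_measure_zero_def
proof (intro allI impI, rule RS_integral_complementary)
  have "continuous_on (fst ` Q) \<Phi>"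
    by (rule has_derivative_continuous_on, rule has_derivative_at_withinI, erule Phi_has_derivative)
  then show "continuous_on {0..T} (\<lambda>t. \<Phi> (y0 t))"
    by (rule continuous_on_compose2[OF _ y0_continuous]) (use y0_fst in blast)
  show "\<Phi> (y0 t) = 0" if "t \<in> {t1..t2}" for t using Phi0(1) that .
  show "\<mu> a = \<mu> b" if "0 \<le> a" "a \<le> b" "b \<le> T" "{a..b} \<inter> {t1..t2} = {}" for a b
  proof -
    have "b < t1 \<or> t2 < a"
    proof (rule ccontr)
      assume "\<not> (b < t1 \<or> t2 < a)"
      then have "max a t1 \<in> {a..b} \<inter> {t1..t2}" using that times by auto
      then show False using that by blast
    qed
    then show ?thesis using \<mu>_pieces(1)[of a] \<mu>_pieces(1)[of b] \<mu>_right[of a] \<mu>_right[of b] that by auto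
  qed
qed (use \<mu>_mono times in auto)

text \<open>\<mu> takes its right-hand values at both switching times; this is the form in which
  integrals against a monotone function were shown to exist.\<close>

lemma \<mu>_right_continuous: "0 \<le> t \<Longrightarrow> t < T \<Longrightarrow> continuous (at_right t) \<mu>"
proof -
  assume t: "0 \<le> t" "t < T"
  have *: "continuous (at_right t) \<mu>" if "t < b" "continuous_on {t..b} g" "\<And>s. s \<in> {t..<b} \<Longrightarrow> \<mu> s = g s" for g b
  proof -
    have "(g \<longlongrightarrow> g t) (at t within {t..b})" using that by (simp add: continuous_on)
    then have "(g \<longlongrightarrow> g t) (at_right t)" using that(1) by (simp add: at_within_Icc_at_right)
    moreover have "\<forall>\<^sub>F s in at_right t. \<mu> s = g s"
      using that(1,3) by (auto simp: eventually_at_right intro!: exI[of _ b])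
    ultimately have "(\<mu> \<longlongrightarrow> g t) (at_right t)" by (simp add: tendsto_cong)
    then show ?thesis using that(1,3) by (simp add: continuous_within)
  qed
  consider "t < t1" | "t1 \<le> t" "t < t2" | "t2 \<le> t" by linarith
  then show ?thesis
  proof cases
    case 1 show ?thesis by (rule *[OF 1, of "\<lambda>_. \<mu>1"]) (use \<mu>_pieces(1) t in auto)
  next
    case 2 show ?thesis
      by (rule *[OF 2(2), of \<mu>2]) (use \<mu>2(2) 2 in \<open>auto intro: continuous_on_subset[OF \<mu>2_continuous]\<close>)
  next
    case 3 show ?thesis by (rule *[OF t(2), of "\<lambda>_. 0"]) (use \<mu>_right 3 in auto)
  qed
qed

section \<open>Adjoint equation, energy and control multiplier\<close>

definition "\<alpha> t = \<psi> t v* jacobian (\<lambda>y. f y (u0 t)) (at (y0 t))"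

lemma \<alpha>_eq: "t \<in> {0..T} - {t1, t2} \<Longrightarrow> \<alpha> t = \<psi> t v* A t"
  using jacobian_partials(1)[of "y0 t" "u0 t"] u_u0[of t] reference_mem[of t] by (simp add: \<alpha>_def A_def)

lemma \<alpha>_bcont: "bcont_off {t1, t2} 0 T \<alpha>"
  by (rule bcont_off_cong[where g = "\<lambda>t. \<psi> t v* A t"]) (intro bcont_off_intros \<psi>_bcont A_bcont, simp_all add: \<alpha>_eq)

text \<open>In the equation for \<open>\<psi>t\<close>, the substitution
  \<open>\<psi>t = \<psi> + \<mu> p\<close> cancels the term \<mu> times \<open>p t v* A t\<close>
  and leaves \<open>\<mu> q - \<alpha>\<close>; as \<open>q\<close> is the derivative of
  \<open>p\<close>, integration by parts in each component gives the equality of measures.\<close>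

lemma adjoint: "adjoint_measure_eq T \<psi> \<alpha> p \<mu>"
proof -
  have comp: "bcont_off {t1, t2} 0 T (\<lambda>t. x t $ i)" if "bcont_off {t1, t2} 0 T x" for x :: "real \<Rightarrow> real^'a" and i
    by (rule bcont_off_linear[OF bounded_linear_vec_nth that])
  have scomp: "solves {t1, t2} 0 T (\<lambda>t. x t $ i) (\<lambda>t. y t $ i)" if "solves {t1, t2} 0 T x y" for x y :: "real \<Rightarrow> real^'a" and i
    using that unfolding solves_def
    by (auto intro!: continuous_on_component bounded_linear.has_vector_derivative[OF bounded_linear_vec_nth])
  have int: "integrable (lebesgue_on {0..T}) (\<lambda>t. \<alpha> t $ i)" for i
    by (rule bcont_off_lebesgue_integrable[OF _ comp[OF \<alpha>_bcont]]) simp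
  have \<psi>s: "solves {t1, t2} 0 T \<psi>t (\<lambda>t. \<mu> t *\<^sub>R q t - \<alpha> t)"
  proof (rule solves_cong[OF \<psi>t])
    fix t assume t: "t \<in> {0<..<T} - {t1, t2}"
    then show "\<mu> t *\<^sub>R (q t + p t v* A t) - \<psi>t t v* A t = \<mu> t *\<^sub>R q t - \<alpha> t"
      using \<alpha>_eq[of t] by (simp add: \<psi>_def bounded_bilinear.diff_left[OF bounded_bilinear_vector_matrix_mult]
          bounded_bilinear.scaleR_left[OF bounded_bilinear_vector_matrix_mult] scaleR_add_right)
  qed
  have main: "\<exists>X B. has_RS_integral g (\<lambda>t. \<psi> t $ i) 0 T X \<and> has_RS_integral (\<lambda>t. g t * p t $ i) \<mu> 0 T B \<and>
      - X = (LINT t|lebesgue_on {0..T}. g t * \<alpha> t $ i) + B" if g: "continuous_on {0..T} g" for g i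
  proof -
    have "continuous_on {0..T} (\<lambda>t. g t * p t $ i)"
      by (intro continuous_intros g p_continuous)
    then obtain B where B: "has_RS_integral (\<lambda>t. g t * p t $ i) \<mu> 0 T B"
      using RS_integral_mono_exists[OF _ \<mu>_mono \<mu>_right_continuous] times by force
    have "has_RS_integral g (\<lambda>t. \<psi>t t $ i - \<mu> t * p t $ i) 0 T (- integral {0..T} (\<lambda>t. g t * \<alpha> t $ i) - B)"
    proof (rule RS_integral_product[OF _ _ \<mu>_mono _ scomp[OF p_solves] \<mu>_bcont comp[OF q_bcont] comp[OF \<alpha>_bcont] g B])
      show "solves {t1, t2} 0 T (\<lambda>t. \<psi>t t $ i) (\<lambda>t. \<mu> t * q t $ i - \<alpha> t $ i)"
        using scomp[OF \<psi>s] by simp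
    qed (use times in auto)
    moreover have "(LINT t|lebesgue_on {0..T}. g t * \<alpha> t $ i) = integral {0..T} (\<lambda>t. g t * \<alpha> t $ i)"
      by (intro lebesgue_integral_eq_integral bcont_off_lebesgue_integrable[of "{t1, t2}"]
          bcont_off_bilinear[OF bounded_bilinear_mult] bcont_off_continuous[OF g] comp[OF \<alpha>_bcont]) auto
    ultimately show ?thesis using B
      by (intro exI[of _ "- integral {0..T} (\<lambda>t. g t * \<alpha> t $ i) - B"] exI[of _ B]) (simp add: \<psi>_def)
  qed
  show ?thesis unfolding adjoint_measure_eq_def using int main by blast
qed

lemma transversality: "\<psi> 0 = J0" "\<psi> T = - JT"
  using \<psi>t_0 \<psi>t_T \<mu>_right[of T] times by (simp_all add: \<psi>_def)

text \<open>The energy is known to be constant off the switching times; continuity of each closed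
  piece gives the one-sided values, with the same constant on all three.\<close>

lemma energy_pieces: "t \<in> {0..t1} \<Longrightarrow> \<psi>1 t \<bullet> f (y0 t) (u1 t) = c" "t \<in> {t1..t2} \<Longrightarrow> \<psi>2 t \<bullet> f (y0 t) (u2 t) = c"
  "t \<in> {t2..T} \<Longrightarrow> \<psi>t t \<bullet> f (y0 t) (u3 t) = c"
proof -
  have cf: "continuous_on X (\<lambda>t. f (y0 t) (v t))" if "continuous_on X (\<lambda>t. (y0 t, v t))" "\<And>t. t \<in> X \<Longrightarrow> (y0 t, v t) \<in> Q" for X v
    using continuous_on_compose2[OF continuous_Q(1) that(1)] that(2) by auto
  show "\<psi>1 t \<bullet> f (y0 t) (u1 t) = c" if "t \<in> {0..t1}"
  proof (rule continuous_const_Icc[OF times(1) _ _ that])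
    show "continuous_on {0..t1} (\<lambda>t. \<psi>1 t \<bullet> f (y0 t) (u1 t))"
      by (intro continuous_on_inner lipschitz_continuous[OF \<psi>_pieces_lipschitz(1)] cf[OF x_continuous(1) inQ(1)])
    show "\<psi>1 t \<bullet> f (y0 t) (u1 t) = c" if "t \<in> {0<..<t1}" for t
      using energy[of t] \<psi>_pieces(1)[of t] u_eq(1)[of t] that times by (simp add: \<psi>_def e_def)
  qed
  show "\<psi>2 t \<bullet> f (y0 t) (u2 t) = c" if "t \<in> {t1..t2}"
  proof (rule continuous_const_Icc[OF times(2) _ _ that])
    show "continuous_on {t1..t2} (\<lambda>t. \<psi>2 t \<bullet> f (y0 t) (u2 t))"
      by (intro continuous_on_inner lipschitz_continuous[OF \<psi>_pieces_lipschitz(2)] cf[OF x_continuous(2) inQ(2)])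
    show "\<psi>2 t \<bullet> f (y0 t) (u2 t) = c" if "t \<in> {t1<..<t2}" for t
      using energy[of t] \<psi>_pieces(2)[of t] u_eq(2)[of t] that times by (simp add: \<psi>_def e_def)
  qed
  show "\<psi>t t \<bullet> f (y0 t) (u3 t) = c" if "t \<in> {t2..T}"
  proof (rule continuous_const_Icc[OF times(3) _ _ that])
    show "continuous_on {t2..T} (\<lambda>t. \<psi>t t \<bullet> f (y0 t) (u3 t))"
      by (intro continuous_on_inner lipschitz_continuous[OF \<psi>_pieces_lipschitz(3)] cf[OF x_continuous(3) inQ(3)])
    show "\<psi>t t \<bullet> f (y0 t) (u3 t) = c" if "t \<in> {t2<..<T}" for t
      using energy[of t] \<mu>_pieces(3)[of t] u_eq(3)[of t] that times by (simp add: e_def)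
  qed
qed

text \<open>\<open>v\<close> and \<open>\<Psi>\<close> are the continuous versions of control and
  costate on the closed arc; the selection needs compactness, while stationarity is known inside the
  arc only.\<close>

lemma control_multiplier_piece:
  assumes cd: "{c'<..<d'} \<subseteq> {0<..<t1} \<union> {t2<..<T}"
    and x: "continuous_on {c'..d'} (\<lambda>t. (y0 t, v t))" "\<And>t. t \<in> {c'..d'} \<Longrightarrow> (y0 t, v t) \<in> Q"
    and \<Psi>: "continuous_on {c'..d'} \<Psi>"
    and eq: "\<And>t. t \<in> {c'<..<d'} \<Longrightarrow> u t = v t \<and> \<psi> t = \<Psi> t"
    and phi: "\<And>t s. t \<in> {c'..d'} \<Longrightarrow> \<phi> (v t) $ s \<le> 0"
    and pos: "\<And>t. t \<in> {c'..d'} \<Longrightarrow> active_gradients_positively_independent \<phi> (v t)"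
  shows "\<exists>h \<in> borel_measurable borel. bounded (range h) \<and>
    (\<forall>t\<in>{c'<..<d'}. (\<forall>s. 0 \<le> h t $ s) \<and> h t \<bullet> \<phi> (u t) = 0 \<and> h t v* D t = \<psi> t v* B t)"
proof -
  let ?D = "\<lambda>t. partial2 (\<phi>' (y0 t, v t))" and ?a = "\<lambda>t. \<Psi> t v* partial2 (f' (y0 t, v t))"
  have g: "grad (\<lambda>w. \<phi> w $ s) (v t) = ?D t $ s" if "t \<in> {c'..d'}" for t s
  proof -
    have d: "((\<lambda>w. \<phi> w $ s) has_derivative (\<lambda>h. \<phi>' (y0 t, v t) (0, h) $ s)) (at (v t))"
      by (rule bounded_linear.has_derivative[OF bounded_linear_vec_nth phi_derivative[OF x(2)[OF that]]])
    show ?thesis by (simp add: grad_eq[OF d] partial2_def matrix_def vec_eq_iff)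
  qed
  have "\<exists>h \<in> borel_measurable borel. bounded (range h) \<and>
    (\<forall>t\<in>{c'<..<d'}. (\<forall>s. 0 \<le> h t $ s) \<and> h t \<bullet> \<phi> (v t) = 0 \<and> h t v* ?D t = ?a t)"
  proof (rule control_multiplier_selection)
    show "continuous_on {c'..d'} ?D"
      by (intro bounded_linear.continuous_on[OF bounded_linear_partial2] continuous_on_compose2[OF cphi' x(1)]) (use x(2) in auto)
    show "continuous_on {c'..d'} (\<lambda>t. \<phi> (v t))"
      using continuous_on_compose2[OF continuous_Q(3) x(1)] x(2) by (auto simp: image_subset_iff)
    show "continuous_on {c'..d'} ?a"
      by (intro bounded_bilinear.continuous_on[OF bounded_bilinear_vector_matrix_mult] \<Psi>
          bounded_linear.continuous_on[OF bounded_linear_partial2] continuous_on_compose2[OF continuous_Q(2) x(1)]) (use x(2) in auto)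
    show "\<phi> (v t) $ s \<le> 0" if "t \<in> {c'..d'}" for t s using phi[OF that] .
    show "positively_independent {s. \<phi> (v t) $ s = 0} (\<lambda>s. ?D t $ s)" if "t \<in> {c'..d'}" for t
      using pos[OF that] by (simp add: active_gradients_positively_independent_def active_def g[OF that])
    show "?a t \<bullet> w \<le> 0" if t: "t \<in> {c'<..<d'}" and w: "\<forall>s. \<phi> (v t) $ s = 0 \<longrightarrow> ?D t $ s \<bullet> w < 0" for t w
    proof -
      have "strict t w" using w eq[OF t] by (simp add: strict_def D_def)
      then have "(\<psi> t v* B t) \<bullet> w \<le> 0" using stationary[of t w] cd t by (auto simp: \<psi>_def)
      then show ?thesis using eq[OF t] by (simp add: B_def)
    qed
  qed
  then show ?thesis using eq by (simp add: D_def B_def)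
qed

lemma control_multiplier:
  "\<exists>h. h \<in> borel_measurable (lebesgue_on {0..T}) \<and> bounded (h ` {0..T}) \<and>
    (\<forall>t\<in>{0..T} - {0, t1, t2, T}. (\<forall>s. 0 \<le> h t $ s) \<and> h t \<bullet> \<phi> (u t) = 0 \<and> h t v* D t = \<psi> t v* B t)"
proof -
  have "\<exists>h \<in> borel_measurable borel. bounded (range h) \<and>
    (\<forall>t\<in>{0<..<t1}. (\<forall>s. 0 \<le> h t $ s) \<and> h t \<bullet> \<phi> (u t) = 0 \<and> h t v* D t = \<psi> t v* B t)"
    by (rule control_multiplier_piece[OF _ x_continuous(1) inQ(1) lipschitz_continuous[OF \<psi>_pieces_lipschitz(1)] _ phi_nonpos(1) gradients(1)])
      (use times u_eq(1) \<psi>_pieces(1) in auto)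
  then obtain h1 where h1: "h1 \<in> borel_measurable borel" "bounded (range h1)"
    "\<And>t. t \<in> {0<..<t1} \<Longrightarrow> (\<forall>s. 0 \<le> h1 t $ s) \<and> h1 t \<bullet> \<phi> (u t) = 0 \<and> h1 t v* D t = \<psi> t v* B t" by blast
  have "\<exists>h \<in> borel_measurable borel. bounded (range h) \<and>
    (\<forall>t\<in>{t2<..<T}. (\<forall>s. 0 \<le> h t $ s) \<and> h t \<bullet> \<phi> (u t) = 0 \<and> h t v* D t = \<psi> t v* B t)"
    by (rule control_multiplier_piece[OF _ x_continuous(3) inQ(3) lipschitz_continuous[OF \<psi>_pieces_lipschitz(3)] _ phi_nonpos(2) gradients(2)])
      (use times u_eq(3) \<psi>_pieces(3) in auto)
  then obtain h3 where h3: "h3 \<in> borel_measurable borel" "bounded (range h3)"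
    "\<And>t. t \<in> {t2<..<T} \<Longrightarrow> (\<forall>s. 0 \<le> h3 t $ s) \<and> h3 t \<bullet> \<phi> (u t) = 0 \<and> h3 t v* D t = \<psi> t v* B t" by blast
  \<comment> \<open>On the boundary arc \<open>\<psi> t v* B t = 0\<close>, so the value 0 serves
    there; the end points of the arcs form a null set.\<close>
  define h where "h t = (if t \<in> {0<..<t1} then h1 t else if t \<in> {t2<..<T} then h3 t else 0)" for t
  have "h \<in> borel_measurable borel" unfolding h_def[abs_def]
    by (intro measurable_If_set h1 h3 borel_measurable_const) auto
  then have "h \<in> borel_measurable (lebesgue_on {0..T})"
    by (intro measurable_restrict_space1 measurable_completion) simp
  moreover have "bounded (h ` {0..T})"
    by (rule bounded_subset[of "range h1 \<union> range h3 \<union> {0}"]) (use h1 h3 in \<open>auto simp: h_def\<close>)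
  moreover have "(\<forall>s. 0 \<le> h t $ s) \<and> h t \<bullet> \<phi> (u t) = 0 \<and> h t v* D t = \<psi> t v* B t"
    if t: "t \<in> {0..T} - {0, t1, t2, T}" for t
  proof -
    consider "t \<in> {0<..<t1}" | "t \<in> {t1<..<t2}" | "t \<in> {t2<..<T}" using t by force
    then show ?thesis
    proof cases
      case 1 then show ?thesis using h1(3)[OF 1] by (simp add: h_def)
    next
      case 2
      then have "h t = 0" using times by (auto simp: h_def)
      moreover have "\<psi> t v* B t = 0" using stationary_mid[OF 2] by (simp add: \<psi>_def)
      ultimately show ?thesis by (simp add: bounded_bilinear.zero_left[OF bounded_bilinear_vector_matrix_mult])
    next
      case 3 then show ?thesis using h3(3)[OF 3] times by (simp add: h_def)
    qed
  qed
  ultimately show ?thesis by blast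
qed

text \<open>The term with \<Phi> is constant in the control, so the derivative of \<mu> does not
  enter the gradient.\<close>

lemma extended_pontryagin_gradient:
  assumes "t \<in> {0..T} - {t1, t2}"
  shows "grad (\<lambda>v. extended_pontryagin f \<phi> \<Phi> m h \<eta> (y0 t) v) (u0 t) = \<eta> v* B t - h v* D t"
proof (rule grad_eq_inner)
  have x: "(y0 t, u0 t) \<in> Q" using reference_mem[of t] u_u0 assms by auto
  have f: "((\<lambda>v. f (y0 t) v) has_derivative (\<lambda>w. f' (y0 t, u0 t) (0, w))) (at (u0 t))"
    by (rule has_derivative_snd_partial[OF df[OF x]])
  have "((\<lambda>v. extended_pontryagin f \<phi> \<Phi> m h \<eta> (y0 t) v) has_derivative
      (\<lambda>w. \<eta> \<bullet> f' (y0 t, u0 t) (0, w) + 0 - h \<bullet> \<phi>' (y0 t, u0 t) (0, w))) (at (u0 t))"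
    unfolding extended_pontryagin_def
    by (intro has_derivative_diff has_derivative_add has_derivative_const has_derivative_inner_right f phi_derivative[OF x])
  then show "((\<lambda>v. extended_pontryagin f \<phi> \<Phi> m h \<eta> (y0 t) v) has_derivative (\<lambda>w. (\<eta> v* B t - h v* D t) \<bullet> w)) (at (u0 t))"
    by (rule has_derivative_eq_rhs)
      (simp add: fun_eq_iff inner_diff_left dot_lmul_matrix B_def D_def partial2_mult u_u0[OF assms])
qed

lemma conclusion:
  "\<exists>(c :: real) (\<psi> :: real \<Rightarrow> real ^ 'a) (\<mu> :: real \<Rightarrow> real) (h :: real \<Rightarrow> real ^ 'c).
    piecewise_Lipschitz T t1 t2 \<psi> \<and> piecewise_Lipschitz T t1 t2 \<mu> \<and>
    h \<in> borel_measurable (lebesgue_on {0..T}) \<and> bounded (h ` {0..T}) \<and>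
    (AE t in lebesgue_on {t1..t2}. \<exists>m\<ge>0. (\<mu> has_real_derivative m) (at t)) \<and>
    0 \<le> jump \<mu> t1 \<and> 0 \<le> jump \<mu> t2 \<and>
    (AE t in lebesgue_on {0..T}. \<forall>s. 0 \<le> h t $ s) \<and>
    RS_measure_zero T (\<lambda>t. \<Phi> (y0 t)) \<mu> \<and>
    (AE t in lebesgue_on {0..T}. h t \<bullet> \<phi> (u0 t) = 0) \<and>
    adjoint_measure_eq T \<psi>
      (\<lambda>t. \<psi> t v* jacobian (\<lambda>y. f y (u0 t)) (at (y0 t))) (\<lambda>t. grad \<Phi> (y0 t)) \<mu> \<and>
    \<psi> 0 = grad (\<lambda>a. J a (y0 T)) (y0 0) \<and>
    \<psi> T = - grad (\<lambda>b. J (y0 0) b) (y0 T) \<and>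
    jump \<psi> t1 = - jump \<mu> t1 *\<^sub>R grad \<Phi> (y0 t1) \<and>
    jump \<psi> t2 = - jump \<mu> t2 *\<^sub>R grad \<Phi> (y0 t2) \<and>
    (\<forall>t\<in>{0..t1}. pontryagin f (piece1 t1 \<psi> t) (y0 t) (piece1 t1 u0 t) = c) \<and>
    (\<forall>t\<in>{t1..t2}. pontryagin f (piece2 t1 t2 \<psi> t) (y0 t) (piece2 t1 t2 u0 t) = c) \<and>
    (\<forall>t\<in>{t2..T}. pontryagin f (piece3 t2 \<psi> t) (y0 t) (piece3 t2 u0 t) = c) \<and>
    (AE t in lebesgue_on {0..T}. \<exists>m. (\<mu> has_real_derivative m) (at t) \<and>
       grad (\<lambda>v. extended_pontryagin f \<phi> \<Phi> m (h t) (\<psi> t) (y0 t) v) (u0 t) = 0)"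
proof -
  obtain N where N: "negligible N" "\<And>t. t \<in> {0..T} - N \<Longrightarrow> \<exists>m\<ge>0. (\<mu> has_real_derivative m) (at t)"
    using \<mu>_derivative by blast
  obtain h where h: "h \<in> borel_measurable (lebesgue_on {0..T})" "bounded (h ` {0..T})"
    "\<And>t. t \<in> {0..T} - {0, t1, t2, T} \<Longrightarrow> (\<forall>s. 0 \<le> h t $ s) \<and> h t \<bullet> \<phi> (u t) = 0 \<and> h t v* D t = \<psi> t v* B t"
    using control_multiplier by blast
  define N' where "N' = N \<union> {0, t1, t2, T}"
  have N': "negligible N'" unfolding N'_def by (intro negligible_Un N negligible_finite) simp
  have 1: "AE t in lebesgue_on {t1..t2}. \<exists>m\<ge>0. (\<mu> has_real_derivative m) (at t)"
    by (rule AE_lebesgue_on_negligible[OF N(1)]) (use N(2) times in force)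
  have 2: "AE t in lebesgue_on {0..T}. \<forall>s. 0 \<le> h t $ s"
    by (rule AE_lebesgue_on_negligible[OF N']) (use h(3) in \<open>simp add: N'_def\<close>)
  have 3: "AE t in lebesgue_on {0..T}. h t \<bullet> \<phi> (u0 t) = 0"
    by (rule AE_lebesgue_on_negligible[OF N']) (use h(3) u_u0 in \<open>simp add: N'_def\<close>)
  have 4: "AE t in lebesgue_on {0..T}. \<exists>m. (\<mu> has_real_derivative m) (at t) \<and>
       grad (\<lambda>v. extended_pontryagin f \<phi> \<Phi> m (h t) (\<psi> t) (y0 t) v) (u0 t) = 0"
  proof (rule AE_lebesgue_on_negligible[OF N'])
    fix t assume t: "t \<in> {0..T} - N'"
    then obtain m where "(\<mu> has_real_derivative m) (at t)" using N(2)[of t] by (auto simp: N'_def)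
    moreover have "grad (\<lambda>v. extended_pontryagin f \<phi> \<Phi> m (h t) (\<psi> t) (y0 t) v) (u0 t) = 0"
      using extended_pontryagin_gradient[of t m "h t" "\<psi> t"] h(3)[of t] t by (simp add: N'_def)
    ultimately show "\<exists>m. (\<mu> has_real_derivative m) (at t) \<and>
       grad (\<lambda>v. extended_pontryagin f \<phi> \<Phi> m (h t) (\<psi> t) (y0 t) v) (u0 t) = 0" by blast
  qed
  show ?thesis
    by (rule exI[of _ c], rule exI[of _ \<psi>], rule exI[of _ \<mu>], rule exI[of _ h], intro conjI ballI)
      (use h(1,2) 1 2 3 4 piecewise_lipschitz jumps complementary transversality energy_pieces
        adjoint[unfolded \<alpha>_def[abs_def] p_def[abs_def]] in
        \<open>simp_all add: pontryagin_def \<psi>_values p_def J0_def JT_def\<close>)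
qed

end

section \<open>The maximum principle\<close>

theorem theorem14p1:
  fixes T t1 t2 :: real
    and n :: nat
    and Q :: "((real ^ 'm::finite) \<times> (real ^ 'k::finite)) set"
    and f :: "real ^ 'm \<Rightarrow> real ^ 'k \<Rightarrow> real ^ 'm"
    and \<phi> :: "real ^ 'k \<Rightarrow> real ^ 'd::finite"
    and \<Phi> :: "real ^ 'm \<Rightarrow> real"
    and J :: "real ^ 'm \<Rightarrow> real ^ 'm \<Rightarrow> real"
    and y0 :: "real \<Rightarrow> real ^ 'm"
    and u0 :: "real \<Rightarrow> real ^ 'k"
  assumes "0 < T" and "1 \<le> n" and "CARD('m) = n + 1"
    and "open Q"
    and "C2_on Q (\<lambda>(y, v). f y v)"
    and "C2_on Q (\<lambda>(y, v). \<phi> v)"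
    and "C2_on Q (\<lambda>(y, v). \<Phi> y)"
    and "C1_on UNIV (\<lambda>(a, b). J a b)"
    and "admissible T Q f \<phi> \<Phi> y0 u0"
    and "0 < t1" and "t1 < t2" and "t2 < T"
    and reference_in_Q:
      "\<forall>t\<in>{0..t1}. (y0 t, piece1 t1 u0 t) \<in> Q"
      "\<forall>t\<in>{t1..t2}. (y0 t, piece2 t1 t2 u0 t) \<in> Q"
      "\<forall>t\<in>{t2..T}. (y0 t, piece3 t2 u0 t) \<in> Q"
    and i: "\<forall>t\<in>{t1..t2}. \<Phi> (y0 t) = 0"
      "\<forall>t\<in>{0..T} - {t1..t2}. 0 < \<Phi> (y0 t)"
    and ii: "continuous_on {0..t1} (piece1 t1 u0)"
      "\<exists>L. L-lipschitz_on {t1..t2} (piece2 t1 t2 u0)"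
      "continuous_on {t2..T} (piece3 t2 u0)"
    and iii: "\<forall>t\<in>{t1..t2}. \<forall>s. \<phi> (piece2 t1 t2 u0 t) $ s < 0"
    and iv: "grad \<Phi> (y0 t1) \<bullet> f (y0 t1) (left_value u0 t1) < 0"
      "grad \<Phi> (y0 t2) \<bullet> f (y0 t2) (right_value u0 t2) > 0"
    and v: "\<forall>t\<in>{t1..t2}.
      grad \<Phi> (y0 t) v* jacobian (f (y0 t)) (at (piece2 t1 t2 u0 t)) \<noteq> 0"
    and vi: "\<forall>t\<in>{0..t1}. active_gradients_positively_independent \<phi> (piece1 t1 u0 t)"
      "\<forall>t\<in>{t2..T}. active_gradients_positively_independent \<phi> (piece3 t2 u0 t)"
    and vii: "\<exists>\<Omega> (P :: nat \<Rightarrow> real ^ 'm \<Rightarrow> real). open \<Omega> \<and> \<Omega> \<subseteq> fst ` Q \<and> y0 ` {0..T} \<subseteq> \<Omega> \<and>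
      (\<forall>i\<in>{1..n}. C2_on \<Omega> (P i)) \<and>
      (let F = P(n + 1 := \<Phi>) in
        (\<forall>y\<in>\<Omega>. linearly_independent {1..n + 1} (\<lambda>i. grad (F i) y)) \<and>
        inj_on (\<lambda>y. \<lambda>i\<in>{1..n + 1}. F i y) \<Omega>)"
    and "extended_weak_minimum T Q f \<phi> \<Phi> J y0 u0"
  shows "\<exists>(c :: real) (\<psi> :: real \<Rightarrow> real ^ 'm) (\<mu> :: real \<Rightarrow> real) (h :: real \<Rightarrow> real ^ 'd).
    piecewise_Lipschitz T t1 t2 \<psi> \<and> piecewise_Lipschitz T t1 t2 \<mu> \<and>
    h \<in> borel_measurable (lebesgue_on {0..T}) \<and> bounded (h ` {0..T}) \<and>
    \<comment> \<open>(a) non-negativity\<close>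
    (AE t in lebesgue_on {t1..t2}. \<exists>m\<ge>0. (\<mu> has_real_derivative m) (at t)) \<and>
    0 \<le> jump \<mu> t1 \<and> 0 \<le> jump \<mu> t2 \<and>
    (AE t in lebesgue_on {0..T}. \<forall>s. 0 \<le> h t $ s) \<and>
    \<comment> \<open>(b) complementary slackness\<close>
    RS_measure_zero T (\<lambda>t. \<Phi> (y0 t)) \<mu> \<and>
    (AE t in lebesgue_on {0..T}. h t \<bullet> \<phi> (u0 t) = 0) \<and>
    \<comment> \<open>(c) adjoint equation\<close>
    adjoint_measure_eq T \<psi>
      (\<lambda>t. \<psi> t v* jacobian (\<lambda>y. f y (u0 t)) (at (y0 t))) (\<lambda>t. grad \<Phi> (y0 t)) \<mu> \<and>
    \<comment> \<open>(d) transversality\<close>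
    \<psi> 0 = grad (\<lambda>a. J a (y0 T)) (y0 0) \<and>
    \<psi> T = - grad (\<lambda>b. J (y0 0) b) (y0 T) \<and>
    \<comment> \<open>(e) jump conditions\<close>
    jump \<psi> t1 = - jump \<mu> t1 *\<^sub>R grad \<Phi> (y0 t1) \<and>
    jump \<psi> t2 = - jump \<mu> t2 *\<^sub>R grad \<Phi> (y0 t2) \<and>
    \<comment> \<open>(f) energy conservation\<close>
    (\<forall>t\<in>{0..t1}. pontryagin f (piece1 t1 \<psi> t) (y0 t) (piece1 t1 u0 t) = c) \<and>
    (\<forall>t\<in>{t1..t2}. pontryagin f (piece2 t1 t2 \<psi> t) (y0 t) (piece2 t1 t2 u0 t) = c) \<and>
    (\<forall>t\<in>{t2..T}. pontryagin f (piece3 t2 \<psi> t) (y0 t) (piece3 t2 u0 t) = c) \<and>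
    \<comment> \<open>(g) stationarity in the control\<close>
    (AE t in lebesgue_on {0..T}. \<exists>m. (\<mu> has_real_derivative m) (at t) \<and>
       grad (\<lambda>v. extended_pontryagin f \<phi> \<Phi> m (h t) (\<psi> t) (y0 t) v) (u0 t) = 0)"
proof -
  obtain f' where f': "\<forall>x\<in>Q. ((\<lambda>(y, v). f y v) has_derivative blinfun_apply (f' x)) (at x)" "C1_on Q f'"
    using assms(5) unfolding C2_on_def by blast
  obtain f'' where f'': "\<forall>x\<in>Q. (f' has_derivative blinfun_apply (f'' x)) (at x)" "continuous_on Q f''"
    using f'(2) unfolding C1_on_def by blast
  obtain \<phi>' where \<phi>': "\<forall>x\<in>Q. ((\<lambda>(y, v). \<phi> v) has_derivative blinfun_apply (\<phi>' x)) (at x)" "C1_on Q \<phi>'"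
    using assms(6) unfolding C2_on_def by blast
  obtain \<phi>'' where \<phi>'': "\<forall>x\<in>Q. (\<phi>' has_derivative blinfun_apply (\<phi>'' x)) (at x)"
    using \<phi>'(2) unfolding C1_on_def by blast
  \<comment> \<open>Differentiability of \<open>\<phi>'\<close> yields its continuity. For
    \<open>f\<close> and \<open>\<Phi>\<close> the second derivatives are kept, because
    \<open>B\<close> must be Lipschitz on the arc and \<open>p\<close> differentiable.\<close>
  have c\<phi>': "continuous_on Q \<phi>'"
    by (rule has_derivative_continuous_on, rule has_derivative_at_withinI, erule bspec[OF \<phi>''])
  obtain \<Phi>' where \<Phi>': "\<forall>x\<in>Q. ((\<lambda>(y, v). \<Phi> y) has_derivative blinfun_apply (\<Phi>' x)) (at x)" "C1_on Q \<Phi>'"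
    using assms(7) unfolding C2_on_def by blast
  obtain \<Phi>'' where \<Phi>'': "\<forall>x\<in>Q. (\<Phi>' has_derivative blinfun_apply (\<Phi>'' x)) (at x)" "continuous_on Q \<Phi>''"
    using \<Phi>'(2) unfolding C1_on_def by blast
  obtain J' where J': "\<forall>x\<in>UNIV. ((\<lambda>(a, b). J a b) has_derivative blinfun_apply (J' x)) (at x)"
    using assms(8) unfolding C1_on_def by blast
  interpret regular_reference T t1 t2 Q f f' f'' \<phi> \<phi>' \<Phi> \<Phi>' \<Phi>'' J "J' (y0 0, y0 T)" y0 u0
    by unfold_locales
      (use assms(4,10,11,12) f'(1) f'' \<phi>'(1) c\<phi>' \<Phi>'(1) \<Phi>'' J' reference_in_Q i ii iii v vi assms(28) in blast)+
  obtain \<psi>t \<mu> c where "solves {t1, t2} 0 T \<psi>t (\<lambda>t. \<mu> t *\<^sub>R (q t + p t v* A t) - \<psi>t t v* A t) \<and>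
     mono_on {0..T} \<mu> \<and> (\<exists>L. L-lipschitz_on {t1..<t2} \<mu>) \<and>
     (\<forall>t\<in>{0..<t1}. \<mu> t = \<mu> 0) \<and> (\<forall>t\<in>{t2..T}. \<mu> t = 0) \<and>
     \<psi>t 0 - \<mu> 0 *\<^sub>R p 0 = J0 \<and> \<psi>t T = - JT \<and>
     (\<forall>t\<in>{0..T} - {t1, t2}. (\<psi>t t - \<mu> t *\<^sub>R p t) \<bullet> e t = c) \<and>
     (\<forall>t\<in>{t1<..<t2}. (\<psi>t t - \<mu> t *\<^sub>R p t) v* B t = 0) \<and>
     (\<forall>\<tau>\<in>{0<..<t1} \<union> {t2<..<T}. \<forall>w. strict \<tau> w \<longrightarrow> ((\<psi>t \<tau> - \<mu> \<tau> *\<^sub>R p \<tau>) v* B \<tau>) \<bullet> w \<le> 0)"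
    using linear_multipliers by (elim exE) (rule that)
  then interpret reference_multipliers T t1 t2 Q f f' f'' \<phi> \<phi>' \<Phi> \<Phi>' \<Phi>'' J "J' (y0 0, y0 T)" y0 u0 \<psi>t \<mu> c
    by unfold_locales blast+
  show ?thesis by (rule conclusion)
qed

end
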